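(* Let $X$ be a compact Hausdorff space and $\mathcal E\to X$ a rank $d$ vector bundle. For every closed group $G\subseteq\mathbf U\mathcal E$ there is a natural isomorphism $SG\simeq\mathbf{aut}_{\mathcal O_G}\mathcal O_{\mathcal E}$ (given by $g\mapsto\widehat g$), where $SG$ is the group of continuous sections of the spectral bundle $\mathcal G\to X$ of $G$. Moreover, the duality map $\mathcal G\mapsto\widehat G$ is injective; i.e. if $G,G'\subseteq\mathbf U\mathcal E$ are closed groups with $\widehat G=\widehat{G'}$, then their spectral bundles coincide, $\mathcal G=\mathcal G'$.
   Context: $\mathcal E\to X$ is a complex Hermitian vector bundle. $\mathcal E^r$ is the $r$-fold tensor power, $\iota := \mathcal E^0 := X\times\mathbb C$. $(\mathcal E^r,\mathcal E^s)$ is the Banach $C(X)$-bimodule of vector bundle morphisms $\mathcal E^r\to\mathcal E^s$ (over $\mathrm{id}_X$); $(\iota,\iota)=C(X)$. Cuntz–Pimsner algebra $\mathcal O_{\mathcal E}$ : embed $(\mathcal E^r,\mathcal E^s)\hookrightarrow(\mathcal E^{r+1},\mathcal E^{s+1})$ by $t\mapsto t\otimes 1$; for $k\in\mathbb Z$ let $\mathcal O^k$ be the inductive limit of $(\mathcal E^r,\mathcal E^{r+k})$ over $r$; composition and adjoint make $\bigoplus_k\mathcal O^k$ a $*$-algebra, and $\mathcal O_{\mathcal E}$ is its closure in the unique $C^*$-norm for which the circle action $t\mapsto z^kt$ ($t\in\mathcal O^k$) is isometric. The spaces $(\mathcal E^r,\mathcal E^s)$ are regarded inside $\mathcal O_{\mathcal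 E}$. $\mathcal O_{\mathcal E}$ is a continuous bundle of $C^*$-algebras over $X$ whose fibre $(\mathcal O_{\mathcal E})_x\simeq\mathcal O_d$ is the Cuntz algebra of the Hilbert space $\mathcal E_x$ (same construction with $\mathcal E_x$ in place of $\mathcal E$). $\mathbf U\mathcal E$ is the group of unitary elements of $(\mathcal E,\mathcal E)$, i.e. of continuous sections of the bundle $\mathcal U\mathcal E\to X$ whose fibre $\mathcal U\mathcal E_x\simeq\mathbb U(d)$ is the unitary group of $\mathcal E_x$; $g_x$ is the value of $g$ at $x$. Each $g\in\mathbf U\mathcal E$ defines an automorphism $\widehat g$ of $\mathcal O_{\mathcal E}$ by $\widehat g(t):=g^{\otimes s}\, t\, (g^* )^{\otimes r}$, $t\in(\mathcal E^r,\mathcal E^s)$; likewise each $u\in\mathcal U\mathcal E_x$ defines an automorphism $\widehat u$ of $(\mathcal O_{\mathcal E})_x$. Put $(\mathcal E^r,\mathcal E^s)_G:=\{y\in(\mathcal E^r,\mathcal E^s):\widehat g(y)=y,\ g\in G\}$; $\mathcal O_G\subseteq\mathcal O_{\mathcal E}$ is the $C^*$-subalgebra generated by all $(\mathcal E^r,\mathcal E^s)_G$, and $(\mathcal O_G)_x\subseteq(\mathcal O_{\mathcal E})_x$ its image in the fibre at $x$. The spectral bundle of $G$ is the topological subspace $\mathcal G:=\{u\in\mathcal U\mathcal E:\ u\in\mathcal U\mathcal E_x,\ x \in X,\ \widehat u(y)=y\ \ \forall y\in(\mathcal O_G)_x\}\subseteq\mathcal U\mathcal E$ with the restricted projection to $X$;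 and $SG:=\{g\in\mathbf U\mathcal E: g_x\in\mathcal G\ \forall x\in X\}$. $\mathbf{aut}_{\mathcal O_G}\mathcal O_{\mathcal E}$ is the group of automorphisms of $\mathcal O_{\mathcal E}$ that are the identity on $\mathcal O_G$. The dual $\widehat G$ is the symmetric tensor $C^*$-category with objects the tensor powers $\mathcal E^r$, $r\in\mathbb N$, and arrows the spaces $(\mathcal E^r,\mathcal E^s)_G$.
   Formalization: The isomorphism SG ≃ aut is stated for rank d ≥ 2: for d = 1 it fails (X a point, G = U(1): SG = U(1) but aut = Homeo(S¹)), and for d = 0 the arrow spaces do not embed in the algebra; the injectivity of the duality map is stated for every d. *)

theory Defs
  imports "HOL-Analysis.Analysis" "HOL-Algebra.Group"
begin

section \<open>C*-algebras\<close>

class cstar_algebra = real_normed_algebra + banach +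
  fixes scaleC :: "complex \<Rightarrow> 'a \<Rightarrow> 'a"
    and star :: "'a \<Rightarrow> 'a"
  assumes scaleC_add_right: "scaleC c (x + y) = scaleC c x + scaleC c y"
    and scaleC_add_left: "scaleC (c + c') x = scaleC c x + scaleC c' x"
    and scaleC_scaleC: "scaleC c (scaleC c' x) = scaleC (c * c') x"
    and scaleC_of_real: "scaleC (complex_of_real r) x = scaleR r x"
    and mult_scaleC_left: "scaleC c x * y = scaleC c (x * y)"
    and mult_scaleC_right: "x * scaleC c y = scaleC c (x * y)"
    and norm_scaleC: "norm (scaleC c x) = cmod c * norm x"
    and star_add: "star (x + y) = star x + star y"
    and star_scaleC: "star (scaleC c x) = scaleC (cnj c) (star x)"
    and star_mult: "star (x * y) = star y * star x"
    and star_star: "star (star x) = x"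
    and cstar_identity: "norm (star x * x) = (norm x)\<^sup>2"

definition star_hom :: "('a::cstar_algebra \<Rightarrow> 'b::cstar_algebra) \<Rightarrow> bool" where
  "star_hom f \<longleftrightarrow>
     (\<forall>x y. f (x + y) = f x + f y) \<and> (\<forall>c x. f (scaleC c x) = scaleC c (f x)) \<and>
     (\<forall>x y. f (x * y) = f x * f y) \<and> (\<forall>x. f (star x) = star (f x))"

definition cstar_subalgebra :: "'a::cstar_algebra set \<Rightarrow> bool" where
  "cstar_subalgebra S \<longleftrightarrow>
     closed S \<and> 0 \<in> S \<and> (\<forall>x\<in>S. \<forall>y\<in>S. x + y \<in> S \<and> x * y \<in> S) \<and>
     (\<forall>c. \<forall>x\<in>S. scaleC c x \<in> S) \<and> (\<forall>x\<in>S. star x \<in> S)"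

definition aut_group :: "'a::cstar_algebra set \<Rightarrow> ('a \<Rightarrow> 'a) monoid" where
  "aut_group S =
     \<lparr>carrier = {\<alpha>. star_hom \<alpha> \<and> bij \<alpha> \<and> (\<forall>a\<in>S. \<alpha> a = a)}, mult = (\<circ>), one = id\<rparr>"


section \<open>Hermitian vector bundles\<close>

text \<open>The operations \<open>vadd\<close>, \<open>vscale\<close>, \<open>herm\<close> matter only on vectors of a common fibre;
  \<open>herm\<close> is conjugate linear in its first argument.\<close>

record ('x, 'e) vbundle =
  base :: "'x topology"
  total_space :: "'e topology"
  proj :: "'e \<Rightarrow> 'x"
  vadd :: "'e \<Rightarrow> 'e \<Rightarrow> 'e"
  vscale :: "complex \<Rightarrow> 'e \<Rightarrow> 'e"
  herm :: "'e \<Rightarrow> 'e \<Rightarrow> complex"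

definition fibre :: "('x, 'e) vbundle \<Rightarrow> 'x \<Rightarrow> 'e set" where
  "fibre E x = {v \<in> topspace (total_space E). proj E v = x}"

definition local_trivialisation ::
  "nat \<Rightarrow> ('x, 'e) vbundle \<Rightarrow> 'x set \<Rightarrow> ('x \<times> (nat \<Rightarrow> complex) \<Rightarrow> 'e) \<Rightarrow> bool" where
  "local_trivialisation d E U h \<longleftrightarrow>
     homeomorphic_map
       (prod_topology (subtopology (base E) U) (product_topology (\<lambda>_. euclidean) {..<d}))
       (subtopology (total_space E) {v. proj E v \<in> U}) h \<and>
     (\<forall>y\<in>U. \<forall>c \<in> PiE {..<d} (\<lambda>_. UNIV). \<forall>c' \<in> PiE {..<d} (\<lambda>_. UNIV). \<forall>a.
        proj E (h (y, c)) = y \<and>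
        h (y, \<lambda>i\<in>{..<d}. c i + c' i) = vadd E (h (y, c)) (h (y, c')) \<and>
        h (y, \<lambda>i\<in>{..<d}. a * c i) = vscale E a (h (y, c)))"

definition hermitian_vector_bundle :: "nat \<Rightarrow> ('x, 'e) vbundle \<Rightarrow> bool" where
  "hermitian_vector_bundle d E \<longleftrightarrow>
     continuous_map (total_space E) (base E) (proj E) \<and>
     (\<forall>x \<in> topspace (base E). \<exists>U h. openin (base E) U \<and> x \<in> U \<and> local_trivialisation d E U h) \<and>
     (\<forall>x \<in> topspace (base E). \<forall>u \<in> fibre E x. \<forall>v \<in> fibre E x. \<forall>w \<in> fibre E x. \<forall>c.
        herm E u (vadd E v w) = herm E u v + herm E u w \<and>
        herm E u (vscale E c v) = c * herm E u v \<and>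
        herm E v u = cnj (herm E u v) \<and>
        (v \<noteq> vscale E 0 v \<longrightarrow> 0 < Re (herm E v v))) \<and>
     continuous_map
       (subtopology (prod_topology (total_space E) (total_space E)) {(v, w). proj E v = proj E w})
       euclidean (\<lambda>(v, w). herm E v w)"

text \<open>The Hilbert space \<open>E\<^sub>x\<close>, as a bundle over the one-point space \<open>{x}\<close>. All the fibrewise
  versions of the constructions below are obtained by applying them to this bundle.\<close>

definition restrict_bundle :: "('x, 'e) vbundle \<Rightarrow> 'x \<Rightarrow> ('x, 'e) vbundle" where
  "restrict_bundle E x =
     E\<lparr>base := subtopology (base E) {x}, total_space := subtopology (total_space E) {v. proj E v = x}\<rparr>"

definition local_section :: "('x, 'e) vbundle \<Rightarrow> 'x set \<Rightarrow> ('x \<Rightarrow> 'e) \<Rightarrow> bool" where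
  "local_section E U v \<longleftrightarrow>
     continuous_map (subtopology (base E) U) (total_space E) v \<and> (\<forall>y\<in>U. proj E (v y) = y)"


section \<open>Tensor powers\<close>

text \<open>The tensor power of order \<open>r\<close> of the finite-dimensional Hilbert space \<open>E\<^sub>x\<close> is modelled by
  the conjugate-multilinear forms on \<open>E\<^sub>x\<close> in \<open>r\<close> variables (lists of length \<open>r\<close>), extended by
  zero to all other lists: the tensor \<open>\<xi>\<close> is the form mapping \<open>ws\<close> to the inner product of
  \<open>w\<^sub>1 \<otimes> \<dots> \<otimes> w\<^sub>r\<close> with \<open>\<xi>\<close>. For \<open>r = 0\<close> this is \<open>\<complex>\<close>, and for \<open>r = 1\<close> it is \<open>E\<^sub>x\<close> by the Riesz
  representation theorem.\<close>

type_synonym 'e tensor = "'e list \<Rightarrow> complex"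

definition tensor_fibre :: "('x, 'e) vbundle \<Rightarrow> nat \<Rightarrow> 'x \<Rightarrow> 'e tensor set" where
  "tensor_fibre E r x = {\<xi>.
     (\<forall>vs. \<xi> vs \<noteq> 0 \<longrightarrow> length vs = r \<and> set vs \<subseteq> fibre E x) \<and>
     (\<forall>us ws v v' c.
        length us + Suc (length ws) = r \<and> set us \<union> set ws \<union> {v, v'} \<subseteq> fibre E x \<longrightarrow>
          \<xi> (us @ vadd E v v' # ws) = \<xi> (us @ v # ws) + \<xi> (us @ v' # ws) \<and>
          \<xi> (us @ vscale E c v # ws) = cnj c * \<xi> (us @ v # ws))}"

definition pure_tensor :: "('x, 'e) vbundle \<Rightarrow> 'x \<Rightarrow> 'e list \<Rightarrow> 'e tensor" where
  "pure_tensor E x vs = (\<lambda>ws.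
     if length ws = length vs \<and> set ws \<subseteq> fibre E x
     then \<Prod>i<length vs. herm E (ws ! i) (vs ! i) else 0)"

definition orthonormal_basis :: "('x, 'e) vbundle \<Rightarrow> 'x \<Rightarrow> 'e set \<Rightarrow> bool" where
  "orthonormal_basis E x B \<longleftrightarrow>
     B \<subseteq> fibre E x \<and> (\<forall>b\<in>B. \<forall>c\<in>B. herm E b c = (if b = c then 1 else 0)) \<and>
     (\<forall>v \<in> fibre E x. (\<forall>b\<in>B. herm E b v = 0) \<longrightarrow> v = vscale E 0 v)"

text \<open>This does not depend on the choice of the basis, and it takes the value
  \<open>\<langle>v\<^sub>1, w\<^sub>1\<rangle> \<dots> \<langle>v\<^sub>r, w\<^sub>r\<rangle>\<close> on the pure tensors of \<open>vs\<close> and \<open>ws\<close>.\<close>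

definition tensor_inner ::
  "('x, 'e) vbundle \<Rightarrow> nat \<Rightarrow> 'x \<Rightarrow> 'e tensor \<Rightarrow> 'e tensor \<Rightarrow> complex" where
  "tensor_inner E r x \<xi> \<eta> =
     (\<Sum>bs \<in> {bs. length bs = r \<and> set bs \<subseteq> (SOME B. orthonormal_basis E x B)}. cnj (\<xi> bs) * \<eta> bs)"

definition tensor_norm :: "('x, 'e) vbundle \<Rightarrow> nat \<Rightarrow> 'x \<Rightarrow> 'e tensor \<Rightarrow> real" where
  "tensor_norm E r x \<xi> = sqrt (Re (tensor_inner E r x \<xi> \<xi>))"

text \<open>The total space of the tensor power, topologised so that its coordinates against local
  continuous sections of \<open>E\<close> are continuous. Over a trivialising open set the coordinates
  against a local frame identify it with a product.\<close>

definition tensor_bundle :: "('x, 'e) vbundle \<Rightarrow> nat \<Rightarrow> ('x \<times> 'e tensor) topology" where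
  "tensor_bundle E r = topology_generated_by
     {{(y, \<xi>). y \<in> U \<and> \<xi> \<in> tensor_fibre E r y \<and> \<xi> (map (\<lambda>v. v y) vs) \<in> V} | U vs V.
        openin (base E) U \<and> length vs = r \<and> (\<forall>v \<in> set vs. local_section E U v) \<and> open V}"


section \<open>Morphisms between tensor powers\<close>

text \<open>Morphisms are extended by zero outside their domain, so that sums and scalar multiples
  can be formed pointwise.\<close>

type_synonym ('x, 'e) arrow = "'x \<Rightarrow> 'e tensor \<Rightarrow> 'e tensor"

definition arrows :: "('x, 'e) vbundle \<Rightarrow> nat \<Rightarrow> nat \<Rightarrow> ('x, 'e) arrow set" where
  "arrows E r s = {t.
     (\<forall>x \<xi>. x \<notin> topspace (base E) \<or> \<xi> \<notin> tensor_fibre E r x \<longrightarrow> t x \<xi> = (\<lambda>_. 0)) \<and>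
     (\<forall>x \<in> topspace (base E). \<forall>\<xi> \<in> tensor_fibre E r x. t x \<xi> \<in> tensor_fibre E s x) \<and>
     (\<forall>x \<in> topspace (base E). \<forall>\<xi> \<in> tensor_fibre E r x. \<forall>\<eta> \<in> tensor_fibre E r x. \<forall>a b.
        t x (\<lambda>vs. a * \<xi> vs + b * \<eta> vs) = (\<lambda>vs. a * t x \<xi> vs + b * t x \<eta> vs)) \<and>
     continuous_map (tensor_bundle E r) (tensor_bundle E s) (\<lambda>(x, \<xi>). (x, t x \<xi>))}"

definition arr_id :: "('x, 'e) vbundle \<Rightarrow> nat \<Rightarrow> ('x, 'e) arrow" where
  "arr_id E r = (\<lambda>x \<xi>.
     if x \<in> topspace (base E) \<and> \<xi> \<in> tensor_fibre E r x then \<xi> else (\<lambda>_. 0))"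

definition arr_comp :: "('x, 'e) arrow \<Rightarrow> ('x, 'e) arrow \<Rightarrow> ('x, 'e) arrow" where
  "arr_comp t' t = (\<lambda>x \<xi>. t' x (t x \<xi>))"

text \<open>Adjoint of \<open>t \<in> arrows E r s\<close>: by definition of the model, the value at \<open>vs\<close> of a tensor is
  its inner product with the pure tensor of \<open>vs\<close>.\<close>

definition arr_adj :: "('x, 'e) vbundle \<Rightarrow> nat \<Rightarrow> nat \<Rightarrow> ('x, 'e) arrow \<Rightarrow> ('x, 'e) arrow" where
  "arr_adj E r s t = (\<lambda>x \<eta> vs.
     if x \<in> topspace (base E) \<and> \<eta> \<in> tensor_fibre E s x \<and> length vs = r \<and> set vs \<subseteq> fibre E x
     then tensor_inner E s x (t x (pure_tensor E x vs)) \<eta> else 0)"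

text \<open>\<open>t \<otimes> t'\<close> for \<open>t \<in> arrows E r s\<close> and \<open>t' \<in> arrows E r' s'\<close>: apply \<open>t'\<close> to the last \<open>r'\<close>
  variables and \<open>t\<close> to the first \<open>r\<close> ones.\<close>

definition arr_tensor ::
  "('x, 'e) vbundle \<Rightarrow> nat \<Rightarrow> nat \<Rightarrow> nat \<Rightarrow> ('x, 'e) arrow \<Rightarrow> ('x, 'e) arrow \<Rightarrow> ('x, 'e) arrow" where
  "arr_tensor E r r' s t t' = (\<lambda>x \<xi> ws.
     if \<xi> \<in> tensor_fibre E (r + r') x
     then t x (\<lambda>v. t' x (\<lambda>v'. \<xi> (v @ v')) (drop s ws)) (take s ws) else 0)"

fun arr_power :: "('x, 'e) vbundle \<Rightarrow> ('x, 'e) arrow \<Rightarrow> nat \<Rightarrow> ('x, 'e) arrow" where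
  "arr_power E g 0 = arr_id E 0"
| "arr_power E g (Suc n) = arr_tensor E n 1 n (arr_power E g n) g"

text \<open>The element 0 is inserted only to cover an empty base.\<close>

definition arr_norm :: "('x, 'e) vbundle \<Rightarrow> nat \<Rightarrow> nat \<Rightarrow> ('x, 'e) arrow \<Rightarrow> real" where
  "arr_norm E r s t = Sup (insert 0 {tensor_norm E s x (t x \<xi>) | x \<xi>.
     x \<in> topspace (base E) \<and> \<xi> \<in> tensor_fibre E r x \<and> tensor_norm E r x \<xi> \<le> 1})"

definition point_arrow :: "'x \<Rightarrow> ('e tensor \<Rightarrow> 'e tensor) \<Rightarrow> ('x, 'e) arrow" where
  "point_arrow x u = (\<lambda>y. if y = x then u else (\<lambda>_ _. 0))"


section \<open>The unitary group\<close>

definition unitaries :: "('x, 'e) vbundle \<Rightarrow> ('x, 'e) arrow set" where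
  "unitaries E = {g \<in> arrows E 1 1.
     arr_comp (arr_adj E 1 1 g) g = arr_id E 1 \<and> arr_comp g (arr_adj E 1 1 g) = arr_id E 1}"

definition unitary_group :: "('x, 'e) vbundle \<Rightarrow> ('x, 'e) arrow monoid" where
  "unitary_group E = \<lparr>carrier = unitaries E, mult = arr_comp, one = arr_id E 1\<rparr>"

definition closed_unitary_subgroup :: "('x, 'e) vbundle \<Rightarrow> ('x, 'e) arrow set \<Rightarrow> bool" where
  "closed_unitary_subgroup E G \<longleftrightarrow>
     subgroup G (unitary_group E) \<and>
     closedin (Metric_space.mtopology (unitaries E)
       (\<lambda>g h. arr_norm E 1 1 (\<lambda>x \<xi> vs. g x \<xi> vs - h x \<xi> vs))) G"

definition unitary_fibre :: "('x, 'e) vbundle \<Rightarrow> 'x \<Rightarrow> ('e tensor \<Rightarrow> 'e tensor) set" where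
  "unitary_fibre E x = {u. point_arrow x u \<in> unitaries (restrict_bundle E x)}"

text \<open>Total space of the bundle of unitary groups, topologised by the matrix coefficients with
  respect to local continuous sections of \<open>E\<close>.\<close>

definition unitary_bundle :: "('x, 'e) vbundle \<Rightarrow> ('x \<times> ('e tensor \<Rightarrow> 'e tensor)) topology" where
  "unitary_bundle E = topology_generated_by
     {{(y, u). y \<in> U \<and> u \<in> unitary_fibre E y \<and> u (pure_tensor E y [v y]) [w y] \<in> V} | U v w V.
        openin (base E) U \<and> local_section E U v \<and> local_section E U w \<and> open V}"

definition arr_act :: "('x, 'e) vbundle \<Rightarrow> nat \<Rightarrow> nat \<Rightarrow> ('x, 'e) arrow \<Rightarrow> ('x, 'e) arrow \<Rightarrow> ('x, 'e) arrow" where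
  "arr_act E r s g t =
     arr_comp (arr_power E g s) (arr_comp t (arr_power E (arr_adj E 1 1 g) r))"

definition fixed_arrows :: "('x, 'e) vbundle \<Rightarrow> ('x, 'e) arrow set \<Rightarrow> nat \<Rightarrow> nat \<Rightarrow> ('x, 'e) arrow set" where
  "fixed_arrows E G r s = {t \<in> arrows E r s. \<forall>g\<in>G. arr_act E r s g t = t}"

text \<open>The dual of \<open>G\<close> is a subcategory, with all objects, of the category of tensor powers of \<open>E\<close>;
  its structure is restricted from there, so it is determined by its spaces of arrows.\<close>

definition dual :: "('x, 'e) vbundle \<Rightarrow> ('x, 'e) arrow set \<Rightarrow> nat \<Rightarrow> nat \<Rightarrow> ('x, 'e) arrow set" where
  "dual E G = (\<lambda>r s. fixed_arrows E G r s)"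


section \<open>The Cuntz-Pimsner algebra\<close>

text \<open>The image in the algebra of the space \<open>O\<^sup>k\<close>.\<close>

definition graded_part ::
  "('x, 'e) vbundle \<Rightarrow> (nat \<Rightarrow> nat \<Rightarrow> ('x, 'e) arrow \<Rightarrow> 'a) \<Rightarrow> int \<Rightarrow> 'a set" where
  "graded_part E emb k = {emb r s t | r s t. t \<in> arrows E r s \<and> int s - int r = k}"

text \<open>The type \<open>'a\<close>, with the maps \<open>emb r s\<close> from \<open>arrows E r s\<close>, is the completion of the
  *-algebra \<open>\<Oplus>\<^sub>k O\<^sup>k\<close> in a C*-norm for which the circle action is isometric. The maps
  \<open>emb\<close> are compatible with \<open>t \<mapsto> t \<otimes> 1\<close> and isometric, hence exhibit the inductive limits \<open>O\<^sup>k\<close>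
  inside \<open>'a\<close>; the last clause contains the directness of their sum (if \<open>\<Sum> a\<^sub>k = 0\<close> then
  \<open>\<Sum> z\<^sup>k a\<^sub>k = 0\<close> for all \<open>z\<close> in the circle, so all \<open>a\<^sub>k\<close> vanish). As that C*-norm is unique,
  these conditions determine \<open>('a, emb)\<close> up to a unique isomorphism.\<close>

definition cuntz_pimsner ::
  "('x, 'e) vbundle \<Rightarrow> (nat \<Rightarrow> nat \<Rightarrow> ('x, 'e) arrow \<Rightarrow> 'a::cstar_algebra) \<Rightarrow> bool" where
  "cuntz_pimsner E emb \<longleftrightarrow>
     (\<forall>r s. \<forall>t \<in> arrows E r s. \<forall>t' \<in> arrows E r s. \<forall>a b.
        emb r s (\<lambda>x \<xi> vs. a * t x \<xi> vs + b * t' x \<xi> vs) =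
        scaleC a (emb r s t) + scaleC b (emb r s t')) \<and>
     (\<forall>r s. \<forall>t \<in> arrows E r s. norm (emb r s t) = arr_norm E r s t) \<and>
     (\<forall>r s. \<forall>t \<in> arrows E r s.
        emb (r + 1) (s + 1) (arr_tensor E r 1 s t (arr_id E 1)) = emb r s t) \<and>
     (\<forall>r s q. \<forall>t \<in> arrows E r s. \<forall>t' \<in> arrows E s q.
        emb r q (arr_comp t' t) = emb s q t' * emb r s t) \<and>
     (\<forall>r s. \<forall>t \<in> arrows E r s. emb s r (arr_adj E r s t) = star (emb r s t)) \<and>
     closure (span (\<Union>r s. emb r s ` arrows E r s)) = UNIV \<and>
     (\<forall>K a z. finite K \<and> (\<forall>k\<in>K. a k \<in> graded_part E emb k) \<and> cmod z = 1 \<longrightarrow>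
        norm (\<Sum>k\<in>K. scaleC (z powi k) (a k)) = norm (\<Sum>k\<in>K. a k))"

text \<open>The automorphism defined by a unitary, extended by continuity from the dense
  *-subalgebra spanned by the spaces of morphisms.\<close>

definition hat_aut ::
  "('x, 'e) vbundle \<Rightarrow> (nat \<Rightarrow> nat \<Rightarrow> ('x, 'e) arrow \<Rightarrow> 'a::cstar_algebra) \<Rightarrow> ('x, 'e) arrow \<Rightarrow> 'a \<Rightarrow> 'a" where
  "hat_aut E emb g = (THE \<alpha>. bounded_linear \<alpha> \<and>
     (\<forall>r s. \<forall>t \<in> arrows E r s. \<alpha> (emb r s t) = emb r s (arr_act E r s g t)))"

definition fixed_algebra ::
  "('x, 'e) vbundle \<Rightarrow> (nat \<Rightarrow> nat \<Rightarrow> ('x, 'e) arrow \<Rightarrow> 'a::cstar_algebra) \<Rightarrow> ('x, 'e) arrow set \<Rightarrow> 'a set" where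
  "fixed_algebra E emb G = cstar_subalgebra hull (\<Union>r s. emb r s ` fixed_arrows E G r s)"

text \<open>The evaluation at \<open>x\<close>, from the Cuntz-Pimsner algebra of \<open>E\<close> (given by \<open>emb\<close>) onto its fibre,
  the Cuntz algebra of \<open>E\<^sub>x\<close> (given by \<open>fib x\<close>).\<close>

definition fibre_map ::
  "('x, 'e) vbundle \<Rightarrow> (nat \<Rightarrow> nat \<Rightarrow> ('x, 'e) arrow \<Rightarrow> 'a::cstar_algebra) \<Rightarrow>
   ('x \<Rightarrow> nat \<Rightarrow> nat \<Rightarrow> ('x, 'e) arrow \<Rightarrow> 'b::cstar_algebra) \<Rightarrow> 'x \<Rightarrow> 'a \<Rightarrow> 'b" where
  "fibre_map E emb fib x = (THE \<pi>. bounded_linear \<pi> \<and>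
     (\<forall>r s. \<forall>t \<in> arrows E r s. \<pi> (emb r s t) = fib x r s (point_arrow x (t x))))"

definition spectral_bundle ::
  "('x, 'e) vbundle \<Rightarrow> (nat \<Rightarrow> nat \<Rightarrow> ('x, 'e) arrow \<Rightarrow> 'a::cstar_algebra) \<Rightarrow>
   ('x \<Rightarrow> nat \<Rightarrow> nat \<Rightarrow> ('x, 'e) arrow \<Rightarrow> 'b::cstar_algebra) \<Rightarrow> ('x, 'e) arrow set \<Rightarrow>
   ('x \<times> ('e tensor \<Rightarrow> 'e tensor)) topology" where
  "spectral_bundle E emb fib G = subtopology (unitary_bundle E)
     {(x, u). x \<in> topspace (base E) \<and> u \<in> unitary_fibre E x \<and>
        (\<forall>y \<in> fibre_map E emb fib x ` fixed_algebra E emb G.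
           hat_aut (restrict_bundle E x) (fib x) (point_arrow x u) y = y)}"

definition section_group ::
  "('x, 'e) vbundle \<Rightarrow> (nat \<Rightarrow> nat \<Rightarrow> ('x, 'e) arrow \<Rightarrow> 'a::cstar_algebra) \<Rightarrow>
   ('x \<Rightarrow> nat \<Rightarrow> nat \<Rightarrow> ('x, 'e) arrow \<Rightarrow> 'b::cstar_algebra) \<Rightarrow> ('x, 'e) arrow set \<Rightarrow>
   ('x, 'e) arrow monoid" where
  "section_group E emb fib G =
     (unitary_group E)\<lparr>carrier := {g \<in> unitaries E.
        \<forall>x \<in> topspace (base E). (x, g x) \<in> topspace (spectral_bundle E emb fib G)}\<rparr>"

end

theory Submission imports Defs begin

text \<open>A *-homomorphism between \<open>C\<^sup>*\<close>-algebras is contractive, and a *-homomorphism on the graded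
algebraic part of a Cuntz-Pimsner algebra that contracts homogeneous elements extends to the closure. This
yields the automorphisms \<open>hat_aut E emb g\<close> and the evaluations at points of \<open>X\<close>; as the norms of arrows
are fibrewise suprema, a section of the spectral bundle fixes every arrow of the dual of \<open>G\<close>.

Conversely let \<open>\<alpha>\<close> be an automorphism fixing \<open>O\<^sub>G\<close>, and let \<open>\<psi>\<close> be a section of \<open>E\<close>. Permutations of
tensor factors commute with \<open>g \<otimes> \<dots> \<otimes> g\<close>, so \<open>\<alpha>\<close> fixes them; hence \<open>\<alpha> \<psi>\<close>, like \<open>\<psi>\<close>, intertwines every
permutation with its shift. For \<open>d \<ge> 2\<close> such an element is homogeneous of degree 1 and again a section of
\<open>E\<close>. With a Parseval frame \<open>\<psi>\<^sub>j\<close> of \<open>E\<close>, the element \<open>\<Sum>\<^sub>j (\<alpha> \<psi>\<^sub>j) \<psi>\<^sub>j\<^sup>*\<close> is then a unitary arrow inducing \<open>\<alpha>\<close>.\<close>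

section \<open>Generalities on C*-algebras\<close>

text \<open>Nothing guarantees in advance that an automorphism fixing \<open>O_G\<close> respects
  degrees. The image of a section is a limit of finite sums of homogeneous elements; their
  components satisfy the permutation relations only up to an error, and better approximations live
  on ever more tensor factors. Hence every estimate needs a constant independent of the number
  \<open>r\<close> of factors. In degree 1 the component is contracted against \<open>card J\<close>
  vectors of norm at most 1 whose squares add up to the unit; the result is a section close to it.
  In degree \<open>k \<noteq> 1\<close> the relations force the component nearly to annihilate the
  difference of two transpositions lying \<open>\<bar>k - 1\<bar>\<close> factors apart. This
  difference is tested against words in the frame and gives Gram determinants, which do not all
  vanish at a point once the rank is at least 2; the resulting constant depends on \<open>k\<close>
  only. A bundle need not have a global basis. A Parseval frame has redundant but globally
  continuous coefficients, its Cuntz-type relations hold with functions on the base in place of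
  Kronecker deltas, and these functions are central.\<close>

lemma scaleC_one [simp]: "scaleC 1 x = (x::'a::cstar_algebra)"
  using scaleC_of_real[of 1 x] by simp

lemma scaleC_zero_left [simp]: "scaleC 0 x = (0::'a::cstar_algebra)"
  using scaleC_of_real[of 0 x] by simp

lemma scaleC_zero_right [simp]: "scaleC c 0 = (0::'a::cstar_algebra)"
  using scaleC_add_right[of c 0 0] by simp

lemma scaleC_minus_right: "scaleC c (- x) = - scaleC c (x::'a::cstar_algebra)"
  using scaleC_add_right[of c x "- x"] by (simp add: minus_unique)

lemma scaleC_diff_right: "scaleC c (x - y) = scaleC c x - scaleC c (y::'a::cstar_algebra)"
  using scaleC_add_right[of c x "- y"] by (simp add: scaleC_minus_right)

lemma scaleC_minus1: "scaleC (-1) x = - (x::'a::cstar_algebra)"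
  using scaleC_of_real[of "-1" x] by simp

lemma scaleC_sum_right: "scaleC c (sum f A) = (\<Sum>i\<in>A. scaleC c (f i :: 'a::cstar_algebra))"
  by (induction A rule: infinite_finite_induct) (simp_all add: scaleC_add_right)

lemma scaleC_sum_left: "scaleC (sum f A) x = (\<Sum>i\<in>A. scaleC (f i) (x :: 'a::cstar_algebra))"
  by (induction A rule: infinite_finite_induct) (simp_all add: scaleC_add_left)

lemma star_zero [simp]: "star 0 = (0::'a::cstar_algebra)"
  using star_add[of "0::'a" 0] by simp

lemma star_minus: "star (- x) = - star (x::'a::cstar_algebra)"
  using star_add[of x "- x"] by (simp add: minus_unique)

lemma star_diff: "star (x - y) = star x - star (y::'a::cstar_algebra)"
  using star_add[of x "- y"] by (simp add: star_minus)

lemma star_sum: "star (sum f A) = (\<Sum>i\<in>A. star (f i :: 'a::cstar_algebra))"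
  by (induction A rule: infinite_finite_induct) (simp_all add: star_add)

lemma star_scaleR: "star (scaleR r x) = scaleR r (star (x::'a::cstar_algebra))"
  using star_scaleC[of "complex_of_real r" x] by (simp add: scaleC_of_real)

lemma norm_star [simp]: "norm (star x) = norm (x::'a::cstar_algebra)"
proof -
  have le: "norm y \<le> norm (star y)" for y :: 'a
  proof (cases "norm y = 0")
    case False
    have "norm y * norm y \<le> norm (star y) * norm y"
      using cstar_identity[of y] norm_mult_ineq[of "star y" y] by (simp add: power2_eq_square)
    then show ?thesis using False by (simp add: mult_le_cancel_right)
  qed simp
  show ?thesis using le[of x] le[of "star x"] by (simp add: star_star)
qed

lemma bounded_linear_star: "bounded_linear (star :: 'a::cstar_algebra \<Rightarrow> 'a)"
  by (rule bounded_linear_intro[where K=1]) (simp_all add: star_add star_scaleR)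

lemma bounded_linear_scaleC: "bounded_linear (scaleC c :: 'a::cstar_algebra \<Rightarrow> 'a)"
proof (rule bounded_linear_intro[where K="cmod c"])
  fix r :: real and x :: 'a
  show "scaleC c (scaleR r x) = scaleR r (scaleC c x)"
    using scaleC_scaleC[of c "complex_of_real r" x] scaleC_scaleC[of "complex_of_real r" c x]
    by (simp add: scaleC_of_real mult.commute)
qed (simp_all add: scaleC_add_right norm_scaleC mult.commute)

lemmas tendsto_star = bounded_linear.tendsto[OF bounded_linear_star]
lemmas tendsto_scaleC = bounded_linear.tendsto[OF bounded_linear_scaleC]

subsection \<open>Contractivity of *-homomorphisms\<close>

lemma star_hom_diff: "star_hom f \<Longrightarrow> f (x - y) = f x - f y"
  unfolding star_hom_def by (metis add_diff_cancel diff_add_cancel)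

lemma star_hom_0: "star_hom f \<Longrightarrow> f 0 = 0"
  using star_hom_diff[of f 0 0] by simp

lemma star_hom_sum: "star_hom f \<Longrightarrow> f (sum g A) = (\<Sum>i\<in>A. f (g i))"
  by (induction A rule: infinite_finite_induct) (simp_all add: star_hom_0, simp_all add: star_hom_def)

lemma star_hom_scaleR: "star_hom f \<Longrightarrow> f (scaleR r x) = scaleR r (f x)"
  unfolding star_hom_def by (metis scaleC_of_real)

lemma star_hom_mult: "star_hom f \<Longrightarrow> f (x * y) = f x * f y"
  and star_hom_add: "star_hom f \<Longrightarrow> f (x + y) = f x + f y"
  and star_hom_star: "star_hom f \<Longrightarrow> f (star x) = star (f x)"
  and star_hom_scaleC: "star_hom f \<Longrightarrow> f (scaleC c x) = scaleC c (f x)"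
  unfolding star_hom_def by auto

text \<open>The solution \<open>w\<close> is \<open>1 - sqrt (1 - c\<^sup>2)\<close>, as a fixed point of \<open>w \<mapsto> (c\<^sup>2 + w\<^sup>2) / 2\<close>.\<close>

lemma selfadjoint_sqrt:
  fixes c :: "'a::cstar_algebra"
  assumes sa: "star c = c" and n: "norm c < 1"
  obtains w where "star w = w" "w * c = c * w" "w + w = c * c + w * w"
proof -
  define f where "f w = (1/2) *\<^sub>R (c * c + w * w)" for w
  \<comment> \<open>Besides bounding the norm, \<open>S\<close> records selfadjointness and
    commutation with \<open>c\<close>: both are closed conditions preserved by \<open>f\<close>, so
    the fixed point has them. On this ball \<open>f\<close> has Lipschitz constant
    \<open>norm c\<close>.\<close>
  define S where "S = {w. norm w \<le> norm c \<and> star w = w \<and> w * c = c * w}"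
  have "closed S"
    unfolding S_def
    by (intro closed_Collect_conj closed_Collect_le closed_Collect_eq continuous_intros
        bounded_linear.continuous_on[OF bounded_linear_star])
  then have "complete S" by (simp add: complete_eq_closed)
  moreover have "S \<noteq> {}" unfolding S_def by (auto intro: exI[of _ 0])
  moreover have "f ` S \<subseteq> S"
  proof safe
    fix w assume w: "w \<in> S"
    have 1: "norm (c * c) \<le> norm c" 
      using norm_mult_ineq[of c c] n mult_left_le[of "norm c" "norm c"] by simp
    have 2: "norm (w * w) \<le> norm c"
    proof -
      have "norm (w * w) \<le> norm w * norm w" by (rule norm_mult_ineq)
      also have "\<dots> \<le> norm c * 1" using w n by (intro mult_mono) (auto simp: S_def)
      finally show ?thesis by simp
    qed
    have "norm (f w) \<le> norm c"
      unfolding f_def using 1 2 norm_triangle_ineq[of "c*c" "w*w"] by simp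
    moreover have "star (f w) = f w" using w sa
      by (simp add: f_def S_def star_scaleR star_add star_mult)
    moreover have "(w * w) * c = c * (w * w)" 
      using w by (metis (mono_tags, lifting) S_def mem_Collect_eq mult.assoc)
    then have "f w * c = c * f w" by (simp add: f_def algebra_simps)
    ultimately show "f w \<in> S" unfolding S_def by simp
  qed
  moreover have "dist (f v) (f w) \<le> norm c * dist v w" if "v \<in> S" "w \<in> S" for v w
  proof -
    have "f v - f w = (1/2) *\<^sub>R (v * (v - w) + (v - w) * w)"
      unfolding f_def scaleR_diff_right[symmetric] by (simp add: algebra_simps)
    then have "dist (f v) (f w) = (1/2) * norm (v * (v - w) + (v - w) * w)"
      by (simp add: dist_norm)
    also have "\<dots> \<le> (1/2) * (norm v * norm (v - w) + norm (v - w) * norm w)"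
      using norm_triangle_ineq[of "v * (v - w)" "(v - w) * w"] norm_mult_ineq[of v "v - w"]
        norm_mult_ineq[of "v - w" w] by simp
    also have "\<dots> \<le> (1/2) * (norm c * norm (v - w) + norm (v - w) * norm c)"
      using that by (intro mult_left_mono add_mono mult_mono) (auto simp: S_def)
    finally show ?thesis by (simp add: dist_norm)
  qed
  ultimately have "\<exists>!w\<in>S. f w = w" using n by (intro Banach_fix[of S "norm c" f]) auto
  then obtain w where w: "w \<in> S" "f w = w" by auto
  show ?thesis
  proof (rule that[of w])
    show "w + w = c * c + w * w" 
      using w(2) unfolding f_def by (metis field_sum_of_halves scaleR_add_left scaleR_half_double scaleR_add_right)
  qed (use w in \<open>auto simp: S_def\<close>)
qed

text \<open>A left unit is selfadjoint, so the C*-identity leaves only 0 and 1 for its norm. The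
  value 0 occurs in the zero algebra, which belongs to an empty base.\<close>

lemma norm_unit_le_1:
  fixes e :: "'a::cstar_algebra"
  assumes "\<And>x. e * x = x"
  shows "norm e \<le> 1"
proof -
  have "star e = e" using assms by (metis star_mult star_star)
  then have "(norm e)\<^sup>2 = norm e" using cstar_identity[of e] assms by simp
  then have "norm e = 0 \<or> norm e = 1" by (simp add: power2_eq_square)
  then show ?thesis by auto
qed

text \<open>A selfadjoint \<open>c\<close> of norm less than 1 is the real part of the unitary
  \<open>c + \<i> sqrt (1 - c\<^sup>2)\<close>, and unitaries are mapped to unitaries.\<close>

lemma star_hom_contractive:
  fixes f :: "'a::cstar_algebra \<Rightarrow> 'b::cstar_algebra"
  assumes f: "star_hom f" and e: "\<And>x. e * x = x" "\<And>x. x * e = x" and fe: "\<And>y. f e * y = y"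
  shows "norm (f a) \<le> norm a"
proof -
  have small: "norm (f c) \<le> 1" if c: "star c = c" "norm c < 1" for c
  proof -
    obtain w where w: "star w = w" "w * c = c * w" "w + w = c * c + w * w"
      by (rule selfadjoint_sqrt[OF c])
    define b where "b = e - w"
    have se: "star e = e" using e by (metis star_mult star_star)
    have bb: "b * b = e - c * c" using w(3) by (simp add: b_def algebra_simps e)
    have sb: "star b = b" by (simp add: b_def star_diff se w)
    have bc: "b * c = c * b" by (simp add: b_def algebra_simps e w)
    define u where "u = f c + scaleC \<i> (f b)"
    have su: "star u = f c - scaleC \<i> (f b)"
      using c sb star_hom_star[OF f, of c] star_hom_star[OF f, of b]
      by (simp add: u_def star_add star_scaleC) (metis add_uminus_conv_diff scaleC_minus1 scaleC_scaleC mult_minus1)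
    have "f b * f c = f c * f b" using bc star_hom_mult[OF f] by metis
    then have "star u * u = f c * f c + f b * f b"
      unfolding su unfolding u_def
      by (simp add: algebra_simps mult_scaleC_left mult_scaleC_right scaleC_scaleC scaleC_minus1
          scaleC_add_right scaleC_diff_right)
    also have "\<dots> = f (c * c + b * b)" by (simp add: star_hom_mult[OF f] star_hom_add[OF f])
    also have "\<dots> = f e" by (simp add: bb)
    finally have "(norm u)\<^sup>2 \<le> 1" using cstar_identity[of u] norm_unit_le_1[OF fe] by simp
    then have nu: "norm u \<le> 1" by (simp add: power_le_one_iff)
    have "f c = (1/2) *\<^sub>R (u + star u)" unfolding su unfolding u_def by (simp add: scaleR_half_double)
    then have "norm (f c) = (1/2) * norm (u + star u)" by simp
    also have "\<dots> \<le> 1" using nu norm_triangle_ineq[of u "star u"] by simp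
    finally show ?thesis .
  qed
  \<comment> \<open>Division by any \<open>t > norm c\<close> brings \<open>c\<close> into the open
    unit ball; then \<open>t\<close> tends to \<open>norm c\<close>.\<close>
  have sa: "norm (f c) \<le> norm c" if c: "star c = c" for c
  proof (rule dense_ge)
    fix t assume t: "norm c < t"
    then have t0: "t > 0" using norm_ge_zero[of c] by linarith
    have "norm (f ((1/t) *\<^sub>R c)) \<le> 1"
      by (rule small) (use t t0 c in \<open>simp_all add: star_scaleR\<close>)
    then show "norm (f c) \<le> t" using t0 by (simp add: star_hom_scaleR[OF f] field_simps)
  qed
  have "(norm (f a))\<^sup>2 = norm (f (star a * a))"
    by (simp add: star_hom_mult[OF f] star_hom_star[OF f] cstar_identity)
  also have "\<dots> \<le> norm (star a * a)" by (rule sa) (simp add: star_mult star_star)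
  also have "\<dots> = (norm a)\<^sup>2" by (rule cstar_identity)
  finally show ?thesis by (simp add: power_mono_iff)
qed

subsection \<open>Fejer means\<close>

text \<open>Orthogonality of characters, used instead of integration over the circle. The bound on
  \<open>l\<close> leaves 0 as the only value divisible by \<open>M\<close>.\<close>

lemma sum_roots_of_unity:
  fixes l :: int and M :: nat
  assumes "\<bar>l\<bar> < int M"
  shows "(\<Sum>j<M. cis (2 * pi * real j / real M) powi l) = (if l = 0 then of_nat M else 0)"
proof (cases "l = 0")
  case False
  define z where "z = cis (2 * pi * real_of_int l / real M)"
  have M: "M > 0" using assms by auto
  have zj: "cis (2 * pi * real j / real M) powi l = z ^ j" for j
    by (simp add: z_def cis_power_int Complex.DeMoivre mult_ac)
  have "z \<noteq> 1"
  proof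
    assume "z = 1"
    then have "cos (2 * pi * real_of_int l / real M) = 1" by (simp add: z_def complex_eq_iff)
    then obtain k :: int where "2 * pi * real_of_int l / real M = real_of_int k * 2 * pi"
      using cos_one_2pi_int by auto
    then have "real_of_int l = real_of_int k * real M" using M by (simp add: field_simps)
    then have "l = k * int M" by (metis of_int_eq_iff of_int_mult of_int_of_nat_eq)
    then show False using assms False 
      by (metis abs_mult abs_of_nat mult_cancel_right1 mult_le_cancel_right1 mult_zero_left not_less
          of_nat_less_0_iff zero_less_abs_iff int_one_le_iff_zero_less abs_ge_zero)
  qed
  moreover have "z ^ M = 1"
  proof -
    have "z ^ M = cis (2 * pi * real_of_int l)" using M by (simp add: z_def Complex.DeMoivre)
    then show ?thesis by (simp add: cis_multiple_2pi)
  qed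
  ultimately show ?thesis using False by (simp add: zj sum_gp_strict)
qed auto

text \<open>The circle action is averaged against the Fejer kernel, translated to the centre
  \<open>c\<close>. The kernel is nonnegative with mean 1, so the weighted sum is a convex
  combination of elements that all have the norm of the original sum.\<close>

lemma fejer_contraction:
  fixes a :: "int \<Rightarrow> 'a::cstar_algebra" and N :: nat and c :: int
  assumes K: "finite K" and N: "N > 0"
    and circ: "\<And>z. cmod z = 1 \<Longrightarrow>
      norm (\<Sum>k\<in>K. scaleC (z powi k) (a k)) = norm (\<Sum>k\<in>K. a k)"
  shows "norm (\<Sum>k\<in>K. max 0 (1 - \<bar>real_of_int (k - c)\<bar> / real N) *\<^sub>R a k) \<le> norm (\<Sum>k\<in>K. a k)"
proof -
  \<comment> \<open>Large enough to exceed every frequency \<open>(p - q) + (k - c)\<close> with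
    \<open>p, q < N\<close> that occurs below, so that the finite averages give the Fourier
    coefficients exactly.\<close>
  define M :: nat where "M = N + 1 + nat (\<Sum>k\<in>K. \<bar>k - c\<bar>)"
  have M: "M > 0" "\<And>k. k \<in> K \<Longrightarrow> \<bar>k - c\<bar> + int N < int M"
  proof -
    fix k assume "k \<in> K"
    then have "\<bar>k - c\<bar> \<le> (\<Sum>k\<in>K. \<bar>k - c\<bar>)" using K by (intro member_le_sum) auto
    then show "\<bar>k - c\<bar> + int N < int M" unfolding M_def by linarith
  qed (simp add: M_def)
  define w where "w j = cis (2 * pi * real j / real M)" for j :: nat
  have w: "w j \<noteq> 0" "cmod (w j) = 1" for j by (auto simp: w_def)
  define W where "W j = (\<Sum>p<N. w j powi int p)" for j
  \<comment> \<open>The Fejer kernel at the roots of unity, written as a square to make its sign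
    visible.\<close>
  define F where "F j = (cmod (W j))\<^sup>2 / real N" for j
  have F: "complex_of_real (F j) = (\<Sum>p<N. \<Sum>q<N. w j powi (int p - int q)) / of_nat N" for j
  proof -
    have "cnj (w j powi q) = w j powi (- q)" for q
      by (metis cis_cnj cis_inverse complex_cnj_power_int power_int_inverse power_int_minus w_def)
    then have "(\<Sum>p<N. \<Sum>q<N. w j powi (int p - int q)) = W j * cnj (W j)"
      unfolding W_def cnj_sum sum_product
      using w by (simp add: power_int_diff power_int_minus divide_inverse flip: power_int_of_nat)
    then show ?thesis using complex_norm_square[of "W j"] by (simp add: F_def)
  qed
  have coef: "(\<Sum>j<M. complex_of_real (F j) * w j powi m) / of_nat M
      = complex_of_real (max 0 (1 - \<bar>real_of_int m\<bar> / real N))" if m: "\<bar>m\<bar> + int N < int M" for m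
  proof -
    have "(\<Sum>j<M. complex_of_real (F j) * w j powi m)
        = (\<Sum>j<M. \<Sum>p<N. \<Sum>q<N. w j powi (int p - int q + m)) / of_nat N"
      unfolding F sum_divide_distrib[symmetric] 
      by (simp add: sum_distrib_right power_int_add w flip: sum_divide_distrib)
    also have "(\<Sum>j<M. \<Sum>p<N. \<Sum>q<N. w j powi (int p - int q + m))
        = (\<Sum>p<N. \<Sum>q<N. \<Sum>j<M. w j powi (int p - int q + m))"
      by (rule trans[OF sum.swap], rule sum.cong[OF refl], rule sum.swap)
    also have "\<dots> = (\<Sum>p<N. \<Sum>q<N. if int p - int q + m = 0 then of_nat M else 0)"
      unfolding w_def using m by (intro sum.cong refl sum_roots_of_unity) auto
    also have "\<dots> = (\<Sum>p<N. if p \<in> {p. 0 \<le> int p + m \<and> int p + m < int N} then of_nat M else 0)"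
    proof (intro sum.cong refl)
      fix p
      show "(\<Sum>q<N. if int p - int q + m = 0 then of_nat M else (0::complex)) =
        (if p \<in> {p. 0 \<le> int p + m \<and> int p + m < int N} then of_nat M else 0)"
      proof (cases "0 \<le> int p + m \<and> int p + m < int N")
        case True
        then have "(\<Sum>q<N. if int p - int q + m = 0 then of_nat M else (0::complex))
          = (\<Sum>q<N. if q = nat (int p + m) then of_nat M else 0)"
          by (intro sum.cong) auto
        then show ?thesis using True by auto
      qed (auto intro!: sum.neutral)
    qed
    \<comment> \<open>The triangular weight is a count: for \<open>\<bar>m\<bar> \<le> N\<close>,
      exactly \<open>N - \<bar>m\<bar>\<close> indices \<open>p < N\<close> have
      \<open>p + m\<close> in the same range; otherwise there are none.\<close>
    also have "\<dots> = of_nat (card ({..<N} \<inter> {p. 0 \<le> int p + m \<and> int p + m < int N})) * of_nat M"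
      by (subst sum.inter_restrict[symmetric]) auto
    also have "{..<N} \<inter> {p. 0 \<le> int p + m \<and> int p + m < int N}
        = {nat (max 0 (- m))..<nat (min (int N) (int N - m))}"
      by auto
    also have "card \<dots> = nat (int N - \<bar>m\<bar>)" by auto
    finally have "(\<Sum>j<M. complex_of_real (F j) * w j powi m) / of_nat M
        = of_nat (nat (int N - \<bar>m\<bar>)) / of_nat N" using M(1) by simp
    also have "\<dots> = complex_of_real (real (nat (int N - \<bar>m\<bar>)) / real N)" by simp
    also have "real (nat (int N - \<bar>m\<bar>)) / real N = max 0 (1 - \<bar>real_of_int m\<bar> / real N)"
      using N by (cases "\<bar>m\<bar> \<le> int N") (auto simp: max_def field_simps of_nat_nat)
    finally show ?thesis .
  qed
  have F0: "F j \<ge> 0" for j by (simp add: F_def)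
  have "(\<Sum>j<M. complex_of_real (F j)) / of_nat M = 1"
  proof -
    have "int N < int M" unfolding M_def by linarith
    then show ?thesis using coef[of 0] by simp
  qed
  then have "complex_of_real ((\<Sum>j<M. F j) / real M) = complex_of_real 1" by simp
  then have sumF: "(\<Sum>j<M. F j) / real M = 1" unfolding of_real_eq_iff .
  have "(\<Sum>k\<in>K. max 0 (1 - \<bar>real_of_int (k - c)\<bar> / real N) *\<^sub>R a k)
      = (\<Sum>k\<in>K. scaleC ((\<Sum>j<M. complex_of_real (F j) * w j powi (k - c)) / of_nat M) (a k))"
    using M(2) by (intro sum.cong refl) (simp add: coef scaleC_of_real)
  also have "\<dots> = (\<Sum>j<M. scaleC (complex_of_real (F j / real M) * w j powi (- c))
                    (\<Sum>k\<in>K. scaleC (w j powi k) (a k)))"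
    unfolding sum_divide_distrib scaleC_sum_left scaleC_sum_right scaleC_scaleC
    by (subst sum.swap) (simp add: mult_ac power_int_add[symmetric] w)
  also have "norm \<dots> \<le> (\<Sum>j<M. (F j / real M) * norm (\<Sum>k\<in>K. a k))"
    by (rule sum_norm_le)
      (simp add: norm_scaleC norm_mult norm_power_int w circ F0 abs_of_nonneg del: of_real_divide)
  also have "\<dots> = norm (\<Sum>k\<in>K. a k)"
    using sumF by (simp add: sum_distrib_right[symmetric] sum_divide_distrib[symmetric])
  finally show ?thesis .
qed

text \<open>The window with \<open>N = 1\<close> retains the single degree \<open>c\<close>.\<close>

lemma norm_component_le:
  fixes a :: "int \<Rightarrow> 'a::cstar_algebra"
  assumes K: "finite K" and c: "c \<in> K"
    and circ: "\<And>z. cmod z = 1 \<Longrightarrow>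
      norm (\<Sum>k\<in>K. scaleC (z powi k) (a k)) = norm (\<Sum>k\<in>K. a k)"
  shows "norm (a c) \<le> norm (\<Sum>k\<in>K. a k)"
proof -
  have "max 0 (1 - \<bar>real_of_int (k - c)\<bar> / real 1) *\<^sub>R a k = (if k = c then a k else 0)" for k
    by auto
  then show ?thesis using fejer_contraction[OF K _ circ, of 1 c] K c by simp
qed

subsection \<open>Extension from a graded dense *-subalgebra\<close>

text \<open>Contractivity on homogeneous elements only gives \<open>norm b \<le> (2 m + 1) norm a\<close> for sums of
  degrees in \<open>[-m, m]\<close>. Applied to \<open>(a\<^sup>* a)^(2^j)\<close>, whose degree grows only linearly in the
  exponent, this improves to \<open>norm b \<le> norm a\<close>.\<close>

lemma graded_extension:
  fixes Rel :: "int \<Rightarrow> ('a::cstar_algebra \<times> 'b::cstar_algebra) set"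
  assumes zero: "\<And>k. (0, 0) \<in> Rel k"
    and add: "\<And>k a b a' b'. (a, b) \<in> Rel k \<Longrightarrow> (a', b') \<in> Rel k \<Longrightarrow> (a + a', b + b') \<in> Rel k"
    and sc: "\<And>k a b c. (a, b) \<in> Rel k \<Longrightarrow> (scaleC c a, scaleC c b) \<in> Rel k"
    and mult: "\<And>j k a b a' b'. (a, b) \<in> Rel j \<Longrightarrow> (a', b') \<in> Rel k \<Longrightarrow> (a * a', b * b') \<in> Rel (j + k)"
    and st: "\<And>k a b. (a, b) \<in> Rel k \<Longrightarrow> (star a, star b) \<in> Rel (- k)"
    and bound: "\<And>k a b. (a, b) \<in> Rel k \<Longrightarrow> norm b \<le> norm a"
    and circ: "\<And>K a z. finite K \<Longrightarrow> \<forall>k\<in>K. a k \<in> fst ` Rel k \<Longrightarrow> cmod z = 1 \<Longrightarrow>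
      norm (\<Sum>k\<in>K. scaleC (z powi k) (a k)) = norm (\<Sum>k\<in>K. a k)"
    and dense: "closure (span (\<Union>k. fst ` Rel k)) = UNIV"
  obtains \<pi> where "bounded_linear \<pi>" "star_hom \<pi>" "\<And>a. norm (\<pi> a) \<le> norm a"
    "\<And>k a b. (a, b) \<in> Rel k \<Longrightarrow> \<pi> a = b"
proof -
  \<comment> \<open>Pairs instead of a map: that a sum of homogeneous elements determines its
    partner is not known beforehand, and only comes out of the norm bound.\<close>
  define T where "T m = {(\<Sum>k\<in>{- int m..int m}. a k, \<Sum>k\<in>{- int m..int m}. b k) | a b.
      \<forall>k. (a k, b k) \<in> Rel k}" for m :: nat
  have TI: "(\<Sum>k\<in>{- int m..int m}. a k, \<Sum>k\<in>{- int m..int m}. b k) \<in> T m"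
    if "\<And>k. (a k, b k) \<in> Rel k" for m a b
    using that unfolding T_def by blast
  have TE: "\<exists>a' b'. (\<forall>k. (a' k, b' k) \<in> Rel k) \<and> a = (\<Sum>k\<in>{- int m..int m}. a' k) \<and>
      b = (\<Sum>k\<in>{- int m..int m}. b' k)" if "(a, b) \<in> T m" for a b m
    using that unfolding T_def by blast
  have T_add: "(a + a', b + b') \<in> T m" if ab: "(a, b) \<in> T m" "(a', b') \<in> T m" for a b a' b' m
  proof -
    obtain u v where uv: "\<And>k. (u k, v k) \<in> Rel k" "a = (\<Sum>k\<in>{- int m..int m}. u k)"
      "b = (\<Sum>k\<in>{- int m..int m}. v k)" using TE[OF ab(1)] by blast
    obtain u' v' where uv': "\<And>k. (u' k, v' k) \<in> Rel k" "a' = (\<Sum>k\<in>{- int m..int m}. u' k)"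
      "b' = (\<Sum>k\<in>{- int m..int m}. v' k)" using TE[OF ab(2)] by blast
    show ?thesis
      using TI[of "\<lambda>k. u k + u' k" "\<lambda>k. v k + v' k" m] uv uv' add by (simp add: sum.distrib)
  qed
  have T_zero: "(0, 0) \<in> T m" for m using TI[of "\<lambda>_. 0" "\<lambda>_. 0" m] zero by simp
  have T_sc: "(scaleC c a, scaleC c b) \<in> T m" if ab: "(a, b) \<in> T m" for a b m c
  proof -
    obtain u v where uv: "\<And>k. (u k, v k) \<in> Rel k" "a = (\<Sum>k\<in>{- int m..int m}. u k)"
      "b = (\<Sum>k\<in>{- int m..int m}. v k)" using TE[OF ab(1)] by blast
    show ?thesis
      using TI[of "\<lambda>k. scaleC c (u k)" "\<lambda>k. scaleC c (v k)" m] uv sc by (simp add: scaleC_sum_right)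
  qed
  have T_st: "(star a, star b) \<in> T m" if ab: "(a, b) \<in> T m" for a b m
  proof -
    obtain u v where uv: "\<And>k. (u k, v k) \<in> Rel k" "a = (\<Sum>k\<in>{- int m..int m}. u k)"
      "b = (\<Sum>k\<in>{- int m..int m}. v k)" using TE[OF ab] by blast
    have r: "(\<Sum>k\<in>{- int m..int m}. g (- k)) = (\<Sum>k\<in>{- int m..int m}. g k)"
      for g :: "int \<Rightarrow> 'c::comm_monoid_add"
      by (rule sum.reindex_bij_witness[of _ uminus uminus]) auto
    have "(star (u (- k)), star (v (- k))) \<in> Rel k" for k using st[OF uv(1)[of "- k"]] by simp
    then show ?thesis
      using TI[of "\<lambda>k. star (u (- k))" "\<lambda>k. star (v (- k))" m]
      by (simp add: r[of "\<lambda>k. star (u k)"] r[of "\<lambda>k. star (v k)"] uv star_sum)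
  qed
  have T_one: "(a, b) \<in> T m" if ab: "(a, b) \<in> Rel k" "\<bar>k\<bar> \<le> int m" for a b k m
  proof -
    have "((if j = k then a else 0), (if j = k then b else 0)) \<in> Rel j" for j
      using ab zero by auto
    then show ?thesis
      using TI[of "\<lambda>j. if j = k then a else 0" "\<lambda>j. if j = k then b else 0" m] ab(2)
      by (simp add: abs_le_iff minus_le_iff)
  qed
  have T_sum: "(\<Sum>i\<in>I. a i, \<Sum>i\<in>I. b i) \<in> T m"
    if "\<And>i. i \<in> I \<Longrightarrow> (a i, b i) \<in> T m" for I :: "(int \<times> int) set" and a b m
    using that by (induction I rule: infinite_finite_induct) (auto simp: T_zero intro!: T_add)
  have T_mult: "(a * a', b * b') \<in> T (m + m')" if ab: "(a, b) \<in> T m" "(a', b') \<in> T m'" for a b a' b' m m'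
  proof -
    obtain u v where uv: "\<And>k. (u k, v k) \<in> Rel k" "a = (\<Sum>k\<in>{- int m..int m}. u k)"
      "b = (\<Sum>k\<in>{- int m..int m}. v k)" using TE[OF ab(1)] by blast
    obtain u' v' where uv': "\<And>k. (u' k, v' k) \<in> Rel k" "a' = (\<Sum>k\<in>{- int m'..int m'}. u' k)"
      "b' = (\<Sum>k\<in>{- int m'..int m'}. v' k)" using TE[OF ab(2)] by blast
    have "(\<Sum>p\<in>{- int m..int m} \<times> {- int m'..int m'}. u (fst p) * u' (snd p),
           \<Sum>p\<in>{- int m..int m} \<times> {- int m'..int m'}. v (fst p) * v' (snd p)) \<in> T (m + m')"
      by (rule T_sum, rule T_one[OF mult[OF uv(1) uv'(1)]]) auto
    then show ?thesis by (simp add: uv uv' sum_product sum.cartesian_product case_prod_beta)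
  qed
  have T_weak: "norm b \<le> (2 * real m + 1) * norm a" if ab: "(a, b) \<in> T m" for a b m
  proof -
    obtain u v where uv: "\<And>k. (u k, v k) \<in> Rel k" "a = (\<Sum>k\<in>{- int m..int m}. u k)"
      "b = (\<Sum>k\<in>{- int m..int m}. v k)" using TE[OF ab] by blast
    have fr: "u k \<in> fst ` Rel k" for k using uv(1)[of k] by force
    have "norm b \<le> (\<Sum>k\<in>{- int m..int m}. norm a)"
      unfolding uv(3)
    proof (rule sum_norm_le)
      fix k assume k: "k \<in> {- int m..int m}"
      have "norm (v k) \<le> norm (u k)" using bound[OF uv(1)] .
      also have "\<dots> \<le> norm a"
        unfolding uv(2) using k fr by (intro norm_component_le circ) auto
      finally show "norm (v k) \<le> norm a" .
    qed
    then show ?thesis by (simp add: algebra_simps)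
  qed
  \<comment> \<open>For selfadjoint elements the C*-identity makes the norm of a square the square
    of the norm, so the norms of these powers are exact while the range of degrees is only
    \<open>2 ^ j * m\<close>.\<close>
  have T_pow: "\<exists>a' b'. (a', b') \<in> T (2 ^ j * m) \<and> star a' = a' \<and> star b' = b' \<and>
      norm a' = norm a ^ 2 ^ j \<and> norm b' = norm b ^ 2 ^ j"
    if ab: "(a, b) \<in> T m" "star a = a" "star b = b" for a b m and j :: nat
  proof (induction j)
    case (Suc j)
    then obtain a' b' where a': "(a', b') \<in> T (2 ^ j * m)" "star a' = a'" "star b' = b'"
      "norm a' = norm a ^ 2 ^ j" "norm b' = norm b ^ 2 ^ j" by blast
    have "(a' * a', b' * b') \<in> T (2 ^ Suc j * m)" using T_mult[OF a'(1) a'(1)]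
      by (simp add: mult.assoc flip: distrib_right mult_2)
    moreover have "norm (a' * a') = norm a ^ 2 ^ Suc j" "norm (b' * b') = norm b ^ 2 ^ Suc j"
      using cstar_identity[of a'] cstar_identity[of b'] a' by (simp_all add: power_mult[symmetric] mult.commute)
    ultimately show ?case using a' by (intro exI[of _ "a' * a'"] exI[of _ "b' * b'"]) (simp add: star_mult)
  qed (use ab in auto)
  have strong_sa: "norm b \<le> norm a" if ab: "(a, b) \<in> T m" "star a = a" "star b = b" for a b m
  proof (rule ccontr)
    assume "\<not> norm b \<le> norm a"
    then have lt: "norm a < norm b" by simp
    have pos: "norm a > 0"
    proof (rule ccontr)
      assume "\<not> norm a > 0"
      then show False using T_weak[OF ab(1)] lt by simp
    qed
    define q where "q = norm b / norm a - 1"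
    have q: "q > 0" using lt pos by (simp add: q_def)
    have le: "q ^ 2 * (2 ^ j * (2 ^ j - 1) / 2) \<le> 2 * real (2 ^ j * m) + 1" for j :: nat
    proof -
      obtain a' b' where a': "(a', b') \<in> T (2 ^ j * m)" 
        "norm a' = norm a ^ 2 ^ j" "norm b' = norm b ^ 2 ^ j" using T_pow[OF ab, of j] by blast
      have "(1 + q) ^ 2 ^ j \<le> 2 * real (2 ^ j * m) + 1"
        using T_weak[OF a'(1)] a' pos by (simp add: q_def power_divide divide_le_eq)
      moreover have "real n * (real n - 1) / 2 * q ^ 2 \<le> (1 + q) ^ n" for n
      proof (induction n)
        case (Suc n)
        have "real n * q \<le> (1 + q) ^ n - 1" using Bernoulli_inequality[of q n] q by simp
        then have "real n * q * q \<le> ((1 + q) ^ n - 1) * q" using q by (intro mult_right_mono) auto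
        then show ?case using Suc q by (simp add: algebra_simps power2_eq_square)
      qed simp
      from this[of "2 ^ j"] have "q ^ 2 * (2 ^ j * (2 ^ j - 1) / 2) \<le> (1 + q) ^ 2 ^ j"
        by (simp add: mult_ac)
      ultimately show ?thesis by linarith
    qed
    \<comment> \<open>Chosen so that \<open>(2 ^ j - 1) * q ^ 2\<close> exceeds
      \<open>2 * (2 * m + 1)\<close>; after multiplication by \<open>2 ^ j\<close> this contradicts
      \<open>le\<close>.\<close>
    obtain j :: nat where j: "2 ^ j > (2 * (2 * real m + 1) / q ^ 2 + 1)"
      using real_arch_pow[of 2] by auto
    have "2 * (2 * real m + 1) < (2 ^ j - 1) * q ^ 2" using j q by (simp add: field_simps)
    then have "2 ^ j * (2 * (2 * real m + 1)) < 2 ^ j * ((2 ^ j - 1) * q ^ 2)" by simp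
    then have "(2::real) * 2 ^ j < 2" using le[of j] by (simp add: algebra_simps)
    moreover have "(1::real) \<le> 2 ^ j" by (rule one_le_power) simp
    ultimately show False by linarith
  qed
  have strong: "norm b \<le> norm a" if ab: "(a, b) \<in> T m" for a b m
  proof -
    have "norm (star b * b) \<le> norm (star a * a)"
      by (rule strong_sa[OF T_mult[OF T_st[OF ab] ab]]) (simp_all add: star_mult star_star)
    then show ?thesis by (simp add: cstar_identity power_mono_iff)
  qed
  define D where "D = (\<Union>m. T m)"
  have T_mono: "T m \<subseteq> T m'" if "m \<le> m'" for m m'
  proof clarify
    fix a b assume "(a, b) \<in> T m"
    then obtain u v where uv: "\<And>k. (u k, v k) \<in> Rel k" "a = (\<Sum>k\<in>{- int m..int m}. u k)"
      "b = (\<Sum>k\<in>{- int m..int m}. v k)" using TE by blast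
    have r: "(\<Sum>k\<in>{- int m'..int m'}. if \<bar>k\<bar> \<le> int m then g k else 0) = (\<Sum>k\<in>{- int m..int m}. g k)"
      for g :: "int \<Rightarrow> 'c::comm_monoid_add"
      using that by (intro sum.mono_neutral_cong_right) auto
    have "(if \<bar>k\<bar> \<le> int m then u k else 0, if \<bar>k\<bar> \<le> int m then v k else 0) \<in> Rel k" for k
      using uv zero by auto
    then show "(a, b) \<in> T m'"
      using TI[of "\<lambda>k. if \<bar>k\<bar> \<le> int m then u k else 0" "\<lambda>k. if \<bar>k\<bar> \<le> int m then v k else 0" m']
      by (simp add: r uv)
  qed
  have D_add: "(a + a', b + b') \<in> D" if "(a, b) \<in> D" "(a', b') \<in> D" for a b a' b'
  proof -
    obtain m m' where "(a, b) \<in> T m" "(a', b') \<in> T m'" using \<open>(a, b) \<in> D\<close> \<open>(a', b') \<in> D\<close> by (auto simp: D_def)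
    then have "(a, b) \<in> T (max m m')" "(a', b') \<in> T (max m m')"
      using T_mono[of m "max m m'"] T_mono[of m' "max m m'"] by auto
    then have "(a + a', b + b') \<in> T (max m m')" by (rule T_add)
    then show ?thesis unfolding D_def by blast
  qed
  have D_mult: "(a * a', b * b') \<in> D" if "(a, b) \<in> D" "(a', b') \<in> D" for a b a' b'
    using that by (auto simp: D_def intro: T_mult)
  have D_sc: "(scaleC c a, scaleC c b) \<in> D" if "(a, b) \<in> D" for a b c
    using that by (auto simp: D_def intro: T_sc)
  have D_st: "(star a, star b) \<in> D" if "(a, b) \<in> D" for a b
    using that by (auto simp: D_def intro: T_st)
  have D_norm: "norm b \<le> norm a" if "(a, b) \<in> D" for a b
    using that by (auto simp: D_def intro: strong)
  have D_diff: "(a - a', b - b') \<in> D" if "(a, b) \<in> D" "(a', b') \<in> D" for a b a' b'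
    using D_add[OF that(1) D_sc[OF that(2), of "-1"]] by (simp add: scaleC_minus1)
  have D_Rel: "(a, b) \<in> D" if "(a, b) \<in> Rel k" for a b k
    using T_one[OF that, of "nat \<bar>k\<bar>"] unfolding D_def by (intro UN_I[OF UNIV_I]) simp
  \<comment> \<open>The closure of \<open>D\<close> is the graph of the extension: the norm bound
    makes it single valued, density and completeness make it total, and the algebraic relations pass
    to limits.\<close>
  define C where "C = closure D"
  have CE: "\<exists>s t. (\<forall>n. (s n, t n) \<in> D) \<and> s \<longlonglongrightarrow> a \<and> t \<longlonglongrightarrow> b" if ab: "(a, b) \<in> C" for a b
  proof -
    obtain p where p: "\<And>n. p n \<in> D" "p \<longlonglongrightarrow> (a, b)"
      using ab unfolding C_def closure_sequential by auto
    show ?thesis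
      using p tendsto_fst[OF p(2)] tendsto_snd[OF p(2)]
      by (intro exI[of _ "\<lambda>n. fst (p n)"] exI[of _ "\<lambda>n. snd (p n)"]) auto
  qed
  have CI: "(a, b) \<in> C" if "\<And>n. (s n, t n) \<in> D" "s \<longlonglongrightarrow> a" "t \<longlonglongrightarrow> b" for s t a b
    unfolding C_def closure_sequential using that
    by (intro exI[of _ "\<lambda>n. (s n, t n)"]) (auto intro: tendsto_Pair)
  have C_add: "(a + a', b + b') \<in> C" if ab: "(a, b) \<in> C" "(a', b') \<in> C" for a b a' b'
  proof -
    obtain s t where st: "\<And>n. (s n, t n) \<in> D" "s \<longlonglongrightarrow> a" "t \<longlonglongrightarrow> b" using CE[OF ab(1)] by auto
    obtain s' t' where st': "\<And>n. (s' n, t' n) \<in> D" "s' \<longlonglongrightarrow> a'" "t' \<longlonglongrightarrow> b'" using CE[OF ab(2)] by auto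
    show ?thesis
      by (rule CI[of "\<lambda>n. s n + s' n" "\<lambda>n. t n + t' n"])
        (intro D_add st st' tendsto_add)+
  qed
  have C_mult: "(a * a', b * b') \<in> C" if ab: "(a, b) \<in> C" "(a', b') \<in> C" for a b a' b'
  proof -
    obtain s t where st: "\<And>n. (s n, t n) \<in> D" "s \<longlonglongrightarrow> a" "t \<longlonglongrightarrow> b" using CE[OF ab(1)] by auto
    obtain s' t' where st': "\<And>n. (s' n, t' n) \<in> D" "s' \<longlonglongrightarrow> a'" "t' \<longlonglongrightarrow> b'" using CE[OF ab(2)] by auto
    show ?thesis
      by (rule CI[of "\<lambda>n. s n * s' n" "\<lambda>n. t n * t' n"])
        (intro D_mult st st' tendsto_mult)+
  qed
  have C_sc: "(scaleC c a, scaleC c b) \<in> C" if ab: "(a, b) \<in> C" for a b c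
  proof -
    obtain s t where st: "\<And>n. (s n, t n) \<in> D" "s \<longlonglongrightarrow> a" "t \<longlonglongrightarrow> b" using CE[OF ab(1)] by auto
    show ?thesis
      by (rule CI[of "\<lambda>n. scaleC c (s n)" "\<lambda>n. scaleC c (t n)"])
        (intro D_sc st tendsto_scaleC)+
  qed
  have C_st: "(star a, star b) \<in> C" if ab: "(a, b) \<in> C" for a b
  proof -
    obtain s t where st: "\<And>n. (s n, t n) \<in> D" "s \<longlonglongrightarrow> a" "t \<longlonglongrightarrow> b" using CE[OF ab(1)] by auto
    show ?thesis
      by (rule CI[of "\<lambda>n. star (s n)" "\<lambda>n. star (t n)"])
        (intro D_st st tendsto_star)+
  qed
  have C_norm: "norm b \<le> norm a" if ab: "(a, b) \<in> C" for a b
  proof -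
    obtain s t where st: "\<And>n. (s n, t n) \<in> D" "s \<longlonglongrightarrow> a" "t \<longlonglongrightarrow> b" using CE[OF ab] by auto
    show ?thesis
      by (rule LIMSEQ_le[OF tendsto_norm[OF st(3)] tendsto_norm[OF st(2)]]) (use D_norm st(1) in blast)
  qed
  have C_unique: "b = b'" if ab: "(a, b) \<in> C" "(a, b') \<in> C" for a b b'
    using C_norm[OF C_add[OF ab(1) C_sc[OF ab(2), of "-1"]]] by (simp add: scaleC_minus1)
  have C_total: "\<exists>b. (a, b) \<in> C" for a
  proof -
    have "subspace (fst ` D)"
    proof (rule subspaceI)
      show "0 \<in> fst ` D" using D_Rel[OF zero] by force
      show "x + y \<in> fst ` D" if xy: "x \<in> fst ` D" "y \<in> fst ` D" for x y
        using xy by (auto intro!: image_eqI[OF _ D_add])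
      show "c *\<^sub>R x \<in> fst ` D" if x: "x \<in> fst ` D" for c x
      proof -
        obtain b where "(x, b) \<in> D" using x by auto
        from D_sc[OF this, of "complex_of_real c"] show ?thesis by (force simp: scaleC_of_real)
      qed
    qed
    moreover have "(\<Union>k. fst ` Rel k) \<subseteq> fst ` D" using D_Rel by force
    ultimately have "span (\<Union>k. fst ` Rel k) \<subseteq> fst ` D" by (rule span_minimal[rotated])
    then have "a \<in> closure (fst ` D)" using dense closure_mono by blast
    then obtain s where s: "\<And>n. s n \<in> fst ` D" "s \<longlonglongrightarrow> a" unfolding closure_sequential by auto
    then have "\<forall>n. \<exists>b. (s n, b) \<in> D" by fastforce
    then obtain t where t: "\<And>n. (s n, t n) \<in> D" by metis
    have "Cauchy s" using s(2) by (rule LIMSEQ_imp_Cauchy)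
    moreover have "dist (t m) (t n) \<le> dist (s m) (s n)" for m n
      using D_norm[OF D_diff[OF t t]] by (simp add: dist_norm)
    ultimately have "Cauchy t" unfolding Cauchy_def by (meson le_less_trans)
    then obtain b where "t \<longlonglongrightarrow> b" using Cauchy_convergent_iff convergent_def by blast
    then show ?thesis using CI[OF t s(2)] by blast
  qed
  define \<pi> where "\<pi> a = (THE b. (a, b) \<in> C)" for a
  have \<pi>: "(a, \<pi> a) \<in> C" for a
    unfolding \<pi>_def using C_total[of a] C_unique by (metis theI)
  have eq: "\<pi> a = b" if "(a, b) \<in> C" for a b using C_unique[OF \<pi> that] .
  show ?thesis
  proof (rule that)
    show sh: "star_hom \<pi>"
      unfolding star_hom_def
      by (intro conjI allI) (intro eq C_add C_mult C_sc C_st \<pi>)+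
    show n: "norm (\<pi> a) \<le> norm a" for a using C_norm[OF \<pi>] .
    show "bounded_linear \<pi>"
      by (rule bounded_linear_intro[where K=1])
        (auto simp: n star_hom_add[OF sh] star_hom_scaleR[OF sh])
    show "\<pi> a = b" if "(a, b) \<in> Rel k" for k a b
      using eq[of a b] D_Rel[OF that] closure_subset[of D] unfolding C_def by blast
  qed
qed

section \<open>Frames of Hermitian vector bundles\<close>

abbreviation continuous_fun :: "'a topology \<Rightarrow> ('a \<Rightarrow> 'b::topological_space) \<Rightarrow> bool" where
  "continuous_fun T \<equiv> continuous_map T euclidean"

lemma continuous_fun_mult:
  fixes f g :: "'a \<Rightarrow> 'b::real_normed_algebra"
  shows "continuous_fun T f \<Longrightarrow> continuous_fun T g \<Longrightarrow> continuous_fun T (\<lambda>x. f x * g x)"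
  by (simp add: continuous_map_atin tendsto_mult)

lemma continuous_fun_divide:
  fixes f g :: "'a \<Rightarrow> 'b::real_normed_field"
  shows "continuous_fun T f \<Longrightarrow> continuous_fun T g \<Longrightarrow> (\<And>x. x \<in> topspace T \<Longrightarrow> g x \<noteq> 0) \<Longrightarrow>
    continuous_fun T (\<lambda>x. f x / g x)"
  by (simp add: continuous_map_atin tendsto_divide)

lemma continuous_fun_cnj: "continuous_fun T f \<Longrightarrow> continuous_fun T (\<lambda>x. cnj (f x))"
  by (simp add: continuous_map_atin tendsto_cnj)

lemma continuous_fun_Re: "continuous_fun T f \<Longrightarrow> continuous_fun T (\<lambda>x. Re (f x))"
  by (simp add: continuous_map_atin tendsto_Re)

lemma continuous_fun_of_real:
  "continuous_fun T f \<Longrightarrow> continuous_fun T (\<lambda>x. complex_of_real (f x))"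
  by (simp add: continuous_map_atin tendsto_of_real)

lemma continuous_fun_sqrt: "continuous_fun T f \<Longrightarrow> continuous_fun T (\<lambda>x. sqrt (f x))"
  by (simp add: continuous_map_atin tendsto_real_sqrt)

text \<open>A finite family \<open>f\<^sub>j\<close> of global continuous sections with \<open>v = \<Sum>\<^sub>j \<langle>f\<^sub>j, v\<rangle> f\<^sub>j\<close> (a Parseval
  frame), together with what is needed of a Hermitian bundle of rank \<open>d\<close>. Unlike local
  triviality, these data restrict to the fibres without further ado.\<close>

locale framed_bundle =
  fixes E :: "('x, 'e) vbundle" and J :: "'j set" and f :: "'j \<Rightarrow> 'x \<Rightarrow> 'e" and d :: nat
  assumes compact_base: "compact_space (base E)"
    and rank: "2 \<le> d"
    and finite_J: "finite J"
    and vadd_fibre: "x \<in> topspace (base E) \<Longrightarrow> v \<in> fibre E x \<Longrightarrow> w \<in> fibre E x \<Longrightarrow> vadd E v w \<in> fibre E x"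
    and vscale_fibre: "x \<in> topspace (base E) \<Longrightarrow> v \<in> fibre E x \<Longrightarrow> vscale E c v \<in> fibre E x"
    and herm_vadd: "x \<in> topspace (base E) \<Longrightarrow> u \<in> fibre E x \<Longrightarrow> v \<in> fibre E x \<Longrightarrow> w \<in> fibre E x \<Longrightarrow>
      herm E u (vadd E v w) = herm E u v + herm E u w"
    and herm_vscale: "x \<in> topspace (base E) \<Longrightarrow> u \<in> fibre E x \<Longrightarrow> v \<in> fibre E x \<Longrightarrow>
      herm E u (vscale E c v) = c * herm E u v"
    and herm_sym: "x \<in> topspace (base E) \<Longrightarrow> u \<in> fibre E x \<Longrightarrow> v \<in> fibre E x \<Longrightarrow>
      herm E v u = cnj (herm E u v)"
    and herm_nonneg: "x \<in> topspace (base E) \<Longrightarrow> v \<in> fibre E x \<Longrightarrow> 0 \<le> Re (herm E v v)"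
    and fibre_eqI: "x \<in> topspace (base E) \<Longrightarrow> v \<in> fibre E x \<Longrightarrow> w \<in> fibre E x \<Longrightarrow>
      (\<And>u. u \<in> fibre E x \<Longrightarrow> herm E u v = herm E u w) \<Longrightarrow> v = w"
    and ex_orthonormal_basis: "x \<in> topspace (base E) \<Longrightarrow> \<exists>B. orthonormal_basis E x B"
    and continuous_herm: "openin (base E) U \<Longrightarrow> local_section E U s \<Longrightarrow> local_section E U t \<Longrightarrow>
      continuous_fun (subtopology (base E) U) (\<lambda>y. herm E (s y) (t y))"
    and section_frame: "j \<in> J \<Longrightarrow> local_section E (topspace (base E)) (f j)"
    and parseval: "x \<in> topspace (base E) \<Longrightarrow> u \<in> fibre E x \<Longrightarrow> v \<in> fibre E x \<Longrightarrow>
      herm E u v = (\<Sum>j\<in>J. herm E u (f j x) * herm E (f j x) v)"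
    and trace_frame: "x \<in> topspace (base E) \<Longrightarrow> (\<Sum>j\<in>J. herm E (f j x) (f j x)) = of_nat d"

section \<open>Local trivialisations in coordinates and Gram-Schmidt orthonormalisation\<close>

locale hermitian_bundle =
  fixes E :: "('x, 'e) vbundle" and d :: nat
  assumes hvb: "hermitian_vector_bundle d E"
begin

abbreviation "X \<equiv> topspace (base E)"

definition trivial_over :: "'x set \<Rightarrow> ('x \<times> (nat \<Rightarrow> complex) \<Rightarrow> 'e) \<Rightarrow> bool" where
  "trivial_over U h \<longleftrightarrow> openin (base E) U \<and> local_trivialisation d E U h"

text \<open>Trivialisations are specified only on extensional coordinate functions; restricting
  first admits arbitrary \<open>c\<close> and keeps the bundle operations coordinatewise.\<close>

definition vec :: "('x \<times> (nat \<Rightarrow> complex) \<Rightarrow> 'e) \<Rightarrow> 'x \<Rightarrow> (nat \<Rightarrow> complex) \<Rightarrow> 'e" where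
  "vec h y c = h (y, \<lambda>i\<in>{..<d}. c i)"

lemma ex_trivial: "x \<in> X \<Longrightarrow> \<exists>U h. x \<in> U \<and> trivial_over U h"
proof -
  assume x: "x \<in> X"
  have "\<forall>x\<in>X. \<exists>U h. openin (base E) U \<and> x \<in> U \<and> local_trivialisation d E U h"
    using hvb unfolding hermitian_vector_bundle_def by (elim conjE)
  then show ?thesis using x unfolding trivial_over_def by blast
qed

lemma herm_axioms:
  assumes "x \<in> X" "u \<in> fibre E x" "v \<in> fibre E x"
  shows "w \<in> fibre E x \<Longrightarrow> herm E u (vadd E v w) = herm E u v + herm E u w"
    "herm E u (vscale E c v) = c * herm E u v"
    "herm E v u = cnj (herm E u v)"
    "v \<noteq> vscale E 0 v \<Longrightarrow> 0 < Re (herm E v v)"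
proof -
  have *: "\<forall>x \<in> topspace (base E). \<forall>u \<in> fibre E x. \<forall>v \<in> fibre E x. \<forall>w \<in> fibre E x. \<forall>c.
        herm E u (vadd E v w) = herm E u v + herm E u w \<and>
        herm E u (vscale E c v) = c * herm E u v \<and>
        herm E v u = cnj (herm E u v) \<and>
        (v \<noteq> vscale E 0 v \<longrightarrow> 0 < Re (herm E v v))"
    using hvb unfolding hermitian_vector_bundle_def by (elim conjE)
  show "w \<in> fibre E x \<Longrightarrow> herm E u (vadd E v w) = herm E u v + herm E u w"
    "herm E u (vscale E c v) = c * herm E u v"
    "herm E v u = cnj (herm E u v)"
    "v \<noteq> vscale E 0 v \<Longrightarrow> 0 < Re (herm E v v)"
    using *[rule_format, OF assms] *[rule_format, OF assms assms(3)] by blast+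
qed

lemma continuous_herm_sections:
  assumes "local_section E U v" "local_section E U w"
  shows "continuous_fun (subtopology (base E) U) (\<lambda>y. herm E (v y) (w y))"
proof -
  have "continuous_map (subtopology (base E) U)
     (subtopology (prod_topology (total_space E) (total_space E)) {(v, w). proj E v = proj E w})
     (\<lambda>y. (v y, w y))"
    using assms
    by (auto simp: local_section_def continuous_map_in_subtopology continuous_map_paired)
  moreover have "continuous_map
     (subtopology (prod_topology (total_space E) (total_space E)) {(v, w). proj E v = proj E w})
     euclidean (\<lambda>(v, w). herm E v w)"
    using hvb unfolding hermitian_vector_bundle_def by (elim conjE)
  ultimately show ?thesis by (auto dest: continuous_map_compose simp: o_def)
qed

context
  fixes U h
  assumes triv: "trivial_over U h"
begin

lemma open_U: "openin (base E) U" and U_sub: "y \<in> U \<Longrightarrow> y \<in> X"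
  using triv openin_subset unfolding trivial_over_def by blast+

lemma hom: "homeomorphic_map
       (prod_topology (subtopology (base E) U) (product_topology (\<lambda>_. euclidean) {..<d}))
       (subtopology (total_space E) {v. proj E v \<in> U}) h"
  using triv unfolding trivial_over_def local_trivialisation_def by blast

lemma vec_cong: "(\<And>i. i < d \<Longrightarrow> c i = c' i) \<Longrightarrow> vec h y c = vec h y c'"
  unfolding vec_def by (metis (no_types, lifting) lessThan_iff restrict_ext)

lemma vec_ops:
  assumes "y \<in> U"
  shows "proj E (vec h y c) = y"
    and "vec h y (\<lambda>i. c i + c' i) = vadd E (vec h y c) (vec h y c')"
    and "vec h y (\<lambda>i. a * c i) = vscale E a (vec h y c)"
proof -
  have t: "\<forall>c \<in> PiE {..<d} (\<lambda>_. UNIV). \<forall>c' \<in> PiE {..<d} (\<lambda>_. UNIV). \<forall>a.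
        proj E (h (y, c)) = y \<and>
        h (y, \<lambda>i\<in>{..<d}. c i + c' i) = vadd E (h (y, c)) (h (y, c')) \<and>
        h (y, \<lambda>i\<in>{..<d}. a * c i) = vscale E a (h (y, c))"
    using triv assms unfolding trivial_over_def local_trivialisation_def by blast
  have m: "restrict c {..<d} \<in> PiE {..<d} (\<lambda>_. UNIV)" for c :: "nat \<Rightarrow> complex" by simp
  have r: "(\<lambda>i\<in>{..<d}. restrict c {..<d} i + restrict c' {..<d} i) = (\<lambda>i\<in>{..<d}. c i + c' i)"
    "(\<lambda>i\<in>{..<d}. a * restrict c {..<d} i) = (\<lambda>i\<in>{..<d}. a * c i)" by (auto simp: restrict_def)
  show "proj E (vec h y c) = y"
    "vec h y (\<lambda>i. c i + c' i) = vadd E (vec h y c) (vec h y c')"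
    "vec h y (\<lambda>i. a * c i) = vscale E a (vec h y c)"
    using t[rule_format, OF m m, of c c' a] unfolding r vec_def by auto
qed

lemma top_dom: "topspace (prod_topology (subtopology (base E) U) (product_topology (\<lambda>_. euclidean) {..<d}))
    = U \<times> PiE {..<d} (\<lambda>_. UNIV :: complex set)"
  using U_sub by auto

lemma vec_fibre:
  assumes "y \<in> U"
  shows "vec h y c \<in> fibre E y"
proof -
  have "h ` (U \<times> PiE {..<d} (\<lambda>_. UNIV)) \<subseteq> topspace (total_space E)"
    using homeomorphic_imp_surjective_map[OF hom] unfolding top_dom by auto
  then have "vec h y c \<in> topspace (total_space E)" using assms unfolding vec_def by auto
  then show ?thesis using vec_ops(1)[OF assms] by (simp add: fibre_def)
qed

lemma vec_surj:
  assumes "y \<in> U" "v \<in> fibre E y"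
  obtains c where "v = vec h y c"
proof -
  have "v \<in> topspace (subtopology (total_space E) {v. proj E v \<in> U})"
    using assms by (simp add: fibre_def)
  then have "v \<in> h ` (U \<times> PiE {..<d} (\<lambda>_. UNIV))"
    using homeomorphic_imp_surjective_map[OF hom] unfolding top_dom by auto
  then obtain y' c where c: "y' \<in> U" "c \<in> PiE {..<d} (\<lambda>_. UNIV)" "v = h (y', c)" by auto
  then have v: "v = vec h y' c" by (simp add: vec_def PiE_restrict)
  then have "y' = y" using vec_ops(1)[OF c(1)] assms(2) by (simp add: fibre_def)
  then show ?thesis using that v by blast
qed

lemma vec_inj:
  assumes "y \<in> U" "vec h y c = vec h y c'" "i < d"
  shows "c i = c' i"
proof -
  have "inj_on h (U \<times> PiE {..<d} (\<lambda>_. UNIV))"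
    using homeomorphic_imp_injective_map[OF hom] unfolding top_dom .
  then have "(y, restrict c {..<d}) = (y, restrict c' {..<d})"
    by (rule inj_onD) (use assms in \<open>auto simp: vec_def\<close>)
  then have "restrict c {..<d} = restrict c' {..<d}" by simp
  then show ?thesis using assms(3) by (metis lessThan_iff restrict_apply')
qed

lemma vec_section:
  assumes "\<And>i. i < d \<Longrightarrow> continuous_fun (subtopology (base E) U) (\<lambda>y. c y i)"
  shows "local_section E U (\<lambda>y. vec h y (c y))"
proof -
  have "continuous_map (subtopology (base E) U)
     (prod_topology (subtopology (base E) U) (product_topology (\<lambda>_. euclidean) {..<d}))
     (\<lambda>y. (y, \<lambda>i\<in>{..<d}. c y i))"
    using assms by (auto simp: continuous_map_paired continuous_map_componentwise)
  from continuous_map_compose[OF this homeomorphic_imp_continuous_map[OF hom]]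
  have "continuous_map (subtopology (base E) U) (total_space E) (\<lambda>y. vec h y (c y))"
    by (auto simp: o_def vec_def continuous_map_in_subtopology)
  then show ?thesis using vec_ops(1) by (simp add: local_section_def)
qed

lemma herm_vec:
  assumes y: "y \<in> U" and u: "u \<in> fibre E y"
  shows "herm E u (vec h y (\<lambda>i. c i + c' i)) = herm E u (vec h y c) + herm E u (vec h y c')"
    and "herm E u (vec h y (\<lambda>i. a * c i)) = a * herm E u (vec h y c)"
    and "herm E u (vec h y (\<lambda>i. 0)) = 0"
    and "herm E u (vec h y (\<lambda>i. \<Sum>j\<in>A. m j * C j i)) = (\<Sum>j\<in>A. m j * herm E u (vec h y (C j)))"
proof -
  show a: "herm E u (vec h y (\<lambda>i. c i + c' i)) = herm E u (vec h y c) + herm E u (vec h y c')" for c c'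
    using vec_ops(2)[OF y] herm_axioms(1)[OF U_sub[OF y] u vec_fibre[OF y] vec_fibre[OF y]] by simp
  show s: "herm E u (vec h y (\<lambda>i. a * c i)) = a * herm E u (vec h y c)" for a c
    using vec_ops(3)[OF y] herm_axioms(2)[OF U_sub[OF y] u vec_fibre[OF y]] by simp
  show z: "herm E u (vec h y (\<lambda>i. 0)) = 0" using s[of 0 "\<lambda>_. 0"] by simp
  show "herm E u (vec h y (\<lambda>i. \<Sum>j\<in>A. m j * C j i)) = (\<Sum>j\<in>A. m j * herm E u (vec h y (C j)))"
    by (induction A rule: infinite_finite_induct) (simp_all add: z a s)
qed

lemma vec_zero_scale: "y \<in> U \<Longrightarrow> vec h y (\<lambda>_. 0) = vscale E 0 (vec h y c)"
  using vec_ops(3)[of y 0 c] by simp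

lemma herm_vec_pos:
  assumes y: "y \<in> U" and i: "i < d" "c i \<noteq> 0"
  shows "0 < Re (herm E (vec h y c) (vec h y c))"
proof (rule herm_axioms(4)[OF U_sub[OF y] vec_fibre[OF y] vec_fibre[OF y]])
  show "vec h y c \<noteq> vscale E 0 (vec h y c)"
    using vec_inj[OF y, of c "\<lambda>_. 0" i] i vec_zero_scale[OF y, of c] by auto
qed

lemma herm_vec_real:
  assumes y: "y \<in> U"
  shows "herm E (vec h y c) (vec h y c) = of_real (Re (herm E (vec h y c) (vec h y c)))"
  using herm_axioms(3)[OF U_sub[OF y] vec_fibre[OF y] vec_fibre[OF y], of c c]
  by (metis complex_eq_iff Reals_cnj_iff of_real_Re complex_of_real_def)

text \<open>The state after \<open>k\<close> rounds of Gram-Schmidt, in coordinates: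
  \<open>k\<close> orthonormal continuous sections in the span of the first \<open>k\<close>
  coordinate vectors. That they exhaust this span is expressed by the triviality of their orthogonal
  complement in it, which avoids dimension counting.\<close>

definition partial_frame :: "nat \<Rightarrow> (nat \<Rightarrow> 'x \<Rightarrow> nat \<Rightarrow> complex) \<Rightarrow> bool" where
  "partial_frame k C \<longleftrightarrow> (\<forall>j<k. \<forall>i. continuous_fun (subtopology (base E) U) (\<lambda>y. C j y i)) \<and>
    (\<forall>y\<in>U. (\<forall>j<k. \<forall>l<k. herm E (vec h y (C j y)) (vec h y (C l y)) = (if j = l then 1 else 0)) \<and>
      (\<forall>j<k. \<forall>i\<ge>k. C j y i = 0) \<and>
      (\<forall>c. (\<forall>i<d. k \<le> i \<longrightarrow> c i = 0) \<and> (\<forall>j<k. herm E (vec h y (C j y)) (vec h y c) = 0) \<longrightarrow>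
         (\<forall>i<d. c i = 0)))"

text \<open>The vectors of earlier rounds have no coordinate \<open>k\<close>, so the residual
  \<open>w\<close> of the new coordinate vector has coordinate \<open>k\<close> equal to 1. It
  vanishes nowhere on \<open>U\<close>, and normalising it keeps the coefficients
  continuous.\<close>

lemma gram_schmidt: "k \<le> d \<Longrightarrow> \<exists>C. partial_frame k C"
proof (induction k)
  case 0
  show ?case by (auto simp: partial_frame_def)
next
  case (Suc k)
  then have kd: "k < d" by simp
  from Suc obtain C where C: "partial_frame k C" by (meson Suc_leD)
  have C_cont: "\<And>j i. j < k \<Longrightarrow> continuous_fun (subtopology (base E) U) (\<lambda>y. C j y i)" and
    C_orth: "\<And>y j l. y \<in> U \<Longrightarrow> j < k \<Longrightarrow> l < k \<Longrightarrow>
      herm E (vec h y (C j y)) (vec h y (C l y)) = (if j = l then 1 else 0)" and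
    C_tri: "\<And>y j i. y \<in> U \<Longrightarrow> j < k \<Longrightarrow> k \<le> i \<Longrightarrow> C j y i = 0" and
    C_compl: "\<And>y c i. y \<in> U \<Longrightarrow> (\<forall>i<d. k \<le> i \<longrightarrow> c i = 0) \<Longrightarrow>
      (\<forall>j<k. herm E (vec h y (C j y)) (vec h y c) = 0) \<Longrightarrow> i < d \<Longrightarrow> c i = 0"
    using C unfolding partial_frame_def by blast+
  define \<delta> where "\<delta> i = (if i = k then 1 else 0 :: complex)" for i
  define m where "m j y = herm E (vec h y (C j y)) (vec h y \<delta>)" for j y
  define w where "w y i = \<delta> i + (\<Sum>j<k. - m j y * C j y i)" for y i
  define N where "N y = Re (herm E (vec h y (w y)) (vec h y (w y)))" for y
  define C' where "C' j y = (if j = k then (\<lambda>i. complex_of_real (1 / sqrt (N y)) * w y i) else C j y)" for j y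
  have C'_k: "C' k y = (\<lambda>i. complex_of_real (1 / sqrt (N y)) * w y i)" 
    and C'_less: "j < k \<Longrightarrow> C' j y = C j y" for j y
    by (simp_all add: C'_def)
  have sec_\<delta>: "local_section E U (\<lambda>y. vec h y \<delta>)" by (rule vec_section) simp
  have m_cont: "continuous_fun (subtopology (base E) U) (m j)" if "j < k" for j
    unfolding m_def by (intro continuous_herm_sections vec_section sec_\<delta> C_cont that)
  have w_cont: "continuous_fun (subtopology (base E) U) (\<lambda>y. w y i)" for i
    unfolding w_def
    by (intro continuous_map_add continuous_map_sum continuous_fun_mult continuous_map_minus m_cont C_cont) auto
  have N_cont: "continuous_fun (subtopology (base E) U) N"
    unfolding N_def by (intro continuous_fun_Re continuous_herm_sections vec_section w_cont)
  have wk: "w y k = 1" if "y \<in> U" for y using C_tri[OF that] by (simp add: w_def \<delta>_def)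
  have wi: "w y i = 0" if "y \<in> U" "k < i" for y i using C_tri[OF that(1)] that(2) by (simp add: w_def \<delta>_def)
  have N_pos: "N y > 0" if "y \<in> U" for y
    unfolding N_def using herm_vec_pos[OF that kd] wk[OF that] by simp
  have hw: "herm E (vec h y (w y)) (vec h y (w y)) = of_real (N y)" if "y \<in> U" for y
    unfolding N_def by (rule herm_vec_real[OF that])
  have orth_w: "herm E (vec h y (C j y)) (vec h y (w y)) = 0" if y: "y \<in> U" and j: "j < k" for y j
  proof -
    note H = herm_vec[OF y vec_fibre[OF y]]
    have "herm E (vec h y (C j y)) (vec h y (w y))
        = m j y + (\<Sum>l<k. - m l y * herm E (vec h y (C j y)) (vec h y (C l y)))"
      unfolding w_def H(1) H(4) by (simp add: m_def)
    also have "(\<Sum>l<k. - m l y * herm E (vec h y (C j y)) (vec h y (C l y))) = (\<Sum>l<k. if l = j then - m j y else 0)"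
      using C_orth[OF y j] by (intro sum.cong) auto
    also have "\<dots> = - m j y" using j by simp
    finally show ?thesis by simp
  qed
  have orth_k: "herm E (vec h y (C j y)) (vec h y (C' k y)) = 0" if y: "y \<in> U" and j: "j < k" for y j
    unfolding C'_k herm_vec(2)[OF y vec_fibre[OF y]] by (simp add: orth_w[OF y j])
  have kk: "herm E (vec h y (C' k y)) (vec h y c) = of_real (1 / sqrt (N y)) * herm E (vec h y (w y)) (vec h y c)"
    if y: "y \<in> U" for y c
  proof -
    have "herm E (vec h y (C' k y)) (vec h y c) = cnj (herm E (vec h y c) (vec h y (C' k y)))"
      by (rule herm_axioms(3)[OF U_sub[OF y] vec_fibre[OF y] vec_fibre[OF y]])
    also have "\<dots> = of_real (1 / sqrt (N y)) * cnj (herm E (vec h y c) (vec h y (w y)))"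
      unfolding C'_k herm_vec(2)[OF y vec_fibre[OF y]] by simp
    also have "cnj (herm E (vec h y c) (vec h y (w y))) = herm E (vec h y (w y)) (vec h y c)"
      by (rule herm_axioms(3)[OF U_sub[OF y] vec_fibre[OF y] vec_fibre[OF y], symmetric])
    finally show ?thesis .
  qed
  show ?case
    unfolding partial_frame_def
  proof (intro exI[of _ C'] conjI ballI allI impI)
    fix j i assume j: "j < Suc k"
    show "continuous_fun (subtopology (base E) U) (\<lambda>y. C' j y i)"
    proof (cases "j = k")
      case True
      have "sqrt (N y) \<noteq> 0" if "y \<in> U" for y using N_pos[OF that] by simp
      then show ?thesis unfolding True C'_k
        by (intro continuous_fun_mult w_cont continuous_fun_of_real continuous_fun_divide continuous_fun_sqrt N_cont)
          (auto)
    next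
      case False then show ?thesis using j C_cont[of j i] by (simp add: C'_less)
    qed
  next
    fix y j l assume y: "y \<in> U" and j: "j < Suc k" and l: "l < Suc k"
    show "herm E (vec h y (C' j y)) (vec h y (C' l y)) = (if j = l then 1 else 0)"
    proof -
      have "herm E (vec h y (C' k y)) (vec h y (C' k y)) = 1"
      proof -
        have "herm E (vec h y (C' k y)) (vec h y (C' k y))
          = of_real (1 / sqrt (N y)) * (of_real (1 / sqrt (N y)) * of_real (N y))"
          unfolding kk[OF y] unfolding C'_k herm_vec(2)[OF y vec_fibre[OF y]] hw[OF y] ..
        also have "\<dots> = of_real (1 / sqrt (N y) * (1 / sqrt (N y) * N y))"
          by (simp only: of_real_mult)
        also have "1 / sqrt (N y) * (1 / sqrt (N y) * N y) = 1" using N_pos[OF y] by simp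
        finally show ?thesis by simp
      qed
      moreover have "herm E (vec h y (C' k y)) (vec h y (C j y)) = 0" if "j < k" for j
        using orth_k[OF y that] herm_axioms(3)[OF U_sub[OF y] vec_fibre[OF y] vec_fibre[OF y], of "C j y" "C' k y"]
        by simp
      ultimately show ?thesis using j l orth_k[OF y] C_orth[OF y]
        by (auto simp: less_Suc_eq C'_less)
    qed
  next
    fix y j i assume y: "y \<in> U" and "j < Suc k" "Suc k \<le> i"
    then show "C' j y i = 0" using C_tri[OF y] wi[OF y] by (auto simp: C'_def)
  next
    fix y c i assume y: "y \<in> U" and i: "i < d"
      and c: "(\<forall>i<d. Suc k \<le> i \<longrightarrow> c i = 0) \<and> (\<forall>j<Suc k. herm E (vec h y (C' j y)) (vec h y c) = 0)"
    \<comment> \<open>The multiple of \<open>w\<close> removes coordinate \<open>k\<close>, which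
      brings the vector into the range of the previous round. Hence it is 0, \<open>c\<close> is a
      multiple of \<open>w\<close>, and orthogonality to \<open>C' k\<close> makes that multiple
      vanish.\<close>
    define c' where "c' i = c i + - c k * w y i" for i
    have "herm E (vec h y (C j y)) (vec h y c') = 0" if j: "j < k" for j
      unfolding c'_def herm_vec(1)[OF y vec_fibre[OF y]] herm_vec(2)[OF y vec_fibre[OF y]] orth_w[OF y j]
      using c j C'_less[OF j] by (auto dest: spec[of _ j])
    moreover have "c' i = 0" if "i < d" "k \<le> i" for i
      using c that wk[OF y] wi[OF y] by (cases "i = k") (auto simp: c'_def)
    ultimately have c'0: "c' i = 0" if "i < d" for i using C_compl[OF y, of c' i] that by blast
    have ck: "c i = c k * w y i" if "i < d" for i using c'0[OF that] by (simp add: c'_def)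
    have "herm E (vec h y (w y)) (vec h y c) = c k * of_real (N y)"
      using vec_cong[of c "\<lambda>i. c k * w y i" y] ck herm_vec(2)[OF y vec_fibre[OF y]] hw[OF y] by simp
    moreover have "herm E (vec h y (C' k y)) (vec h y c) = 0" using c by blast
    ultimately have "c k = 0" using kk[OF y, of c] N_pos[OF y] by simp
    then show "c i = 0" using ck[OF i] by simp
  qed
qed

end

lemma vec_zero_unique:
  assumes "trivial_over U h" "trivial_over U' h'" "y \<in> U" "y \<in> U'"
  shows "vec h y (\<lambda>_. 0) = vec h' y (\<lambda>_. 0)"
  using vec_surj[OF assms(2,4) vec_fibre[OF assms(1,3), of "\<lambda>_. 0"]] vec_zero_scale[OF assms(1,3)]
    vec_zero_scale[OF assms(2,4)] by metis

text \<open>The bundle record carries no zero, so the zero section is borrowed from any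
  trivialisation; all agree because the zero vector is \<open>vscale E 0\<close> of every vector of
  the fibre.\<close>

definition zero_vec :: "'x \<Rightarrow> 'e" where
  "zero_vec y = (SOME z. \<exists>U h. y \<in> U \<and> trivial_over U h \<and> z = vec h y (\<lambda>_. 0))"

lemma zero_vec_eq:
  assumes "trivial_over U h" "y \<in> U"
  shows "zero_vec y = vec h y (\<lambda>_. 0)"
proof -
  have "\<exists>U h. y \<in> U \<and> trivial_over U h \<and> zero_vec y = vec h y (\<lambda>_. 0)"
    unfolding zero_vec_def by (rule someI_ex) (use assms in blast)
  then show ?thesis using vec_zero_unique assms by metis
qed

lemma zero_vec_fibre: "x \<in> X \<Longrightarrow> zero_vec x \<in> fibre E x"
  using ex_trivial zero_vec_eq vec_fibre by metis

lemma herm_zero_vec: "x \<in> X \<Longrightarrow> u \<in> fibre E x \<Longrightarrow> herm E u (zero_vec x) = 0"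
  using ex_trivial zero_vec_eq herm_vec(3) by metis

lemma zero_vec_continuous: "continuous_map (base E) (total_space E) zero_vec"
proof (rule pasting_lemma[where I = "{p. trivial_over (fst p) (snd p)}" and T = fst and f = "\<lambda>_. zero_vec"])
  fix p assume "p \<in> {p. trivial_over (fst p) (snd p)}"
  then have p: "trivial_over (fst p) (snd p)" by simp
  then show "openin (base E) (fst p)" by (rule open_U)
  have "local_section E (fst p) (\<lambda>y. vec (snd p) y (\<lambda>_. 0))" by (rule vec_section[OF p]) simp
  then show "continuous_map (subtopology (base E) (fst p)) (total_space E) zero_vec"
    unfolding local_section_def
    by (elim conjE, elim continuous_map_eq) (use zero_vec_eq[OF p] in auto)
next
  fix x assume "x \<in> topspace (base E)"
  then show "\<exists>p. p \<in> {p. trivial_over (fst p) (snd p)} \<and> x \<in> fst p \<and> zero_vec x = zero_vec x"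
    using ex_trivial[of x] by (metis fst_conv mem_Collect_eq snd_conv)
qed auto

definition orthonormal_over ::
  "'x set \<Rightarrow> ('x \<times> (nat \<Rightarrow> complex) \<Rightarrow> 'e) \<Rightarrow> (nat \<Rightarrow> 'x \<Rightarrow> nat \<Rightarrow> complex) \<Rightarrow> bool" where
  "orthonormal_over U h C \<longleftrightarrow> trivial_over U h \<and>
    (\<forall>j<d. \<forall>i. continuous_fun (subtopology (base E) U) (\<lambda>y. C j y i)) \<and>
    (\<forall>y\<in>U. (\<forall>j<d. \<forall>l<d. herm E (vec h y (C j y)) (vec h y (C l y)) = (if j = l then 1 else 0)) \<and>
      (\<forall>c. (\<forall>j<d. herm E (vec h y (C j y)) (vec h y c) = 0) \<longrightarrow> (\<forall>i<d. c i = 0)))"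

lemma ex_orthonormal_over: "x \<in> X \<Longrightarrow> \<exists>U h C. x \<in> U \<and> orthonormal_over U h C"
proof -
  assume "x \<in> X"
  then obtain U h where U: "x \<in> U" "trivial_over U h" using ex_trivial by blast
  obtain C where "partial_frame U h d C"
    using gram_schmidt[OF U(2) order_refl] by blast
  then have "orthonormal_over U h C" using U(2) by (simp add: orthonormal_over_def partial_frame_def[OF U(2)])
  then show ?thesis using U(1) by blast
qed

lemma
  assumes "orthonormal_over U h C"
  shows orthonormal_triv: "trivial_over U h"
    and orthonormal_cont: "j < d \<Longrightarrow> continuous_fun (subtopology (base E) U) (\<lambda>y. C j y i)"
    and orthonormal_orth: "y \<in> U \<Longrightarrow> j < d \<Longrightarrow> l < d \<Longrightarrow>
      herm E (vec h y (C j y)) (vec h y (C l y)) = (if j = l then 1 else 0)"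
    and orthonormal_complete: "y \<in> U \<Longrightarrow> (\<And>j. j < d \<Longrightarrow> herm E (vec h y (C j y)) (vec h y c) = 0) \<Longrightarrow>
      i < d \<Longrightarrow> c i = 0"
  using assms unfolding orthonormal_over_def by blast+

text \<open>The coordinates \<open>c'\<close> of \<open>v\<close> minus its projections are
  orthogonal to the whole orthonormal frame, hence zero by completeness.\<close>

lemma orthonormal_parseval:
  assumes on: "orthonormal_over U h C" and y: "y \<in> U" and u: "u \<in> fibre E y" and v: "v \<in> fibre E y"
  shows "herm E u v = (\<Sum>j<d. herm E u (vec h y (C j y)) * herm E (vec h y (C j y)) v)"
proof -
  note t = orthonormal_triv[OF on]
  obtain c where c: "v = vec h y c" using vec_surj[OF t y v] .
  define m where "m j = - herm E (vec h y (C j y)) v" for j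
  define c' where "c' i = c i + (\<Sum>j<d. m j * C j y i)" for i
  have H: "herm E u (vec h y c') = herm E u v + (\<Sum>j<d. m j * herm E u (vec h y (C j y)))"
    if "u \<in> fibre E y" for u
    unfolding c'_def herm_vec(1)[OF t y that] herm_vec(4)[OF t y that] c ..
  have "herm E (vec h y (C j y)) (vec h y c') = 0" if j: "j < d" for j
  proof -
    have "(\<Sum>l<d. m l * herm E (vec h y (C j y)) (vec h y (C l y))) = (\<Sum>l<d. if l = j then m j else 0)"
      using orthonormal_orth[OF on y j] by (intro sum.cong) auto
    then show ?thesis using j unfolding H[OF vec_fibre[OF t y]] by (simp add: m_def)
  qed
  then have z: "c' i = 0" if "i < d" for i by (rule orthonormal_complete[OF on y _ that])
  have "vec h y c' = vec h y (\<lambda>_. 0)" by (rule vec_cong[OF t], rule z)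
  then have "herm E u (vec h y c') = 0" using herm_vec(3)[OF t y u] by simp
  then show ?thesis unfolding H[OF u] m_def by (simp add: sum_negf mult.commute)
qed

section \<open>Gluing local orthonormal frames into a global Parseval frame\<close>

lemma ex_bump:
  assumes "compact_space (base E)" "Hausdorff_space (base E)" and U: "openin (base E) U" "x \<in> U"
  shows "\<exists>\<phi> V. continuous_fun (base E) \<phi> \<and> (\<forall>y. 0 \<le> \<phi> y) \<and> (0::real) < \<phi> x \<and>
    openin (base E) V \<and> X \<subseteq> U \<union> V \<and> (\<forall>y\<in>V. \<phi> y = 0)"
proof -
  have "normal_space (base E)" using assms compact_Hausdorff_or_regular_imp_normal_space by blast
  moreover have cl: "closedin (base E) (X - U)" using U by blast
  moreover have "x \<in> X" using U openin_subset[of "base E" U] by auto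
  then have "closedin (base E) {x}" using assms(2) by (simp add: closedin_Hausdorff_sing_eq)
  moreover have "disjnt (X - U) {x}" using U by (simp add: disjnt_def)
  ultimately have "\<exists>b. continuous_fun (base E) b \<and> b ` (X - U) \<subseteq> {0::real} \<and> b ` {x} \<subseteq> {1}"
    using normal_space_iff_Urysohn_alt[THEN iffD1, rule_format, of "base E" "X - U" "{x}"] by simp
  then obtain b where b: "continuous_fun (base E) b" "b ` (X - U) \<subseteq> {0::real}" "b ` {x} \<subseteq> {1}"
    by (elim exE conjE)
  \<comment> \<open>A function that is merely 0 outside \<open>U\<close> would not do: pasting with
    the zero section needs an open set of zeros covering the complement of \<open>U\<close>. Cutting
    the Urysohn function at height 1/2 produces it.\<close>
  define V where "V = {y \<in> X. b y \<in> {..<1/2}}"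
  have "openin (base E) V"
    unfolding V_def by (rule openin_continuous_map_preimage[OF b(1)]) simp
  moreover have "X \<subseteq> U \<union> V" "b x = 1" using b(2,3) by (auto simp: V_def)
  ultimately show ?thesis
    by (intro exI[of _ "\<lambda>y. max 0 (b y - 1/2)"] exI[of _ V] conjI)
      (auto simp: V_def intro!: continuous_intros b(1))
qed

lemma cutoff_section:
  assumes t: "trivial_over U h" and c: "\<And>i. i < d \<Longrightarrow> continuous_fun (subtopology (base E) U) (\<lambda>y. c y i)"
    and \<phi>: "continuous_fun (base E) \<phi>"
    and V: "openin (base E) V" "X \<subseteq> U \<union> V" "\<And>y. y \<in> V \<Longrightarrow> \<phi> y = 0"
  shows "local_section E X (\<lambda>y. if y \<in> U then vec h y (\<lambda>i. \<phi> y * c y i) else zero_vec y)"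
    (is "local_section E X ?s")
proof -
  have sec: "local_section E U (\<lambda>y. vec h y (\<lambda>i. \<phi> y * c y i))"
    by (intro vec_section[OF t] continuous_fun_mult c continuous_map_from_subtopology[OF \<phi>])
  have "continuous_map (base E) (total_space E) ?s"
  proof (rule pasting_lemma[where I = "{U, V}" and T = id
        and f = "\<lambda>W. if W = U then \<lambda>y. vec h y (\<lambda>i. \<phi> y * c y i) else zero_vec"])
    show "openin (base E) (id W)" if "W \<in> {U, V}" for W using that open_U[OF t] V(1) by auto
    show "continuous_map (subtopology (base E) (id W)) (total_space E)
        (if W = U then \<lambda>y. vec h y (\<lambda>i. \<phi> y * c y i) else zero_vec)" if "W \<in> {U, V}" for W
      using that sec continuous_map_from_subtopology[OF zero_vec_continuous]
      by (auto simp: local_section_def)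
    have z: "vec h y (\<lambda>i. \<phi> y * c y i) = zero_vec y" if "y \<in> U" "y \<in> V" for y
      using V(3)[OF that(2)] zero_vec_eq[OF t that(1)] by simp
    show "(if W = U then \<lambda>y. vec h y (\<lambda>i. \<phi> y * c y i) else zero_vec) y =
        (if W' = U then \<lambda>y. vec h y (\<lambda>i. \<phi> y * c y i) else zero_vec) y"
      if "W \<in> {U, V}" "W' \<in> {U, V}" "y \<in> X \<inter> id W \<inter> id W'" for W W' y
      using that z by auto
    show "\<exists>W. W \<in> {U, V} \<and> y \<in> id W \<and>
        ?s y = (if W = U then \<lambda>y. vec h y (\<lambda>i. \<phi> y * c y i) else zero_vec) y" if "y \<in> X" for y
      using that V(2) by (cases "y \<in> U") (auto intro: exI[of _ U] exI[of _ V])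
  qed
  moreover have "proj E (?s y) = y" if "y \<in> X" for y
    using vec_ops(1)[OF t] zero_vec_fibre[OF that] by (auto simp: fibre_def)
  ultimately show ?thesis by (simp add: local_section_def)
qed

text \<open>Finitely many local orthonormal frames are multiplied by functions
  \<open>\<psi> p\<close> and extended by zero. Each piece contributes
  \<open>(\<psi> p)\<^sup>2\<close> times the inner product to Parseval's identity and
  \<open>(\<psi> p)\<^sup>2 * d\<close> to the trace.\<close>

theorem ex_framed_bundle:
  assumes cpt: "compact_space (base E)" and hd: "Hausdorff_space (base E)" and rank: "2 \<le> d"
  shows "\<exists>J (f :: 'x \<times> nat \<Rightarrow> 'x \<Rightarrow> 'e). framed_bundle E J f d"
proof -
  have "\<exists>U h C \<phi> V. x \<in> U \<and> orthonormal_over U h C \<and> continuous_fun (base E) \<phi> \<and> (\<forall>y. 0 \<le> \<phi> y) \<and>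
      (0::real) < \<phi> x \<and> openin (base E) V \<and> X \<subseteq> U \<union> V \<and> (\<forall>y\<in>V. \<phi> y = 0)" if x: "x \<in> X" for x
  proof -
    obtain U h C where "x \<in> U" "orthonormal_over U h C" using ex_orthonormal_over[OF x] by blast
    with ex_bump[OF cpt hd open_U[OF orthonormal_triv], of U h C x] show ?thesis by blast
  qed
  then obtain U h C \<phi> V where loc: "\<And>x. x \<in> X \<Longrightarrow> x \<in> U x \<and> orthonormal_over (U x) (h x) (C x) \<and>
      continuous_fun (base E) (\<phi> x) \<and> (\<forall>y. 0 \<le> \<phi> x y) \<and>
      (0::real) < \<phi> x x \<and> openin (base E) (V x) \<and> X \<subseteq> U x \<union> V x \<and> (\<forall>y\<in>V x. \<phi> x y = 0)"
    by metis
  define W where "W x = {y \<in> X. \<phi> x y \<in> {0<..}}" for x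
  have "openin (base E) (W x)" if "x \<in> X" for x
    unfolding W_def by (rule openin_continuous_map_preimage[where Y=euclidean]) (use loc[OF that] in auto)
  moreover have "X \<subseteq> \<Union> (W ` X)" using loc by (auto simp: W_def)
  ultimately obtain \<F> where "finite \<F>" "\<F> \<subseteq> W ` X" "X \<subseteq> \<Union> \<F>"
    using cpt unfolding compact_space_alt by (metis (no_types, lifting) imageE)
  then obtain F where F: "finite F" "F \<subseteq> X" "X \<subseteq> \<Union> (W ` F)"
    by (metis finite_subset_image)
  define \<beta> where "\<beta> y = (\<Sum>p\<in>F. (\<phi> p y)\<^sup>2)" for y
  have \<beta>_pos: "\<beta> y > 0" if y: "y \<in> X" for y
  proof -
    obtain p where "p \<in> F" "\<phi> p y > 0" using F(3) y by (auto simp: W_def)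
    then show ?thesis unfolding \<beta>_def by (intro sum_pos2[of F p]) (use F(1) in auto)
  qed
  \<comment> \<open>The squares, not the functions themselves, must add up to 1, since each frame
    vector enters Parseval's identity twice; hence the root of \<open>\<beta>\<close>.\<close>
  define \<psi> where "\<psi> p y = \<phi> p y / sqrt (\<beta> y)" for p y
  have \<psi>_cont: "continuous_fun (base E) (\<psi> p)" if "p \<in> F" for p
    unfolding \<psi>_def \<beta>_def
    by (intro continuous_fun_divide continuous_fun_sqrt continuous_map_sum F(1) continuous_map_real_pow)
      (use loc F(2) that \<beta>_pos in \<open>auto simp: \<beta>_def less_imp_neq[THEN not_sym] order_less_imp_not_eq2\<close>)
  have \<psi>_sum: "(\<Sum>p\<in>F. (\<psi> p y)\<^sup>2) = 1" if "y \<in> X" for y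
    using \<beta>_pos[OF that] by (simp add: \<psi>_def power_divide \<beta>_def[symmetric] sum_divide_distrib[symmetric])
  define f where "f pi y = (if y \<in> U (fst pi)
      then vec (h (fst pi)) y (\<lambda>k. complex_of_real (\<psi> (fst pi) y) * C (fst pi) (snd pi) y k)
      else zero_vec y)" for pi y
  have on: "orthonormal_over (U p) (h p) (C p)" and Vp: "openin (base E) (V p)" "X \<subseteq> U p \<union> V p"
    "\<And>y. y \<in> V p \<Longrightarrow> \<psi> p y = 0" if "p \<in> F" for p
    using loc F(2) that by (auto simp: \<psi>_def)
  have f_sec: "local_section E X (f (p, i))" if "p \<in> F" "i < d" for p i
    unfolding f_def fst_conv snd_conv
    by (rule cutoff_section[OF orthonormal_triv[OF on[OF that(1)]] orthonormal_cont[OF on[OF that(1)] that(2)]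
          continuous_fun_of_real[OF \<psi>_cont[OF that(1)]] Vp(1,2)[OF that(1)]]) (simp add: Vp(3)[OF that(1)])
  have f_fibre: "f (p, i) y \<in> fibre E y" if "p \<in> F" "y \<in> X" for p i y
    using vec_fibre[OF orthonormal_triv[OF on[OF that(1)]]] zero_vec_fibre[OF that(2)] by (simp add: f_def)
  have f_right: "herm E u (f (p, i) y) = \<psi> p y * herm E u (vec (h p) y (C p i y))"
    if "p \<in> F" "y \<in> U p" "u \<in> fibre E y" for p i y u
    using herm_vec(2)[OF orthonormal_triv[OF on[OF that(1)]] that(2,3)] that(2) by (simp add: f_def)
  have f_left: "herm E (f (p, i) y) u = \<psi> p y * herm E (vec (h p) y (C p i y)) u"
    if "p \<in> F" "y \<in> U p" "u \<in> fibre E y" for p i y u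
  proof -
    note t = orthonormal_triv[OF on[OF that(1)]]
    have y: "y \<in> X" using U_sub[OF t that(2)] .
    show ?thesis
      using herm_axioms(3)[OF y that(3) f_fibre[OF that(1) y], of i] f_right[OF that, of i]
        herm_axioms(3)[OF y that(3) vec_fibre[OF t that(2)]] by simp
  qed
  have outside: "\<psi> p y = 0" "f (p, i) y = zero_vec y" if "p \<in> F" "y \<in> X" "y \<notin> U p" for p i y
    using Vp(2,3)[OF that(1)] that(2,3) by (auto simp: f_def)
  have local_sum: "(\<Sum>i<d. herm E u (f (p, i) y) * herm E (f (p, i) y) v) = (\<psi> p y)\<^sup>2 * herm E u v"
    if p: "p \<in> F" and y: "y \<in> X" and u: "u \<in> fibre E y" and v: "v \<in> fibre E y" for p y u v
  proof (cases "y \<in> U p")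
    case True
    show ?thesis
      unfolding orthonormal_parseval[OF on[OF p] True u v] sum_distrib_left
      by (simp add: f_left[OF p True v] f_right[OF p True u] power2_eq_square mult_ac)
  next
    case False
    then show ?thesis using outside[OF p y False] herm_zero_vec[OF y u] by simp
  qed
  have local_trace: "(\<Sum>i<d. herm E (f (p, i) y) (f (p, i) y)) = (\<psi> p y)\<^sup>2 * of_nat d"
    if p: "p \<in> F" and y: "y \<in> X" for p y
  proof (cases "y \<in> U p")
    case True
    note t = orthonormal_triv[OF on[OF p]]
    have "herm E (f (p, i) y) (f (p, i) y) = (\<psi> p y)\<^sup>2" if "i < d" for i
      unfolding f_left[OF p True f_fibre[OF p y]] f_right[OF p True vec_fibre[OF t True]]
      using orthonormal_orth[OF on[OF p] True that that] by (simp add: power2_eq_square)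
    then show ?thesis by simp
  next
    case False
    then show ?thesis using outside[OF p y False] herm_zero_vec[OF y zero_vec_fibre[OF y]] by simp
  qed
  have "framed_bundle E (F \<times> {..<d}) f d"
  proof
    show "compact_space (base E)" "2 \<le> d" "finite (F \<times> {..<d})" using cpt rank F(1) by auto
  next
    fix x v w assume x: "x \<in> X" and v: "v \<in> fibre E x" and w: "w \<in> fibre E x"
    obtain W h where t: "x \<in> W" "trivial_over W h" using ex_trivial[OF x] by blast
    obtain c where c: "v = vec h x c" using vec_surj[OF t(2,1) v] .
    obtain c' where c': "w = vec h x c'" using vec_surj[OF t(2,1) w] .
    show "vadd E v w \<in> fibre E x"
      unfolding c c' vec_ops(2)[OF t(2,1), symmetric] by (rule vec_fibre[OF t(2,1)])
    assume eq: "\<And>u. u \<in> fibre E x \<Longrightarrow> herm E u v = herm E u w"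
    have "c i = c' i" if i: "i < d" for i
    proof (rule ccontr)
      assume ne: "c i \<noteq> c' i"
      let ?z = "vec h x (\<lambda>i. c i + - 1 * c' i)"
      have "herm E ?z ?z = 0"
        using eq[OF vec_fibre[OF t(2,1)]]
        unfolding herm_vec(1)[OF t(2,1) vec_fibre[OF t(2,1)]] herm_vec(2)[OF t(2,1) vec_fibre[OF t(2,1)]] c c'
        by simp
      then show False using herm_vec_pos[OF t(2,1) i, of "\<lambda>i. c i + - 1 * c' i"] ne by simp
    qed
    then show "v = w" unfolding c c' by (rule vec_cong[OF t(2)])
  next
    fix x v c assume x: "x \<in> X" and v: "v \<in> fibre E x"
    obtain W h where t: "x \<in> W" "trivial_over W h" using ex_trivial[OF x] by blast
    obtain c' where c: "v = vec h x c'" using vec_surj[OF t(2,1) v] .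
    show "vscale E c v \<in> fibre E x"
      unfolding c vec_ops(3)[OF t(2,1), symmetric] by (rule vec_fibre[OF t(2,1)])
  next
    fix x u v w assume "x \<in> X" "u \<in> fibre E x" "v \<in> fibre E x" "w \<in> fibre E x"
    then show "herm E u (vadd E v w) = herm E u v + herm E u w" by (rule herm_axioms(1))
  next
    fix x u v c assume "x \<in> X" "u \<in> fibre E x" "v \<in> fibre E x"
    then show "herm E u (vscale E c v) = c * herm E u v" by (rule herm_axioms(2))
  next
    fix x u v assume "x \<in> X" "u \<in> fibre E x" "v \<in> fibre E x"
    then show "herm E v u = cnj (herm E u v)" by (rule herm_axioms(3))
  next
    fix x v assume x: "x \<in> X" "v \<in> fibre E x"
    show "0 \<le> Re (herm E v v)"
    proof (cases "v = vscale E 0 v")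
      case True
      then have "herm E v v = 0" using herm_axioms(2)[OF x x(2), of 0] by simp
      then show ?thesis by simp
    next
      case False then show ?thesis using herm_axioms(4)[OF x x(2)] by simp
    qed
  next
    fix x assume x: "x \<in> X"
    obtain W h C where t: "x \<in> W" "orthonormal_over W h C" using ex_orthonormal_over[OF x] by blast
    note tr = orthonormal_triv[OF t(2)]
    have "orthonormal_basis E x ((\<lambda>j. vec h x (C j x)) ` {..<d})"
      unfolding orthonormal_basis_def
    proof (intro conjI ballI impI)
      show "(\<lambda>j. vec h x (C j x)) ` {..<d} \<subseteq> fibre E x" using vec_fibre[OF tr t(1)] by auto
    next
      fix b b' assume "b \<in> (\<lambda>j. vec h x (C j x)) ` {..<d}" "b' \<in> (\<lambda>j. vec h x (C j x)) ` {..<d}"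
      then obtain j l where j: "j < d" "b = vec h x (C j x)" and l: "l < d" "b' = vec h x (C l x)" by auto
      have "j = l" if "b = b'"
        using orthonormal_orth[OF t(2,1) j(1) l(1)] orthonormal_orth[OF t(2,1) j(1) j(1)] that j l
        by (metis zero_neq_one)
      then show "herm E b b' = (if b = b' then 1 else 0)"
        using orthonormal_orth[OF t(2,1) j(1) l(1)] j l by auto
    next
      fix v assume v: "v \<in> fibre E x" and z: "\<forall>b\<in>(\<lambda>j. vec h x (C j x)) ` {..<d}. herm E b v = 0"
      obtain c where c: "v = vec h x c" using vec_surj[OF tr t(1) v] .
      have "c i = 0" if "i < d" for i
        by (rule orthonormal_complete[OF t(2,1) _ that]) (use z c in auto)
      then have "v = vec h x (\<lambda>_. 0)" unfolding c by (rule vec_cong[OF tr])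
      then show "v = vscale E 0 v" using vec_zero_scale[OF tr t(1), of c] c by simp
    qed
    then show "\<exists>B. orthonormal_basis E x B" by blast
  next
    fix U s t assume "openin (base E) U" "local_section E U s" "local_section E U t"
    then show "continuous_fun (subtopology (base E) U) (\<lambda>y. herm E (s y) (t y))"
      by (intro continuous_herm_sections)
  next
    fix j assume "j \<in> F \<times> {..<d}"
    then show "local_section E X (f j)" using f_sec by auto
  next
    fix x u v assume x: "x \<in> X" and u: "u \<in> fibre E x" and v: "v \<in> fibre E x"
    have "(\<Sum>j\<in>F \<times> {..<d}. herm E u (f j x) * herm E (f j x) v)
        = (\<Sum>p\<in>F. \<Sum>i<d. herm E u (f (p, i) x) * herm E (f (p, i) x) v)"
      by (simp add: sum.cartesian_product case_prod_beta)
    also have "\<dots> = (\<Sum>p\<in>F. (\<psi> p x)\<^sup>2 * herm E u v)"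
      using local_sum[OF _ x u v] by (intro sum.cong) auto
    also have "\<dots> = of_real (\<Sum>p\<in>F. (\<psi> p x)\<^sup>2) * herm E u v" by (simp add: sum_distrib_right)
    finally show "herm E u v = (\<Sum>j\<in>F \<times> {..<d}. herm E u (f j x) * herm E (f j x) v)"
      using \<psi>_sum[OF x] by simp
  next
    fix x assume x: "x \<in> X"
    have "(\<Sum>j\<in>F \<times> {..<d}. herm E (f j x) (f j x)) = (\<Sum>p\<in>F. \<Sum>i<d. herm E (f (p, i) x) (f (p, i) x))"
      by (simp add: sum.cartesian_product case_prod_beta)
    also have "\<dots> = (\<Sum>p\<in>F. complex_of_real ((\<psi> p x)\<^sup>2) * of_nat d)"
      using local_trace[OF _ x] by (intro sum.cong) auto
    also have "\<dots> = of_real (\<Sum>p\<in>F. (\<psi> p x)\<^sup>2) * of_nat d" by (simp add: sum_distrib_right)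
    finally show "(\<Sum>j\<in>F \<times> {..<d}. herm E (f j x) (f j x)) = of_nat d"
      using \<psi>_sum[OF x] by simp
  qed
  then show ?thesis by blast
qed

end

section \<open>Tensor powers\<close>

definition tuples :: "'j set \<Rightarrow> nat \<Rightarrow> 'j list set" where
  "tuples J r = {is. length is = r \<and> set is \<subseteq> J}"

lemma tuples_0 [simp]: "tuples J 0 = {[]}"
  by (auto simp: tuples_def)

lemma tuples_Suc: "tuples J (Suc r) = (\<lambda>(j, is). j # is) ` (J \<times> tuples J r)"
  by (auto simp: tuples_def length_Suc_conv image_iff)

lemma finite_tuples: "finite J \<Longrightarrow> finite (tuples J r)"
  unfolding tuples_def using finite_lists_length_eq[of J r] by (simp add: conj_commute)

lemma sum_tuples_Suc: "(\<Sum>is\<in>tuples J (Suc r). g is) = (\<Sum>j\<in>J. \<Sum>is\<in>tuples J r. g (j # is))"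
  unfolding tuples_Suc
  by (subst sum.reindex) (auto simp: inj_on_def sum.cartesian_product case_prod_beta)

lemma sum_tuples_append:
  "(\<Sum>is\<in>tuples J (r + s). g is) = (\<Sum>is\<in>tuples J r. \<Sum>js\<in>tuples J s. g (is @ js))"
  by (induction r arbitrary: g) (simp_all add: sum_tuples_Suc)

lemma tuples_length: "is \<in> tuples J r \<Longrightarrow> length is = r"
  by (simp add: tuples_def)

lemma take_drop_tuples:
  "is \<in> tuples J (r + s) \<Longrightarrow> take r is \<in> tuples J r" "is \<in> tuples J (r + s) \<Longrightarrow> drop r is \<in> tuples J s"
  by (auto simp: tuples_def dest: in_set_takeD in_set_dropD)

lemma pure_tensor_Nil: "pure_tensor E x [] ws = (if ws = [] then 1 else 0)"
  by (auto simp: pure_tensor_def)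

lemma pure_tensor_Cons_Nil: "pure_tensor E x (v # vs) [] = 0"
  by (auto simp: pure_tensor_def)

lemma pure_tensor_Cons:
  "pure_tensor E x (v # vs) (w # ws) = (if w \<in> fibre E x then herm E w v * pure_tensor E x vs ws else 0)"
  unfolding pure_tensor_def by (auto simp: prod.lessThan_Suc_shift simp del: prod.lessThan_Suc)

lemma pure_tensor_eq_0:
  "length vs \<noteq> length ws \<or> \<not> set ws \<subseteq> fibre E x \<Longrightarrow> pure_tensor E x vs ws = 0"
  unfolding pure_tensor_def by auto

lemma pure_tensor_append:
  "length us = length ws \<Longrightarrow>
    pure_tensor E x (us @ vs) (ws @ zs) = pure_tensor E x us ws * pure_tensor E x vs zs"
  by (induction us ws rule: list_induct2) (auto simp: pure_tensor_Nil pure_tensor_Cons)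

lemma tensor_fibreI:
  assumes "\<And>vs. \<xi> vs \<noteq> 0 \<Longrightarrow> length vs = r \<and> set vs \<subseteq> fibre E x"
    and "\<And>us ws v v'. length us + Suc (length ws) = r \<Longrightarrow> set us \<union> set ws \<union> {v, v'} \<subseteq> fibre E x \<Longrightarrow>
      \<xi> (us @ vadd E v v' # ws) = \<xi> (us @ v # ws) + \<xi> (us @ v' # ws)"
    and "\<And>us ws v c. length us + Suc (length ws) = r \<Longrightarrow> set us \<union> set ws \<union> {v} \<subseteq> fibre E x \<Longrightarrow>
      \<xi> (us @ vscale E c v # ws) = cnj c * \<xi> (us @ v # ws)"
  shows "\<xi> \<in> tensor_fibre E r x"
  unfolding tensor_fibre_def using assms by auto

lemma tensor_fibre_supp: "\<xi> \<in> tensor_fibre E r x \<Longrightarrow> length vs \<noteq> r \<or> \<not> set vs \<subseteq> fibre E x \<Longrightarrow> \<xi> vs = 0"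
  unfolding tensor_fibre_def by auto

lemma tensor_fibre_add:
  assumes "\<xi> \<in> tensor_fibre E r x" "length us + Suc (length ws) = r"
    "set us \<union> set ws \<union> {v, v'} \<subseteq> fibre E x"
  shows "\<xi> (us @ vadd E v v' # ws) = \<xi> (us @ v # ws) + \<xi> (us @ v' # ws)"
  using assms unfolding tensor_fibre_def by simp

lemma tensor_fibre_scale:
  assumes "\<xi> \<in> tensor_fibre E r x" "length us + Suc (length ws) = r"
    "set us \<union> set ws \<union> {v} \<subseteq> fibre E x"
  shows "\<xi> (us @ vscale E c v # ws) = cnj c * \<xi> (us @ v # ws)"
  using assms(1) assms(2,3) unfolding tensor_fibre_def mem_Collect_eq
  by (elim conjE allE[of _ us] allE[of _ ws] allE[of _ v]) auto

lemma tensor_fibre_zero: "(\<lambda>_. 0) \<in> tensor_fibre E r x"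
  by (rule tensor_fibreI) auto

lemma tensor_fibre_lin:
  assumes "\<xi> \<in> tensor_fibre E r x" "\<eta> \<in> tensor_fibre E r x"
  shows "(\<lambda>vs. a * \<xi> vs + b * \<eta> vs) \<in> tensor_fibre E r x"
proof (rule tensor_fibreI)
  fix vs assume nz: "a * \<xi> vs + b * \<eta> vs \<noteq> 0"
  show "length vs = r \<and> set vs \<subseteq> fibre E x"
    by (rule ccontr)
      (use nz tensor_fibre_supp[OF assms(1), of vs] tensor_fibre_supp[OF assms(2), of vs] in simp)
qed (simp_all add: tensor_fibre_add[OF assms(1)] tensor_fibre_add[OF assms(2)]
    tensor_fibre_scale[OF assms(1)] tensor_fibre_scale[OF assms(2)] algebra_simps)

lemma tensor_fibre_sum:
  assumes "\<And>i. i \<in> A \<Longrightarrow> \<xi> i \<in> tensor_fibre E r x"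
  shows "(\<lambda>vs. \<Sum>i\<in>A. c i * \<xi> i vs) \<in> tensor_fibre E r x"
  using assms
proof (induction A rule: infinite_finite_induct)
  case (insert i A)
  then show ?case using tensor_fibre_lin[of "\<xi> i" E r x "\<lambda>vs. \<Sum>i\<in>A. c i * \<xi> i vs" "c i" 1] by simp
qed (auto simp: tensor_fibre_zero)

section \<open>Expansion of tensors along Parseval families\<close>

context framed_bundle
begin

abbreviation "X \<equiv> topspace (base E)"

abbreviation "pure \<equiv> pure_tensor E"

definition fr :: "'x \<Rightarrow> 'j list \<Rightarrow> 'e list" where
  "fr x is = map (\<lambda>j. f j x) is"

lemma frame_fibre: "x \<in> X \<Longrightarrow> j \<in> J \<Longrightarrow> f j x \<in> fibre E x"
  using section_frame[of j] unfolding local_section_def fibre_def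
  by (auto simp: continuous_map_def)

lemma fr_simps [simp]: "fr x [] = []" "fr x (j # is) = f j x # fr x is"
  "fr x (is @ js) = fr x is @ fr x js" "length (fr x is) = length is"
  by (simp_all add: fr_def)

lemma fr_fibre: "x \<in> X \<Longrightarrow> is \<in> tuples J r \<Longrightarrow> set (fr x is) \<subseteq> fibre E x"
  using frame_fibre by (auto simp: fr_def tuples_def)

lemma J_nonempty: "x \<in> X \<Longrightarrow> J \<noteq> {}"
  using trace_frame rank by fastforce

lemma fibre_nonempty: "x \<in> X \<Longrightarrow> fibre E x \<noteq> {}"
  using J_nonempty frame_fibre by blast

lemma herm_vadd_left:
  assumes "x \<in> X" "u \<in> fibre E x" "v \<in> fibre E x" "w \<in> fibre E x"
  shows "herm E (vadd E u v) w = herm E u w + herm E v w"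
  using herm_vadd[OF assms(1) assms(4,2,3)] herm_sym[OF assms(1), of w] assms vadd_fibre[OF assms(1,2,3)]
  by simp

lemma herm_vscale_left:
  assumes "x \<in> X" "u \<in> fibre E x" "w \<in> fibre E x"
  shows "herm E (vscale E c u) w = cnj c * herm E u w"
  using herm_vscale[OF assms(1) assms(3,2)] herm_sym[OF assms(1), of w] assms vscale_fibre[OF assms(1,2)]
  by simp

definition conj_linear :: "'x \<Rightarrow> ('e \<Rightarrow> complex) \<Rightarrow> bool" where
  "conj_linear x g \<longleftrightarrow> (\<forall>v\<in>fibre E x. \<forall>w\<in>fibre E x. \<forall>c.
     g (vadd E v w) = g v + g w \<and> g (vscale E c v) = cnj c * g v)"

text \<open>Stated for an arbitrary family, because it serves both the frame and the orthonormal
  basis chosen inside \<open>tensor_inner\<close>.\<close>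

definition parseval_at :: "'x \<Rightarrow> 'i set \<Rightarrow> ('i \<Rightarrow> 'e) \<Rightarrow> bool" where
  "parseval_at x I b \<longleftrightarrow> finite I \<and> (\<forall>i\<in>I. b i \<in> fibre E x) \<and>
     (\<forall>u\<in>fibre E x. \<forall>v\<in>fibre E x. herm E u v = (\<Sum>i\<in>I. herm E u (b i) * herm E (b i) v))"

lemma parseval_at_frame: "x \<in> X \<Longrightarrow> parseval_at x J (\<lambda>j. f j x)"
  unfolding parseval_at_def using finite_J frame_fibre parseval by blast

lemma conj_linear_herm: "x \<in> X \<Longrightarrow> w \<in> fibre E x \<Longrightarrow> conj_linear x (\<lambda>v. herm E v w)"
  unfolding conj_linear_def by (simp add: herm_vadd_left herm_vscale_left)

text \<open>The bundle record has no finite sums of vectors. A linear combination is therefore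
  characterised by its value under every conjugate linear functional, which also explains the
  conjugated coefficients.\<close>

lemma ex_combination:
  assumes x: "x \<in> X" and b: "\<And>i. i \<in> I \<Longrightarrow> b i \<in> fibre E x"
  shows "\<exists>w\<in>fibre E x. \<forall>g. conj_linear x g \<longrightarrow> g w = (\<Sum>i\<in>I. cnj (c i) * g (b i))"
  using b
proof (induction I rule: infinite_finite_induct)
  case (insert i I)
  have bi: "b i \<in> fibre E x" using insert.prems by simp
  have "\<exists>w\<in>fibre E x. \<forall>g. conj_linear x g \<longrightarrow> g w = (\<Sum>i\<in>I. cnj (c i) * g (b i))"
    by (rule insert.IH) (simp add: insert.prems)
  then obtain w where w: "w \<in> fibre E x"
    "\<forall>g. conj_linear x g \<longrightarrow> g w = (\<Sum>i\<in>I. cnj (c i) * g (b i))"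
    by (elim bexE)
  show ?case
  proof (rule bexI[OF _ vadd_fibre[OF x vscale_fibre[OF x bi] w(1)]], intro allI impI)
    fix g assume g: "conj_linear x g"
    then have "g (vadd E (vscale E (c i) (b i)) w) = cnj (c i) * g (b i) + g w"
      using vscale_fibre[OF x bi] bi w(1) unfolding conj_linear_def by simp
    then show "g (vadd E (vscale E (c i) (b i)) w) = (\<Sum>i\<in>insert i I. cnj (c i) * g (b i))"
      using w(2) g insert.hyps by simp
  qed
next
  case (infinite I)
  obtain v where v: "v \<in> fibre E x" using fibre_nonempty[OF x] by blast
  have "g (vscale E 0 v) = 0" if "conj_linear x g" for g using that v unfolding conj_linear_def by simp
  then show ?case using infinite(1) vscale_fibre[OF x v] by (auto intro!: bexI[of _ "vscale E 0 v"])
next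
  case empty
  obtain v where v: "v \<in> fibre E x" using fibre_nonempty[OF x] by blast
  have "g (vscale E 0 v) = 0" if "conj_linear x g" for g using that v unfolding conj_linear_def by simp
  then show ?case using vscale_fibre[OF x v] by (auto intro!: bexI[of _ "vscale E 0 v"])
qed

text \<open>The combination with coefficients \<open>herm E (b i) v\<close> has the same inner
  products as \<open>v\<close>, so it is \<open>v\<close>; any functional may then be evaluated on
  it term by term.\<close>

lemma conj_linear_expand:
  assumes x: "x \<in> X" and p: "parseval_at x I b" and g: "conj_linear x g" and v: "v \<in> fibre E x"
  shows "g v = (\<Sum>i\<in>I. herm E v (b i) * g (b i))"
proof -
  have b: "b i \<in> fibre E x" if "i \<in> I" for i using p that unfolding parseval_at_def by blast
  have par: "herm E u v = (\<Sum>i\<in>I. herm E u (b i) * herm E (b i) v)" if "u \<in> fibre E x" for u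
    using p that v unfolding parseval_at_def by blast
  have "\<exists>w\<in>fibre E x. \<forall>g. conj_linear x g \<longrightarrow> g w = (\<Sum>i\<in>I. cnj (herm E (b i) v) * g (b i))"
    by (rule ex_combination[OF x b])
  then obtain w where w: "w \<in> fibre E x"
    "\<forall>g. conj_linear x g \<longrightarrow> g w = (\<Sum>i\<in>I. cnj (herm E (b i) v) * g (b i))"
    by (elim bexE)
  have "w = v"
  proof (rule fibre_eqI[OF x w(1) v])
    fix u assume u: "u \<in> fibre E x"
    have "herm E u w = cnj (herm E w u)" by (rule herm_sym[OF x w(1) u])
    also have "herm E w u = (\<Sum>i\<in>I. cnj (herm E (b i) v) * herm E (b i) u)"
      by (rule w(2)[rule_format, OF conj_linear_herm[OF x u]])
    also have "cnj \<dots> = (\<Sum>i\<in>I. herm E (b i) v * herm E u (b i))"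
      using herm_sym[OF x b u] by simp
    also have "\<dots> = herm E u v" unfolding par[OF u] by (simp add: mult.commute)
    finally show "herm E u w = herm E u v" .
  qed
  then have "g v = (\<Sum>i\<in>I. cnj (herm E (b i) v) * g (b i))" using w(2) g by simp
  then show ?thesis using herm_sym[OF x b v] by simp
qed

text \<open>The prefix \<open>us\<close> collects arguments already replaced by members of the
  family, so that the induction treats one variable at a time.\<close>

lemma tensor_expand_prefix:
  assumes x: "x \<in> X" and p: "parseval_at x I b" and \<xi>: "\<xi> \<in> tensor_fibre E r x"
    and "length us + length vs = r" "set us \<subseteq> fibre E x" "set vs \<subseteq> fibre E x"
  shows "\<xi> (us @ vs) = (\<Sum>is\<in>tuples I (length vs). \<xi> (us @ map b is) * pure x (map b is) vs)"
  using assms(4-)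
proof (induction vs arbitrary: us)
  case Nil
  then show ?case by (simp add: pure_tensor_Nil)
next
  case (Cons v vs)
  have b: "b i \<in> fibre E x" if "i \<in> I" for i using p that unfolding parseval_at_def by blast
  have v: "v \<in> fibre E x" and len: "length us + Suc (length vs) = r" using Cons.prems by simp_all
  have "conj_linear x (\<lambda>v. \<xi> (us @ v # vs))"
    unfolding conj_linear_def
    using tensor_fibre_add[OF \<xi> len] tensor_fibre_scale[OF \<xi> len] Cons.prems by simp
  from conj_linear_expand[OF x p this v]
  have "\<xi> (us @ v # vs) = (\<Sum>i\<in>I. herm E v (b i) * \<xi> (us @ b i # vs))" .
  also have "\<dots> = (\<Sum>i\<in>I. herm E v (b i) *
      (\<Sum>is\<in>tuples I (length vs). \<xi> ((us @ [b i]) @ map b is) * pure x (map b is) vs))"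
  proof (intro sum.cong refl)
    fix i assume "i \<in> I"
    then show "herm E v (b i) * \<xi> (us @ b i # vs) = herm E v (b i) *
      (\<Sum>is\<in>tuples I (length vs). \<xi> ((us @ [b i]) @ map b is) * pure x (map b is) vs)"
      using Cons.IH[of "us @ [b i]"] Cons.prems b by simp
  qed
  also have "\<dots> = (\<Sum>is\<in>tuples I (length (v # vs)). \<xi> (us @ map b is) * pure x (map b is) (v # vs))"
    using v by (simp add: sum_tuples_Suc pure_tensor_Cons sum_distrib_left mult_ac)
  finally show ?case .
qed

lemma tensor_expand:
  assumes x: "x \<in> X" and p: "parseval_at x I b" and \<xi>: "\<xi> \<in> tensor_fibre E r x"
  shows "\<xi> vs = (\<Sum>is\<in>tuples I r. \<xi> (map b is) * pure x (map b is) vs)"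
proof (cases "length vs = r \<and> set vs \<subseteq> fibre E x")
  case True
  then show ?thesis using tensor_expand_prefix[OF x p \<xi>, of "[]" vs] by simp
next
  case False
  then have "\<xi> vs = 0" using tensor_fibre_supp[OF \<xi>] by blast
  moreover have "pure x (map b is) vs = 0" if "is \<in> tuples I r" for "is"
    using False tuples_length[OF that] by (intro pure_tensor_eq_0) auto
  ultimately show ?thesis by simp
qed

lemma tensor_expand_frame:
  "x \<in> X \<Longrightarrow> \<xi> \<in> tensor_fibre E r x \<Longrightarrow> \<xi> vs = (\<Sum>is\<in>tuples J r. \<xi> (fr x is) * pure x (fr x is) vs)"
  unfolding fr_def by (rule tensor_expand[OF _ parseval_at_frame])

lemma pure_sym:
  "x \<in> X \<Longrightarrow> set vs \<subseteq> fibre E x \<Longrightarrow> set ws \<subseteq> fibre E x \<Longrightarrow> pure x ws vs = cnj (pure x vs ws)"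
proof (induction vs arbitrary: ws)
  case Nil
  then show ?case by (cases ws) (auto simp: pure_tensor_Nil pure_tensor_Cons_Nil)
next
  case (Cons v vs)
  then show ?case
  proof (cases ws)
    case (Cons w ws')
    have "pure x ws' vs = cnj (pure x vs ws')" using Cons.IH Cons.prems Cons by simp
    moreover have "herm E v w = cnj (herm E w v)" using Cons.prems Cons by (intro herm_sym) auto
    ultimately show ?thesis using Cons.prems Cons by (simp add: pure_tensor_Cons)
  qed (auto simp: pure_tensor_Nil pure_tensor_Cons_Nil)
qed

lemma pure_in_tensor_fibre:
  assumes x: "x \<in> X" and vs: "set vs \<subseteq> fibre E x" "length vs = r"
  shows "pure x vs \<in> tensor_fibre E r x"
proof (rule tensor_fibreI)
  show "pure x vs ws \<noteq> 0 \<Longrightarrow> length ws = r \<and> set ws \<subseteq> fibre E x" for ws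
    using pure_tensor_eq_0[of vs ws E x] vs(2) by metis
next
  fix us ws v v'
  assume l: "length us + Suc (length ws) = r" and sub: "set us \<union> set ws \<union> {v, v'} \<subseteq> fibre E x"
  obtain as b bs where ab: "vs = as @ b # bs" "length as = length us"
    using l vs(2) id_take_nth_drop[of "length us" vs] by (metis add_Suc_right length_take less_add_Suc1 min.absorb4)
  show "pure x vs (us @ vadd E v v' # ws) = pure x vs (us @ v # ws) + pure x vs (us @ v' # ws)"
    using sub ab vs x vadd_fibre[OF x, of v v']
    by (simp add: pure_tensor_append pure_tensor_Cons herm_vadd_left algebra_simps)
next
  fix us ws v c
  assume l: "length us + Suc (length ws) = r" and sub: "set us \<union> set ws \<union> {v} \<subseteq> fibre E x"
  obtain as b bs where ab: "vs = as @ b # bs" "length as = length us"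
    using l vs(2) id_take_nth_drop[of "length us" vs] by (metis add_Suc_right length_take less_add_Suc1 min.absorb4)
  show "pure x vs (us @ vscale E c v # ws) = cnj c * pure x vs (us @ v # ws)"
    using sub ab vs x vscale_fibre[OF x, of v c]
    by (simp add: pure_tensor_append pure_tensor_Cons herm_vscale_left algebra_simps)
qed

lemma pure_fr_in: "x \<in> X \<Longrightarrow> is \<in> tuples J r \<Longrightarrow> pure x (fr x is) \<in> tensor_fibre E r x"
  by (intro pure_in_tensor_fibre fr_fibre) (auto simp: tuples_length)

text \<open>The vector minus its orthogonal projection, described by inner products because
  combinations are only accessible through \<open>ex_combination\<close>.\<close>

lemma orthonormal_residual:
  assumes x: "x \<in> X" and B: "finite B" "B \<subseteq> fibre E x" and v: "v \<in> fibre E x"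
    and orth: "\<And>b c. b \<in> B \<Longrightarrow> c \<in> B \<Longrightarrow> herm E b c = (if b = c then 1 else 0)"
  shows "\<exists>w\<in>fibre E x. (\<forall>b\<in>B. herm E b w = 0) \<and>
    (\<forall>u\<in>fibre E x. herm E u w = herm E u v - (\<Sum>b\<in>B. herm E b v * herm E u b))"
proof -
  have "\<exists>w\<in>fibre E x. \<forall>g. conj_linear x g \<longrightarrow> g w = (\<Sum>b\<in>B. cnj (- herm E b v) * g b)"
    by (rule ex_combination[OF x]) (use B in blast)
  then obtain w0 where w0: "w0 \<in> fibre E x"
    "\<forall>g. conj_linear x g \<longrightarrow> g w0 = (\<Sum>b\<in>B. cnj (- herm E b v) * g b)"
    by (elim bexE)
  define w where "w = vadd E v w0"
  have w: "w \<in> fibre E x" using vadd_fibre[OF x v w0(1)] by (simp add: w_def)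
  have res: "herm E u w = herm E u v - (\<Sum>b\<in>B. herm E b v * herm E u b)" if u: "u \<in> fibre E x" for u
  proof -
    have "herm E u w = herm E u v + cnj (herm E w0 u)"
      unfolding w_def herm_vadd[OF x u v w0(1)] herm_sym[OF x w0(1) u] ..
    also have "herm E w0 u = (\<Sum>b\<in>B. cnj (- herm E b v) * herm E b u)"
      by (rule w0(2)[rule_format, OF conj_linear_herm[OF x u]])
    also have "cnj \<dots> = (\<Sum>b\<in>B. - (herm E b v * herm E u b))"
      unfolding cnj_sum using B(2) by (intro sum.cong refl) (simp add: herm_sym[OF x _ u] subsetD)
    finally show ?thesis by (simp add: sum_negf)
  qed
  have "herm E b w = 0" if b: "b \<in> B" for b
  proof -
    have "(\<Sum>c\<in>B. herm E c v * herm E b c) = (\<Sum>c\<in>B. if c = b then herm E b v else 0)"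
      using orth[OF b] by (intro sum.cong) auto
    then show ?thesis using res[of b] b B by auto
  qed
  with w res show ?thesis by blast
qed

text \<open>The definition of \<open>orthonormal_basis\<close> speaks of completeness only, so
  finiteness has to be proved first; then the residual of every vector vanishes.\<close>

lemma parseval_at_orthonormal_basis:
  assumes x: "x \<in> X" and on: "orthonormal_basis E x B"
  shows "parseval_at x B id"
proof -
  have B: "B \<subseteq> fibre E x" and orth: "\<And>b c. b \<in> B \<Longrightarrow> c \<in> B \<Longrightarrow> herm E b c = (if b = c then 1 else 0)"
    and compl: "\<And>v. v \<in> fibre E x \<Longrightarrow> (\<And>b. b \<in> B \<Longrightarrow> herm E b v = 0) \<Longrightarrow> v = vscale E 0 v"
    using on unfolding orthonormal_basis_def by auto
  have sq: "Re (herm E u v * herm E v u) = (cmod (herm E v u))\<^sup>2" if "u \<in> fibre E x" "v \<in> fibre E x" for u v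
    using herm_sym[OF x that(2,1)] by (metis Re_complex_of_real complex_norm_square mult.commute)
  have bessel: "(\<Sum>b\<in>G. (cmod (herm E b v))\<^sup>2) \<le> Re (herm E v v)"
    if G: "G \<subseteq> B" "finite G" and v: "v \<in> fibre E x" for G v
  proof -
    have G': "G \<subseteq> fibre E x" using G B by blast
    have "herm E b c = (if b = c then 1 else 0)" if "b \<in> G" "c \<in> G" for b c
      using orth G(1) that by blast
    then obtain w where w: "w \<in> fibre E x" "\<forall>b\<in>G. herm E b w = 0"
      "\<forall>u\<in>fibre E x. herm E u w = herm E u v - (\<Sum>b\<in>G. herm E b v * herm E u b)"
      using orthonormal_residual[OF x G(2) G' v] by auto
    have "herm E w b = 0" if "b \<in> G" for b using herm_sym[OF x, of b w] w(1,2) G' that by auto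
    then have "herm E w w = herm E w v" using w(3)[rule_format, OF w(1)] by simp
    also have "\<dots> = cnj (herm E v w)" using herm_sym[OF x v w(1)] .
    finally have "Re (herm E w w) = Re (herm E v v) - (\<Sum>b\<in>G. Re (herm E b v * herm E v b))"
      using w(3)[rule_format, OF v] by simp
    also have "(\<Sum>b\<in>G. Re (herm E b v * herm E v b)) = (\<Sum>b\<in>G. (cmod (herm E b v))\<^sup>2)"
      using sq v G' by (intro sum.cong refl) (metis mult.commute subsetD)
    finally show ?thesis using herm_nonneg[OF x w(1)] by simp
  qed
  \<comment> \<open>Each unit vector of \<open>G\<close> is expanded along the frame. After
    exchanging the sums, Bessel's inequality bounds the total by the trace of the frame, which is
    \<open>d\<close>.\<close>
  have card: "card G \<le> d" if G: "G \<subseteq> B" "finite G" for G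
  proof -
    have "real (card G) = (\<Sum>b\<in>G. Re (herm E b b))" using orth G(1) by (simp add: subsetD)
    also have "\<dots> = (\<Sum>b\<in>G. \<Sum>j\<in>J. (cmod (herm E b (f j x)))\<^sup>2)"
    proof (intro sum.cong refl)
      fix b assume "b \<in> G"
      then have b: "b \<in> fibre E x" using G B by blast
      show "Re (herm E b b) = (\<Sum>j\<in>J. (cmod (herm E b (f j x)))\<^sup>2)"
        unfolding parseval[OF x b b] Re_sum
        using sq[OF frame_fibre[OF x] b] by (intro sum.cong refl) (simp add: mult.commute)
    qed
    also have "\<dots> = (\<Sum>j\<in>J. \<Sum>b\<in>G. (cmod (herm E b (f j x)))\<^sup>2)" by (rule sum.swap)
    also have "\<dots> \<le> (\<Sum>j\<in>J. Re (herm E (f j x) (f j x)))"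
      by (intro sum_mono bessel G frame_fibre x)
    also have "\<dots> = Re (of_nat d)" using trace_frame[OF x] by (metis Re_sum)
    finally show ?thesis by simp
  qed
  then have fin: "finite B" using finite_if_finite_subsets_card_bdd[of B d] by blast
  have "herm E u v = (\<Sum>b\<in>B. herm E u b * herm E b v)" if u: "u \<in> fibre E x" and v: "v \<in> fibre E x" for u v
  proof -
    obtain w where w: "w \<in> fibre E x" "\<forall>b\<in>B. herm E b w = 0"
      "\<forall>u\<in>fibre E x. herm E u w = herm E u v - (\<Sum>b\<in>B. herm E b v * herm E u b)"
      using orthonormal_residual[OF x fin B v orth] by auto
    have "w = vscale E 0 w" using compl[OF w(1)] w(2) by blast
    then have "herm E u w = 0" using herm_vscale[OF x u w(1), of 0] by simp
    then show ?thesis using w(3)[rule_format, OF u] by (simp add: mult.commute)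
  qed
  then show ?thesis unfolding parseval_at_def using fin B by auto
qed

text \<open>Removes the arbitrary choice of a basis: \<open>\<xi>\<close> is expanded along the
  frame, and the sum over the basis that remains is the expansion of \<open>\<eta>\<close>.\<close>

lemma tensor_inner_frame:
  assumes x: "x \<in> X" and \<xi>: "\<xi> \<in> tensor_fibre E r x" and \<eta>: "\<eta> \<in> tensor_fibre E r x"
  shows "tensor_inner E r x \<xi> \<eta> = (\<Sum>is\<in>tuples J r. cnj (\<xi> (fr x is)) * \<eta> (fr x is))"
proof -
  define B where "B = (SOME B. orthonormal_basis E x B)"
  have "orthonormal_basis E x B" unfolding B_def using ex_orthonormal_basis[OF x] by (rule someI_ex)
  then have p: "parseval_at x B id" by (rule parseval_at_orthonormal_basis[OF x])
  then have B: "finite B" "B \<subseteq> fibre E x" unfolding parseval_at_def by auto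
  have "tensor_inner E r x \<xi> \<eta> = (\<Sum>bs\<in>tuples B r. cnj (\<xi> bs) * \<eta> bs)"
    unfolding tensor_inner_def B_def[symmetric] tuples_def ..
  also have "\<dots> = (\<Sum>bs\<in>tuples B r. \<Sum>is\<in>tuples J r. cnj (\<xi> (fr x is)) * (\<eta> bs * cnj (pure x (fr x is) bs)))"
    by (subst tensor_expand_frame[OF x \<xi>]) (simp add: sum_distrib_right sum_distrib_left mult_ac)
  also have "\<dots> = (\<Sum>is\<in>tuples J r. cnj (\<xi> (fr x is)) * (\<Sum>bs\<in>tuples B r. \<eta> bs * cnj (pure x (fr x is) bs)))"
    by (subst sum.swap) (simp add: sum_distrib_left)
  also have "\<dots> = (\<Sum>is\<in>tuples J r. cnj (\<xi> (fr x is)) * \<eta> (fr x is))"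
  proof (intro sum.cong refl arg_cong2[of _ _ _ _ "(*)"])
    fix "is" assume i: "is \<in> tuples J r"
    have "cnj (pure x (fr x is) bs) = pure x bs (fr x is)" if "bs \<in> tuples B r" for bs
      using pure_sym[OF x fr_fibre[OF x i], of bs] that B by (auto simp: tuples_def)
    then show "(\<Sum>bs\<in>tuples B r. \<eta> bs * cnj (pure x (fr x is) bs)) = \<eta> (fr x is)"
      using tensor_expand[OF x p \<eta>, of "fr x is"] by simp
  qed
  finally show ?thesis .
qed

end

section \<open>Arrows in coordinates\<close>

lemma
  assumes "t \<in> arrows E r s"
  shows arrow_zero: "x \<notin> topspace (base E) \<or> \<xi> \<notin> tensor_fibre E r x \<Longrightarrow> t x \<xi> = (\<lambda>_. 0)"
    and arrow_fibre: "x \<in> topspace (base E) \<Longrightarrow> \<xi> \<in> tensor_fibre E r x \<Longrightarrow> t x \<xi> \<in> tensor_fibre E s x"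
    and arrow_lin: "x \<in> topspace (base E) \<Longrightarrow> \<xi> \<in> tensor_fibre E r x \<Longrightarrow> \<eta> \<in> tensor_fibre E r x \<Longrightarrow>
      t x (\<lambda>vs. a * \<xi> vs + b * \<eta> vs) = (\<lambda>vs. a * t x \<xi> vs + b * t x \<eta> vs)"
    and arrow_continuous: "continuous_map (tensor_bundle E r) (tensor_bundle E s) (\<lambda>(x, \<xi>). (x, t x \<xi>))"
  using assms unfolding arrows_def mem_Collect_eq by blast+

lemma arrow_lin_sum:
  assumes t: "t \<in> arrows E r s" and x: "x \<in> topspace (base E)"
    and \<xi>: "\<And>i. i \<in> A \<Longrightarrow> \<xi> i \<in> tensor_fibre E r x"
  shows "t x (\<lambda>vs. \<Sum>i\<in>A. c i * \<xi> i vs) = (\<lambda>ws. \<Sum>i\<in>A. c i * t x (\<xi> i) ws)"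
  using \<xi>
proof (induction A rule: infinite_finite_induct)
  case (insert i A)
  have "t x (\<lambda>vs. c i * \<xi> i vs + 1 * (\<Sum>i\<in>A. c i * \<xi> i vs)) =
      (\<lambda>ws. c i * t x (\<xi> i) ws + 1 * t x (\<lambda>vs. \<Sum>i\<in>A. c i * \<xi> i vs) ws)"
    by (rule arrow_lin[OF t x]) (use insert.prems in \<open>auto intro!: tensor_fibre_sum\<close>)
  then show ?case using insert by simp
qed (use arrow_lin[OF t x tensor_fibre_zero tensor_fibre_zero, of 0 0] in simp_all)

lemma arr_comp_assoc: "arr_comp (arr_comp a b) c = arr_comp a (arr_comp b c)"
  by (simp add: arr_comp_def)

lemma local_section_subset:
  assumes "local_section E U s" "V \<subseteq> U"
  shows "local_section E V s"
  using assms continuous_map_from_subtopology_mono unfolding local_section_def by blast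

context framed_bundle
begin

lemma arrow_expand:
  assumes t: "t \<in> arrows E r s" and x: "x \<in> X" and \<xi>: "\<xi> \<in> tensor_fibre E r x"
  shows "t x \<xi> ws = (\<Sum>is\<in>tuples J r. \<xi> (fr x is) * t x (pure x (fr x is)) ws)"
proof -
  have "\<xi> = (\<lambda>vs. \<Sum>is\<in>tuples J r. \<xi> (fr x is) * pure x (fr x is) vs)"
    using tensor_expand_frame[OF x \<xi>] by blast
  then have "t x \<xi> = t x (\<lambda>vs. \<Sum>is\<in>tuples J r. \<xi> (fr x is) * pure x (fr x is) vs)" by simp
  then show ?thesis using arrow_lin_sum[OF t x pure_fr_in[OF x], of "tuples J r" "\<lambda>is. is"] by simp
qed

text \<open>Frame expansions are combinations of pure tensors, so an identity of arrows reduces to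
  one of matrix coefficients. Most later identities are proved this way.\<close>

lemma arrow_eqI:
  assumes t: "t \<in> arrows E r s" and t': "t' \<in> arrows E r s"
    and eq: "\<And>x us ws. x \<in> X \<Longrightarrow> set us \<subseteq> fibre E x \<Longrightarrow> set ws \<subseteq> fibre E x \<Longrightarrow> length us = r \<Longrightarrow>
      length ws = s \<Longrightarrow> t x (pure x us) ws = t' x (pure x us) ws"
  shows "t = t'"
proof (intro ext)
  fix x \<xi> ws
  show "t x \<xi> ws = t' x \<xi> ws"
  proof (cases "x \<in> X \<and> \<xi> \<in> tensor_fibre E r x")
    case True
    then have x: "x \<in> X" and \<xi>: "\<xi> \<in> tensor_fibre E r x" by auto
    show ?thesis
    proof (cases "length ws = s \<and> set ws \<subseteq> fibre E x")
      case True
      show ?thesis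
        unfolding arrow_expand[OF t x \<xi>] arrow_expand[OF t' x \<xi>]
        using True by (intro sum.cong refl) (simp add: eq[OF x fr_fibre[OF x]] tuples_length)
    next
      case False
      then show ?thesis
        using tensor_fibre_supp[OF arrow_fibre[OF t x \<xi>], of ws] tensor_fibre_supp[OF arrow_fibre[OF t' x \<xi>], of ws]
        by auto
    qed
  next
    case False
    then show ?thesis using arrow_zero[OF t, of x \<xi>] arrow_zero[OF t', of x \<xi>] by auto
  qed
qed

lemma tensor_bundle_basis:
  assumes "openin (base E) U" "length vs = r" "\<And>v. v \<in> set vs \<Longrightarrow> local_section E U v" "open V"
  shows "openin (tensor_bundle E r) {(y, \<xi>). y \<in> U \<and> \<xi> \<in> tensor_fibre E r y \<and> \<xi> (map (\<lambda>v. v y) vs) \<in> V}"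
  unfolding tensor_bundle_def by (rule topology_generated_by_Basis) (use assms in blast)

lemma topspace_tensor_bundle: "topspace (tensor_bundle E r) = {(y, \<xi>). y \<in> X \<and> \<xi> \<in> tensor_fibre E r y}"
proof (intro equalityI subsetI)
  fix p assume "p \<in> topspace (tensor_bundle E r)"
  then obtain U vs V where "openin (base E) U"
    "p \<in> {(y, \<xi>). y \<in> U \<and> \<xi> \<in> tensor_fibre E r y \<and> \<xi> (map (\<lambda>v. v y) vs) \<in> V}"
    unfolding tensor_bundle_def topology_generated_by_topspace by (elim UnionE CollectE exE conjE) simp
  then show "p \<in> {(y, \<xi>). y \<in> X \<and> \<xi> \<in> tensor_fibre E r y}"
    using openin_subset[of "base E" U] by auto
next
  fix p assume p: "p \<in> {(y, \<xi>). y \<in> X \<and> \<xi> \<in> tensor_fibre E r y}"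
  then have "fst p \<in> X" by auto
  then obtain j where j: "j \<in> J" using J_nonempty by blast
  \<comment> \<open>With \<open>V = UNIV\<close> and one global frame section in every slot, a
    single subbasic set is already the whole total space.\<close>
  have "openin (tensor_bundle E r) {(y, \<xi>). y \<in> X \<and> \<xi> \<in> tensor_fibre E r y \<and>
      \<xi> (map (\<lambda>v. v y) (replicate r (f j))) \<in> UNIV}"
    by (rule tensor_bundle_basis) (use section_frame[OF j] in \<open>auto split: if_splits\<close>)
  then show "p \<in> topspace (tensor_bundle E r)" using openin_subset p by blast
qed

lemma tensor_bundle_fst: "continuous_map (tensor_bundle E r) (base E) fst"
  unfolding continuous_map_def
proof (intro conjI allI impI)
  show "fst \<in> topspace (tensor_bundle E r) \<rightarrow> X" by (auto simp: topspace_tensor_bundle)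
  fix U assume U: "openin (base E) U"
  show "openin (tensor_bundle E r) {p \<in> topspace (tensor_bundle E r). fst p \<in> U}"
  proof (cases "X = {}")
    case True
    then have "{p \<in> topspace (tensor_bundle E r). fst p \<in> U} = {}" by (auto simp: topspace_tensor_bundle)
    then show ?thesis by (metis openin_empty)
  next
    case False
    then obtain j where j: "j \<in> J" using J_nonempty by blast
    have "openin (tensor_bundle E r) {(y, \<xi>). y \<in> U \<and> \<xi> \<in> tensor_fibre E r y \<and>
        \<xi> (map (\<lambda>v. v y) (replicate r (f j))) \<in> UNIV}"
      by (rule tensor_bundle_basis[OF U])
        (use local_section_subset[OF section_frame[OF j] openin_subset[OF U]] in \<open>auto split: if_splits\<close>)
    moreover have "{p \<in> topspace (tensor_bundle E r). fst p \<in> U} = {(y, \<xi>). y \<in> U \<and> \<xi> \<in> tensor_fibre E r y \<and>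
        \<xi> (map (\<lambda>v. v y) (replicate r (f j))) \<in> UNIV}"
      using openin_subset[OF U] by (auto simp: topspace_tensor_bundle)
    ultimately show ?thesis by simp
  qed
qed

lemma tensor_bundle_coord:
  assumes "is \<in> tuples J r"
  shows "continuous_fun (tensor_bundle E r) (\<lambda>p. snd p (fr (fst p) is))"
  unfolding continuous_map_def
proof (intro conjI allI impI)
  fix V :: "complex set" assume "openin euclidean V"
  then have V: "open V" by simp
  have "openin (tensor_bundle E r) {(y, \<xi>). y \<in> X \<and> \<xi> \<in> tensor_fibre E r y \<and> \<xi> (map (\<lambda>v. v y) (map f is)) \<in> V}"
    by (rule tensor_bundle_basis) (use assms V section_frame in \<open>auto simp: tuples_def\<close>)
  moreover have "{p \<in> topspace (tensor_bundle E r). snd p (fr (fst p) is) \<in> V} =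
      {(y, \<xi>). y \<in> X \<and> \<xi> \<in> tensor_fibre E r y \<and> \<xi> (map (\<lambda>v. v y) (map f is)) \<in> V}"
    by (auto simp: topspace_tensor_bundle fr_def o_def)
  ultimately show "openin (tensor_bundle E r) {p \<in> topspace (tensor_bundle E r). snd p (fr (fst p) is) \<in> V}" by simp
qed simp

text \<open>The coordinates of a subbasic set make sense only where its local sections live.
  Openness is tested there and passes to \<open>T\<close>, because the preimage of that set is
  open.\<close>

lemma continuous_into_tensor_bundle:
  assumes fst: "continuous_map T (base E) a"
    and snd: "\<And>p. p \<in> topspace T \<Longrightarrow> b p \<in> tensor_fibre E s (a p)"
    and coord: "\<And>U vs. openin (base E) U \<Longrightarrow> length vs = s \<Longrightarrow> (\<And>v. v \<in> set vs \<Longrightarrow> local_section E U v) \<Longrightarrow>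
      continuous_fun (subtopology T {p. a p \<in> U}) (\<lambda>p. b p (map (\<lambda>v. v (a p)) vs))"
  shows "continuous_map T (tensor_bundle E s) (\<lambda>p. (a p, b p))"
proof -
  have aX: "a p \<in> X" if "p \<in> topspace T" for p using fst that by (auto simp: continuous_map_def)
  show ?thesis
    unfolding tensor_bundle_def
  proof (rule continuous_on_generated_topo)
    fix S assume "S \<in> {{(y, \<xi>). y \<in> U \<and> \<xi> \<in> tensor_fibre E s y \<and> \<xi> (map (\<lambda>v. v y) vs) \<in> V} | U vs V.
        openin (base E) U \<and> length vs = s \<and> (\<forall>v \<in> set vs. local_section E U v) \<and> open V}"
    then obtain U vs V where S: "S = {(y, \<xi>). y \<in> U \<and> \<xi> \<in> tensor_fibre E s y \<and> \<xi> (map (\<lambda>v. v y) vs) \<in> V}"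
      and U: "openin (base E) U" "length vs = s" "\<And>v. v \<in> set vs \<Longrightarrow> local_section E U v" and V: "open V"
      by blast
    have o: "openin T {p \<in> topspace T. a p \<in> U}" by (rule openin_continuous_map_preimage[OF fst U(1)])
    have e: "subtopology T {p. a p \<in> U} = subtopology T {p \<in> topspace T. a p \<in> U}"
      using subtopology_restrict[of T "{p. a p \<in> U}"] by (simp add: Int_def)
    have "openin (subtopology T {p. a p \<in> U})
        {p \<in> topspace (subtopology T {p. a p \<in> U}). b p (map (\<lambda>v. v (a p)) vs) \<in> V}"
      by (rule openin_continuous_map_preimage[OF coord[OF U]]) (use V in simp_all)
    then have "openin T {p \<in> topspace (subtopology T {p. a p \<in> U}). b p (map (\<lambda>v. v (a p)) vs) \<in> V}"
      unfolding e by (rule openin_trans_full[OF _ o])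
    moreover have "{p \<in> topspace (subtopology T {p. a p \<in> U}). b p (map (\<lambda>v. v (a p)) vs) \<in> V} =
      (\<lambda>p. (a p, b p)) -` S \<inter> topspace T"
      using snd by (auto simp: S)
    ultimately show "openin T ((\<lambda>p. (a p, b p)) -` S \<inter> topspace T)" by simp
  next
    have "(\<lambda>p. (a p, b p)) ` topspace T \<subseteq> topspace (tensor_bundle E s)"
      using snd aX by (auto simp: topspace_tensor_bundle)
    then show "(\<lambda>p. (a p, b p)) ` topspace T \<subseteq>
      \<Union> {{(y, \<xi>). y \<in> U \<and> \<xi> \<in> tensor_fibre E s y \<and> \<xi> (map (\<lambda>v. v y) vs) \<in> V} | U vs V.
        openin (base E) U \<and> length vs = s \<and> (\<forall>v \<in> set vs. local_section E U v) \<and> open V}"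
      unfolding tensor_bundle_def topology_generated_by_topspace .
  qed
qed

lemma continuous_pure_sections:
  assumes U: "openin (base E) U"
  shows "length ss = length vs \<Longrightarrow> (\<And>v. v \<in> set ss \<union> set vs \<Longrightarrow> local_section E U v) \<Longrightarrow>
    continuous_fun (subtopology (base E) U) (\<lambda>y. pure y (map (\<lambda>v. v y) ss) (map (\<lambda>v. v y) vs))"
proof (induction ss vs rule: list_induct2)
  case Nil
  then show ?case by (simp add: pure_tensor_Nil)
next
  case (Cons s ss v vs)
  have v: "v y \<in> fibre E y" if "y \<in> U" for y
    using Cons.prems[of v] that openin_subset[OF U]
    by (auto simp: local_section_def fibre_def continuous_map_def)
  have "continuous_fun (subtopology (base E) U) (\<lambda>y. herm E (v y) (s y) * pure y (map (\<lambda>v. v y) ss) (map (\<lambda>v. v y) vs))"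
    by (intro continuous_fun_mult continuous_herm[OF U] Cons.IH) (use Cons.prems in auto)
  then show ?case
    by (rule continuous_map_eq) (use v in \<open>auto simp: pure_tensor_Cons\<close>)
qed

lemma continuous_pure_frame:
  assumes "openin (base E) U" "length is = length vs" "is \<in> tuples J r" "\<And>v. v \<in> set vs \<Longrightarrow> local_section E U v"
  shows "continuous_fun (subtopology (base E) U) (\<lambda>y. pure y (fr y is) (map (\<lambda>v. v y) vs))"
proof -
  have "continuous_fun (subtopology (base E) U) (\<lambda>y. pure y (map (\<lambda>v. v y) (map f is)) (map (\<lambda>v. v y) vs))"
  proof (rule continuous_pure_sections[OF assms(1)])
    fix v assume "v \<in> set (map f is) \<union> set vs"
    then show "local_section E U v"
      using assms(3,4) local_section_subset[OF section_frame openin_subset[OF assms(1)]] by (auto simp: tuples_def)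
  qed (use assms(2) in simp)
  then show ?thesis by (simp add: fr_def o_def)
qed

lemma continuous_arrow_coord:
  assumes t: "t \<in> arrows E r s" and i: "is \<in> tuples J r" "js \<in> tuples J s"
  shows "continuous_fun (base E) (\<lambda>x. t x (pure x (fr x is)) (fr x js))"
proof -
  have "continuous_map (base E) (tensor_bundle E r) (\<lambda>x. (x, pure x (fr x is)))"
  proof (rule continuous_into_tensor_bundle)
    fix U vs assume U: "openin (base E) U" "length vs = r" "\<And>v. v \<in> set vs \<Longrightarrow> local_section E U v"
    then show "continuous_fun (subtopology (base E) {p. p \<in> U}) (\<lambda>p. pure p (fr p is) (map (\<lambda>v. v p) vs))"
      using continuous_pure_frame[OF U(1) _ i(1) U(3)] tuples_length[OF i(1)] by simp
  qed (use pure_fr_in i in auto)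
  from continuous_map_compose[OF continuous_map_compose[OF this arrow_continuous[OF t]] tensor_bundle_coord[OF i(2)]]
  show ?thesis by (simp add: o_def)
qed

text \<open>The frame is redundant, so \<open>M\<close> is not determined by the arrow; but every
  continuous \<open>M\<close> gives an arrow. Continuity on total spaces thus becomes continuity of
  finitely many functions on the base.\<close>

definition mat_arrow :: "nat \<Rightarrow> nat \<Rightarrow> ('x \<Rightarrow> 'j list \<Rightarrow> 'j list \<Rightarrow> complex) \<Rightarrow> ('x, 'e) arrow" where
  "mat_arrow r s M = (\<lambda>x \<xi> ws. if x \<in> X \<and> \<xi> \<in> tensor_fibre E r x
     then \<Sum>is\<in>tuples J r. \<Sum>js\<in>tuples J s. (\<xi> (fr x is) * M x is js) * pure x (fr x js) ws else 0)"

lemma arrow_eq_mat: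
  assumes t: "t \<in> arrows E r s"
  shows "t = mat_arrow r s (\<lambda>x is js. t x (pure x (fr x is)) (fr x js))"
proof (intro ext)
  fix x \<xi> ws
  show "t x \<xi> ws = mat_arrow r s (\<lambda>x is js. t x (pure x (fr x is)) (fr x js)) x \<xi> ws"
  proof (cases "x \<in> X \<and> \<xi> \<in> tensor_fibre E r x")
    case True
    then have x: "x \<in> X" and \<xi>: "\<xi> \<in> tensor_fibre E r x" by auto
    have "t x \<xi> ws = (\<Sum>is\<in>tuples J r. \<xi> (fr x is) * t x (pure x (fr x is)) ws)"
      by (rule arrow_expand[OF t x \<xi>])
    also have "\<dots> = (\<Sum>is\<in>tuples J r. \<xi> (fr x is) *
        (\<Sum>js\<in>tuples J s. t x (pure x (fr x is)) (fr x js) * pure x (fr x js) ws))"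
      by (intro sum.cong refl arg_cong2[of _ _ _ _ "(*)"] tensor_expand_frame[OF x]
          arrow_fibre[OF t x] pure_fr_in[OF x])
    finally show ?thesis using True by (simp add: mat_arrow_def sum_distrib_left mult_ac)
  next
    case False
    then show ?thesis using arrow_zero[OF t, of x \<xi>] by (auto simp: mat_arrow_def)
  qed
qed

lemma mat_arrow_in:
  assumes M: "\<And>is js. is \<in> tuples J r \<Longrightarrow> js \<in> tuples J s \<Longrightarrow> continuous_fun (base E) (\<lambda>x. M x is js)"
  shows "mat_arrow r s M \<in> arrows E r s"
  unfolding arrows_def mem_Collect_eq
proof (intro conjI ballI allI impI)
  fix x \<xi> assume "x \<notin> X \<or> \<xi> \<notin> tensor_fibre E r x"
  then show "mat_arrow r s M x \<xi> = (\<lambda>_. 0)" by (auto simp: mat_arrow_def)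
next
  show fib: "mat_arrow r s M x \<xi> \<in> tensor_fibre E s x" if x: "x \<in> X" and \<xi>: "\<xi> \<in> tensor_fibre E r x" for x \<xi>
  proof -
    have "(\<lambda>ws. \<Sum>js\<in>tuples J s. (\<Sum>is\<in>tuples J r. \<xi> (fr x is) * M x is js) * pure x (fr x js) ws)
        \<in> tensor_fibre E s x"
      by (intro tensor_fibre_sum pure_fr_in x)
    also have "(\<lambda>ws. \<Sum>js\<in>tuples J s. (\<Sum>is\<in>tuples J r. \<xi> (fr x is) * M x is js) * pure x (fr x js) ws)
        = mat_arrow r s M x \<xi>"
      using that by (intro ext) (simp add: mat_arrow_def sum_distrib_right sum.swap[of _ "tuples J r"])
    finally show ?thesis .
  qed
  fix x \<xi> \<eta> a b assume x: "x \<in> X" and \<xi>: "\<xi> \<in> tensor_fibre E r x" and \<eta>: "\<eta> \<in> tensor_fibre E r x"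
  show "mat_arrow r s M x (\<lambda>vs. a * \<xi> vs + b * \<eta> vs) =
    (\<lambda>vs. a * mat_arrow r s M x \<xi> vs + b * mat_arrow r s M x \<eta> vs)"
    using x \<xi> \<eta> tensor_fibre_lin[OF \<xi> \<eta>, of a b]
    by (simp add: mat_arrow_def sum_distrib_left sum.distrib[symmetric] algebra_simps)
next
  have "continuous_map (tensor_bundle E r) (tensor_bundle E s) (\<lambda>p. (fst p, mat_arrow r s M (fst p) (snd p)))"
  proof (rule continuous_into_tensor_bundle[OF tensor_bundle_fst])
    fix p assume "p \<in> topspace (tensor_bundle E r)"
    then have x: "fst p \<in> X" and \<xi>: "snd p \<in> tensor_fibre E r (fst p)" by (auto simp: topspace_tensor_bundle)
    have "(\<lambda>ws. \<Sum>js\<in>tuples J s. (\<Sum>is\<in>tuples J r. snd p (fr (fst p) is) * M (fst p) is js) * pure (fst p) (fr (fst p) js) ws)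
        \<in> tensor_fibre E s (fst p)"
      by (intro tensor_fibre_sum pure_fr_in x)
    also have "(\<lambda>ws. \<Sum>js\<in>tuples J s. (\<Sum>is\<in>tuples J r. snd p (fr (fst p) is) * M (fst p) is js) * pure (fst p) (fr (fst p) js) ws)
        = mat_arrow r s M (fst p) (snd p)"
      using x \<xi> by (intro ext) (simp add: mat_arrow_def sum_distrib_right sum.swap[of _ "tuples J r"])
    finally show "mat_arrow r s M (fst p) (snd p) \<in> tensor_fibre E s (fst p)" .
  next
    fix U vs assume U: "openin (base E) U" "length vs = s" "\<And>v. v \<in> set vs \<Longrightarrow> local_section E U v"
    let ?T = "subtopology (tensor_bundle E r) {p. fst p \<in> U}"
    have f: "continuous_map ?T (subtopology (base E) U) fst"
      by (auto simp: continuous_map_in_subtopology intro: continuous_map_from_subtopology[OF tensor_bundle_fst])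
    have 1: "continuous_fun ?T (\<lambda>p. snd p (fr (fst p) is))" if "is \<in> tuples J r" for "is"
      by (rule continuous_map_from_subtopology[OF tensor_bundle_coord[OF that]])
    have 2: "continuous_fun ?T (\<lambda>p. M (fst p) is js)" if "is \<in> tuples J r" "js \<in> tuples J s" for "is" js
      using continuous_map_compose[OF continuous_map_from_subtopology[OF tensor_bundle_fst] M[OF that]]
      by (simp add: o_def)
    have 3: "continuous_fun ?T (\<lambda>p. pure (fst p) (fr (fst p) js) (map (\<lambda>v. v (fst p)) vs))" if "js \<in> tuples J s" for js
      using continuous_map_compose[OF f continuous_pure_frame[OF U(1) _ that U(3)]] tuples_length[OF that] U(2)
      by (simp add: o_def)
    have "continuous_fun ?T (\<lambda>p. \<Sum>is\<in>tuples J r. \<Sum>js\<in>tuples J s.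
        (snd p (fr (fst p) is) * M (fst p) is js) * pure (fst p) (fr (fst p) js) (map (\<lambda>v. v (fst p)) vs))"
      by (intro continuous_map_sum continuous_fun_mult finite_tuples finite_J 1 2 3)
    then show "continuous_fun ?T (\<lambda>p. mat_arrow r s M (fst p) (snd p) (map (\<lambda>v. v (fst p)) vs))"
      by (rule continuous_map_eq) (auto simp: mat_arrow_def topspace_tensor_bundle)
  qed
  then show "continuous_map (tensor_bundle E r) (tensor_bundle E s) (\<lambda>(x, \<xi>). (x, mat_arrow r s M x \<xi>))"
    by (simp add: case_prod_beta')
qed

end

section \<open>Closure of the arrows under linear operations, composition, adjoint and tensor
  product\<close>

context framed_bundle
begin

lemma arrowI_mat:
  assumes M: "\<And>is js. is \<in> tuples J r \<Longrightarrow> js \<in> tuples J s \<Longrightarrow> continuous_fun (base E) (\<lambda>x. M x is js)"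
    and z: "\<And>x \<xi>. x \<notin> X \<or> \<xi> \<notin> tensor_fibre E r x \<Longrightarrow> t x \<xi> = (\<lambda>_. 0)"
    and eq: "\<And>x \<xi> ws. x \<in> X \<Longrightarrow> \<xi> \<in> tensor_fibre E r x \<Longrightarrow> t x \<xi> ws =
      (\<Sum>is\<in>tuples J r. \<Sum>js\<in>tuples J s. (\<xi> (fr x is) * M x is js) * pure x (fr x js) ws)"
  shows "t \<in> arrows E r s"
proof -
  have "t = mat_arrow r s M"
    by (intro ext) (use z eq in \<open>auto simp: mat_arrow_def\<close>)
  then show ?thesis using mat_arrow_in[OF M] by simp
qed

lemma arrow_expand2:
  assumes t: "t \<in> arrows E r s" and "x \<in> X" and "\<xi> \<in> tensor_fibre E r x"
  shows "t x \<xi> ws = (\<Sum>is\<in>tuples J r. \<Sum>js\<in>tuples J s.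
    (\<xi> (fr x is) * t x (pure x (fr x is)) (fr x js)) * pure x (fr x js) ws)"
  using arg_cong[OF arrow_eq_mat[OF t], of "\<lambda>t. t x \<xi> ws"] assms(2,3) by (simp add: mat_arrow_def)

lemma arrow_0: "t \<in> arrows E r s \<Longrightarrow> x \<in> X \<Longrightarrow> t x (\<lambda>_. 0) = (\<lambda>_. 0)"
  using arrow_lin_sum[of t E r s x "{}" "\<lambda>_. \<lambda>_. 0" "\<lambda>_. 0"] by simp

lemma arrows_lincomb:
  assumes t: "t \<in> arrows E r s" and t': "t' \<in> arrows E r s"
  shows "(\<lambda>x \<xi> vs. a * t x \<xi> vs + b * t' x \<xi> vs) \<in> arrows E r s"
proof (rule arrowI_mat[where M = "\<lambda>x is js. a * t x (pure x (fr x is)) (fr x js) + b * t' x (pure x (fr x is)) (fr x js)"])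
  fix x \<xi> ws assume x: "x \<in> X" and \<xi>: "\<xi> \<in> tensor_fibre E r x"
  show "a * t x \<xi> ws + b * t' x \<xi> ws = (\<Sum>is\<in>tuples J r. \<Sum>js\<in>tuples J s.
    (\<xi> (fr x is) * (a * t x (pure x (fr x is)) (fr x js) + b * t' x (pure x (fr x is)) (fr x js))) *
      pure x (fr x js) ws)"
    unfolding arrow_expand2[OF t x \<xi>, of ws] arrow_expand2[OF t' x \<xi>, of ws]
    by (simp add: sum_distrib_left sum.distrib[symmetric] algebra_simps)
qed (intro continuous_map_add continuous_fun_mult continuous_arrow_coord[OF t] continuous_arrow_coord[OF t']
    continuous_map_canonical_const | use arrow_zero[OF t] arrow_zero[OF t'] in simp)+

lemma arrows_zero: "(\<lambda>x \<xi> vs. 0) \<in> arrows E r s"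
  by (rule arrowI_mat[where M = "\<lambda>_ _ _. 0"]) auto

lemma arr_id_in: "arr_id E r \<in> arrows E r r"
proof (rule arrowI_mat[where M = "\<lambda>x is js. pure x (fr x is) (fr x js)"])
  fix "is" js assume i: "is \<in> tuples J r" and j: "js \<in> tuples J r"
  have "continuous_fun (subtopology (base E) X) (\<lambda>y. pure y (fr y is) (map (\<lambda>v. v y) (map f js)))"
    by (rule continuous_pure_frame[OF _ _ i])
      (use i j section_frame in \<open>auto simp: tuples_def\<close>)
  then show "continuous_fun (base E) (\<lambda>x. pure x (fr x is) (fr x js))" by (simp add: fr_def o_def)
next
  fix x \<xi> ws assume x: "x \<in> X" and \<xi>: "\<xi> \<in> tensor_fibre E r x"
  have "\<xi> ws = (\<Sum>is\<in>tuples J r. \<xi> (fr x is) * (\<Sum>js\<in>tuples J r. pure x (fr x is) (fr x js) * pure x (fr x js) ws))"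
    by (subst tensor_expand_frame[OF x \<xi>]) (intro sum.cong refl arg_cong2[of _ _ _ _ "(*)"] tensor_expand_frame[OF x] pure_fr_in[OF x])
  then show "arr_id E r x \<xi> ws = (\<Sum>is\<in>tuples J r. \<Sum>js\<in>tuples J r.
      (\<xi> (fr x is) * pure x (fr x is) (fr x js)) * pure x (fr x js) ws)"
    using x \<xi> by (simp add: arr_id_def sum_distrib_left mult_ac)
qed (auto simp: arr_id_def)

lemma arr_id_pure: "x \<in> X \<Longrightarrow> set us \<subseteq> fibre E x \<Longrightarrow> length us = r \<Longrightarrow> arr_id E r x (pure x us) = pure x us"
  using pure_in_tensor_fibre by (simp add: arr_id_def)

lemma arr_comp_in:
  assumes t: "t \<in> arrows E r s" and t': "t' \<in> arrows E s q"
  shows "arr_comp t' t \<in> arrows E r q"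
  unfolding arrows_def mem_Collect_eq arr_comp_def
proof (intro conjI ballI allI impI)
  fix x \<xi> assume "x \<notin> X \<or> \<xi> \<notin> tensor_fibre E r x"
  then show "t' x (t x \<xi>) = (\<lambda>_. 0)"
    using arrow_zero[OF t, of x \<xi>] arrow_zero[OF t', of x "\<lambda>_. 0"] arrow_0[OF t'] by (cases "x \<in> X") auto
next
  show "x \<in> X \<Longrightarrow> \<xi> \<in> tensor_fibre E r x \<Longrightarrow> t' x (t x \<xi>) \<in> tensor_fibre E q x" for x \<xi>
    using arrow_fibre[OF t] arrow_fibre[OF t'] by blast
next
  fix x \<xi> \<eta> a b assume x: "x \<in> X" and \<xi>: "\<xi> \<in> tensor_fibre E r x" and \<eta>: "\<eta> \<in> tensor_fibre E r x"
  show "t' x (t x (\<lambda>vs. a * \<xi> vs + b * \<eta> vs)) = (\<lambda>vs. a * t' x (t x \<xi>) vs + b * t' x (t x \<eta>) vs)"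
    unfolding arrow_lin[OF t x \<xi> \<eta>] arrow_lin[OF t' x arrow_fibre[OF t x \<xi>] arrow_fibre[OF t x \<eta>]] ..
next
  show "continuous_map (tensor_bundle E r) (tensor_bundle E q) (\<lambda>(x, \<xi>). (x, t' x (t x \<xi>)))"
    using continuous_map_compose[OF arrow_continuous[OF t] arrow_continuous[OF t']]
    by (simp add: o_def case_prod_beta')
qed

lemma arr_comp_id: "t \<in> arrows E r s \<Longrightarrow> arr_comp t (arr_id E r) = t"
  "t \<in> arrows E r s \<Longrightarrow> arr_comp (arr_id E s) t = t"
proof -
  assume t: "t \<in> arrows E r s"
  show "arr_comp t (arr_id E r) = t"
  proof (intro ext)
    fix x \<xi> ws
    show "arr_comp t (arr_id E r) x \<xi> ws = t x \<xi> ws"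
      using arrow_zero[OF t, of x \<xi>] arrow_zero[OF t, of x "\<lambda>_. 0"] arrow_0[OF t, of x]
      by (cases "x \<in> X") (auto simp: arr_comp_def arr_id_def)
  qed
  show "arr_comp (arr_id E s) t = t"
  proof (intro ext)
    fix x \<xi> ws
    show "arr_comp (arr_id E s) t x \<xi> ws = t x \<xi> ws"
      using arrow_zero[OF t, of x \<xi>] arrow_fibre[OF t, of x \<xi>]
      by (cases "x \<in> X \<and> \<xi> \<in> tensor_fibre E r x") (auto simp: arr_comp_def arr_id_def)
  qed
qed

lemma arr_comp_pure:
  assumes t: "t \<in> arrows E r s" and t': "t' \<in> arrows E s q" and x: "x \<in> X"
    and us: "set us \<subseteq> fibre E x" "length us = r"
  shows "arr_comp t' t x (pure x us) ws =
    (\<Sum>js\<in>tuples J s. t x (pure x us) (fr x js) * t' x (pure x (fr x js)) ws)"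
  unfolding arr_comp_def
  by (rule arrow_expand[OF t' x arrow_fibre[OF t x pure_in_tensor_fibre[OF x us]]])

lemma cnj_pure:
  "x \<in> X \<Longrightarrow> set vs \<subseteq> fibre E x \<Longrightarrow> set ws \<subseteq> fibre E x \<Longrightarrow> cnj (pure x vs ws) = pure x ws vs"
  using pure_sym[of x vs ws] by simp

lemma arr_adj_in:
  assumes t: "t \<in> arrows E r s"
  shows "arr_adj E r s t \<in> arrows E s r"
proof (rule arrowI_mat[where M = "\<lambda>x js is. cnj (t x (pure x (fr x is)) (fr x js))"])
  fix x \<eta> ws assume x: "x \<in> X" and \<eta>: "\<eta> \<in> tensor_fibre E s x"
  show "arr_adj E r s t x \<eta> ws = (\<Sum>js\<in>tuples J s. \<Sum>is\<in>tuples J r.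
    (\<eta> (fr x js) * cnj (t x (pure x (fr x is)) (fr x js))) * pure x (fr x is) ws)"
  proof (cases "length ws = r \<and> set ws \<subseteq> fibre E x")
    case True
    then have ws: "pure x ws \<in> tensor_fibre E r x" using pure_in_tensor_fibre[OF x] by blast
    have "arr_adj E r s t x \<eta> ws = (\<Sum>js\<in>tuples J s. cnj (t x (pure x ws) (fr x js)) * \<eta> (fr x js))"
      using True x \<eta> tensor_inner_frame[OF x arrow_fibre[OF t x ws] \<eta>] by (simp add: arr_adj_def)
    also have "\<dots> = (\<Sum>js\<in>tuples J s. (\<Sum>is\<in>tuples J r. pure x (fr x is) ws * cnj (t x (pure x (fr x is)) (fr x js))) * \<eta> (fr x js))"
      unfolding arrow_expand[OF t x ws] cnj_sum complex_cnj_mult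
      using True cnj_pure[OF x _ fr_fibre[OF x], of ws] by simp
    finally show ?thesis by (simp add: sum_distrib_right sum_distrib_left mult_ac)
  next
    case False
    then have "arr_adj E r s t x \<eta> ws = 0" by (auto simp: arr_adj_def)
    moreover have "pure x (fr x is) ws = 0" if "is \<in> tuples J r" for "is"
      using False tuples_length[OF that] by (intro pure_tensor_eq_0) auto
    ultimately show ?thesis by simp
  qed
qed (intro continuous_fun_cnj continuous_arrow_coord[OF t] | auto simp: arr_adj_def)+

lemma arr_adj_pure:
  assumes t: "t \<in> arrows E r s" and x: "x \<in> X" and us: "set us \<subseteq> fibre E x" "length us = s"
    and ws: "set ws \<subseteq> fibre E x" "length ws = r"
  shows "arr_adj E r s t x (pure x us) ws = cnj (t x (pure x ws) us)"
proof -
  have w: "pure x ws \<in> tensor_fibre E r x" and u: "pure x us \<in> tensor_fibre E s x"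
    using pure_in_tensor_fibre[OF x] us ws by blast+
  have "arr_adj E r s t x (pure x us) ws = (\<Sum>js\<in>tuples J s. cnj (t x (pure x ws) (fr x js)) * pure x us (fr x js))"
    using us ws x u tensor_inner_frame[OF x arrow_fibre[OF t x w] u] by (simp add: arr_adj_def)
  also have "\<dots> = cnj (\<Sum>js\<in>tuples J s. t x (pure x ws) (fr x js) * pure x (fr x js) us)"
    unfolding cnj_sum complex_cnj_mult by (intro sum.cong refl) (simp add: cnj_pure[OF x fr_fibre[OF x] us(1)])
  also have "(\<Sum>js\<in>tuples J s. t x (pure x ws) (fr x js) * pure x (fr x js) us) = t x (pure x ws) us"
    by (rule tensor_expand_frame[OF x arrow_fibre[OF t x w], symmetric])
  finally show ?thesis .
qed

lemma arr_adj_adj: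
  assumes t: "t \<in> arrows E r s"
  shows "arr_adj E s r (arr_adj E r s t) = t"
  by (rule arrow_eqI[OF arr_adj_in[OF arr_adj_in[OF t]] t])
    (simp add: arr_adj_pure[OF arr_adj_in[OF t]] arr_adj_pure[OF t])

lemma arr_adj_id: "arr_adj E r r (arr_id E r) = arr_id E r"
  by (rule arrow_eqI[OF arr_adj_in[OF arr_id_in] arr_id_in])
    (simp add: arr_adj_pure[OF arr_id_in] arr_id_pure cnj_pure)

lemma arr_adj_comp:
  assumes t: "t \<in> arrows E r s" and t': "t' \<in> arrows E s q"
  shows "arr_adj E r q (arr_comp t' t) = arr_comp (arr_adj E r s t) (arr_adj E s q t')"
proof (rule arrow_eqI[OF arr_adj_in[OF arr_comp_in[OF t t']] arr_comp_in[OF arr_adj_in[OF t'] arr_adj_in[OF t]]])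
  fix x us ws assume *: "x \<in> X" "set us \<subseteq> fibre E x" "set ws \<subseteq> fibre E x" "length us = q" "length ws = r"
  have "arr_comp (arr_adj E r s t) (arr_adj E s q t') x (pure x us) ws =
     (\<Sum>js\<in>tuples J s. cnj (t' x (pure x (fr x js)) us) * cnj (t x (pure x ws) (fr x js)))"
    unfolding arr_comp_pure[OF arr_adj_in[OF t'] arr_adj_in[OF t] *(1,2,4)]
    by (intro sum.cong refl arg_cong2[of _ _ _ _ "(*)"] arr_adj_pure[OF t'] arr_adj_pure[OF t]
        fr_fibre[OF *(1)] *) (simp_all add: tuples_length)
  then show "arr_adj E r q (arr_comp t' t) x (pure x us) ws =
    arr_comp (arr_adj E r s t) (arr_adj E s q t') x (pure x us) ws"
    using arr_adj_pure[OF arr_comp_in[OF t t'] *(1,2,4,3,5)] arr_comp_pure[OF t t' *(1,3,5)]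
    by (simp add: mult.commute)
qed

lemma tensor_slice_left:
  assumes \<xi>: "\<xi> \<in> tensor_fibre E (r + r') x" and v: "length v = r" "set v \<subseteq> fibre E x"
  shows "(\<lambda>v'. \<xi> (v @ v')) \<in> tensor_fibre E r' x"
proof (rule tensor_fibreI)
  show "length vs = r' \<and> set vs \<subseteq> fibre E x" if "\<xi> (v @ vs) \<noteq> 0" for vs
    using tensor_fibre_supp[OF \<xi>, of "v @ vs"] that v by (metis Un_subset_iff add_left_cancel length_append set_append)
next
  fix us ws a b assume "length us + Suc (length ws) = r'" "set us \<union> set ws \<union> {a, b} \<subseteq> fibre E x"
  then show "\<xi> (v @ us @ vadd E a b # ws) = \<xi> (v @ us @ a # ws) + \<xi> (v @ us @ b # ws)"
    using tensor_fibre_add[OF \<xi>, of "v @ us" ws a b] v by simp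
next
  fix us ws a c assume "length us + Suc (length ws) = r'" "set us \<union> set ws \<union> {a} \<subseteq> fibre E x"
  then show "\<xi> (v @ us @ vscale E c a # ws) = cnj c * \<xi> (v @ us @ a # ws)"
    using tensor_fibre_scale[OF \<xi>, of "v @ us" ws a c] v by simp
qed

lemma tensor_slice_right:
  assumes \<xi>: "\<xi> \<in> tensor_fibre E (r + r') x" and v: "length v = r'" "set v \<subseteq> fibre E x"
  shows "(\<lambda>u. \<xi> (u @ v)) \<in> tensor_fibre E r x"
proof (rule tensor_fibreI)
  show "length vs = r \<and> set vs \<subseteq> fibre E x" if "\<xi> (vs @ v) \<noteq> 0" for vs
    using tensor_fibre_supp[OF \<xi>, of "vs @ v"] that v by (metis Un_subset_iff add_right_cancel length_append set_append)
next
  fix us ws a b assume "length us + Suc (length ws) = r" "set us \<union> set ws \<union> {a, b} \<subseteq> fibre E x"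
  then show "\<xi> ((us @ vadd E a b # ws) @ v) = \<xi> ((us @ a # ws) @ v) + \<xi> ((us @ b # ws) @ v)"
    using tensor_fibre_add[OF \<xi>, of us "ws @ v" a b] v by simp
next
  fix us ws a c assume "length us + Suc (length ws) = r" "set us \<union> set ws \<union> {a} \<subseteq> fibre E x"
  then show "\<xi> ((us @ vscale E c a # ws) @ v) = cnj c * \<xi> ((us @ a # ws) @ v)"
    using tensor_fibre_scale[OF \<xi>, of us "ws @ v" a c] v by simp
qed

lemma arr_tensor_zero:
  assumes t: "t \<in> arrows E r s" and "x \<notin> X \<or> \<xi> \<notin> tensor_fibre E (r + r') x"
  shows "arr_tensor E r r' s t t' x \<xi> = (\<lambda>_. 0)"
  using assms(2) arrow_zero[OF t, of x] by (auto simp: arr_tensor_def)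

lemma arr_tensor_expand:
  assumes t: "t \<in> arrows E r s" and t': "t' \<in> arrows E r' s'" and x: "x \<in> X"
    and \<xi>: "\<xi> \<in> tensor_fibre E (r + r') x"
  shows "arr_tensor E r r' s t t' x \<xi> ws = (\<Sum>is\<in>tuples J r. \<Sum>is'\<in>tuples J r'.
    \<xi> (fr x is @ fr x is') * (t x (pure x (fr x is)) (take s ws) * t' x (pure x (fr x is')) (drop s ws)))"
proof -
  have bad: "\<xi> (v @ v') = 0" if "\<not> (length v = r \<and> set v \<subseteq> fibre E x)" "length v' = r'" for v v'
    using tensor_fibre_supp[OF \<xi>, of "v @ v'"] that by auto
  have inner: "t' x (\<lambda>v'. \<xi> (v @ v')) w = (\<Sum>is'\<in>tuples J r'. t' x (pure x (fr x is')) w * \<xi> (v @ fr x is'))" for v w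
  proof (cases "length v = r \<and> set v \<subseteq> fibre E x")
    case True
    then show ?thesis
      using arrow_expand[OF t' x tensor_slice_left[OF \<xi>], of v w] by (simp add: mult.commute)
  next
    case False
    \<comment> \<open>\<open>arr_tensor\<close> also forms slices at lists \<open>v\<close> of the
      wrong kind. Such a slice is 0 on all lists of length \<open>r'\<close>, so it is either the
      zero tensor or no tensor at all, and \<open>t'\<close> returns 0 in both cases.\<close>
    have "t' x (\<lambda>v'. \<xi> (v @ v')) = (\<lambda>_. 0)"
    proof (cases "(\<lambda>v'. \<xi> (v @ v')) \<in> tensor_fibre E r' x")
      case True
      have "\<xi> (v @ v') = 0" for v' using bad[OF False, of v'] tensor_fibre_supp[OF True, of v'] by blast
      then show ?thesis using arrow_0[OF t' x] by simp
    qed (use arrow_zero[OF t'] in blast)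
    then show ?thesis using bad[OF False] by (simp add: tuples_length)
  qed
  have "arr_tensor E r r' s t t' x \<xi> ws =
      t x (\<lambda>v. \<Sum>is'\<in>tuples J r'. t' x (pure x (fr x is')) (drop s ws) * \<xi> (v @ fr x is')) (take s ws)"
    using \<xi> by (simp add: arr_tensor_def inner)
  also have "\<dots> = (\<Sum>is'\<in>tuples J r'. t' x (pure x (fr x is')) (drop s ws) * t x (\<lambda>v. \<xi> (v @ fr x is')) (take s ws))"
    using arrow_lin_sum[OF t x, of "tuples J r'" "\<lambda>is' v. \<xi> (v @ fr x is')"] tensor_slice_right[OF \<xi>] fr_fibre[OF x]
    by (simp add: tuples_length)
  also have "\<dots> = (\<Sum>is'\<in>tuples J r'. t' x (pure x (fr x is')) (drop s ws) *
      (\<Sum>is\<in>tuples J r. \<xi> (fr x is @ fr x is') * t x (pure x (fr x is)) (take s ws)))"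
    by (intro sum.cong refl arg_cong2[of _ _ _ _ "(*)"] arrow_expand[OF t x] tensor_slice_right[OF \<xi>] fr_fibre[OF x])
      (auto simp: tuples_length)
  also have "\<dots> = (\<Sum>is\<in>tuples J r. \<Sum>is'\<in>tuples J r'.
    \<xi> (fr x is @ fr x is') * (t x (pure x (fr x is)) (take s ws) * t' x (pure x (fr x is')) (drop s ws)))"
    by (simp add: sum_distrib_left sum.swap[of _ "tuples J r'"] mult_ac)
  finally show ?thesis .
qed

lemma pure_take_drop:
  "length as = s \<Longrightarrow> pure x as (take s ws) * pure x bs (drop s ws) = pure x (as @ bs) ws"
proof (cases "s \<le> length ws")
  case True
  assume "length as = s"
  then show ?thesis using True pure_tensor_append[of as "take s ws" E x bs "drop s ws"] by simp
next
  case False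
  assume "length as = s"
  then show ?thesis
    using False pure_tensor_eq_0[of as "take s ws" E x] pure_tensor_eq_0[of "as @ bs" ws E x] by simp
qed

lemma arr_tensor_in:
  assumes t: "t \<in> arrows E r s" and t': "t' \<in> arrows E r' s'"
  shows "arr_tensor E r r' s t t' \<in> arrows E (r + r') (s + s')"
proof (rule arrowI_mat[where M = "\<lambda>x is js. t x (pure x (fr x (take r is))) (fr x (take s js)) *
    t' x (pure x (fr x (drop r is))) (fr x (drop s js))"])
  fix x \<xi> ws assume x: "x \<in> X" and \<xi>: "\<xi> \<in> tensor_fibre E (r + r') x"
  have "t x (pure x (fr x is)) (take s ws) * t' x (pure x (fr x is')) (drop s ws) =
    (\<Sum>js\<in>tuples J s. \<Sum>js'\<in>tuples J s'. t x (pure x (fr x is)) (fr x js) * t' x (pure x (fr x is')) (fr x js') *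
      pure x (fr x js @ fr x js') ws)" if i: "is \<in> tuples J r" "is' \<in> tuples J r'" for "is" is'
  proof -
    have "t x (pure x (fr x is)) (take s ws) * t' x (pure x (fr x is')) (drop s ws) =
      (\<Sum>js\<in>tuples J s. t x (pure x (fr x is)) (fr x js) * pure x (fr x js) (take s ws)) *
      (\<Sum>js'\<in>tuples J s'. t' x (pure x (fr x is')) (fr x js') * pure x (fr x js') (drop s ws))"
      by (intro arg_cong2[of _ _ _ _ "(*)"] tensor_expand_frame[OF x] arrow_fibre[OF t x] arrow_fibre[OF t' x]
          pure_fr_in[OF x] i)
    also have "\<dots> = (\<Sum>js\<in>tuples J s. \<Sum>js'\<in>tuples J s'. t x (pure x (fr x is)) (fr x js) * t' x (pure x (fr x is')) (fr x js') *
      (pure x (fr x js) (take s ws) * pure x (fr x js') (drop s ws)))"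
      unfolding sum_product by (intro sum.cong refl) (simp add: mult_ac)
    finally show ?thesis by (simp add: pure_take_drop tuples_length)
  qed
  then show "arr_tensor E r r' s t t' x \<xi> ws = (\<Sum>is\<in>tuples J (r + r'). \<Sum>js\<in>tuples J (s + s').
    (\<xi> (fr x is) * (t x (pure x (fr x (take r is))) (fr x (take s js)) *
    t' x (pure x (fr x (drop r is))) (fr x (drop s js)))) * pure x (fr x js) ws)"
    unfolding arr_tensor_expand[OF t t' x \<xi>] sum_tuples_append
    by (intro sum.cong refl) (simp add: tuples_length sum_distrib_left mult_ac)
next
  fix "is" js assume "is \<in> tuples J (r + r')" "js \<in> tuples J (s + s')"
  then show "continuous_fun (base E) (\<lambda>x. t x (pure x (fr x (take r is))) (fr x (take s js)) *
    t' x (pure x (fr x (drop r is))) (fr x (drop s js)))"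
    by (intro continuous_fun_mult continuous_arrow_coord[OF t] continuous_arrow_coord[OF t'] take_drop_tuples)
qed (use arr_tensor_zero[OF t] in blast)

text \<open>Together with \<open>arrow_eqI_append\<close>, this turns identities between tensor
  products into identities between products of matrix coefficients.\<close>

lemma arr_tensor_pure:
  assumes t: "t \<in> arrows E r s" and t': "t' \<in> arrows E r' s'" and x: "x \<in> X"
    and us: "set us \<subseteq> fibre E x" "length us = r" and us': "set us' \<subseteq> fibre E x" "length us' = r'"
    and ws: "length ws = s"
  shows "arr_tensor E r r' s t t' x (pure x (us @ us')) (ws @ ws') = t x (pure x us) ws * t' x (pure x us') ws'"
proof -
  have p: "pure x (us @ us') \<in> tensor_fibre E (r + r') x"
    using us us' by (intro pure_in_tensor_fibre[OF x]) auto
  have "arr_tensor E r r' s t t' x (pure x (us @ us')) (ws @ ws') = (\<Sum>is\<in>tuples J r. \<Sum>is'\<in>tuples J r'.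
    (pure x us (fr x is) * pure x us' (fr x is')) * (t x (pure x (fr x is)) ws * t' x (pure x (fr x is')) ws'))"
    unfolding arr_tensor_expand[OF t t' x p]
    using ws us by (intro sum.cong refl) (simp add: pure_tensor_append tuples_length)
  also have "\<dots> = (\<Sum>is\<in>tuples J r. pure x us (fr x is) * t x (pure x (fr x is)) ws) *
    (\<Sum>is'\<in>tuples J r'. pure x us' (fr x is') * t' x (pure x (fr x is')) ws')"
    unfolding sum_product by (intro sum.cong refl) (simp add: mult_ac)
  also have "\<dots> = t x (pure x us) ws * t' x (pure x us') ws'"
    by (intro arg_cong2[of _ _ _ _ "(*)"] arrow_expand[OF t x, symmetric] arrow_expand[OF t' x, symmetric]
        pure_in_tensor_fibre[OF x] us us')
  finally show ?thesis .
qed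

lemma arrow_eqI_append:
  assumes t: "t \<in> arrows E (r + r') (s + s')" and t': "t' \<in> arrows E (r + r') (s + s')"
    and eq: "\<And>x us us' ws ws'. x \<in> X \<Longrightarrow> set us \<subseteq> fibre E x \<Longrightarrow> set us' \<subseteq> fibre E x \<Longrightarrow>
      set ws \<subseteq> fibre E x \<Longrightarrow> set ws' \<subseteq> fibre E x \<Longrightarrow> length us = r \<Longrightarrow> length us' = r' \<Longrightarrow>
      length ws = s \<Longrightarrow> length ws' = s' \<Longrightarrow>
      t x (pure x (us @ us')) (ws @ ws') = t' x (pure x (us @ us')) (ws @ ws')"
  shows "t = t'"
proof (rule arrow_eqI[OF t t'])
  fix x us ws assume *: "x \<in> X" "set us \<subseteq> fibre E x" "set ws \<subseteq> fibre E x" "length us = r + r'" "length ws = s + s'"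
  show "t x (pure x us) ws = t' x (pure x us) ws"
    using eq[of x "take r us" "drop r us" "take s ws" "drop s ws"] * 
    by (auto dest: in_set_takeD in_set_dropD)
qed

lemma arr_tensor_comp:
  assumes t: "t \<in> arrows E r s" and t': "t' \<in> arrows E r' s'" and w: "w \<in> arrows E s q" and w': "w' \<in> arrows E s' q'"
  shows "arr_comp (arr_tensor E s s' q w w') (arr_tensor E r r' s t t') =
    arr_tensor E r r' q (arr_comp w t) (arr_comp w' t')"
proof (rule arrow_eqI_append[OF arr_comp_in[OF arr_tensor_in[OF t t'] arr_tensor_in[OF w w']]
      arr_tensor_in[OF arr_comp_in[OF t w] arr_comp_in[OF t' w']]])
  fix x us us' ws ws' assume *: "x \<in> X" "set us \<subseteq> fibre E x" "set us' \<subseteq> fibre E x"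
      "set ws \<subseteq> fibre E x" "set ws' \<subseteq> fibre E x" "length us = r" "length us' = r'" "length ws = q" "length ws' = q'"
  have uu: "set (us @ us') \<subseteq> fibre E x" "length (us @ us') = r + r'" using * by auto
  have "arr_comp (arr_tensor E s s' q w w') (arr_tensor E r r' s t t') x (pure x (us @ us')) (ws @ ws') =
    (\<Sum>js\<in>tuples J s. \<Sum>js'\<in>tuples J s'. (t x (pure x us) (fr x js) * t' x (pure x us') (fr x js')) *
       (w x (pure x (fr x js)) ws * w' x (pure x (fr x js')) ws'))"
    unfolding arr_comp_pure[OF arr_tensor_in[OF t t'] arr_tensor_in[OF w w'] *(1) uu] sum_tuples_append
  proof (intro sum.cong refl arg_cong2[of _ _ _ _ "(*)"])
    fix js js' assume j: "js \<in> tuples J s" "js' \<in> tuples J s'"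
    show "arr_tensor E r r' s t t' x (pure x (us @ us')) (fr x (js @ js')) =
      t x (pure x us) (fr x js) * t' x (pure x us') (fr x js')"
      using arr_tensor_pure[OF t t' *(1,2,6,3,7), of "fr x js" "fr x js'"] j by (simp add: tuples_length)
    show "arr_tensor E s s' q w w' x (pure x (fr x (js @ js'))) (ws @ ws') =
      w x (pure x (fr x js)) ws * w' x (pure x (fr x js')) ws'"
      using arr_tensor_pure[OF w w' *(1) fr_fibre[OF *(1) j(1)] _ fr_fibre[OF *(1) j(2)] _ *(8)] j
      by (simp add: tuples_length)
  qed
  also have "\<dots> = arr_comp w t x (pure x us) ws * arr_comp w' t' x (pure x us') ws'"
    unfolding arr_comp_pure[OF t w *(1,2,6)] arr_comp_pure[OF t' w' *(1,3,7)] sum_product by (intro sum.cong refl) (simp add: mult_ac)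
  also have "\<dots> = arr_tensor E r r' q (arr_comp w t) (arr_comp w' t') x (pure x (us @ us')) (ws @ ws')"
    by (rule arr_tensor_pure[OF arr_comp_in[OF t w] arr_comp_in[OF t' w'] *(1,2,6,3,7,8), symmetric])
  finally show "arr_comp (arr_tensor E s s' q w w') (arr_tensor E r r' s t t') x (pure x (us @ us')) (ws @ ws') =
    arr_tensor E r r' q (arr_comp w t) (arr_comp w' t') x (pure x (us @ us')) (ws @ ws')" .
qed

lemma arr_adj_tensor:
  assumes t: "t \<in> arrows E r s" and t': "t' \<in> arrows E r' s'"
  shows "arr_adj E (r + r') (s + s') (arr_tensor E r r' s t t') =
    arr_tensor E s s' r (arr_adj E r s t) (arr_adj E r' s' t')"
proof (rule arrow_eqI_append[OF arr_adj_in[OF arr_tensor_in[OF t t']] arr_tensor_in[OF arr_adj_in[OF t] arr_adj_in[OF t']]])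
  fix x us us' ws ws' assume *: "x \<in> X" "set us \<subseteq> fibre E x" "set us' \<subseteq> fibre E x"
      "set ws \<subseteq> fibre E x" "set ws' \<subseteq> fibre E x" "length us = s" "length us' = s'" "length ws = r" "length ws' = r'"
  have "arr_adj E (r + r') (s + s') (arr_tensor E r r' s t t') x (pure x (us @ us')) (ws @ ws') =
     cnj (arr_tensor E r r' s t t' x (pure x (ws @ ws')) (us @ us'))"
    by (rule arr_adj_pure[OF arr_tensor_in[OF t t'] *(1)]) (use * in auto)
  also have "\<dots> = cnj (t x (pure x ws) us) * cnj (t' x (pure x ws') us')"
    using arr_tensor_pure[OF t t' *(1,4,8,5,9,6)] by simp
  also have "\<dots> = arr_tensor E s s' r (arr_adj E r s t) (arr_adj E r' s' t') x (pure x (us @ us')) (ws @ ws')"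
    using arr_tensor_pure[OF arr_adj_in[OF t] arr_adj_in[OF t'] *(1,2,6,3,7,8)]
      arr_adj_pure[OF t *(1,2,6,4,8)] arr_adj_pure[OF t' *(1,3,7,5,9)] by simp
  finally show "arr_adj E (r + r') (s + s') (arr_tensor E r r' s t t') x (pure x (us @ us')) (ws @ ws') =
    arr_tensor E s s' r (arr_adj E r s t) (arr_adj E r' s' t') x (pure x (us @ us')) (ws @ ws')" .
qed

lemma arr_tensor_id: "arr_tensor E r r' r (arr_id E r) (arr_id E r') = arr_id E (r + r')"
proof (rule arrow_eqI_append[OF arr_tensor_in[OF arr_id_in arr_id_in] arr_id_in])
  fix x us us' ws ws' assume *: "x \<in> X" "set us \<subseteq> fibre E x" "set us' \<subseteq> fibre E x"
      "set ws \<subseteq> fibre E x" "set ws' \<subseteq> fibre E x" "length us = r" "length us' = r'" "length ws = r" "length ws' = r'"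
  show "arr_tensor E r r' r (arr_id E r) (arr_id E r') x (pure x (us @ us')) (ws @ ws') =
    arr_id E (r + r') x (pure x (us @ us')) (ws @ ws')"
    using arr_tensor_pure[OF arr_id_in arr_id_in *(1,2,6,3,7,8)] * 
    by (simp add: arr_id_pure pure_tensor_append)
qed

lemma arr_tensor_id0:
  assumes t: "t \<in> arrows E r s"
  shows "arr_tensor E 0 r 0 (arr_id E 0) t = t"
proof -
  have "arr_tensor E 0 r 0 (arr_id E 0) t \<in> arrows E r s" using arr_tensor_in[OF arr_id_in t, of 0] by simp
  then show ?thesis
  proof (rule arrow_eqI[OF _ t])
    fix x us ws assume *: "x \<in> X" "set us \<subseteq> fibre E x" "set ws \<subseteq> fibre E x" "length us = r" "length ws = s"
    then show "arr_tensor E 0 r 0 (arr_id E 0) t x (pure x us) ws = t x (pure x us) ws"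
      using arr_tensor_pure[of "arr_id E 0" 0 0 t r s x "[]" us "[]" ws] t arr_id_in[of 0]
      by (simp add: arr_id_pure pure_tensor_Nil)
  qed
qed

end

declare One_nat_def [simp del]

section \<open>The action of unitaries on arrows\<close>

lemma unitary_arrow: "g \<in> unitaries E \<Longrightarrow> g \<in> arrows E 1 1"
  and unitary_left: "g \<in> unitaries E \<Longrightarrow> arr_comp (arr_adj E 1 1 g) g = arr_id E 1"
  and unitary_right: "g \<in> unitaries E \<Longrightarrow> arr_comp g (arr_adj E 1 1 g) = arr_id E 1"
  unfolding unitaries_def by auto

context framed_bundle
begin

lemma arr_power_in: "g \<in> arrows E 1 1 \<Longrightarrow> arr_power E g n \<in> arrows E n n"
proof (induction n)
  case (Suc n)
  then show ?case using arr_tensor_in[of "arr_power E g n" n n g 1 1] by (simp add: One_nat_def)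
qed (simp add: arr_id_in)

lemma arr_power_comp:
  assumes "g \<in> arrows E 1 1" "h \<in> arrows E 1 1"
  shows "arr_comp (arr_power E g n) (arr_power E h n) = arr_power E (arr_comp g h) n"
proof (induction n)
  case (Suc n)
  show ?case
    using arr_tensor_comp[OF arr_power_in[OF assms(2), of n] assms(2) arr_power_in[OF assms(1), of n] assms(1)] Suc
    by (simp add: One_nat_def)
qed (simp add: arr_comp_id(1)[OF arr_id_in])

lemma arr_power_id: "arr_power E (arr_id E 1) n = arr_id E n"
proof (induction n)
  case (Suc n)
  then show ?case using arr_tensor_id[of n 1] by (simp add: One_nat_def)
qed simp

lemma arr_power_adj:
  assumes "g \<in> arrows E 1 1"
  shows "arr_adj E n n (arr_power E g n) = arr_power E (arr_adj E 1 1 g) n"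
proof (induction n)
  case (Suc n)
  show ?case using arr_adj_tensor[OF arr_power_in[OF assms, of n] assms] Suc by (simp add: One_nat_def)
qed (simp add: arr_adj_id)

lemma arr_power_1: "g \<in> arrows E 1 1 \<Longrightarrow> arr_power E g 1 = g"
  using arr_tensor_id0[of g 1 1] arr_power.simps(2)[of E g 0] by (simp add: One_nat_def)

lemma arr_adj_unitary: "g \<in> unitaries E \<Longrightarrow> arr_adj E 1 1 g \<in> unitaries E"
  unfolding unitaries_def using arr_adj_in arr_adj_adj by simp

lemma arr_comp_unitary:
  assumes g: "g \<in> unitaries E" and h: "h \<in> unitaries E"
  shows "arr_comp g h \<in> unitaries E"
proof -
  note ga = unitary_arrow[OF g] and ha = unitary_arrow[OF h]
  note gs = arr_adj_in[OF ga] and hs = arr_adj_in[OF ha]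
  have adj: "arr_adj E 1 1 (arr_comp g h) = arr_comp (arr_adj E 1 1 h) (arr_adj E 1 1 g)"
    by (rule arr_adj_comp[OF ha ga])
  have "arr_comp (arr_comp (arr_adj E 1 1 h) (arr_adj E 1 1 g)) (arr_comp g h) =
      arr_comp (arr_adj E 1 1 h) (arr_comp (arr_comp (arr_adj E 1 1 g) g) h)"
    by (simp only: arr_comp_assoc)
  then have 1: "arr_comp (arr_comp (arr_adj E 1 1 h) (arr_adj E 1 1 g)) (arr_comp g h) = arr_id E 1"
    by (simp only: unitary_left[OF g] unitary_left[OF h] arr_comp_id(2)[OF ha])
  have "arr_comp (arr_comp g h) (arr_comp (arr_adj E 1 1 h) (arr_adj E 1 1 g)) =
      arr_comp g (arr_comp (arr_comp h (arr_adj E 1 1 h)) (arr_adj E 1 1 g))"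
    by (simp only: arr_comp_assoc)
  then have 2: "arr_comp (arr_comp g h) (arr_comp (arr_adj E 1 1 h) (arr_adj E 1 1 g)) = arr_id E 1"
    by (simp only: unitary_right[OF g] unitary_right[OF h] arr_comp_id(2)[OF gs])
  show ?thesis unfolding unitaries_def mem_Collect_eq adj using arr_comp_in[OF ha ga] 1 2 by blast
qed

lemma arr_id_unitary: "arr_id E 1 \<in> unitaries E"
  unfolding unitaries_def using arr_id_in arr_adj_id arr_comp_id[OF arr_id_in] by simp

lemma group_unitary: "group (unitary_group E)"
proof (rule groupI)
  fix g assume "g \<in> carrier (unitary_group E)"
  then have g: "g \<in> unitaries E" by (simp add: unitary_group_def)
  show "\<exists>h\<in>carrier (unitary_group E). h \<otimes>\<^bsub>unitary_group E\<^esub> g = \<one>\<^bsub>unitary_group E\<^esub>"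
    using arr_adj_unitary[OF g] unitary_left[OF g] by (auto simp: unitary_group_def)
  show "\<one>\<^bsub>unitary_group E\<^esub> \<otimes>\<^bsub>unitary_group E\<^esub> g = g"
    using arr_comp_id(2)[OF unitary_arrow[OF g]] by (simp add: unitary_group_def)
qed (simp_all add: unitary_group_def arr_id_unitary arr_comp_unitary arr_comp_assoc)

lemma arr_power_unitary:
  assumes g: "g \<in> unitaries E"
  shows "arr_comp (arr_power E (arr_adj E 1 1 g) n) (arr_power E g n) = arr_id E n"
    and "arr_comp (arr_power E g n) (arr_power E (arr_adj E 1 1 g) n) = arr_id E n"
  using arr_power_comp[OF arr_adj_in[OF unitary_arrow[OF g]] unitary_arrow[OF g], of n]
    arr_power_comp[OF unitary_arrow[OF g] arr_adj_in[OF unitary_arrow[OF g]], of n]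
    unitary_left[OF g] unitary_right[OF g] arr_power_id[of n] by simp_all

lemma arr_comp_lincomb:
  assumes P: "P \<in> arrows E s q" and t: "t \<in> arrows E r s" and t': "t' \<in> arrows E r s"
  shows "arr_comp P (\<lambda>x \<xi> vs. a * t x \<xi> vs + b * t' x \<xi> vs) =
    (\<lambda>x \<xi> vs. a * arr_comp P t x \<xi> vs + b * arr_comp P t' x \<xi> vs)"
proof (intro ext)
  fix x \<xi> vs
  show "arr_comp P (\<lambda>x \<xi> vs. a * t x \<xi> vs + b * t' x \<xi> vs) x \<xi> vs =
    a * arr_comp P t x \<xi> vs + b * arr_comp P t' x \<xi> vs"
  proof (cases "x \<in> X \<and> \<xi> \<in> tensor_fibre E r x")
    case True
    then show ?thesis
      using arrow_lin[OF P _ arrow_fibre[OF t] arrow_fibre[OF t'], of x \<xi> \<xi> a b] by (simp add: arr_comp_def)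
  next
    case False
    then have "t x \<xi> = (\<lambda>_. 0)" "t' x \<xi> = (\<lambda>_. 0)" using arrow_zero[OF t] arrow_zero[OF t'] by auto
    moreover have "P x (\<lambda>_. 0) = (\<lambda>_. 0)" using arrow_0[OF P] arrow_zero[OF P] by blast
    ultimately show ?thesis by (simp add: arr_comp_def)
  qed
qed

lemma arr_act_in:
  assumes g: "g \<in> arrows E 1 1" and t: "t \<in> arrows E r s"
  shows "arr_act E r s g t \<in> arrows E r s"
  unfolding arr_act_def
  by (rule arr_comp_in[OF arr_comp_in[OF arr_power_in[OF arr_adj_in[OF g]] t] arr_power_in[OF g]])

lemma arr_act_lincomb:
  assumes g: "g \<in> arrows E 1 1" and t: "t \<in> arrows E r s" and t': "t' \<in> arrows E r s"
  shows "arr_act E r s g (\<lambda>x \<xi> vs. a * t x \<xi> vs + b * t' x \<xi> vs) =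
    (\<lambda>x \<xi> vs. a * arr_act E r s g t x \<xi> vs + b * arr_act E r s g t' x \<xi> vs)"
proof -
  have "arr_comp (\<lambda>x \<xi> vs. a * t x \<xi> vs + b * t' x \<xi> vs) P =
    (\<lambda>x \<xi> vs. a * arr_comp t P x \<xi> vs + b * arr_comp t' P x \<xi> vs)" for P
    by (simp add: arr_comp_def)
  then show ?thesis
    unfolding arr_act_def
    using arr_comp_lincomb[OF arr_power_in[OF g] arr_comp_in[OF arr_power_in[OF arr_adj_in[OF g]] t]
        arr_comp_in[OF arr_power_in[OF arr_adj_in[OF g]] t']] by simp
qed

lemma arr_act_comp:
  assumes g: "g \<in> unitaries E" and t: "t \<in> arrows E r s" and t': "t' \<in> arrows E s q"
  shows "arr_act E r q g (arr_comp t' t) = arr_comp (arr_act E s q g t') (arr_act E r s g t)"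
proof -
  have "arr_comp (arr_act E s q g t') (arr_act E r s g t) = arr_comp (arr_power E g q) (arr_comp t'
    (arr_comp (arr_comp (arr_power E (arr_adj E 1 1 g) s) (arr_power E g s)) (arr_comp t (arr_power E (arr_adj E 1 1 g) r))))"
    unfolding arr_act_def by (simp only: arr_comp_assoc)
  also have "\<dots> = arr_comp (arr_power E g q) (arr_comp t' (arr_comp t (arr_power E (arr_adj E 1 1 g) r)))"
    unfolding arr_power_unitary[OF g]
    using arr_comp_id(2)[OF arr_comp_in[OF arr_power_in[OF arr_adj_in[OF unitary_arrow[OF g]]] t]] by simp
  finally show ?thesis unfolding arr_act_def by (simp only: arr_comp_assoc)
qed

lemma arr_act_adj:
  assumes g: "g \<in> arrows E 1 1" and t: "t \<in> arrows E r s"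
  shows "arr_act E s r g (arr_adj E r s t) = arr_adj E r s (arr_act E r s g t)"
proof -
  note P = arr_power_in[OF g] and Q = arr_power_in[OF arr_adj_in[OF g]]
  have Qa: "arr_adj E n n (arr_power E (arr_adj E 1 1 g) n) = arr_power E g n" for n
    using arr_power_adj[OF arr_adj_in[OF g], of n] arr_adj_adj[OF g] by simp
  show ?thesis
    unfolding arr_act_def
    by (simp add: arr_adj_comp[OF arr_comp_in[OF Q t] P] arr_adj_comp[OF Q t] Qa arr_power_adj[OF g] arr_comp_assoc)
qed

text \<open>On the added factor the action produces \<open>g\<close> times its adjoint, which
  unitarity makes the identity. This is what lets the action pass to the inductive limits.\<close>

lemma arr_act_tensor:
  assumes g: "g \<in> unitaries E" and t: "t \<in> arrows E r s"
  shows "arr_act E (r + 1) (s + 1) g (arr_tensor E r 1 s t (arr_id E 1)) =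
    arr_tensor E r 1 s (arr_act E r s g t) (arr_id E 1)"
proof -
  note ga = unitary_arrow[OF g] and gs = arr_adj_in[OF unitary_arrow[OF g]]
  note P = arr_power_in[OF ga] and Q = arr_power_in[OF gs]
  have "arr_act E (r + 1) (s + 1) g (arr_tensor E r 1 s t (arr_id E 1)) =
    arr_comp (arr_tensor E s 1 s (arr_power E g s) g) (arr_comp (arr_tensor E r 1 s t (arr_id E 1))
      (arr_tensor E r 1 r (arr_power E (arr_adj E 1 1 g) r) (arr_adj E 1 1 g)))"
    by (simp only: arr_act_def arr_power.simps Suc_eq_plus1[symmetric])
  also have "\<dots> = arr_tensor E r 1 s (arr_act E r s g t) (arr_comp g (arr_comp (arr_id E 1) (arr_adj E 1 1 g)))"
    unfolding arr_tensor_comp[OF Q gs t arr_id_in]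
      arr_tensor_comp[OF arr_comp_in[OF Q t] arr_comp_in[OF gs arr_id_in] P ga] arr_act_def ..
  also have "arr_comp g (arr_comp (arr_id E 1) (arr_adj E 1 1 g)) = arr_id E 1"
    unfolding arr_comp_id(2)[OF gs] by (rule unitary_right[OF g])
  finally show ?thesis .
qed

lemma arr_act_mult:
  assumes g: "g \<in> arrows E 1 1" and h: "h \<in> arrows E 1 1"
  shows "arr_act E r s (arr_comp g h) t = arr_act E r s g (arr_act E r s h t)"
  unfolding arr_act_def arr_adj_comp[OF h g] arr_power_comp[OF g h, symmetric]
    arr_power_comp[OF arr_adj_in[OF h] arr_adj_in[OF g], symmetric] by (simp only: arr_comp_assoc)

lemma arr_act_id: "t \<in> arrows E r s \<Longrightarrow> arr_act E r s (arr_id E 1) t = t"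
  by (simp add: arr_act_def arr_adj_id arr_power_id arr_comp_id)

lemma arr_act_scalar: "t \<in> arrows E 0 0 \<Longrightarrow> arr_act E 0 0 g t = t"
  by (simp add: arr_act_def arr_comp_id)

lemma arr_act_vector: "g \<in> arrows E 1 1 \<Longrightarrow> t \<in> arrows E 0 1 \<Longrightarrow> arr_act E 0 1 g t = arr_comp g t"
  using arr_power_1[of g] by (simp add: arr_act_def arr_comp_id)

section \<open>Norms of arrows\<close>

lemma tensor_norm_frame:
  assumes "x \<in> X" "\<xi> \<in> tensor_fibre E r x"
  shows "tensor_norm E r x \<xi> = sqrt (\<Sum>is\<in>tuples J r. (cmod (\<xi> (fr x is)))\<^sup>2)"
proof -
  have "Re (cnj z * z) = (cmod z)\<^sup>2" for z by (metis Re_complex_of_real complex_norm_square mult.commute)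
  then show ?thesis unfolding tensor_norm_def tensor_inner_frame[OF assms assms(2)] by simp
qed

lemma tensor_norm_coord_le:
  assumes "x \<in> X" "\<xi> \<in> tensor_fibre E r x" "is \<in> tuples J r"
  shows "cmod (\<xi> (fr x is)) \<le> tensor_norm E r x \<xi>"
  unfolding tensor_norm_frame[OF assms(1,2)]
  by (intro real_le_rsqrt member_le_sum[of "is" _ "\<lambda>is. (cmod (\<xi> (fr x is)))\<^sup>2"])
    (use assms(3) finite_tuples[OF finite_J] in auto)

lemma bounded_continuous_fun:
  fixes g :: "'x \<Rightarrow> real"
  assumes "continuous_fun (base E) g"
  shows "\<exists>K. \<forall>x\<in>X. g x \<le> K"
proof -
  have "compactin euclidean (g ` X)"
    using image_compactin[OF _ assms] compact_base unfolding compact_space_def by blast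
  then have "bounded (g ` X)" using compact_imp_bounded by auto
  then show ?thesis by (metis bounded_has_Sup(1) image_eqI empty_iff image_is_empty)
qed

text \<open>Needed for the supremum in \<open>arr_norm\<close> to be a genuine one. The matrix
  coefficients are continuous on a compact space, and the frame coordinates of a tensor of norm at
  most 1 are bounded by 1.\<close>

lemma arrow_bounded:
  assumes t: "t \<in> arrows E r s"
  shows "\<exists>K. \<forall>x\<in>X. \<forall>\<xi>\<in>tensor_fibre E r x. tensor_norm E r x \<xi> \<le> 1 \<longrightarrow> tensor_norm E s x (t x \<xi>) \<le> K"
proof -
  have "continuous_fun (base E) (\<lambda>x. \<Sum>js\<in>tuples J s. \<Sum>is\<in>tuples J r. cmod (t x (pure x (fr x is)) (fr x js)))"
    by (intro continuous_map_sum continuous_map_norm finite_tuples finite_J continuous_arrow_coord[OF t])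
  from bounded_continuous_fun[OF this] obtain K where
    K: "\<forall>x\<in>X. (\<Sum>js\<in>tuples J s. \<Sum>is\<in>tuples J r. cmod (t x (pure x (fr x is)) (fr x js))) \<le> K" by blast
  show ?thesis
  proof (intro exI[of _ K] ballI impI)
    fix x \<xi> assume x: "x \<in> X" and \<xi>: "\<xi> \<in> tensor_fibre E r x" and n: "tensor_norm E r x \<xi> \<le> 1"
    have "tensor_norm E s x (t x \<xi>) = sqrt (\<Sum>js\<in>tuples J s. (cmod (t x \<xi> (fr x js)))\<^sup>2)"
      by (rule tensor_norm_frame[OF x arrow_fibre[OF t x \<xi>]])
    also have "\<dots> \<le> (\<Sum>js\<in>tuples J s. cmod (t x \<xi> (fr x js)))"
      using L2_set_le_sum[of "tuples J s" "\<lambda>js. cmod (t x \<xi> (fr x js))"] by (simp add: L2_set_def)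
    also have "\<dots> \<le> (\<Sum>js\<in>tuples J s. \<Sum>is\<in>tuples J r. cmod (t x (pure x (fr x is)) (fr x js)))"
    proof (rule sum_mono)
      fix js
      have "cmod (t x \<xi> (fr x js)) \<le> (\<Sum>is\<in>tuples J r. cmod (\<xi> (fr x is)) * cmod (t x (pure x (fr x is)) (fr x js)))"
        unfolding arrow_expand[OF t x \<xi>] norm_mult[symmetric] by (rule norm_sum)
      also have "\<dots> \<le> (\<Sum>is\<in>tuples J r. 1 * cmod (t x (pure x (fr x is)) (fr x js)))"
        using order_trans[OF tensor_norm_coord_le[OF x \<xi>] n] by (intro sum_mono mult_right_mono) auto
      finally show "cmod (t x \<xi> (fr x js)) \<le> (\<Sum>is\<in>tuples J r. cmod (t x (pure x (fr x is)) (fr x js)))" by simp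
    qed
    also have "\<dots> \<le> K" using K x by blast
    finally show "tensor_norm E s x (t x \<xi>) \<le> K" .
  qed
qed

abbreviation norm_set :: "nat \<Rightarrow> nat \<Rightarrow> ('x, 'e) arrow \<Rightarrow> real set" where
  "norm_set r s t \<equiv> insert 0 {tensor_norm E s x (t x \<xi>) | x \<xi>.
     x \<in> X \<and> \<xi> \<in> tensor_fibre E r x \<and> tensor_norm E r x \<xi> \<le> 1}"

lemma norm_set_bdd: "t \<in> arrows E r s \<Longrightarrow> bdd_above (norm_set r s t)"
proof -
  assume "t \<in> arrows E r s"
  from arrow_bounded[OF this] obtain K where
    "\<forall>x\<in>X. \<forall>\<xi>\<in>tensor_fibre E r x. tensor_norm E r x \<xi> \<le> 1 \<longrightarrow> tensor_norm E s x (t x \<xi>) \<le> K" by blast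
  then show ?thesis by (intro bdd_aboveI[of _ "max 0 K"]) (auto simp: le_max_iff_disj)
qed

lemma tensor_norm_le_arr_norm:
  assumes "t \<in> arrows E r s" "x \<in> X" "\<xi> \<in> tensor_fibre E r x" "tensor_norm E r x \<xi> \<le> 1"
  shows "tensor_norm E s x (t x \<xi>) \<le> arr_norm E r s t"
  unfolding arr_norm_def by (rule cSup_upper[OF _ norm_set_bdd[OF assms(1)]]) (use assms in blast)

lemma arr_norm_eq_0:
  assumes t: "t \<in> arrows E r s" and n: "arr_norm E r s t = 0"
  shows "t = (\<lambda>_ _ _. 0)"
proof (rule arrow_eqI[OF t arrows_zero])
  fix x us ws assume *: "x \<in> X" "set us \<subseteq> fibre E x" "set ws \<subseteq> fibre E x" "length us = r" "length ws = s"
  define \<xi> where "\<xi> = pure x us"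
  have \<xi>: "\<xi> \<in> tensor_fibre E r x" using pure_in_tensor_fibre[OF *(1,2,4)] by (simp add: \<xi>_def)
  \<comment> \<open>Scales the pure tensor into the unit ball; the summand 1 keeps the denominator
    positive for the zero tensor.\<close>
  define c where "c = 1 / (1 + tensor_norm E r x \<xi>)"
  have tn: "0 \<le> tensor_norm E r x \<xi>" unfolding tensor_norm_frame[OF *(1) \<xi>] by (simp add: sum_nonneg)
  then have c: "c > 0" by (simp add: c_def)
  define \<eta> where "\<eta> = (\<lambda>vs. complex_of_real c * \<xi> vs + 0 * \<xi> vs)"
  have \<eta>: "\<eta> \<in> tensor_fibre E r x" unfolding \<eta>_def by (rule tensor_fibre_lin[OF \<xi> \<xi>])
  have "tensor_norm E r x \<eta> = c * tensor_norm E r x \<xi>"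
    unfolding tensor_norm_frame[OF *(1) \<xi>] tensor_norm_frame[OF *(1) \<eta>] using c
    by (simp add: \<eta>_def norm_mult power_mult_distrib sum_distrib_left[symmetric] real_sqrt_mult)
  then have "tensor_norm E r x \<eta> \<le> 1" using tn by (simp add: c_def)
  from tensor_norm_le_arr_norm[OF t *(1) \<eta> this] have le: "tensor_norm E s x (t x \<eta>) \<le> 0" using n by simp
  have t\<eta>: "t x \<eta> \<in> tensor_fibre E s x" by (rule arrow_fibre[OF t *(1) \<eta>])
  have "t x \<eta> (fr x js) = 0" if "js \<in> tuples J s" for js
    using order_trans[OF tensor_norm_coord_le[OF *(1) t\<eta> that] le] by simp
  then have "t x \<eta> ws = 0" unfolding tensor_expand_frame[OF *(1) t\<eta>, of ws] by simp
  then have "c * t x \<xi> ws = 0" using arrow_lin[OF t *(1) \<xi> \<xi>, of c 0] unfolding \<eta>_def by simp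
  then show "t x (pure x us) ws = 0" using c by (simp add: \<xi>_def)
qed

section \<open>Functions on the base as arrows\<close>

definition value0 :: "('x, 'e) arrow \<Rightarrow> 'x \<Rightarrow> complex" where
  "value0 t x = t x (pure x []) []"

definition scalar :: "nat \<Rightarrow> ('x \<Rightarrow> complex) \<Rightarrow> ('x, 'e) arrow" where
  "scalar n g = (\<lambda>x \<xi> ws. g x * arr_id E n x \<xi> ws)"

lemma scalar_in:
  assumes "continuous_fun (base E) g"
  shows "scalar n g \<in> arrows E n n"
proof (rule arrowI_mat[where M = "\<lambda>x is js. g x * arr_id E n x (pure x (fr x is)) (fr x js)"])
  fix x \<xi> ws assume x: "x \<in> X" and \<xi>: "\<xi> \<in> tensor_fibre E n x"
  show "scalar n g x \<xi> ws = (\<Sum>is\<in>tuples J n. \<Sum>js\<in>tuples J n.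
    (\<xi> (fr x is) * (g x * arr_id E n x (pure x (fr x is)) (fr x js))) * pure x (fr x js) ws)"
    unfolding scalar_def arrow_expand2[OF arr_id_in x \<xi>, of ws] sum_distrib_left
    by (intro sum.cong refl) (simp add: mult_ac)
qed (intro continuous_fun_mult assms continuous_arrow_coord[OF arr_id_in] | auto simp: scalar_def arr_id_def)+

lemma value0_scalar: "x \<in> X \<Longrightarrow> value0 (scalar 0 g) x = g x"
  unfolding value0_def scalar_def by (simp add: arr_id_pure pure_tensor_Nil)

lemma continuous_value0: "t \<in> arrows E 0 0 \<Longrightarrow> continuous_fun (base E) (value0 t)"
  using continuous_arrow_coord[of t 0 0 "[]" "[]"] by (simp add: value0_def[abs_def])

lemma scalar_value0:
  assumes t: "t \<in> arrows E 0 0"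
  shows "scalar 0 (value0 t) = t"
  by (rule arrow_eqI[OF scalar_in[OF continuous_value0[OF t]] t])
    (simp add: scalar_def arr_id_pure pure_tensor_Nil value0_def)

lemma scalar_cong: "(\<And>x. x \<in> X \<Longrightarrow> g x = h x) \<Longrightarrow> scalar n g = scalar n h"
  unfolding scalar_def arr_id_def by (intro ext) auto

lemma scalar_tensor:
  assumes g: "continuous_fun (base E) g"
  shows "arr_tensor E n 1 n (scalar n g) (arr_id E 1) = scalar (n + 1) g"
proof (rule arrow_eqI_append[OF arr_tensor_in[OF scalar_in[OF g] arr_id_in] scalar_in[OF g]])
  fix x us us' ws ws' assume *: "x \<in> X" "set us \<subseteq> fibre E x" "set us' \<subseteq> fibre E x"
      "set ws \<subseteq> fibre E x" "set ws' \<subseteq> fibre E x" "length us = n" "length us' = 1" "length ws = n" "length ws' = 1"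
  show "arr_tensor E n 1 n (scalar n g) (arr_id E 1) x (pure x (us @ us')) (ws @ ws') =
    scalar (n + 1) g x (pure x (us @ us')) (ws @ ws')"
    using arr_tensor_pure[OF scalar_in[OF g] arr_id_in *(1,2,6,3,7,8)] *
    by (simp add: scalar_def arr_id_pure pure_tensor_append)
qed

lemma scalar_comp_left: "t \<in> arrows E r s \<Longrightarrow> arr_comp (scalar s g) t = (\<lambda>x \<xi> ws. g x * t x \<xi> ws)"
  using arr_comp_id(2)[of t r s] unfolding arr_comp_def scalar_def by (metis (full_types))

lemma scalar_comp_right:
  assumes t: "t \<in> arrows E r s"
  shows "arr_comp t (scalar r g) = (\<lambda>x \<xi> ws. g x * t x \<xi> ws)"
proof (intro ext)
  fix x \<xi> ws
  show "arr_comp t (scalar r g) x \<xi> ws = g x * t x \<xi> ws"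
  proof (cases "x \<in> X \<and> \<xi> \<in> tensor_fibre E r x")
    case True
    then show ?thesis using arrow_lin[OF t, of x \<xi> \<xi> "g x" 0]
      by (simp add: arr_comp_def scalar_def arr_id_def)
  next
    case False
    then have "arr_id E r x \<xi> = (\<lambda>_. 0)" by (auto simp: arr_id_def)
    moreover have "t x (\<lambda>_. 0) = (\<lambda>_. 0)" using arrow_0[OF t] arrow_zero[OF t] by blast
    moreover have "t x \<xi> = (\<lambda>_. 0)" using False arrow_zero[OF t] by blast
    ultimately show ?thesis by (simp add: arr_comp_def scalar_def)
  qed
qed

lemma tensor_norm_0: "x \<in> X \<Longrightarrow> \<xi> \<in> tensor_fibre E 0 x \<Longrightarrow> tensor_norm E 0 x \<xi> = cmod (\<xi> [])"
  by (simp add: tensor_norm_frame)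

lemma arr_norm_scalar_le:
  assumes t: "t \<in> arrows E 0 0" and C: "0 \<le> C" "\<And>x. x \<in> X \<Longrightarrow> cmod (value0 t x) \<le> C"
  shows "arr_norm E 0 0 t \<le> C"
  unfolding arr_norm_def
proof (rule cSup_least)
  fix a assume "a \<in> norm_set 0 0 t"
  then consider "a = 0" | x \<xi> where "a = tensor_norm E 0 x (t x \<xi>)" "x \<in> X" "\<xi> \<in> tensor_fibre E 0 x"
    "tensor_norm E 0 x \<xi> \<le> 1" by blast
  then show "a \<le> C"
  proof cases
    case 2
    have "t x \<xi> [] = \<xi> [] * value0 t x"
      using arrow_expand[OF t 2(2,3), of "[]"] by (simp add: value0_def)
    then have "a = cmod (\<xi> []) * cmod (value0 t x)"
      using 2 tensor_norm_0[OF 2(2) arrow_fibre[OF t 2(2,3)]] by (simp add: norm_mult)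
    also have "\<dots> \<le> 1 * C" using 2 tensor_norm_0[OF 2(2,3)] C by (intro mult_mono) auto
    finally show ?thesis by simp
  qed (use C in simp)
qed simp

lemma value0_le_arr_norm:
  assumes t: "t \<in> arrows E 0 0" and x: "x \<in> X"
  shows "cmod (value0 t x) \<le> arr_norm E 0 0 t"
proof -
  have p: "pure x [] \<in> tensor_fibre E 0 x" using pure_in_tensor_fibre[OF x, of "[]" 0] by simp
  have "tensor_norm E 0 x (t x (pure x [])) \<le> arr_norm E 0 0 t"
    by (rule tensor_norm_le_arr_norm[OF t x p]) (simp add: tensor_norm_0[OF x p] pure_tensor_Nil)
  then show ?thesis using tensor_norm_0[OF x arrow_fibre[OF t x p]] by (simp add: value0_def)
qed

end

section \<open>Restriction to a fibre\<close>

lemma restrict_bundle_simps [simp]: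
  "base (restrict_bundle E x) = subtopology (base E) {x}"
  "total_space (restrict_bundle E x) = subtopology (total_space E) {v. proj E v = x}"
  "proj (restrict_bundle E x) = proj E" "vadd (restrict_bundle E x) = vadd E"
  "vscale (restrict_bundle E x) = vscale E" "herm (restrict_bundle E x) = herm E"
  by (simp_all add: restrict_bundle_def)

lemma fibre_restrict [simp]: "fibre (restrict_bundle E x) x = fibre E x"
  by (auto simp: fibre_def)

lemma tensor_fibre_restrict [simp]: "tensor_fibre (restrict_bundle E x) r x = tensor_fibre E r x"
  by (simp add: tensor_fibre_def)

lemma pure_tensor_restrict [simp]: "pure_tensor (restrict_bundle E x) x = pure_tensor E x"
  by (simp add: pure_tensor_def fun_eq_iff)

lemma orthonormal_basis_restrict [simp]:
  "orthonormal_basis (restrict_bundle E x) x = orthonormal_basis E x"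
  by (simp add: orthonormal_basis_def fun_eq_iff)

lemma tensor_inner_restrict [simp]: "tensor_inner (restrict_bundle E x) r x = tensor_inner E r x"
  by (simp add: tensor_inner_def fun_eq_iff)

lemma tensor_norm_restrict [simp]: "tensor_norm (restrict_bundle E x) r x = tensor_norm E r x"
  by (simp add: tensor_norm_def fun_eq_iff)

lemma point_arrow_simps [simp]: "point_arrow x u x = u" "y \<noteq> x \<Longrightarrow> point_arrow x u y = (\<lambda>_ _. 0)"
  by (simp_all add: point_arrow_def)

lemma point_arrow_comp:
  "arr_comp (point_arrow x (t' x)) (point_arrow x (t x)) = point_arrow x (arr_comp t' t x)"
  by (simp add: arr_comp_def point_arrow_def fun_eq_iff)

lemma point_arrow_eqD: "point_arrow x u = point_arrow x v \<Longrightarrow> u = v"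
  by (metis point_arrow_simps(1))

context framed_bundle
begin

lemma continuous_fun_singleton:
  assumes "topspace T \<subseteq> {x}"
  shows "continuous_fun T g"
  by (rule continuous_map_eq[where f = "\<lambda>_. g x"]) (use assms in auto)

lemma framed_bundle_restrict:
  assumes x: "x \<in> X"
  shows "framed_bundle (restrict_bundle E x) J f d"
proof
  show "compact_space (base (restrict_bundle E x))"
    using x by (simp add: compact_space_subtopology)
  show "2 \<le> d" "finite J" by (fact rank finite_J)+
next
  fix y v w c assume "y \<in> topspace (base (restrict_bundle E x))" and v: "v \<in> fibre (restrict_bundle E x) y"
  then have y: "y = x" by simp
  show "vscale (restrict_bundle E x) c v \<in> fibre (restrict_bundle E x) y"
    using vscale_fibre[OF x] v by (simp add: y)
  show "0 \<le> Re (herm (restrict_bundle E x) v v)" using herm_nonneg[OF x] v by (simp add: y)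
  assume w: "w \<in> fibre (restrict_bundle E x) y"
  show "vadd (restrict_bundle E x) v w \<in> fibre (restrict_bundle E x) y"
    using vadd_fibre[OF x] v w by (simp add: y)
  show "herm (restrict_bundle E x) v (vscale (restrict_bundle E x) c w) = c * herm (restrict_bundle E x) v w"
    using herm_vscale[OF x] v w by (simp add: y)
  show "herm (restrict_bundle E x) w v = cnj (herm (restrict_bundle E x) v w)"
    using herm_sym[OF x, of v w] v w by (simp add: y)
  show "herm (restrict_bundle E x) v w =
    (\<Sum>j\<in>J. herm (restrict_bundle E x) v (f j y) * herm (restrict_bundle E x) (f j y) w)"
    using parseval[OF x, of v w] v w by (simp add: y)
  show "herm (restrict_bundle E x) u (vadd (restrict_bundle E x) v w) =
      herm (restrict_bundle E x) u v + herm (restrict_bundle E x) u w"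
    if "u \<in> fibre (restrict_bundle E x) y" for u
    using herm_vadd[OF x] v w that by (simp add: y)
  show "v = w" if "\<And>u. u \<in> fibre (restrict_bundle E x) y \<Longrightarrow>
      herm (restrict_bundle E x) u v = herm (restrict_bundle E x) u w"
    by (rule fibre_eqI[OF x]) (use v w that in \<open>simp_all add: y\<close>)
next
  fix y assume "y \<in> topspace (base (restrict_bundle E x))"
  then have y: "y = x" by simp
  show "\<exists>B. orthonormal_basis (restrict_bundle E x) y B" using ex_orthonormal_basis[OF x] by (simp add: y)
  show "(\<Sum>j\<in>J. herm (restrict_bundle E x) (f j y) (f j y)) = of_nat d" using trace_frame[OF x] by (simp add: y)
next
  fix U s t
  show "continuous_fun (subtopology (base (restrict_bundle E x)) U) (\<lambda>y. herm (restrict_bundle E x) (s y) (t y))"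
    by (rule continuous_fun_singleton[of _ x]) auto
next
  fix j assume "j \<in> J"
  then have fj: "f j x \<in> fibre E x" by (rule frame_fibre[OF x])
  have "continuous_map (subtopology (base E) {x}) (subtopology (total_space E) {v. proj E v = x}) (f j)"
    by (rule continuous_map_eq[where f = "\<lambda>_. f j x"]) (use fj in \<open>auto simp: fibre_def\<close>)
  then show "local_section (restrict_bundle E x) (topspace (base (restrict_bundle E x))) (f j)"
    using fj x by (simp add: local_section_def fibre_def subtopology_subtopology)
qed

text \<open>Over a single point continuity imposes nothing, so the matrix of \<open>t\<close> at
  \<open>x\<close>, taken as constant, defines an arrow.\<close>

lemma point_arrow_in:
  assumes x: "x \<in> X" and t: "t \<in> arrows E r s"
  shows "point_arrow x (t x) \<in> arrows (restrict_bundle E x) r s"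
proof -
  interpret R: framed_bundle "restrict_bundle E x" J f d by (rule framed_bundle_restrict[OF x])
  show ?thesis
  proof (rule R.arrowI_mat[where M = "\<lambda>y is js. t x (pure x (fr x is)) (fr x js)"])
    fix y \<xi> assume *: "y \<notin> topspace (base (restrict_bundle E x)) \<or> \<xi> \<notin> tensor_fibre (restrict_bundle E x) r y"
    show "point_arrow x (t x) y \<xi> = (\<lambda>_. 0)"
      using * x arrow_zero[OF t, of x \<xi>] by (cases "y = x") auto
  next
    fix y \<xi> ws assume y: "y \<in> topspace (base (restrict_bundle E x))" and \<xi>: "\<xi> \<in> tensor_fibre (restrict_bundle E x) r y"
    then have "y = x" by simp
    with \<xi> show "point_arrow x (t x) y \<xi> ws = (\<Sum>is\<in>tuples J r. \<Sum>js\<in>tuples J s.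
      \<xi> (fr y is) * t x (pure x (fr x is)) (fr x js) * pure_tensor (restrict_bundle E x) y (fr y js) ws)"
      using arrow_expand2[OF t x, of \<xi> ws] by simp
  qed simp
qed

lemma point_arrow_id: "x \<in> X \<Longrightarrow> arr_id (restrict_bundle E x) r = point_arrow x (arr_id E r x)"
  by (auto simp: arr_id_def point_arrow_def fun_eq_iff)

lemma point_arrow_adj:
  "x \<in> X \<Longrightarrow> arr_adj (restrict_bundle E x) r s (point_arrow x (t x)) = point_arrow x (arr_adj E r s t x)"
  by (auto simp: arr_adj_def point_arrow_def fun_eq_iff)

lemma point_arrow_tensor:
  "arr_tensor (restrict_bundle E x) r r' s (point_arrow x (t x)) (point_arrow x (t' x)) =
    point_arrow x (arr_tensor E r r' s t t' x)"
proof (intro ext)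
  fix y \<xi> ws
  show "arr_tensor (restrict_bundle E x) r r' s (point_arrow x (t x)) (point_arrow x (t' x)) y \<xi> ws =
    point_arrow x (arr_tensor E r r' s t t' x) y \<xi> ws"
    by (cases "y = x") (auto simp: arr_tensor_def)
qed

lemma point_arrow_power:
  "x \<in> X \<Longrightarrow> arr_power (restrict_bundle E x) (point_arrow x (g x)) n = point_arrow x (arr_power E g n x)"
  by (induction n) (simp_all add: point_arrow_id point_arrow_tensor)

lemma point_arrow_act:
  "x \<in> X \<Longrightarrow> arr_act (restrict_bundle E x) r s (point_arrow x (g x)) (point_arrow x (t x)) =
    point_arrow x (arr_act E r s g t x)"
  by (simp add: arr_act_def point_arrow_power point_arrow_adj point_arrow_comp)

lemma point_arrow_unitary:
  assumes x: "x \<in> X" and g: "g \<in> unitaries E"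
  shows "point_arrow x (g x) \<in> unitaries (restrict_bundle E x)"
  unfolding unitaries_def mem_Collect_eq point_arrow_adj[OF x] point_arrow_comp point_arrow_id[OF x]
    unitary_left[OF g] unitary_right[OF g]
  using point_arrow_in[OF x unitary_arrow[OF g]] by simp

lemma arr_norm_restrict_le:
  assumes x: "x \<in> X" and t: "t \<in> arrows E r s"
  shows "arr_norm (restrict_bundle E x) r s (point_arrow x (t x)) \<le> arr_norm E r s t"
  unfolding arr_norm_def
proof (rule cSup_subset_mono[OF _ norm_set_bdd[OF t]])
  show "insert 0 {tensor_norm (restrict_bundle E x) s xa (point_arrow x (t x) xa \<xi>) | xa \<xi>.
     xa \<in> topspace (base (restrict_bundle E x)) \<and> \<xi> \<in> tensor_fibre (restrict_bundle E x) r xa \<and>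
     tensor_norm (restrict_bundle E x) r xa \<xi> \<le> 1} \<subseteq> norm_set r s t"
    using x by auto
qed simp

end

section \<open>Automorphisms and evaluation maps\<close>

lemma cstar_subalgebra_fixed:
  assumes "star_hom \<alpha>" "bounded_linear \<alpha>"
  shows "cstar_subalgebra {a. \<alpha> a = a}"
proof -
  have "closed {a. \<alpha> a = a}"
    by (intro closed_Collect_eq linear_continuous_on[OF assms(2)] continuous_on_id)
  then show ?thesis
    unfolding cstar_subalgebra_def using assms(1) star_hom_0[OF assms(1)] by (simp add: star_hom_def)
qed

locale cp_algebra = framed_bundle E J f d for E :: "('x, 'e) vbundle" and J :: "'j set" and f d +
  fixes emb :: "nat \<Rightarrow> nat \<Rightarrow> ('x, 'e) arrow \<Rightarrow> 'a::cstar_algebra"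
  assumes cp: "cuntz_pimsner E emb"
begin

lemma emb_lincomb: "t \<in> arrows E r s \<Longrightarrow> t' \<in> arrows E r s \<Longrightarrow>
    emb r s (\<lambda>x \<xi> vs. a * t x \<xi> vs + b * t' x \<xi> vs) = scaleC a (emb r s t) + scaleC b (emb r s t')"
  and emb_norm: "t \<in> arrows E r s \<Longrightarrow> norm (emb r s t) = arr_norm E r s t"
  and emb_tensor: "t \<in> arrows E r s \<Longrightarrow> emb (r + 1) (s + 1) (arr_tensor E r 1 s t (arr_id E 1)) = emb r s t"
  and emb_comp: "t \<in> arrows E r s \<Longrightarrow> t' \<in> arrows E s q \<Longrightarrow> emb r q (arr_comp t' t) = emb s q t' * emb r s t"
  and emb_adj: "t \<in> arrows E r s \<Longrightarrow> emb s r (arr_adj E r s t) = star (emb r s t)"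
  and emb_dense: "closure (span (\<Union>r s. emb r s ` arrows E r s)) = UNIV"
  and emb_circle: "finite K \<Longrightarrow> (\<And>k. k \<in> K \<Longrightarrow> a' k \<in> graded_part E emb k) \<Longrightarrow> cmod z = 1 \<Longrightarrow>
    norm (\<Sum>k\<in>K. scaleC (z powi k) (a' k)) = norm (\<Sum>k\<in>K. a' k)"
  using cp unfolding cuntz_pimsner_def by simp_all

lemma emb_inj:
  assumes t: "t \<in> arrows E r s" and t': "t' \<in> arrows E r s" and eq: "emb r s t = emb r s t'"
  shows "t = t'"
proof -
  let ?d = "\<lambda>x \<xi> vs. 1 * t x \<xi> vs + (-1) * t' x \<xi> vs"
  have "emb r s ?d = 0" unfolding emb_lincomb[OF t t'] eq by (simp add: scaleC_minus1)
  then have "arr_norm E r s ?d = 0" using emb_norm[OF arrows_lincomb[OF t t', of 1 "-1"]] by simp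
  from arr_norm_eq_0[OF arrows_lincomb[OF t t'] this] show ?thesis by (simp add: fun_eq_iff)
qed

lemma emb_determines:
  fixes \<alpha> \<beta> :: "'a \<Rightarrow> 'c::real_normed_vector"
  assumes \<alpha>: "bounded_linear \<alpha>" and \<beta>: "bounded_linear \<beta>"
    and eq: "\<And>r s t. t \<in> arrows E r s \<Longrightarrow> \<alpha> (emb r s t) = \<beta> (emb r s t)"
  shows "\<alpha> = \<beta>"
proof
  fix a
  have "span (\<Union>r s. emb r s ` arrows E r s) \<subseteq> {a. \<alpha> a = \<beta> a}"
    by (rule span_minimal)
      (use eq \<alpha> \<beta> in \<open>auto simp: subspace_def bounded_linear_def linear_0 linear_add linear_scale\<close>)
  moreover have "closed {a. \<alpha> a = \<beta> a}"
    by (intro closed_Collect_eq linear_continuous_on \<alpha> \<beta>)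
  ultimately have "closure (span (\<Union>r s. emb r s ` arrows E r s)) \<subseteq> {a. \<alpha> a = \<beta> a}"
    by (rule closure_minimal)
  then show "\<alpha> a = \<beta> a" using emb_dense by auto
qed

text \<open>The class \<open>cstar_algebra\<close> provides no unit. This identity arrow is one: it
  acts as identity on all arrows, and these span a dense subspace.\<close>

definition unit :: 'a where "unit = emb 0 0 (arr_id E 0)"

lemma emb_id: "emb n n (arr_id E n) = unit"
proof (induction n)
  case (Suc n)
  have "emb (n + 1) (n + 1) (arr_id E (n + 1)) = emb n n (arr_id E n)"
    using emb_tensor[OF arr_id_in, of n] unfolding arr_tensor_id .
  then show ?case using Suc unfolding Suc_eq_plus1 by (rule trans)
qed (simp add: unit_def)

lemma unit_left: "unit * a = a"
proof -
  have "(\<lambda>a. unit * a) = (\<lambda>a. a)"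
  proof (rule emb_determines[OF bounded_linear_mult_right bounded_linear_ident])
    fix r s t assume t: "t \<in> arrows E r s"
    show "unit * emb r s t = emb r s t"
      using emb_comp[OF t arr_id_in] arr_comp_id(2)[OF t] by (simp add: emb_id)
  qed
  then show ?thesis by (rule fun_cong)
qed

lemma star_unit: "star unit = unit"
  using emb_adj[OF arr_id_in, of 0] by (simp add: arr_adj_id unit_def)

lemma unit_right: "a * unit = a"
  using unit_left[of "star a"] by (metis star_mult star_star star_unit)

lemma norm_unit: "norm unit \<le> 1"
  using unit_left by (rule norm_unit_le_1)

text \<open>Brings arrows to a common number of tensor factors without changing their image; the map
  \<open>F\<close> travels along so that \<open>emb\<close> and a prospective homomorphism are
  raised by the same arrow.\<close>

lemma emb_raise:
  fixes F :: "nat \<Rightarrow> nat \<Rightarrow> ('x, 'e) arrow \<Rightarrow> 'b"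
  assumes F: "\<And>r s t. t \<in> arrows E r s \<Longrightarrow> F (r + 1) (s + 1) (arr_tensor E r 1 s t (arr_id E 1)) = F r s t"
    and t: "t \<in> arrows E r s"
  shows "\<exists>t'\<in>arrows E (r + m) (s + m). emb (r + m) (s + m) t' = emb r s t \<and> F (r + m) (s + m) t' = F r s t"
proof (induction m)
  case (Suc m)
  then obtain t' where t': "t' \<in> arrows E (r + m) (s + m)" "emb (r + m) (s + m) t' = emb r s t"
    "F (r + m) (s + m) t' = F r s t" by auto
  show ?case
    unfolding Suc_eq_plus1 add.assoc[symmetric]
    by (intro bexI[of _ "arr_tensor E (r + m) 1 (s + m) t' (arr_id E 1)"] conjI
        arr_tensor_in[OF t'(1) arr_id_in] trans[OF emb_tensor[OF t'(1)] t'(2)] trans[OF F[OF t'(1)] t'(3)])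
qed (use t in auto)

text \<open>Universal property of the algebra. The relation of degree \<open>k\<close> pairs
  \<open>emb r s t\<close> with \<open>F r s t\<close>; sums and products of pairs are formed after
  raising both arrows to matching tensor powers, and \<open>graded_extension\<close> does the
  rest.\<close>

lemma emb_extension:
  fixes F :: "nat \<Rightarrow> nat \<Rightarrow> ('x, 'e) arrow \<Rightarrow> 'b::cstar_algebra"
  assumes lin: "\<And>r s t t' a b. t \<in> arrows E r s \<Longrightarrow> t' \<in> arrows E r s \<Longrightarrow>
      F r s (\<lambda>x \<xi> vs. a * t x \<xi> vs + b * t' x \<xi> vs) = scaleC a (F r s t) + scaleC b (F r s t')"
    and tens: "\<And>r s t. t \<in> arrows E r s \<Longrightarrow> F (r + 1) (s + 1) (arr_tensor E r 1 s t (arr_id E 1)) = F r s t"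
    and comp: "\<And>r s q t t'. t \<in> arrows E r s \<Longrightarrow> t' \<in> arrows E s q \<Longrightarrow> F r q (arr_comp t' t) = F s q t' * F r s t"
    and adj: "\<And>r s t. t \<in> arrows E r s \<Longrightarrow> F s r (arr_adj E r s t) = star (F r s t)"
    and bound: "\<And>r s t. t \<in> arrows E r s \<Longrightarrow> norm (F r s t) \<le> norm (emb r s t)"
  shows "\<exists>\<pi>. bounded_linear \<pi> \<and> star_hom \<pi> \<and> (\<forall>r s. \<forall>t\<in>arrows E r s. \<pi> (emb r s t) = F r s t)"
proof -
  define Rel where "Rel k = {(emb r s t, F r s t) | r s t. t \<in> arrows E r s \<and> int s - int r = k}" for k
  have RelI: "(emb r s t, F r s t) \<in> Rel k" if "t \<in> arrows E r s" "int s - int r = k" for r s t k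
    using that unfolding Rel_def by blast
  have RelE: "\<exists>r s t. t \<in> arrows E r s \<and> int s - int r = k \<and> a = emb r s t \<and> b = F r s t"
    if "(a, b) \<in> Rel k" for a b k using that unfolding Rel_def by blast
  have RelE': "\<exists>t'\<in>arrows E (r + m) (s + m). emb (r + m) (s + m) t' = emb r s t \<and> F (r + m) (s + m) t' = F r s t"
    if "t \<in> arrows E r s" for r s t m using emb_raise[where F=F, OF tens that] .
  have fst: "fst ` Rel k = graded_part E emb k" for k
    unfolding Rel_def graded_part_def by force
  have un: "(\<Union>k. fst ` Rel k) = (\<Union>r s. emb r s ` arrows E r s)"
    unfolding fst graded_part_def by blast
  have dns: "closure (span (\<Union>k. fst ` Rel k)) = UNIV" unfolding un by (rule emb_dense)
  obtain \<pi> where \<pi>: "bounded_linear \<pi>" "star_hom \<pi>" "\<And>k a b. (a, b) \<in> Rel k \<Longrightarrow> \<pi> a = b"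
  proof (rule graded_extension[of Rel, OF _ _ _ _ _ _ _ dns])
    fix k :: int
    \<comment> \<open>Every degree, negative ones included, has the arrow space from
      \<open>nat (- k)\<close> to \<open>nat k\<close> factors.\<close>
    have "emb (nat (- k)) (nat k) (\<lambda>x \<xi> vs. 0) = 0" "F (nat (- k)) (nat k) (\<lambda>x \<xi> vs. 0) = 0"
      using emb_lincomb[OF arrows_zero arrows_zero, of "nat (- k)" "nat k" 0 0]
        lin[OF arrows_zero arrows_zero, of "nat (- k)" "nat k" 0 0] by simp_all
    then show "(0, 0) \<in> Rel k"
      using RelI[OF arrows_zero, of "nat k" "nat (- k)" k] by simp
  next
    fix k a b a' b' assume "(a, b) \<in> Rel k" and "(a', b') \<in> Rel k"
    then obtain r s t r' s' t' where t: "t \<in> arrows E r s" "int s - int r = k" "a = emb r s t" "b = F r s t"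
      and t': "t' \<in> arrows E r' s'" "int s' - int r' = k" "a' = emb r' s' t'" "b' = F r' s' t'"
      using RelE by metis
    obtain u where u: "u \<in> arrows E (r + r') (s + r')" "emb (r + r') (s + r') u = a" "F (r + r') (s + r') u = b"
      using RelE'[OF t(1), of r'] t by auto
    have e: "r' + r = r + r'" "s' + r = s + r'" using t(2) t'(2) by auto
    obtain u' where u': "u' \<in> arrows E (r + r') (s + r')" "emb (r + r') (s + r') u' = a'" "F (r + r') (s + r') u' = b'"
      using RelE'[OF t'(1), of r, unfolded e] t'(3,4) by auto
    show "(a + a', b + b') \<in> Rel k"
      using RelI[OF arrows_lincomb[OF u(1) u'(1), of 1 1], of k] emb_lincomb[OF u(1) u'(1), of 1 1]
        lin[OF u(1) u'(1), of 1 1] u u' t(2) by simp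
  next
    fix k a b c assume "(a, b) \<in> Rel k"
    then obtain r s t where t: "t \<in> arrows E r s" "int s - int r = k" "a = emb r s t" "b = F r s t"
      using RelE by metis
    show "(scaleC c a, scaleC c b) \<in> Rel k"
      using RelI[OF arrows_lincomb[OF t(1) t(1), of c 0] t(2)] emb_lincomb[OF t(1) t(1), of c 0]
        lin[OF t(1) t(1), of c 0] t by simp
  next
    fix j k a b a' b' assume "(a, b) \<in> Rel j" and "(a', b') \<in> Rel k"
    then obtain r s t r' s' t' where t: "t \<in> arrows E r s" "int s - int r = j" "a = emb r s t" "b = F r s t"
      and t': "t' \<in> arrows E r' s'" "int s' - int r' = k" "a' = emb r' s' t'" "b' = F r' s' t'"
      using RelE by metis
    \<comment> \<open>Raising by \<open>s'\<close> and \<open>r\<close> respectively makes the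
      source of the first arrow and the target of the second both equal to \<open>r + s'\<close>, so
      that they can be composed.\<close>
    obtain u where u: "u \<in> arrows E (r + s') (s + s')" "emb (r + s') (s + s') u = a" "F (r + s') (s + s') u = b"
      using RelE'[OF t(1), of s'] t by auto
    obtain u' where u': "u' \<in> arrows E (r' + r) (r + s')" "emb (r' + r) (r + s') u' = a'" "F (r' + r) (r + s') u' = b'"
      using RelE'[OF t'(1), of r, unfolded add.commute[of s' r]] t'(3,4) by auto
    show "(a * a', b * b') \<in> Rel (j + k)"
      using RelI[OF arr_comp_in[OF u'(1) u(1)], of "j + k"] emb_comp[OF u'(1) u(1)] comp[OF u'(1) u(1)] u u' t(2) t'(2)
      by simp
  next
    fix k a b assume "(a, b) \<in> Rel k"
    then obtain r s t where t: "t \<in> arrows E r s" "int s - int r = k" "a = emb r s t" "b = F r s t"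
      using RelE by metis
    show "(star a, star b) \<in> Rel (- k)"
      using RelI[OF arr_adj_in[OF t(1)], of "- k"] t emb_adj[OF t(1)] adj[OF t(1)] by simp
  next
    fix k a b assume "(a, b) \<in> Rel k"
    then obtain r s t where t: "t \<in> arrows E r s" "int s - int r = k" "a = emb r s t" "b = F r s t"
      using RelE by metis
    show "norm b \<le> norm a" using bound[OF t(1)] t by simp
  next
    fix K a and z :: complex
    assume "finite K" "\<forall>k\<in>K. a k \<in> fst ` Rel k" "cmod z = 1"
    then show "norm (\<Sum>k\<in>K. scaleC (z powi k) (a k)) = norm (\<Sum>k\<in>K. a k)"
      unfolding fst by (intro emb_circle) auto
  qed auto
  have "\<pi> (emb r s t) = F r s t" if "t \<in> arrows E r s" for r s t
    using \<pi>(3)[OF RelI[OF that refl]] .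
  then show ?thesis using \<pi>(1,2) by blast
qed

lemma norm_emb_isometry:
  assumes t: "t \<in> arrows E r s" and u: "arr_comp (arr_adj E r s t) t = arr_id E r"
  shows "norm (emb r s t) \<le> 1"
proof -
  have "star (emb r s t) * emb r s t = unit"
    using emb_comp[OF t arr_adj_in[OF t]] emb_adj[OF t] by (simp add: u emb_id)
  then have "(norm (emb r s t))\<^sup>2 \<le> 1" using cstar_identity[of "emb r s t"] norm_unit by simp
  then show ?thesis by (simp add: power_le_one_iff)
qed

text \<open>The action multiplies on both sides by tensor powers of a unitary, which have norm at
  most 1 in the algebra. Homogeneous elements are thus contracted, and \<open>emb_extension\<close>
  applies.\<close>

lemma hat_aut_exists:
  assumes g: "g \<in> unitaries E"
  shows "bounded_linear (hat_aut E emb g) \<and> star_hom (hat_aut E emb g) \<and>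
    (\<forall>r s. \<forall>t\<in>arrows E r s. hat_aut E emb g (emb r s t) = emb r s (arr_act E r s g t))"
proof -
  note ga = unitary_arrow[OF g]
  have ex: "\<exists>\<pi>. bounded_linear \<pi> \<and> star_hom \<pi> \<and>
      (\<forall>r s. \<forall>t\<in>arrows E r s. \<pi> (emb r s t) = emb r s (arr_act E r s g t))"
  proof (rule emb_extension)
    fix r s t t' a b assume t: "t \<in> arrows E r s" and t': "t' \<in> arrows E r s"
    show "emb r s (arr_act E r s g (\<lambda>x \<xi> vs. a * t x \<xi> vs + b * t' x \<xi> vs)) =
      scaleC a (emb r s (arr_act E r s g t)) + scaleC b (emb r s (arr_act E r s g t'))"
      unfolding arr_act_lincomb[OF ga t t'] by (rule emb_lincomb[OF arr_act_in[OF ga t] arr_act_in[OF ga t']])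
  next
    fix r s t assume t: "t \<in> arrows E r s"
    show "emb (r + 1) (s + 1) (arr_act E (r + 1) (s + 1) g (arr_tensor E r 1 s t (arr_id E 1))) =
      emb r s (arr_act E r s g t)"
      unfolding arr_act_tensor[OF g t] by (rule emb_tensor[OF arr_act_in[OF ga t]])
    show "emb s r (arr_act E s r g (arr_adj E r s t)) = star (emb r s (arr_act E r s g t))"
      unfolding arr_act_adj[OF ga t] by (rule emb_adj[OF arr_act_in[OF ga t]])
    note P = arr_power_in[OF ga] and Q = arr_power_in[OF arr_adj_in[OF ga]]
    have nP: "norm (emb s s (arr_power E g s)) \<le> 1"
      by (rule norm_emb_isometry[OF P]) (simp add: arr_power_adj[OF ga] arr_power_unitary[OF g])
    have nQ: "norm (emb r r (arr_power E (arr_adj E 1 1 g) r)) \<le> 1"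
      by (rule norm_emb_isometry[OF Q])
        (simp add: arr_power_adj[OF arr_adj_in[OF ga]] arr_adj_adj[OF ga] arr_power_unitary[OF g])
    have "norm (emb r s (arr_act E r s g t)) =
      norm (emb s s (arr_power E g s) * (emb r s t * emb r r (arr_power E (arr_adj E 1 1 g) r)))"
      unfolding arr_act_def emb_comp[OF arr_comp_in[OF Q t] P] emb_comp[OF Q t] ..
    also have "\<dots> \<le> norm (emb s s (arr_power E g s)) * (norm (emb r s t) * norm (emb r r (arr_power E (arr_adj E 1 1 g) r)))"
      by (intro order_trans[OF norm_mult_ineq] mult_left_mono norm_mult_ineq) simp
    also have "\<dots> \<le> 1 * (norm (emb r s t) * 1)"
      by (intro mult_mono nP nQ mult_nonneg_nonneg) auto
    finally show "norm (emb r s (arr_act E r s g t)) \<le> norm (emb r s t)" by simp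
  next
    fix r s q t t' assume t: "t \<in> arrows E r s" and t': "t' \<in> arrows E s q"
    show "emb r q (arr_act E r q g (arr_comp t' t)) = emb s q (arr_act E s q g t') * emb r s (arr_act E r s g t)"
      unfolding arr_act_comp[OF g t t'] by (rule emb_comp[OF arr_act_in[OF ga t] arr_act_in[OF ga t']])
  qed
  then obtain \<pi> where \<pi>: "bounded_linear \<pi>" "star_hom \<pi>"
    "\<forall>r s. \<forall>t\<in>arrows E r s. \<pi> (emb r s t) = emb r s (arr_act E r s g t)" by blast
  have "hat_aut E emb g = \<pi>"
    unfolding hat_aut_def
  proof (rule the_equality)
    show "bounded_linear \<pi> \<and> (\<forall>r s. \<forall>t\<in>arrows E r s. \<pi> (emb r s t) = emb r s (arr_act E r s g t))"
      using \<pi> by blast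
    fix \<alpha> assume "bounded_linear \<alpha> \<and> (\<forall>r s. \<forall>t\<in>arrows E r s. \<alpha> (emb r s t) = emb r s (arr_act E r s g t))"
    then show "\<alpha> = \<pi>" using \<pi> by (intro emb_determines) auto
  qed
  then show ?thesis using \<pi> by simp
qed

lemma hat_bounded: "g \<in> unitaries E \<Longrightarrow> bounded_linear (hat_aut E emb g)"
  and hat_star_hom: "g \<in> unitaries E \<Longrightarrow> star_hom (hat_aut E emb g)"
  and hat_emb: "g \<in> unitaries E \<Longrightarrow> t \<in> arrows E r s \<Longrightarrow> hat_aut E emb g (emb r s t) = emb r s (arr_act E r s g t)"
  using hat_aut_exists by blast+

lemma hat_comp:
  assumes g: "g \<in> unitaries E" and h: "h \<in> unitaries E"
  shows "hat_aut E emb (arr_comp g h) = hat_aut E emb g \<circ> hat_aut E emb h"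
proof (rule emb_determines)
  show "bounded_linear (hat_aut E emb (arr_comp g h))" by (rule hat_bounded[OF arr_comp_unitary[OF g h]])
  show "bounded_linear (hat_aut E emb g \<circ> hat_aut E emb h)"
    unfolding o_def by (rule bounded_linear_compose[OF hat_bounded[OF g] hat_bounded[OF h]])
  fix r s t assume t: "t \<in> arrows E r s"
  show "hat_aut E emb (arr_comp g h) (emb r s t) = (hat_aut E emb g \<circ> hat_aut E emb h) (emb r s t)"
    using hat_emb[OF arr_comp_unitary[OF g h] t] hat_emb[OF h t] hat_emb[OF g arr_act_in[OF unitary_arrow[OF h] t]]
    by (simp add: arr_act_mult[OF unitary_arrow[OF g] unitary_arrow[OF h]])
qed

lemma hat_id: "hat_aut E emb (arr_id E 1) = id"
proof (rule emb_determines[OF hat_bounded[OF arr_id_unitary]])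
  show "bounded_linear (id :: 'a \<Rightarrow> 'a)" unfolding id_def by (rule bounded_linear_ident)
  show "hat_aut E emb (arr_id E 1) (emb r s t) = id (emb r s t)" if "t \<in> arrows E r s" for r s t
    using hat_emb[OF arr_id_unitary that] arr_act_id[OF that] by simp
qed

lemma hat_bij:
  assumes g: "g \<in> unitaries E"
  shows "bij (hat_aut E emb g)"
proof (rule o_bij)
  show "hat_aut E emb (arr_adj E 1 1 g) \<circ> hat_aut E emb g = id"
    using hat_comp[OF arr_adj_unitary[OF g] g] unitary_left[OF g] hat_id by simp
  show "hat_aut E emb g \<circ> hat_aut E emb (arr_adj E 1 1 g) = id"
    using hat_comp[OF g arr_adj_unitary[OF g]] unitary_right[OF g] hat_id by simp
qed

lemma fibre_map_exists:
  assumes x: "x \<in> X" and cpx: "cuntz_pimsner (restrict_bundle E x) (fib x)"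
  shows "bounded_linear (fibre_map E emb fib x) \<and>
    (\<forall>r s. \<forall>t\<in>arrows E r s. fibre_map E emb fib x (emb r s t) = fib x r s (point_arrow x (t x)))"
proof -
  interpret R: cp_algebra "restrict_bundle E x" J f d "fib x"
    by (intro cp_algebra.intro framed_bundle_restrict[OF x] cp_algebra_axioms.intro cpx)
  note pin = point_arrow_in[OF x]
  have "\<exists>\<pi>. bounded_linear \<pi> \<and> star_hom \<pi> \<and>
      (\<forall>r s. \<forall>t\<in>arrows E r s. \<pi> (emb r s t) = fib x r s (point_arrow x (t x)))"
  proof (rule emb_extension)
    fix r s t t' a b assume t: "t \<in> arrows E r s" and t': "t' \<in> arrows E r s"
    have "point_arrow x (\<lambda>\<xi> vs. a * t x \<xi> vs + b * t' x \<xi> vs) =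
      (\<lambda>y \<xi> vs. a * point_arrow x (t x) y \<xi> vs + b * point_arrow x (t' x) y \<xi> vs)"
      by (simp add: point_arrow_def fun_eq_iff)
    then show "fib x r s (point_arrow x (\<lambda>\<xi> vs. a * t x \<xi> vs + b * t' x \<xi> vs)) =
      scaleC a (fib x r s (point_arrow x (t x))) + scaleC b (fib x r s (point_arrow x (t' x)))"
      using R.emb_lincomb[OF pin[OF t] pin[OF t']] by simp
  next
    fix r s t assume t: "t \<in> arrows E r s"
    show "fib x (r + 1) (s + 1) (point_arrow x (arr_tensor E r 1 s t (arr_id E 1) x)) = fib x r s (point_arrow x (t x))"
      using R.emb_tensor[OF pin[OF t]] unfolding point_arrow_id[OF x] point_arrow_tensor .
    show "fib x s r (point_arrow x (arr_adj E r s t x)) = star (fib x r s (point_arrow x (t x)))"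
      using R.emb_adj[OF pin[OF t]] unfolding point_arrow_adj[OF x] .
    show "norm (fib x r s (point_arrow x (t x))) \<le> norm (emb r s t)"
      unfolding R.emb_norm[OF pin[OF t]] emb_norm[OF t] by (rule arr_norm_restrict_le[OF x t])
  next
    fix r s q t t' assume t: "t \<in> arrows E r s" and t': "t' \<in> arrows E s q"
    show "fib x r q (point_arrow x (arr_comp t' t x)) = fib x s q (point_arrow x (t' x)) * fib x r s (point_arrow x (t x))"
      using R.emb_comp[OF pin[OF t] pin[OF t']] unfolding point_arrow_comp .
  qed
  then obtain \<pi> where \<pi>: "bounded_linear \<pi>"
    "\<forall>r s. \<forall>t\<in>arrows E r s. \<pi> (emb r s t) = fib x r s (point_arrow x (t x))" by blast
  have "fibre_map E emb fib x = \<pi>"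
    unfolding fibre_map_def
  proof (rule the_equality)
    show "bounded_linear \<pi> \<and> (\<forall>r s. \<forall>t\<in>arrows E r s. \<pi> (emb r s t) = fib x r s (point_arrow x (t x)))"
      using \<pi> by blast
    fix \<alpha> assume "bounded_linear \<alpha> \<and> (\<forall>r s. \<forall>t\<in>arrows E r s. \<alpha> (emb r s t) = fib x r s (point_arrow x (t x)))"
    then show "\<alpha> = \<pi>" using \<pi> by (intro emb_determines) auto
  qed
  then show ?thesis using \<pi> by simp
qed

text \<open>The link between the two groups of the theorem: it mentions neither \<open>emb\<close>
  nor \<open>fib\<close>, and for unitary \<open>g\<close> it turns out to characterise both the
  sections of the spectral bundle and the automorphisms fixing the algebra of
  \<open>G\<close>.\<close>

definition fixes_dual :: "('x, 'e) arrow set \<Rightarrow> ('x, 'e) arrow \<Rightarrow> bool" where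
  "fixes_dual G g \<longleftrightarrow> (\<forall>r s. \<forall>t\<in>fixed_arrows E G r s. arr_act E r s g t = t)"

lemma fixed_arrow_emb: "t \<in> fixed_arrows E G r s \<Longrightarrow> emb r s t \<in> fixed_algebra E emb G"
  unfolding fixed_algebra_def by (rule hull_inc) blast

lemma fixed_algebra_hat:
  assumes g: "g \<in> unitaries E" and fx: "fixes_dual G g" and a: "a \<in> fixed_algebra E emb G"
  shows "hat_aut E emb g a = a"
proof -
  have "fixed_algebra E emb G \<subseteq> {a. hat_aut E emb g a = a}"
    unfolding fixed_algebra_def
  proof (rule hull_minimal[where S = cstar_subalgebra])
    show "cstar_subalgebra {a. hat_aut E emb g a = a}"
      by (rule cstar_subalgebra_fixed[OF hat_star_hom[OF g] hat_bounded[OF g]])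
    show "(\<Union>r s. emb r s ` fixed_arrows E G r s) \<subseteq> {a. hat_aut E emb g a = a}"
      using fx hat_emb[OF g] unfolding fixes_dual_def by (auto simp: fixed_arrows_def)
  qed
  then show ?thesis using a by blast
qed

lemma topspace_unitary_bundle: "x \<in> X \<Longrightarrow> u \<in> unitary_fibre E x \<Longrightarrow> (x, u) \<in> topspace (unitary_bundle E)"
proof -
  assume x: "x \<in> X" and u: "u \<in> unitary_fibre E x"
  obtain j where j: "j \<in> J" using J_nonempty[OF x] by blast
  have "{(y, u). y \<in> X \<and> u \<in> unitary_fibre E y \<and> u (pure_tensor E y [f j y]) [f j y] \<in> UNIV} \<in>
    {{(y, u). y \<in> U \<and> u \<in> unitary_fibre E y \<and> u (pure_tensor E y [v y]) [w y] \<in> V} | U v w V.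
        openin (base E) U \<and> local_section E U v \<and> local_section E U w \<and> open V}"
    using section_frame[OF j] by blast
  then show ?thesis
    unfolding unitary_bundle_def topology_generated_by_topspace
    by (rule UnionI) (use x u in simp)
qed

text \<open>Evaluation at \<open>x\<close> intertwines the automorphisms of \<open>g\<close> and of
  \<open>g x\<close>, because it does so on arrows. For an arrow of the dual, the fibrewise
  condition then says that the arrow and its transform agree at \<open>x\<close>, by injectivity of
  \<open>fib x\<close> on arrows.\<close>

lemma spectral_section_iff:
  assumes g: "g \<in> unitaries E"
    and cpx: "\<And>x. x \<in> X \<Longrightarrow> cuntz_pimsner (restrict_bundle E x) (fib x)"
  shows "(\<forall>x\<in>X. (x, g x) \<in> topspace (spectral_bundle E emb fib G)) \<longleftrightarrow> fixes_dual G g"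
proof -
  have key: "hat_aut (restrict_bundle E x) (fib x) (point_arrow x (g x)) (fibre_map E emb fib x a) =
      fibre_map E emb fib x (hat_aut E emb g a)" if x: "x \<in> X" for x a
  proof -
    interpret R: cp_algebra "restrict_bundle E x" J f d "fib x"
      by (intro cp_algebra.intro framed_bundle_restrict[OF x] cp_algebra_axioms.intro cpx x)
    note gx = point_arrow_unitary[OF x g]
    have fm: "bounded_linear (fibre_map E emb fib x)"
      "\<And>r s t. t \<in> arrows E r s \<Longrightarrow> fibre_map E emb fib x (emb r s t) = fib x r s (point_arrow x (t x))"
      using fibre_map_exists[where fib = fib, OF x cpx[OF x]] by blast+
    have "(\<lambda>a. hat_aut (restrict_bundle E x) (fib x) (point_arrow x (g x)) (fibre_map E emb fib x a)) =
      (\<lambda>a. fibre_map E emb fib x (hat_aut E emb g a))"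
    proof (rule emb_determines)
      fix r s t assume t: "t \<in> arrows E r s"
      show "hat_aut (restrict_bundle E x) (fib x) (point_arrow x (g x)) (fibre_map E emb fib x (emb r s t)) =
        fibre_map E emb fib x (hat_aut E emb g (emb r s t))"
        using fm(2)[OF t] R.hat_emb[OF gx point_arrow_in[OF x t]] hat_emb[OF g t]
          fm(2)[OF arr_act_in[OF unitary_arrow[OF g] t]] by (simp add: point_arrow_act[OF x])
    qed (intro bounded_linear_compose[OF R.hat_bounded[OF gx]] bounded_linear_compose[OF _ hat_bounded[OF g]] fm(1))+
    then show ?thesis by (rule fun_cong)
  qed
  have uf: "g x \<in> unitary_fibre E x" if "x \<in> X" for x
    using point_arrow_unitary[OF that g] by (simp add: unitary_fibre_def)
  have "(x, g x) \<in> topspace (spectral_bundle E emb fib G) \<longleftrightarrow>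
    (\<forall>a\<in>fixed_algebra E emb G. fibre_map E emb fib x (hat_aut E emb g a) = fibre_map E emb fib x a)" if x: "x \<in> X" for x
    unfolding spectral_bundle_def topspace_subtopology
    using topspace_unitary_bundle[OF x uf[OF x]] uf[OF x] x key[OF x] by simp
  then have iff: "(\<forall>x\<in>X. (x, g x) \<in> topspace (spectral_bundle E emb fib G)) \<longleftrightarrow>
    (\<forall>x\<in>X. \<forall>a\<in>fixed_algebra E emb G. fibre_map E emb fib x (hat_aut E emb g a) = fibre_map E emb fib x a)" by blast
  show ?thesis
    unfolding iff
  proof
    assume H: "\<forall>x\<in>X. \<forall>a\<in>fixed_algebra E emb G. fibre_map E emb fib x (hat_aut E emb g a) = fibre_map E emb fib x a"
    show "fixes_dual G g"
      unfolding fixes_dual_def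
    proof (intro allI ballI)
      fix r s t assume tG: "t \<in> fixed_arrows E G r s"
      then have t: "t \<in> arrows E r s" by (simp add: fixed_arrows_def)
      note at = arr_act_in[OF unitary_arrow[OF g] t]
      have "arr_act E r s g t x = t x" for x
      proof (cases "x \<in> X")
        case x: True
        interpret R: cp_algebra "restrict_bundle E x" J f d "fib x"
          by (intro cp_algebra.intro framed_bundle_restrict[OF x] cp_algebra_axioms.intro cpx x)
        have fm: "\<And>r s t. t \<in> arrows E r s \<Longrightarrow> fibre_map E emb fib x (emb r s t) = fib x r s (point_arrow x (t x))"
          using fibre_map_exists[where fib = fib, OF x cpx[OF x]] by blast
        have "fib x r s (point_arrow x (arr_act E r s g t x)) = fib x r s (point_arrow x (t x))"
          using H[rule_format, OF x fixed_arrow_emb[OF tG]] hat_emb[OF g t] fm[OF at] fm[OF t] by simp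
        then have "point_arrow x (arr_act E r s g t x) = point_arrow x (t x)"
          by (rule R.emb_inj[OF point_arrow_in[OF x at] point_arrow_in[OF x t]])
        then show ?thesis by (rule point_arrow_eqD)
      next
        case False
        then show ?thesis using arrow_zero[OF t, of x] arrow_zero[OF at, of x] by auto
      qed
      then show "arr_act E r s g t = t" by (rule ext)
    qed
  next
    assume "fixes_dual G g"
    then show "\<forall>x\<in>X. \<forall>a\<in>fixed_algebra E emb G. fibre_map E emb fib x (hat_aut E emb g a) = fibre_map E emb fib x a"
      using fixed_algebra_hat[OF g] by simp
  qed
qed

end

section \<open>Permutations inside the Cuntz-Pimsner algebra\<close>

context cp_algebra
begin

section \<open>Sections of tensor powers and functions inside the algebra\<close>

lemma emb_sum:
  assumes "finite I" "\<And>i. i \<in> I \<Longrightarrow> t i \<in> arrows E r s"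
  shows "(\<lambda>x \<xi> ws. \<Sum>i\<in>I. t i x \<xi> ws) \<in> arrows E r s \<and>
    emb r s (\<lambda>x \<xi> ws. \<Sum>i\<in>I. t i x \<xi> ws) = (\<Sum>i\<in>I. emb r s (t i))"
  using assms
proof (induction I rule: finite_induct)
  case empty
  have "emb r s (\<lambda>x \<xi> vs. 0) = 0" using emb_lincomb[OF arrows_zero arrows_zero, of r s 0 0] by simp
  then show ?case using arrows_zero by simp
next
  case (insert i I)
  then have i: "t i \<in> arrows E r s" and I: "(\<lambda>x \<xi> ws. \<Sum>i\<in>I. t i x \<xi> ws) \<in> arrows E r s"
    and e: "emb r s (\<lambda>x \<xi> ws. \<Sum>i\<in>I. t i x \<xi> ws) = (\<Sum>i\<in>I. emb r s (t i))" by auto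
  show ?case
    using arrows_lincomb[OF i I, of 1 1] emb_lincomb[OF i I, of 1 1] e insert.hyps by simp
qed

text \<open>Continuous sections of the tensor power of order \<open>r\<close>, as arrows from the
  trivial bundle. The product of two such elements is their tensor product, and \<open>H 0\<close>
  is the algebra of continuous functions on the base.\<close>

definition H :: "nat \<Rightarrow> 'a set" where
  "H r = emb 0 r ` arrows E 0 r"

lemma H_I: "t \<in> arrows E 0 r \<Longrightarrow> emb 0 r t \<in> H r"
  unfolding H_def by blast

lemma H_E: "\<phi> \<in> H r \<Longrightarrow> \<exists>t\<in>arrows E 0 r. \<phi> = emb 0 r t"
  unfolding H_def by blast

lemma emb_raise': "t \<in> arrows E r s \<Longrightarrow> \<exists>t'\<in>arrows E (r + m) (s + m). emb (r + m) (s + m) t' = emb r s t"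
  using emb_raise[where F = "\<lambda>r s t. emb r s t", OF emb_tensor] by blast

lemma emb_H: "t \<in> arrows E r s \<Longrightarrow> \<phi> \<in> H r \<Longrightarrow> emb r s t * \<phi> \<in> H s"
proof -
  assume t: "t \<in> arrows E r s" and "\<phi> \<in> H r"
  then obtain t' where t': "t' \<in> arrows E 0 r" "\<phi> = emb 0 r t'" using H_E by meson
  show ?thesis using H_I[OF arr_comp_in[OF t'(1) t]] emb_comp[OF t'(1) t] t'(2) by simp
qed

lemma H_mult:
  assumes \<phi>: "\<phi> \<in> H r" and \<eta>: "\<eta> \<in> H s"
  shows "\<phi> * \<eta> \<in> H (r + s)"
proof -
  obtain t where t: "t \<in> arrows E 0 r" "\<phi> = emb 0 r t" using H_E[OF \<phi>] by blast
  obtain t' where t': "t' \<in> arrows E (0 + s) (r + s)" "emb (0 + s) (r + s) t' = \<phi>"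
    using emb_raise'[OF t(1), of s] t(2) by auto
  show ?thesis using emb_H[OF t'(1), of \<eta>] \<eta> t'(2) by simp
qed

text \<open>Raised by \<open>s\<close> factors, the adjoint of \<open>\<phi>\<close> contracts the
  first \<open>r\<close> factors and leaves \<open>s\<close>. For \<open>s = 0\<close> the result is
  a function on the base, hence central.\<close>

lemma star_H_mult:
  assumes \<phi>: "\<phi> \<in> H r" and \<eta>: "\<eta> \<in> H (r + s)"
  shows "star \<phi> * \<eta> \<in> H s"
proof -
  obtain t where t: "t \<in> arrows E 0 r" "\<phi> = emb 0 r t" using H_E[OF \<phi>] by blast
  obtain t' where t': "t' \<in> arrows E (r + s) (0 + s)" "emb (r + s) (0 + s) t' = star \<phi>"
    using emb_raise'[OF arr_adj_in[OF t(1)], of s] t(2) emb_adj[OF t(1)] by auto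
  show ?thesis using emb_H[OF t'(1), of \<eta>] \<eta> t'(2) by simp
qed

lemma H_lincomb: "\<phi> \<in> H r \<Longrightarrow> \<eta> \<in> H r \<Longrightarrow> scaleC a \<phi> + scaleC b \<eta> \<in> H r"
proof -
  assume "\<phi> \<in> H r" "\<eta> \<in> H r"
  then obtain t t' where t: "t \<in> arrows E 0 r" "\<phi> = emb 0 r t" and t': "t' \<in> arrows E 0 r" "\<eta> = emb 0 r t'"
    using H_E by meson
  show ?thesis using H_I[OF arrows_lincomb[OF t(1) t'(1), of a b]] emb_lincomb[OF t(1) t'(1), of a b] t(2) t'(2) by simp
qed

lemma H_zero: "0 \<in> H r"
  using H_I[OF arrows_zero, of r] emb_lincomb[OF arrows_zero arrows_zero, of 0 r 0 0] by simp

lemma H_sum: "(\<And>i. i \<in> I \<Longrightarrow> \<phi> i \<in> H r) \<Longrightarrow> (\<Sum>i\<in>I. \<phi> i) \<in> H r"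
proof (induction I rule: infinite_finite_induct)
  case (insert i I)
  then show ?case using H_lincomb[of "\<phi> i" r "\<Sum>i\<in>I. \<phi> i" 1 1] by simp
qed (simp_all add: H_zero)

definition func :: "('x \<Rightarrow> complex) \<Rightarrow> 'a" where
  "func g = emb 0 0 (scalar 0 g)"

lemma func_H0: "continuous_fun (base E) g \<Longrightarrow> func g \<in> H 0"
  unfolding func_def by (intro H_I scalar_in)

lemma H0_func: "z \<in> H 0 \<Longrightarrow> \<exists>g. continuous_fun (base E) g \<and> z = func g"
  using H_E[of z 0] continuous_value0 scalar_value0 unfolding func_def by fastforce

lemma emb_scalar: "continuous_fun (base E) g \<Longrightarrow> emb n n (scalar n g) = func g"
proof (induction n)
  case (Suc n)
  have "emb (n + 1) (n + 1) (scalar (n + 1) g) = emb n n (scalar n g)"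
    using emb_tensor[OF scalar_in[OF Suc.prems], of n] unfolding scalar_tensor[OF Suc.prems] .
  then show ?case using Suc unfolding Suc_eq_plus1 by simp
qed (simp add: func_def)

text \<open>Functions on the base act as scalars in every fibre and so commute with fibrewise linear
  maps; density extends this to the algebra.\<close>

lemma H0_central:
  assumes "z \<in> H 0"
  shows "z * a = a * z"
proof -
  obtain g where g: "continuous_fun (base E) g" "z = func g" using H0_func[OF assms] by blast
  have "(\<lambda>a. z * a) = (\<lambda>a. a * z)"
  proof (rule emb_determines[OF bounded_linear_mult_right bounded_linear_mult_left])
    fix r s t assume t: "t \<in> arrows E r s"
    show "z * emb r s t = emb r s t * z"
      using emb_comp[OF t scalar_in[OF g(1)]] emb_comp[OF scalar_in[OF g(1)] t]
      by (simp add: g(2) emb_scalar[OF g(1)] scalar_comp_left[OF t] scalar_comp_right[OF t])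
  qed
  then show ?thesis by (rule fun_cong)
qed

lemma func_mult:
  assumes "continuous_fun (base E) g" "continuous_fun (base E) h"
  shows "func g * func h = func (\<lambda>x. g x * h x)"
proof -
  have "func g * func h = emb 0 0 (arr_comp (scalar 0 g) (scalar 0 h))"
    unfolding func_def using emb_comp[OF scalar_in[OF assms(2), of 0] scalar_in[OF assms(1)]] by simp
  also have "arr_comp (scalar 0 g) (scalar 0 h) = scalar 0 (\<lambda>x. g x * h x)"
    unfolding scalar_comp_left[OF scalar_in[OF assms(2)]] by (simp add: scalar_def mult.assoc)
  finally show ?thesis by (simp add: func_def)
qed

lemma func_sum:
  assumes "finite I" "\<And>i. i \<in> I \<Longrightarrow> continuous_fun (base E) (g i)"
  shows "(\<Sum>i\<in>I. func (g i)) = func (\<lambda>x. \<Sum>i\<in>I. g i x)"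
  using emb_sum[of I "\<lambda>i. scalar 0 (g i)" 0 0] assms scalar_in
  by (simp add: func_def scalar_def[abs_def] sum_distrib_right)

lemma func_diff:
  assumes g: "continuous_fun (base E) g" and h: "continuous_fun (base E) h"
  shows "func g - func h = func (\<lambda>x. g x - h x)"
  using emb_lincomb[OF scalar_in[OF g, of 0] scalar_in[OF h, of 0], of 1 "-1"]
  by (simp add: func_def scalar_def[abs_def] scaleC_minus1 algebra_simps)

lemma func_cong: "(\<And>x. x \<in> X \<Longrightarrow> g x = h x) \<Longrightarrow> func g = func h"
  unfolding func_def using scalar_cong[of g h] by simp

lemma func_1: "(\<And>x. x \<in> X \<Longrightarrow> g x = 1) \<Longrightarrow> func g = unit"
  using func_cong[of g "\<lambda>_. 1"] by (simp add: func_def unit_def scalar_def[abs_def])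

lemma norm_func_le:
  assumes g: "continuous_fun (base E) g" and C: "0 \<le> C" "\<And>x. x \<in> X \<Longrightarrow> cmod (g x) \<le> C"
  shows "norm (func g) \<le> C"
  unfolding func_def emb_norm[OF scalar_in[OF g]]
  by (rule arr_norm_scalar_le[OF scalar_in[OF g] C(1)]) (simp add: value0_scalar C(2))

lemma le_norm_func:
  assumes g: "continuous_fun (base E) g" and x: "x \<in> X"
  shows "cmod (g x) \<le> norm (func g)"
  unfolding func_def emb_norm[OF scalar_in[OF g]]
  using value0_le_arr_norm[OF scalar_in[OF g] x] by (simp add: value0_scalar x)

text \<open>The frame section \<open>f j\<close> as an arrow from the trivial bundle, given through
  its coordinates against the frame; \<open>sec_pure\<close> confirms that it sends 1 to the tensor
  of \<open>f j x\<close>.\<close>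

definition sec :: "'j \<Rightarrow> ('x, 'e) arrow" where
  "sec j = mat_arrow 0 1 (\<lambda>x is js. pure x [f j x] (fr x js))"

text \<open>Substitutes for the Cuntz isometries: the relation \<open>psi_frame\<close> persists,
  whereas \<open>star (psi i) * psi j\<close> is a Gram function instead of a Kronecker
  delta.\<close>

definition psi :: "'j \<Rightarrow> 'a" where
  "psi j = emb 0 1 (sec j)"

lemma continuous_pure_1:
  assumes "j \<in> J" "js \<in> tuples J 1"
  shows "continuous_fun (base E) (\<lambda>x. pure x [f j x] (fr x js))"
proof -
  have "continuous_fun (subtopology (base E) X) (\<lambda>y. pure y (fr y [j]) (map (\<lambda>v. v y) (map f js)))"
    by (rule continuous_pure_frame[where r = 1])
      (use assms section_frame in \<open>auto simp: tuples_def\<close>)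
  then show ?thesis by (simp add: fr_def o_def)
qed

lemma sec_in: "j \<in> J \<Longrightarrow> sec j \<in> arrows E 0 1"
  unfolding sec_def by (rule mat_arrow_in) (rule continuous_pure_1)

lemma sec_pure:
  assumes x: "x \<in> X" and j: "j \<in> J"
  shows "sec j x (pure x []) ws = pure x [f j x] ws"
proof -
  have "pure x [] \<in> tensor_fibre E 0 x" using pure_in_tensor_fibre[OF x, of "[]" 0] by simp
  moreover have "pure x [f j x] \<in> tensor_fibre E 1 x"
    using pure_in_tensor_fibre[OF x, of "[f j x]" 1] frame_fibre[OF x j] by simp
  ultimately show ?thesis
    using tensor_expand_frame[OF x, of "pure x [f j x]" 1 ws] x
    by (simp add: sec_def mat_arrow_def pure_tensor_Nil)
qed

lemma psi_H: "j \<in> J \<Longrightarrow> psi j \<in> H 1"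
  unfolding psi_def by (intro H_I sec_in)

lemma sum_tuples_1: "(\<Sum>is\<in>tuples J 1. g is) = (\<Sum>j\<in>J. g [j])"
  unfolding One_nat_def sum_tuples_Suc by simp

definition gram :: "'j \<Rightarrow> 'j \<Rightarrow> 'x \<Rightarrow> complex" where
  "gram i j x = herm E (f i x) (f j x)"

lemma continuous_gram: "i \<in> J \<Longrightarrow> j \<in> J \<Longrightarrow> continuous_fun (base E) (gram i j)"
  unfolding gram_def[abs_def]
  using continuous_herm[OF _ section_frame section_frame, of i j] by simp

lemma star_psi_psi:
  assumes i: "i \<in> J" and j: "j \<in> J"
  shows "star (psi i) * psi j = func (gram i j)"
proof -
  note a = arr_adj_in[OF sec_in[OF i]]
  have "arr_comp (arr_adj E 0 1 (sec i)) (sec j) = scalar 0 (gram i j)"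
  proof (rule arrow_eqI[OF arr_comp_in[OF sec_in[OF j] a] scalar_in[OF continuous_gram[OF i j]]])
    fix x and us ws :: "'e list" assume *: "x \<in> X" "length us = 0" "length ws = 0"
    have "arr_comp (arr_adj E 0 1 (sec i)) (sec j) x (pure x []) [] =
      (\<Sum>k\<in>J. sec j x (pure x []) [f k x] * arr_adj E 0 1 (sec i) x (pure x [f k x]) [])"
      using arr_comp_pure[OF sec_in[OF j] a *(1), of "[]" "[]"] by (simp add: sum_tuples_1)
    also have "\<dots> = (\<Sum>k\<in>J. herm E (f k x) (f j x) * cnj (herm E (f k x) (f i x)))"
      using * frame_fibre[OF *(1)] arr_adj_pure[OF sec_in[OF i] *(1)]
      by (intro sum.cong refl) (simp add: sec_pure i j pure_tensor_Cons pure_tensor_Nil)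
    also have "\<dots> = herm E (f i x) (f j x)"
      unfolding parseval[OF *(1) frame_fibre[OF *(1) i] frame_fibre[OF *(1) j]]
      by (intro sum.cong refl)
        (simp add: herm_sym[OF *(1) frame_fibre[OF *(1) i] frame_fibre[OF *(1)]])
    finally show "arr_comp (arr_adj E 0 1 (sec i)) (sec j) x (pure x us) ws = scalar 0 (gram i j) x (pure x us) ws"
      using * by (simp add: scalar_def arr_id_pure pure_tensor_Nil gram_def)
  qed
  then show ?thesis
    using emb_comp[OF sec_in[OF j] a] emb_adj[OF sec_in[OF i]] by (simp add: psi_def func_def)
qed

lemma psi_frame: "(\<Sum>j\<in>J. psi j * star (psi j)) = unit"
proof -
  have c: "arr_comp (sec j) (arr_adj E 0 1 (sec j)) \<in> arrows E 1 1" if "j \<in> J" for j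
    by (rule arr_comp_in[OF arr_adj_in[OF sec_in[OF that]] sec_in[OF that]])
  note S = emb_sum[OF finite_J, of "\<lambda>j. arr_comp (sec j) (arr_adj E 0 1 (sec j))", OF c]
  have "(\<lambda>x \<xi> ws. \<Sum>j\<in>J. arr_comp (sec j) (arr_adj E 0 1 (sec j)) x \<xi> ws) = arr_id E 1"
  proof (rule arrow_eqI[OF S[THEN conjunct1] arr_id_in])
    fix x us ws assume *: "x \<in> X" "set us \<subseteq> fibre E x" "set ws \<subseteq> fibre E x" "length us = 1" "length ws = 1"
    then obtain u w where u: "us = [u]" "u \<in> fibre E x" and w: "ws = [w]" "w \<in> fibre E x"
      by (auto simp: One_nat_def length_Suc_conv)
    have "arr_comp (sec j) (arr_adj E 0 1 (sec j)) x (pure x us) ws = herm E w (f j x) * herm E (f j x) u"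
      if j: "j \<in> J" for j
    proof -
      have "arr_comp (sec j) (arr_adj E 0 1 (sec j)) x (pure x us) ws =
        arr_adj E 0 1 (sec j) x (pure x us) [] * sec j x (pure x []) ws"
        using arr_comp_pure[OF arr_adj_in[OF sec_in[OF j]] sec_in[OF j] *(1,2,4), of ws] by simp
      also have "\<dots> = cnj (herm E u (f j x)) * herm E w (f j x)"
        using arr_adj_pure[OF sec_in[OF j] *(1,2,4), of "[]"] u w
        by (simp add: sec_pure[OF *(1) j] pure_tensor_Cons pure_tensor_Nil)
      finally show ?thesis
        using herm_sym[OF *(1) u(2) frame_fibre[OF *(1) j]] by (simp add: mult.commute)
    qed
    then have "(\<Sum>j\<in>J. arr_comp (sec j) (arr_adj E 0 1 (sec j)) x (pure x us) ws) = herm E w u"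
      using parseval[OF *(1) w(2) u(2)] by simp
    then show "(\<Sum>j\<in>J. arr_comp (sec j) (arr_adj E 0 1 (sec j)) x (pure x us) ws) = arr_id E 1 x (pure x us) ws"
      using u w arr_id_pure[OF *(1,2,4)] by (simp add: pure_tensor_Cons pure_tensor_Nil)
  qed
  then have "(\<Sum>j\<in>J. emb 1 1 (arr_comp (sec j) (arr_adj E 0 1 (sec j)))) = unit"
    using S[THEN conjunct2] emb_id by simp
  moreover have "emb 1 1 (arr_comp (sec j) (arr_adj E 0 1 (sec j))) = psi j * star (psi j)" if "j \<in> J" for j
    using emb_comp[OF arr_adj_in[OF sec_in[OF that]] sec_in[OF that]] emb_adj[OF sec_in[OF that]]
    by (simp add: psi_def)
  ultimately show ?thesis by simp
qed

fun word :: "'j list \<Rightarrow> 'a" where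
  "word [] = unit"
| "word (j # is) = psi j * word is"

lemma unit_H0: "unit \<in> H 0"
  unfolding unit_def by (rule H_I[OF arr_id_in])

lemma word_H: "is \<in> tuples J r \<Longrightarrow> word is \<in> H r"
proof (induction "is" arbitrary: r)
  case (Cons j "is")
  then obtain r' where r': "r = 1 + r'" "is \<in> tuples J r'" by (auto simp: tuples_def)
  show ?case using H_mult[OF psi_H Cons.IH[OF r'(2)], of j] Cons.prems by (simp add: r'(1) tuples_def)
qed (simp add: tuples_def unit_H0)

lemma word_append: "word (is @ js) = word is * word js"
  by (induction "is") (simp_all add: unit_left mult.assoc)

lemma word_frame: "(\<Sum>is\<in>tuples J r. word is * star (word is)) = unit"
proof (induction r)
  case 0
  show ?case by (simp add: star_unit unit_left)
next
  case (Suc r)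
  have "(\<Sum>is\<in>tuples J (Suc r). word is * star (word is)) =
    (\<Sum>j\<in>J. psi j * (\<Sum>is\<in>tuples J r. word is * star (word is)) * star (psi j))"
    by (simp add: sum_tuples_Suc star_mult sum_distrib_left sum_distrib_right mult.assoc)
  also have "\<dots> = unit" unfolding Suc.IH by (simp add: unit_right psi_frame)
  finally show ?case .
qed

lemma word_frame_left: "(\<Sum>is\<in>tuples J r. word is * (star (word is) * a)) = a"
  using arg_cong[OF word_frame[of r], of "\<lambda>u. u * a"] by (simp add: sum_distrib_right unit_left mult.assoc)

lemma word_frame_right: "(\<Sum>is\<in>tuples J r. a * word is * star (word is)) = a"
  using arg_cong[OF word_frame[of r], of "\<lambda>u. a * u"] by (simp add: sum_distrib_left unit_right mult.assoc)

text \<open>The canonical shift, \<open>a \<mapsto> 1 \<otimes> a\<close> with an identity on \<open>m\<close> tensor factors.\<close>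

definition shift :: "nat \<Rightarrow> 'a \<Rightarrow> 'a" where
  "shift m a = (\<Sum>is\<in>tuples J m. word is * a * star (word is))"

text \<open>The coefficients \<open>star (word is) * \<eta>\<close> are functions on the base, so
  \<open>a\<close> can be moved past them; the words then reassemble \<open>\<eta>\<close>.\<close>

lemma shift_H:
  assumes \<eta>: "\<eta> \<in> H m"
  shows "shift m a * \<eta> = \<eta> * a"
proof -
  have "shift m a * \<eta> = (\<Sum>is\<in>tuples J m. word is * (a * (star (word is) * \<eta>)))"
    by (simp add: shift_def sum_distrib_right mult.assoc)
  also have "\<dots> = (\<Sum>is\<in>tuples J m. word is * (star (word is) * (\<eta> * a)))"
  proof (intro sum.cong refl)
    fix "is" assume "is \<in> tuples J m"
    then have "star (word is) * \<eta> \<in> H 0" using star_H_mult[OF word_H, of "is" m \<eta> 0] \<eta> by simp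
    from H0_central[OF this, of a]
    show "word is * (a * (star (word is) * \<eta>)) = word is * (star (word is) * (\<eta> * a))"
      by (simp add: mult.assoc)
  qed
  also have "\<dots> = \<eta> * a" by (rule word_frame_left)
  finally show ?thesis .
qed

lemma shift_eqI:
  assumes "\<And>is. is \<in> tuples J m \<Longrightarrow> b * word is = word is * a"
  shows "b = shift m a"
proof -
  have "b = (\<Sum>is\<in>tuples J m. b * word is * star (word is))" by (rule word_frame_right[symmetric])
  also have "\<dots> = shift m a" unfolding shift_def using assms by (intro sum.cong refl) simp
  finally show ?thesis .
qed

lemma shift_mult: "shift m (a * b) = shift m a * shift m b"
proof (rule shift_eqI[symmetric])
  fix "is" assume "is \<in> tuples J m"
  note S = shift_H[OF word_H[OF this]]
  show "shift m a * shift m b * word is = word is * (a * b)"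
    by (simp add: S mult.assoc) (simp add: S mult.assoc[symmetric])
qed

lemma shift_unit: "shift m unit = unit"
  by (rule shift_eqI[symmetric]) (simp add: unit_left unit_right)

lemma star_shift: "star (shift m a) = shift m (star a)"
  by (simp add: shift_def star_sum star_mult star_star mult.assoc)

lemma star_hom_shift: "star_hom (shift m)"
  unfolding star_hom_def shift_mult star_shift
  by (simp add: shift_def sum.distrib distrib_left distrib_right scaleC_sum_right mult_scaleC_left mult_scaleC_right)

lemma norm_shift_le: "norm (shift m a) \<le> norm a"
  by (rule star_hom_contractive[OF star_hom_shift, of unit]) (simp_all add: unit_left unit_right shift_unit)

lemma shift_shift: "shift (j + k) a = shift j (shift k a)"
  by (simp add: shift_def sum_tuples_append word_append star_mult sum_distrib_left sum_distrib_right mult.assoc)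

lemma shift_central: "z \<in> H 0 \<Longrightarrow> shift m z = z"
  by (rule shift_eqI[symmetric]) (rule H0_central)

text \<open>The arrow acts on the first tensor factors, the shifted element behind them; only the
  number of factors in front changes, from \<open>r\<close> to \<open>s\<close>.\<close>

lemma emb_shift:
  assumes t: "t \<in> arrows E r s"
  shows "emb r s t * shift r b = shift s b * emb r s t"
proof -
  have "shift s b * emb r s t = (\<Sum>is\<in>tuples J r. shift s b * (emb r s t * word is) * star (word is))"
    using word_frame_right[of "shift s b * emb r s t" r] by (simp add: mult.assoc)
  also have "\<dots> = (\<Sum>is\<in>tuples J r. emb r s t * (word is * b * star (word is)))"
    using shift_H[OF emb_H[OF t word_H]] by (intro sum.cong refl) (simp add: mult.assoc)
  finally show ?thesis by (simp add: shift_def sum_distrib_left)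
qed

text \<open>The exchange of two blocks of \<open>r\<close> tensor factors.\<close>

definition flip :: "nat \<Rightarrow> 'a" where
  "flip r = (\<Sum>js\<in>tuples J r. shift r (word js) * star (word js))"

text \<open>By definition this holds for words. It extends to \<open>H r\<close> because the
  coefficients of \<open>\<phi>\<close> against words are functions on the base, which the shift
  leaves unchanged.\<close>

lemma flip_shift:
  assumes \<phi>: "\<phi> \<in> H r"
  shows "flip r * \<phi> = shift r \<phi>"
proof -
  have "flip r * \<phi> = (\<Sum>js\<in>tuples J r. shift r (word js * (star (word js) * \<phi>)))"
    unfolding flip_def sum_distrib_right
  proof (intro sum.cong refl)
    fix js assume "js \<in> tuples J r"
    then have "star (word js) * \<phi> \<in> H 0" using star_H_mult[OF word_H, of js r \<phi> 0] \<phi> by simp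
    from shift_central[OF this]
    show "shift r (word js) * star (word js) * \<phi> = shift r (word js * (star (word js) * \<phi>))"
      unfolding shift_mult[of r "word js" "star (word js) * \<phi>"] by (simp add: mult.assoc)
  qed
  also have "\<dots> = shift r (\<Sum>js\<in>tuples J r. word js * (star (word js) * \<phi>))"
    by (simp add: star_hom_sum[OF star_hom_shift])
  finally show ?thesis by (simp add: word_frame_left)
qed

lemma flip_H: "\<phi> \<in> H r \<Longrightarrow> \<omega> \<in> H r \<Longrightarrow> flip r * (\<phi> * \<omega>) = \<omega> * \<phi>"
  using flip_shift[of \<phi> r] shift_H[of \<omega> r \<phi>] by (simp add: mult.assoc[symmetric])

text \<open>Expanding the shift gives a double sum that the adjoint changes only by exchanging the
  two summation indices.\<close>

lemma star_flip: "star (flip r) = flip r"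
proof -
  have "star (flip r) = (\<Sum>js\<in>tuples J r. \<Sum>is\<in>tuples J r. word js * (word is * (star (word js) * star (word is))))"
    by (simp add: flip_def star_sum star_mult star_star star_shift)
      (simp add: shift_def sum_distrib_left mult.assoc)
  also have "\<dots> = (\<Sum>is\<in>tuples J r. \<Sum>js\<in>tuples J r. word js * (word is * (star (word js) * star (word is))))"
    by (rule sum.swap)
  also have "\<dots> = flip r" by (simp add: flip_def shift_def sum_distrib_right mult.assoc)
  finally show ?thesis .
qed

lemma flip_of_shift:
  assumes \<phi>: "\<phi> \<in> H r"
  shows "flip r * shift r \<phi> = \<phi>"
proof -
  have "flip r * shift r \<phi> = (\<Sum>is\<in>tuples J r. flip r * shift r \<phi> * word is * star (word is))"
    by (rule word_frame_right[symmetric])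
  also have "\<dots> = (\<Sum>is\<in>tuples J r. \<phi> * word is * star (word is))"
    using shift_H[OF word_H] flip_H[OF word_H \<phi>] by (intro sum.cong refl) (simp add: mult.assoc)
  also have "\<dots> = \<phi>" by (rule word_frame_right)
  finally show ?thesis .
qed

lemma flip_flip: "flip r * flip r = unit"
proof -
  have "flip r * flip r = (\<Sum>js\<in>tuples J r. flip r * shift r (word js) * star (word js))"
    by (subst (2) flip_def) (simp add: sum_distrib_left mult.assoc)
  also have "\<dots> = unit" using flip_of_shift[OF word_H] word_frame[of r] by simp
  finally show ?thesis .
qed

lemma norm_flip: "norm (flip r) \<le> 1"
proof -
  have "(norm (flip r))\<^sup>2 \<le> 1" using cstar_identity[of "flip r"] norm_unit by (simp add: star_flip flip_flip)
  then show ?thesis by (simp add: power_le_one_iff)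
qed

lemma star_hom_word_frame:
  assumes \<beta>: "star_hom \<beta>" "\<beta> unit = unit"
  shows "(\<Sum>is\<in>tuples J r. \<beta> (word is) * star (\<beta> (word is))) = unit"
  using arg_cong[OF word_frame[of r], of \<beta>] \<beta>(2)
  by (simp add: star_hom_sum[OF \<beta>(1)] star_hom_mult[OF \<beta>(1)] star_hom_star[OF \<beta>(1)])

text \<open>The images of the words under \<open>\<beta>\<close> are again elements of
  \<open>H m\<close> resolving the unit, and the shift can be computed with any such family. For
  \<open>\<beta>\<close> coming from a unitary, this and the analogue for \<open>flip\<close> make
  the shifted flips invariant.\<close>

lemma star_hom_of_shift:
  assumes \<beta>: "star_hom \<beta>" "\<beta> unit = unit" and H: "\<beta> ` H m \<subseteq> H m"
  shows "\<beta> (shift m a) = shift m (\<beta> a)"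
proof -
  have "shift m (\<beta> a) = shift m (\<beta> a) * (\<Sum>is\<in>tuples J m. \<beta> (word is) * star (\<beta> (word is)))"
    using star_hom_word_frame[OF \<beta>] unit_right by simp
  also have "\<dots> = (\<Sum>is\<in>tuples J m. \<beta> (word is) * \<beta> a * star (\<beta> (word is)))"
    unfolding sum_distrib_left using shift_H[OF subsetD[OF H imageI[OF word_H]]]
    by (intro sum.cong refl) (simp add: mult.assoc[symmetric])
  also have "\<dots> = \<beta> (shift m a)"
    by (simp add: shift_def star_hom_sum[OF \<beta>(1)] star_hom_mult[OF \<beta>(1)] star_hom_star[OF \<beta>(1)])
  finally show ?thesis by simp
qed

lemma star_hom_flip:
  assumes \<beta>: "star_hom \<beta>" "\<beta> unit = unit" and H: "\<beta> ` H r \<subseteq> H r"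
  shows "\<beta> (flip r) = flip r"
proof -
  have "flip r = flip r * (\<Sum>is\<in>tuples J r. \<beta> (word is) * star (\<beta> (word is)))"
    using star_hom_word_frame[OF \<beta>] unit_right by simp
  also have "\<dots> = (\<Sum>is\<in>tuples J r. shift r (\<beta> (word is)) * star (\<beta> (word is)))"
    unfolding sum_distrib_left using flip_shift[OF subsetD[OF H imageI[OF word_H]]]
    by (intro sum.cong refl) (simp add: mult.assoc[symmetric])
  also have "\<dots> = \<beta> (flip r)"
    by (simp add: flip_def star_hom_sum[OF \<beta>(1)] star_hom_mult[OF \<beta>(1)] star_hom_star[OF \<beta>(1)]
        star_hom_of_shift[OF \<beta> H])
  finally show ?thesis by simp
qed

section \<open>Calculus of homogeneous elements\<close>

lemma graded_large:
  assumes "a \<in> graded_part E emb k"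
  shows "\<exists>r0. \<forall>r\<ge>r0. \<exists>s. \<exists>t\<in>arrows E r s. int s = int r + k \<and> a = emb r s t"
proof -
  obtain r0 s0 t where t: "t \<in> arrows E r0 s0" "int s0 - int r0 = k" "a = emb r0 s0 t"
    using assms unfolding graded_part_def by blast
  show ?thesis
  proof (rule exI[of _ r0], intro allI impI)
    fix r assume "r0 \<le> r"
    then obtain m where m: "r = r0 + m" using le_iff_add by blast
    obtain t' where t': "t' \<in> arrows E (r0 + m) (s0 + m)" "emb (r0 + m) (s0 + m) t' = a"
      using emb_raise'[OF t(1), of m] t(3) by auto
    have "int (s0 + m) = int r + k" using t(2) m by simp
    moreover have "a = emb r (s0 + m) t'" "t' \<in> arrows E r (s0 + m)" using t' by (simp_all add: m)
    ultimately show "\<exists>s. \<exists>t\<in>arrows E r s. int s = int r + k \<and> a = emb r s t" by blast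
  qed
qed

lemma gradedI: "t \<in> arrows E r s \<Longrightarrow> int s - int r = k \<Longrightarrow> emb r s t \<in> graded_part E emb k"
  unfolding graded_part_def by blast

lemma graded_lincomb:
  assumes "a \<in> graded_part E emb k" "b \<in> graded_part E emb k"
  shows "scaleC c a + scaleC c' b \<in> graded_part E emb k"
proof -
  obtain r0 r0' where r0: "\<forall>r\<ge>r0. \<exists>s. \<exists>t\<in>arrows E r s. int s = int r + k \<and> a = emb r s t"
    "\<forall>r\<ge>r0'. \<exists>s. \<exists>t\<in>arrows E r s. int s = int r + k \<and> b = emb r s t"
    using graded_large[OF assms(1)] graded_large[OF assms(2)] by blast
  define r where "r = max r0 r0'"
  have "r0 \<le> r" "r0' \<le> r" by (simp_all add: r_def)
  obtain s t where t: "t \<in> arrows E r s" "int s = int r + k" "a = emb r s t" using r0(1) \<open>r0 \<le> r\<close> by blast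
  obtain s' t' where t': "t' \<in> arrows E r s'" "int s' = int r + k" "b = emb r s' t'" using r0(2) \<open>r0' \<le> r\<close> by blast
  have s: "s' = s" using t(2) t'(2) by simp
  show ?thesis
    using gradedI[OF arrows_lincomb[OF t(1) t'(1)[unfolded s]], of k c c']
      emb_lincomb[OF t(1) t'(1)[unfolded s], of c c'] t t' s by simp
qed

lemma graded_zero: "0 \<in> graded_part E emb k"
  using gradedI[OF arrows_zero, of "nat k" "nat (- k)" k]
    emb_lincomb[OF arrows_zero arrows_zero, of "nat (- k)" "nat k" 0 0] by simp

lemma graded_diff:
  "a \<in> graded_part E emb k \<Longrightarrow> b \<in> graded_part E emb k \<Longrightarrow> a - b \<in> graded_part E emb k"
  using graded_lincomb[of a k b 1 "-1"] by (simp add: scaleC_minus1)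

lemma graded_sum:
  "(\<And>i. i \<in> I \<Longrightarrow> a i \<in> graded_part E emb k) \<Longrightarrow> (\<Sum>i\<in>I. a i) \<in> graded_part E emb k"
proof (induction I rule: infinite_finite_induct)
  case (insert i I)
  then show ?case using graded_lincomb[of "a i" k "\<Sum>i\<in>I. a i" 1 1] by simp
qed (simp_all add: graded_zero)

lemma graded_mult:
  assumes "a \<in> graded_part E emb j" "b \<in> graded_part E emb k"
  shows "a * b \<in> graded_part E emb (j + k)"
proof -
  obtain r0 r0' where r0: "\<forall>r\<ge>r0. \<exists>s. \<exists>t\<in>arrows E r s. int s = int r + j \<and> a = emb r s t"
    "\<forall>r\<ge>r0'. \<exists>s. \<exists>t\<in>arrows E r s. int s = int r + k \<and> b = emb r s t"
    using graded_large[OF assms(1)] graded_large[OF assms(2)] by blast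
  \<comment> \<open>The source is at least \<open>r0'\<close>, and after adding \<open>k\<close> the
    target is still at least \<open>r0\<close>, so the left factor can be represented with exactly
    this target as its source.\<close>
  obtain s t where t: "t \<in> arrows E (r0' + (r0 + nat (- k))) s" "int s = int (r0' + (r0 + nat (- k))) + k"
    "b = emb (r0' + (r0 + nat (- k))) s t" using r0(2)[rule_format, of "r0' + (r0 + nat (- k))"] by auto
  have "r0 \<le> s" using t(2) by linarith
  then obtain s' t' where t': "t' \<in> arrows E s s'" "int s' = int s + j" "a = emb s s' t'" using r0(1) by blast
  show ?thesis
    using gradedI[OF arr_comp_in[OF t(1) t'(1)], of "j + k"] emb_comp[OF t(1) t'(1)] t t' by simp
qed

lemma graded_star: "a \<in> graded_part E emb k \<Longrightarrow> star a \<in> graded_part E emb (- k)"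
proof -
  assume "a \<in> graded_part E emb k"
  then obtain r s t where t: "t \<in> arrows E r s" "int s - int r = k" "a = emb r s t" unfolding graded_part_def by blast
  then show ?thesis using gradedI[OF arr_adj_in[OF t(1)], of "- k"] emb_adj[OF t(1)] by simp
qed

lemma graded_H: "\<phi> \<in> H r \<Longrightarrow> \<phi> \<in> graded_part E emb (int r)"
  using H_E[of \<phi> r] gradedI[of _ 0 r "int r"] by auto

lemma graded_shift:
  assumes "a \<in> graded_part E emb k"
  shows "shift m a \<in> graded_part E emb k"
  unfolding shift_def
proof (rule graded_sum)
  fix "is" assume "is \<in> tuples J m"
  then have w: "word is \<in> graded_part E emb (int m)" by (intro graded_H word_H)
  show "word is * a * star (word is) \<in> graded_part E emb k"
    using graded_mult[OF graded_mult[OF w assms] graded_star[OF w]] by simp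
qed

lemma graded_flip: "flip r \<in> graded_part E emb 0"
  unfolding flip_def
proof (rule graded_sum)
  fix "is" assume "is \<in> tuples J r"
  then have w: "word is \<in> graded_part E emb (int r)" by (intro graded_H word_H)
  show "shift r (word is) * star (word is) \<in> graded_part E emb 0"
    using graded_mult[OF graded_shift[OF w] graded_star[OF w]] by simp
qed

end

section \<open>Intertwiners of the shift\<close>

context cp_algebra
begin

section \<open>The Gram matrix of the frame\<close>

definition rho :: "'j \<Rightarrow> 'x \<Rightarrow> real" where
  "rho j x = Re (gram j j x)"

lemma gram_rho: "x \<in> X \<Longrightarrow> j \<in> J \<Longrightarrow> gram j j x = of_real (rho j x)"
  unfolding rho_def gram_def
  using herm_sym[OF _ frame_fibre frame_fibre, of x j j] by (simp add: complex_eq_iff)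

lemma rho_nonneg: "x \<in> X \<Longrightarrow> j \<in> J \<Longrightarrow> 0 \<le> rho j x"
  unfolding rho_def gram_def using herm_nonneg frame_fibre by blast

lemma continuous_rho: "j \<in> J \<Longrightarrow> continuous_fun (base E) (rho j)"
  unfolding rho_def[abs_def] by (intro continuous_fun_Re continuous_gram)

lemma sum_rho: "x \<in> X \<Longrightarrow> (\<Sum>j\<in>J. rho j x) = real d"
  using trace_frame[of x] unfolding rho_def gram_def by (metis Re_sum of_real_of_nat_eq Re_complex_of_real)

lemma gram_cauchy_schwarz:
  assumes x: "x \<in> X" and i: "i \<in> J" and j: "j \<in> J"
  shows "(cmod (gram i j x))\<^sup>2 \<le> rho i x * rho j x"
proof -
  note fi = frame_fibre[OF x i] and fj = frame_fibre[OF x j]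
  have sym: "gram j i x = cnj (gram i j x)" using herm_sym[OF x fi fj] by (simp add: gram_def)
  have gg: "gram i j x * cnj (gram i j x) = of_real ((cmod (gram i j x))\<^sup>2)"
    by (rule complex_norm_square[symmetric])
  have gen: "0 \<le> (cmod a)\<^sup>2 * rho i x + 2 * Re (cnj a * b * gram i j x) + (cmod b)\<^sup>2 * rho j x" for a b
  proof -
    define w where "w = vadd E (vscale E a (f i x)) (vscale E b (f j x))"
    note ai = vscale_fibre[OF x fi, of a] and bj = vscale_fibre[OF x fj, of b]
    have w: "w \<in> fibre E x" unfolding w_def by (rule vadd_fibre[OF x ai bj])
    have "herm E w w = cnj a * (a * gram i i x + b * gram i j x) + cnj b * (a * gram j i x + b * gram j j x)"
      unfolding w_def
      by (simp add: herm_vadd_left[OF x ai bj vadd_fibre[OF x ai bj]] herm_vadd[OF x _ ai bj] ai bj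
          herm_vscale_left[OF x _ ] herm_vscale[OF x] fi fj gram_def algebra_simps)
    also have "\<dots> = of_real ((cmod a)\<^sup>2 * rho i x + (cmod b)\<^sup>2 * rho j x) +
        of_real (2 * Re (cnj a * b * gram i j x))"
      unfolding complex_add_cnj[symmetric]
      unfolding gram_rho[OF x i] gram_rho[OF x j] sym of_real_add of_real_mult complex_norm_square
      by (simp add: algebra_simps)
    finally have "Re (herm E w w) = (cmod a)\<^sup>2 * rho i x + (cmod b)\<^sup>2 * rho j x + 2 * Re (cnj a * b * gram i j x)"
      by (simp only: plus_complex.sel Re_complex_of_real)
    then show ?thesis using herm_nonneg[OF x w] by simp
  qed
  have r: "0 \<le> rho i x" "0 \<le> rho j x" using rho_nonneg x i j by auto
  show ?thesis
  proof (cases "rho j x = 0")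
    case False
    then have p: "rho j x > 0" using r by simp
    \<comment> \<open>The usual minimising coefficients, cleared of their denominator.\<close>
    have "0 \<le> (cmod (of_real (rho j x)))\<^sup>2 * rho i x +
      2 * Re (cnj (of_real (rho j x)) * (- cnj (gram i j x)) * gram i j x) + (cmod (- cnj (gram i j x)))\<^sup>2 * rho j x"
      by (rule gen)
    also have "cnj (of_real (rho j x)) * (- cnj (gram i j x)) * gram i j x = of_real (- (rho j x * (cmod (gram i j x))\<^sup>2))"
      using gg by (simp add: mult_ac)
    finally have "0 \<le> rho j x * (rho i x * rho j x - (cmod (gram i j x))\<^sup>2)"
      by (simp add: algebra_simps power2_eq_square)
    then show ?thesis using p by (simp add: zero_le_mult_iff)
  next
    case True
    define c where "c = (cmod (gram i j x))\<^sup>2"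
    have c: "0 \<le> c" by (simp add: c_def)
    \<comment> \<open>In the degenerate case nonnegativity leaves an affine function of
      \<open>s\<close> that is bounded below on the whole line, so its slope \<open>c\<close> must
      vanish.\<close>
    have ineq: "0 \<le> rho i x - 2 * (s * c)" for s
    proof -
      have "0 \<le> (cmod 1)\<^sup>2 * rho i x + 2 * Re (cnj 1 * (- of_real s * cnj (gram i j x)) * gram i j x) +
        (cmod (- of_real s * cnj (gram i j x)))\<^sup>2 * rho j x" by (rule gen)
      also have "cnj 1 * (- of_real s * cnj (gram i j x)) * gram i j x = of_real (- (s * c))"
        using gg by (simp add: c_def mult_ac)
      finally show ?thesis using True by simp
    qed
    have "c = 0"
    proof (rule ccontr)
      assume "c \<noteq> 0"
      then show False using ineq[of "(rho i x + 1) / (2 * c)"] by simp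
    qed
    then show ?thesis using r True by (simp add: c_def)
  qed
qed

text \<open>If all Gram determinants vanished, then summing \<open>\<rho>\<^sub>i \<rho>\<^sub>j = \<bar>g\<^sub>i\<^sub>j\<bar>\<^sup>2\<close> would give \<open>d\<^sup>2 = d\<close>.\<close>

lemma gram_determinant_pos:
  assumes x: "x \<in> X"
  shows "0 < (\<Sum>i\<in>J. \<Sum>j\<in>J. rho j x ^ l * (rho i x * rho j x - (cmod (gram i j x))\<^sup>2))"
proof -
  have nonneg: "0 \<le> rho j x ^ l * (rho i x * rho j x - (cmod (gram i j x))\<^sup>2)" if "i \<in> J" "j \<in> J" for i j
    using gram_cauchy_schwarz[OF x that] rho_nonneg[OF x that(2)] by simp
  have sum_nonneg': "0 \<le> (\<Sum>j\<in>J. rho j x ^ l * (rho i x * rho j x - (cmod (gram i j x))\<^sup>2))" if "i \<in> J" for i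
    using nonneg[OF that] by (intro sum_nonneg)
  show ?thesis
  proof (rule ccontr)
    assume "\<not> ?thesis"
    moreover have "0 \<le> (\<Sum>i\<in>J. \<Sum>j\<in>J. rho j x ^ l * (rho i x * rho j x - (cmod (gram i j x))\<^sup>2))"
      by (intro sum_nonneg sum_nonneg')
    ultimately have z0: "(\<Sum>i\<in>J. \<Sum>j\<in>J. rho j x ^ l * (rho i x * rho j x - (cmod (gram i j x))\<^sup>2)) = 0"
      by linarith
    have z1: "(\<Sum>j\<in>J. rho j x ^ l * (rho i x * rho j x - (cmod (gram i j x))\<^sup>2)) = 0" if "i \<in> J" for i
      by (rule sum_nonneg_0[OF finite_J _ z0 that]) (rule sum_nonneg')
    have z: "rho j x ^ l * (rho i x * rho j x - (cmod (gram i j x))\<^sup>2) = 0" if "i \<in> J" "j \<in> J" for i j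
      by (rule sum_nonneg_0[OF finite_J _ z1[OF that(1)] that(2)]) (rule nonneg[OF that(1)])
    \<comment> \<open>The weight can hide a nonzero determinant only where
      \<open>rho j x = 0\<close>, and there Cauchy-Schwarz makes both sides 0.\<close>
    have eq: "rho i x * rho j x = (cmod (gram i j x))\<^sup>2" if "i \<in> J" "j \<in> J" for i j
    proof (cases "rho j x = 0")
      case True
      then show ?thesis using gram_cauchy_schwarz[OF x that] by simp
    next
      case False
      then show ?thesis using z[OF that] by simp
    qed
    have "real d * real d = (\<Sum>i\<in>J. \<Sum>j\<in>J. rho i x * rho j x)"
      unfolding sum_rho[OF x, symmetric] sum_product ..
    also have "\<dots> = (\<Sum>i\<in>J. \<Sum>j\<in>J. (cmod (gram i j x))\<^sup>2)" using eq by (intro sum.cong refl) auto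
    also have "\<dots> = (\<Sum>i\<in>J. rho i x)"
    proof (intro sum.cong refl)
      fix i assume i: "i \<in> J"
      have "complex_of_real (rho i x) = (\<Sum>j\<in>J. gram i j x * gram j i x)"
        unfolding gram_rho[OF x i, symmetric] unfolding gram_def
        by (rule parseval[OF x frame_fibre[OF x i] frame_fibre[OF x i]])
      also have "\<dots> = (\<Sum>j\<in>J. of_real ((cmod (gram i j x))\<^sup>2))"
      proof (intro sum.cong refl)
        fix j assume "j \<in> J"
        then have "gram j i x = cnj (gram i j x)"
          using herm_sym[OF x frame_fibre[OF x i] frame_fibre[OF x], of j] by (simp add: gram_def)
        then show "gram i j x * gram j i x = of_real ((cmod (gram i j x))\<^sup>2)" by (simp only: complex_norm_square)
      qed
      finally have "complex_of_real (rho i x) = of_real (\<Sum>j\<in>J. (cmod (gram i j x))\<^sup>2)" by simp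
      then show "(\<Sum>j\<in>J. (cmod (gram i j x))\<^sup>2) = rho i x" by (simp only: of_real_eq_iff)
    qed
    finally have "real d * real d = real d" using sum_rho[OF x] by simp
    then show False using rank by simp
  qed
qed

lemma sum_rho_power_pos:
  assumes x: "x \<in> X"
  shows "0 < (\<Sum>j\<in>J. rho j x ^ r)"
proof -
  have "\<exists>j\<in>J. rho j x \<noteq> 0"
  proof (rule ccontr)
    assume "\<not> (\<exists>j\<in>J. rho j x \<noteq> 0)"
    then have "(\<Sum>j\<in>J. rho j x) = 0" by simp
    then show False using sum_rho[OF x] rank by simp
  qed
  then obtain j where j: "j \<in> J" "rho j x \<noteq> 0" by blast
  then have "0 < rho j x ^ r" using rho_nonneg[OF x j(1)] by simp
  then show ?thesis
    by (rule sum_pos2[OF finite_J j(1)]) (use rho_nonneg[OF x] in simp)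
qed

definition pw :: "'j \<Rightarrow> nat \<Rightarrow> 'a" where
  "pw j r = word (replicate r j)"

lemma pw_H: "j \<in> J \<Longrightarrow> pw j r \<in> H r"
  unfolding pw_def by (rule word_H) (auto simp: tuples_def)

lemma pw_Suc: "pw j (Suc r) = psi j * pw j r"
  by (simp add: pw_def)

text \<open>Splits off the last two factors, the ones on which the shifted transposition acts in
  \<open>ex_flip_separation\<close>.\<close>

lemma pw_Suc2: "pw j (Suc (Suc r)) = pw j r * (psi j * psi j)"
proof -
  have "replicate (Suc (Suc r)) j = replicate r j @ [j, j]"
    by (metis replicate_append_same replicate_Suc append_Cons append_assoc append_Nil)
  then show ?thesis unfolding pw_def by (simp add: word_append unit_right del: replicate_Suc)
qed

lemma pw_pw:
  assumes j: "j \<in> J"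
  shows "star (pw j r) * pw j r = func (\<lambda>x. of_real (rho j x ^ r))"
proof (induction r)
  case 0
  show ?case by (simp add: pw_def star_unit unit_left func_1)
next
  case (Suc r)
  have g: "continuous_fun (base E) (gram j j)" using continuous_gram[OF j j] .
  have p: "continuous_fun (base E) (\<lambda>x. complex_of_real (rho j x ^ r))"
    by (intro continuous_fun_of_real continuous_map_real_pow continuous_rho j)
  have "star (pw j (Suc r)) * pw j (Suc r) = star (pw j r) * ((star (psi j) * psi j) * pw j r)"
    by (simp add: pw_Suc star_mult mult.assoc)
  also have "(star (psi j) * psi j) * pw j r = pw j r * func (gram j j)"
    unfolding star_psi_psi[OF j j] by (rule H0_central[OF func_H0[OF g]])
  also have "star (pw j r) * \<dots> = func (\<lambda>x. of_real (rho j x ^ r)) * func (gram j j)"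
    unfolding Suc[symmetric] by (simp only: mult.assoc)
  also have "\<dots> = func (\<lambda>x. of_real (rho j x ^ r) * gram j j x)" by (rule func_mult[OF p g])
  also have "\<dots> = func (\<lambda>x. of_real (rho j x ^ Suc r))"
    by (rule func_cong) (simp add: gram_rho j mult.commute)
  finally show ?case .
qed

text \<open>Normalised powers of the frame vectors. Their number does not depend on \<open>r\<close>.\<close>

lemma ex_row_isometry:
  "\<exists>\<phi>. (\<forall>j\<in>J. \<phi> j \<in> H r \<and> norm (\<phi> j) \<le> 1) \<and> (\<Sum>j\<in>J. star (\<phi> j) * \<phi> j) = unit"
proof -
  define S where "S x = (\<Sum>j\<in>J. rho j x ^ r)" for x
  have S_pos: "0 < S x" if "x \<in> X" for x unfolding S_def by (rule sum_rho_power_pos[OF that])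
  have S_cont: "continuous_fun (base E) S"
    unfolding S_def[abs_def] by (intro continuous_map_sum continuous_map_real_pow continuous_rho finite_J)
  \<comment> \<open>The squares of the powers \<open>pw j r\<close> are the functions
    \<open>rho j x ^ r\<close>; dividing by the root of their sum makes the squares add up to the
    unit. The sum is positive because some frame vector is nonzero at each point.\<close>
  define w where "w x = 1 / sqrt (S x)" for x
  have w_cont: "continuous_fun (base E) (\<lambda>x. complex_of_real (w x))"
    unfolding w_def
    by (intro continuous_fun_of_real continuous_fun_divide continuous_fun_sqrt S_cont) (use S_pos in force)+
  define \<phi> where "\<phi> j = pw j r * func (\<lambda>x. of_real (w x))" for j
  have star_w: "star (func (\<lambda>x. of_real (w x))) = func (\<lambda>x. of_real (w x))"
  proof -
    have "arr_adj E 0 0 (scalar 0 (\<lambda>x. of_real (w x))) = scalar 0 (\<lambda>x. of_real (w x))"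
    proof (rule arrow_eqI[OF arr_adj_in[OF scalar_in[OF w_cont]] scalar_in[OF w_cont]])
      fix x and us ws :: "'e list" assume *: "x \<in> X" "length us = 0" "length ws = 0"
      show "arr_adj E 0 0 (scalar 0 (\<lambda>x. complex_of_real (w x))) x (pure x us) ws =
        scalar 0 (\<lambda>x. complex_of_real (w x)) x (pure x us) ws"
        using arr_adj_pure[OF scalar_in[OF w_cont] *(1), of us 0 ws] *
        by (simp add: scalar_def arr_id_pure pure_tensor_Nil)
    qed
    then show ?thesis using emb_adj[OF scalar_in[OF w_cont], of 0] by (simp add: func_def)
  qed
  have H: "\<phi> j \<in> H r" if "j \<in> J" for j
    unfolding \<phi>_def using H_mult[OF pw_H[OF that] func_H0[OF w_cont], of r] by simp
  have p_cont: "continuous_fun (base E) (\<lambda>x. complex_of_real (rho j x ^ r))" if "j \<in> J" for j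
    by (intro continuous_fun_of_real continuous_map_real_pow continuous_rho that)
  have sq: "star (\<phi> j) * \<phi> j = func (\<lambda>x. of_real (rho j x ^ r / S x))" if j: "j \<in> J" for j
  proof -
    have "star (\<phi> j) * \<phi> j = func (\<lambda>x. of_real (w x)) * (star (pw j r) * pw j r) * func (\<lambda>x. of_real (w x))"
      by (simp add: \<phi>_def star_mult star_w mult.assoc)
    also have "\<dots> = func (\<lambda>x. of_real (w x) * of_real (rho j x ^ r) * of_real (w x))"
      unfolding pw_pw[OF j] func_mult[OF w_cont p_cont[OF j]]
      by (rule func_mult[OF continuous_fun_mult[OF w_cont p_cont[OF j]] w_cont])
    also have "\<dots> = func (\<lambda>x. of_real (rho j x ^ r / S x))"
    proof (rule func_cong)
      fix x assume "x \<in> X"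
      then have "w x * rho j x ^ r * w x = rho j x ^ r / S x"
        using S_pos[of x] by (simp add: w_def)
      then show "complex_of_real (w x) * of_real (rho j x ^ r) * of_real (w x) = of_real (rho j x ^ r / S x)"
        by (metis of_real_mult)
    qed
    finally show ?thesis .
  qed
  have q_cont: "continuous_fun (base E) (\<lambda>x. complex_of_real (rho j x ^ r / S x))" if "j \<in> J" for j
    by (intro continuous_fun_of_real continuous_fun_divide continuous_map_real_pow continuous_rho S_cont that)
      (use S_pos in force)
  have n: "norm (\<phi> j) \<le> 1" if j: "j \<in> J" for j
  proof -
    have "norm (star (\<phi> j) * \<phi> j) \<le> 1"
      unfolding sq[OF j]
    proof (rule norm_func_le[OF q_cont[OF j]])
      fix x assume x: "x \<in> X"
      have "rho j x ^ r \<le> S x"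
        unfolding S_def by (rule member_le_sum[OF j]) (use rho_nonneg[OF x] finite_J in auto)
      then show "cmod (complex_of_real (rho j x ^ r / S x)) \<le> 1"
        unfolding norm_of_real using S_pos[OF x] rho_nonneg[OF x j] by simp
    qed simp
    then show ?thesis by (simp add: cstar_identity power_le_one_iff)
  qed
  have "(\<Sum>j\<in>J. star (\<phi> j) * \<phi> j) = func (\<lambda>x. \<Sum>j\<in>J. of_real (rho j x ^ r / S x))"
    using func_sum[OF finite_J q_cont] by (simp add: sq)
  also have "\<dots> = unit"
  proof (rule func_1)
    fix x assume x: "x \<in> X"
    have "(\<Sum>j\<in>J. complex_of_real (rho j x ^ r / S x)) = of_real (\<Sum>j\<in>J. rho j x ^ r / S x)" by simp
    also have "(\<Sum>j\<in>J. rho j x ^ r / S x) = 1"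
      using S_pos[OF x] by (simp add: sum_divide_distrib[symmetric] S_def)
    finally show "(\<Sum>j\<in>J. complex_of_real (rho j x ^ r / S x)) = 1" by simp
  qed
  finally show ?thesis using H n by blast
qed

section \<open>Homogeneous elements that almost intertwine the permutations\<close>

lemma norm_sandwich_le:
  assumes "norm a \<le> A" "norm b \<le> B" "norm c \<le> C" "0 \<le> A" "0 \<le> B"
  shows "norm (a * b * c :: 'a) \<le> A * B * C"
proof -
  have "norm (a * b * c) \<le> norm (a * b) * norm c" by (rule norm_mult_ineq)
  also have "\<dots> \<le> (norm a * norm b) * norm c" by (intro mult_right_mono norm_mult_ineq) simp
  also have "\<dots> \<le> (A * B) * C" using assms by (intro mult_mono) auto
  finally show ?thesis .
qed

text \<open>An exact intertwiner in degree 1 is recovered by contracting its last \<open>r\<close>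
  factors: it equals the sum of \<open>shift 1 (star (\<phi> j)) * a * \<phi> j\<close>, which lies
  in \<open>H 1\<close>. With an error \<open>\<epsilon>\<close> in the relation, each of the
  \<open>card J\<close> terms contributes at most \<open>\<epsilon>\<close>, because all factors
  have norm at most 1. Hence the constant does not grow with \<open>r\<close>.\<close>

lemma degree_one_component:
  assumes a: "a \<in> graded_part E emb 1"
    and comm: "\<And>r. norm (a * flip r - shift 1 (flip r) * a) \<le> \<epsilon>"
  shows "\<exists>\<eta>\<in>H 1. norm (a - \<eta>) \<le> real (card J) * \<epsilon>"
proof -
  obtain r s t where t: "t \<in> arrows E r s" "int s - int r = 1" "a = emb r s t"
    using a unfolding graded_part_def by blast
  then have s: "s = r + 1" by simp
  obtain \<phi> where \<phi>: "\<And>j. j \<in> J \<Longrightarrow> \<phi> j \<in> H r" "\<And>j. j \<in> J \<Longrightarrow> norm (\<phi> j) \<le> 1"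
    "(\<Sum>j\<in>J. star (\<phi> j) * \<phi> j) = unit" using ex_row_isometry[of r] by blast
  define D where "D = a * flip r - shift 1 (flip r) * a"
  have e0: "0 \<le> \<epsilon>" using order_trans[OF norm_ge_zero comm] .
  \<comment> \<open>In the first product of \<open>D\<close> the flip turns \<open>\<phi> j\<close>
    into \<open>shift r (\<phi> j)\<close>, which passes through \<open>a\<close> and meets its
    adjoint. In the second the flip brings the shifted adjoint forward, behind the first factor
    only.\<close>
  have summand: "shift s (star (\<phi> j)) * D * \<phi> j = star (\<phi> j) * \<phi> j * a - shift 1 (star (\<phi> j)) * a * \<phi> j"
    if j: "j \<in> J" for j
  proof -
    have z: "star (\<phi> j) * \<phi> j \<in> H 0" using star_H_mult[OF \<phi>(1)[OF j], of "\<phi> j" 0] \<phi>(1)[OF j] by simp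
    have "a * flip r * \<phi> j = shift s (\<phi> j) * a"
      unfolding mult.assoc flip_shift[OF \<phi>(1)[OF j]] t(3) by (rule emb_shift[OF t(1)])
    then have "shift s (star (\<phi> j)) * (a * flip r * \<phi> j) = shift s (star (\<phi> j) * \<phi> j) * a"
      by (simp add: shift_mult mult.assoc)
    also have "\<dots> = star (\<phi> j) * \<phi> j * a" by (simp only: shift_central[OF z])
    finally have 1: "shift s (star (\<phi> j)) * (a * flip r * \<phi> j) = star (\<phi> j) * \<phi> j * a" .
    have "star (flip r * shift r (\<phi> j)) = star (\<phi> j)" by (simp add: flip_of_shift[OF \<phi>(1)[OF j]])
    then have fl: "shift r (star (\<phi> j)) * flip r = star (\<phi> j)" by (simp add: star_mult star_flip star_shift)
    have "shift s (star (\<phi> j)) = shift 1 (shift r (star (\<phi> j)))"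
      unfolding s add.commute[of r 1] by (rule shift_shift)
    then have "shift s (star (\<phi> j)) * (shift 1 (flip r) * a * \<phi> j) =
        shift 1 (shift r (star (\<phi> j)) * flip r) * (a * \<phi> j)"
      by (simp add: shift_mult mult.assoc)
    then have 2: "shift s (star (\<phi> j)) * (shift 1 (flip r) * a * \<phi> j) = shift 1 (star (\<phi> j)) * a * \<phi> j"
      by (simp add: fl mult.assoc)
    have "shift s (star (\<phi> j)) * D * \<phi> j =
        shift s (star (\<phi> j)) * (a * flip r * \<phi> j) - shift s (star (\<phi> j)) * (shift 1 (flip r) * a * \<phi> j)"
      by (simp add: D_def right_diff_distrib left_diff_distrib mult.assoc)
    then show ?thesis unfolding 1 2 .
  qed
  define \<eta> where "\<eta> = (\<Sum>j\<in>J. shift 1 (star (\<phi> j)) * a * \<phi> j)"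
  have "\<eta> \<in> H 1"
    unfolding \<eta>_def
  proof (rule H_sum)
    fix j assume j: "j \<in> J"
    \<comment> \<open>The product has \<open>1 + r\<close> factors; removing one by a word and then
      \<open>r\<close> by \<open>\<phi> j\<close> leaves a function on the base.\<close>
    have a\<phi>: "a * \<phi> j \<in> H (1 + r)" using emb_H[OF t(1) \<phi>(1)[OF j]] by (simp add: t(3) s add.commute)
    have "shift 1 (star (\<phi> j)) * a * \<phi> j = (\<Sum>is\<in>tuples J 1. word is * (star (\<phi> j) * (star (word is) * (a * \<phi> j))))"
      by (simp add: shift_def sum_distrib_right mult.assoc)
    also have "\<dots> \<in> H 1"
    proof (rule H_sum)
      fix "is" assume w: "is \<in> tuples J 1"
      have "star (word is) * (a * \<phi> j) \<in> H (r + 0)" using star_H_mult[OF word_H[OF w] a\<phi>] by simp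
      then have "star (\<phi> j) * (star (word is) * (a * \<phi> j)) \<in> H 0" by (rule star_H_mult[OF \<phi>(1)[OF j]])
      then show "word is * (star (\<phi> j) * (star (word is) * (a * \<phi> j))) \<in> H 1"
        using H_mult[OF word_H[OF w], of _ 0] by simp
    qed
    finally show "shift 1 (star (\<phi> j)) * a * \<phi> j \<in> H 1" .
  qed
  moreover have "a - \<eta> = (\<Sum>j\<in>J. shift s (star (\<phi> j)) * D * \<phi> j)"
    using arg_cong[OF \<phi>(3), of "\<lambda>u. u * a"]
    by (simp add: summand sum_subtractf \<eta>_def sum_distrib_right unit_left)
  then have "norm (a - \<eta>) \<le> (\<Sum>j\<in>J. \<epsilon>)"
  proof (simp only:, intro sum_norm_le)
    fix j assume j: "j \<in> J"
    have "norm (shift s (star (\<phi> j)) * D * \<phi> j) \<le> 1 * \<epsilon> * 1"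
      by (rule norm_sandwich_le) (use \<phi>(2)[OF j] comm norm_shift_le[of s "star (\<phi> j)"] e0 in \<open>simp_all add: D_def\<close>)
    then show "norm (shift s (star (\<phi> j)) * D * \<phi> j) \<le> \<epsilon>" by simp
  qed
  then have "norm (a - \<eta>) \<le> real (card J) * \<epsilon>" by simp
  ultimately show ?thesis by blast
qed

text \<open>For a pair \<open>(i, j)\<close> the vector \<open>psi i * psi j * pw j l\<close> is
  sent by \<open>flip 1\<close> to \<open>psi j * psi i * pw j l\<close> and fixed by the flip
  shifted by \<open>l\<close>. Pairing the difference with the first image gives
  \<open>rho j ^ l\<close> times the Gram determinant of the two frame vectors, and
  \<open>gram_determinant_pos\<close> keeps the sum over all pairs away from 0.\<close>

lemma ex_flip_separation:
  assumes l: "l > 0"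
  shows "\<exists>\<tau>. continuous_fun (base E) \<tau> \<and> (\<forall>x\<in>X. \<tau> x \<noteq> 0) \<and> (\<Sum>p\<in>J\<times>J.
    star (psi (snd p) * (psi (fst p) * pw (snd p) l)) * (flip 1 - shift l (flip 1)) * (psi (fst p) * (psi (snd p) * pw (snd p) l)))
    = func \<tau>"
proof -
  obtain l' where l': "l = Suc l'" using l by (cases l) auto
  define \<tau> where "\<tau> i j x = complex_of_real (rho j x ^ l) * (gram i i x * gram j j x - gram j i x * gram i j x)" for i j x
  have \<tau>_cont: "continuous_fun (base E) (\<tau> i j)" if "i \<in> J" "j \<in> J" for i j
    unfolding \<tau>_def[abs_def]
    by (intro continuous_fun_mult continuous_map_diff continuous_gram that continuous_fun_of_real
        continuous_map_real_pow continuous_rho)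
  have summand: "star (psi j * (psi i * pw j l)) * (flip 1 - shift l (flip 1)) * (psi i * (psi j * pw j l)) = func (\<tau> i j)"
    if i: "i \<in> J" and j: "j \<in> J" for i j
  proof -
    let ?v = "psi i * (psi j * pw j l)" and ?u = "psi j * (psi i * pw j l)"
    have 1: "flip 1 * ?v = ?u"
      using flip_H[OF psi_H[OF i] psi_H[OF j]] by (simp add: mult.assoc[symmetric])
    \<comment> \<open>Since \<open>l > 0\<close>, the word ends in two equal letters, preceded by
      exactly \<open>l\<close> letters; exchanging the two has no effect.\<close>
    have v: "?v = (psi i * pw j l') * (psi j * psi j)"
      using pw_Suc2[of j l'] by (simp add: l' pw_Suc mult.assoc)
    have "psi i * pw j l' \<in> H l" using H_mult[OF psi_H[OF i] pw_H[OF j, of l']] by (simp add: l' One_nat_def)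
    then have 2: "shift l (flip 1) * ?v = ?v"
      unfolding v mult.assoc[symmetric, of "shift l (flip 1)"] by (simp add: shift_H mult.assoc flip_H[OF psi_H[OF j] psi_H[OF j]])
    have c1: "star (psi k) * psi m \<in> H 0" if "k \<in> J" "m \<in> J" for k m
      using star_psi_psi[OF that] func_H0[OF continuous_gram[OF that]] by simp
    have move: "star (pw j l) * z * pw j l = z * func (\<lambda>x. of_real (rho j x ^ l))" if "z \<in> H 0" for z
      using H0_central[OF that, of "star (pw j l)"] pw_pw[OF j, of l] by (metis mult.assoc)
    have g: "func (gram k m) \<in> H 0" if "k \<in> J" "m \<in> J" for k m using func_H0[OF continuous_gram[OF that]] .
    have "star ?u * ?u = star (pw j l) * (star (psi i) * (func (gram j j) * psi i)) * pw j l"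
      by (simp add: star_mult mult.assoc star_psi_psi[OF j j, symmetric])
    also have "star (psi i) * (func (gram j j) * psi i) = func (gram i i) * func (gram j j)"
      unfolding H0_central[OF g[OF j j], of "psi i"] by (simp add: star_psi_psi[OF i i, symmetric] mult.assoc)
    finally have uu: "star ?u * ?u = func (gram i i) * func (gram j j) * func (\<lambda>x. of_real (rho j x ^ l))"
      using move[of "func (gram i i) * func (gram j j)"] H_mult[OF g[OF i i] g[OF j j]] by simp
    have "star ?u * ?v = star (pw j l) * (star (psi i) * (func (gram j i) * psi j)) * pw j l"
      by (simp add: star_mult mult.assoc star_psi_psi[OF j i, symmetric])
    also have "star (psi i) * (func (gram j i) * psi j) = func (gram i j) * func (gram j i)"
      unfolding H0_central[OF g[OF j i], of "psi j"] by (simp add: star_psi_psi[OF i j, symmetric] mult.assoc)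
    finally have uv: "star ?u * ?v = func (gram i j) * func (gram j i) * func (\<lambda>x. of_real (rho j x ^ l))"
      using move[of "func (gram i j) * func (gram j i)"] H_mult[OF g[OF i j] g[OF j i]] by simp
    have p: "continuous_fun (base E) (\<lambda>x. complex_of_real (rho j x ^ l))"
      by (intro continuous_fun_of_real continuous_map_real_pow continuous_rho j)
    note cg = continuous_gram
    have "star ?u * (flip 1 - shift l (flip 1)) * ?v = star ?u * ?u - star ?u * ?v"
      using 1 2 by (simp add: right_diff_distrib left_diff_distrib mult.assoc)
    also have "\<dots> = func (\<lambda>x. gram i i x * gram j j x * of_real (rho j x ^ l)) -
        func (\<lambda>x. gram i j x * gram j i x * of_real (rho j x ^ l))"
      unfolding uu uv
      by (simp only: func_mult[OF cg[OF i i] cg[OF j j]] func_mult[OF cg[OF i j] cg[OF j i]]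
          func_mult[OF continuous_fun_mult[OF cg[OF i i] cg[OF j j]] p]
          func_mult[OF continuous_fun_mult[OF cg[OF i j] cg[OF j i]] p])
    also have "\<dots> = func (\<lambda>x. gram i i x * gram j j x * of_real (rho j x ^ l) - gram i j x * gram j i x * of_real (rho j x ^ l))"
      by (rule func_diff) (intro continuous_fun_mult cg i j p)+
    also have "\<dots> = func (\<tau> i j)" by (rule func_cong) (simp add: \<tau>_def algebra_simps)
    finally show ?thesis .
  qed
  have "(\<Sum>p\<in>J\<times>J. star (psi (snd p) * (psi (fst p) * pw (snd p) l)) * (flip 1 - shift l (flip 1)) *
      (psi (fst p) * (psi (snd p) * pw (snd p) l))) = (\<Sum>p\<in>J\<times>J. func (\<tau> (fst p) (snd p)))"
    by (intro sum.cong refl summand) auto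
  also have "\<dots> = func (\<lambda>x. \<Sum>p\<in>J\<times>J. \<tau> (fst p) (snd p) x)"
    by (rule func_sum) (use finite_J \<tau>_cont in auto)
  finally have eq: "(\<Sum>p\<in>J\<times>J. star (psi (snd p) * (psi (fst p) * pw (snd p) l)) * (flip 1 - shift l (flip 1)) *
      (psi (fst p) * (psi (snd p) * pw (snd p) l))) = func (\<lambda>x. \<Sum>p\<in>J\<times>J. \<tau> (fst p) (snd p) x)" .
  have cont: "continuous_fun (base E) (\<lambda>x. \<Sum>p\<in>J\<times>J. \<tau> (fst p) (snd p) x)"
    by (rule continuous_map_sum) (use finite_J \<tau>_cont in auto)
  have nz: "(\<Sum>p\<in>J\<times>J. \<tau> (fst p) (snd p) x) \<noteq> 0" if x: "x \<in> X" for x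
  proof -
    have "\<tau> i j x = of_real (rho j x ^ l * (rho i x * rho j x - (cmod (gram i j x))\<^sup>2))" if "i \<in> J" "j \<in> J" for i j
    proof -
      have "gram j i x = cnj (gram i j x)"
        using herm_sym[OF x frame_fibre[OF x that(1)] frame_fibre[OF x that(2)]] by (simp add: gram_def)
      then have "gram j i x * gram i j x = of_real ((cmod (gram i j x))\<^sup>2)"
        by (simp only: complex_norm_square mult.commute)
      then show ?thesis unfolding \<tau>_def gram_rho[OF x that(1)] gram_rho[OF x that(2)] by simp
    qed
    then have "(\<Sum>p\<in>J\<times>J. \<tau> (fst p) (snd p) x) =
      of_real (\<Sum>i\<in>J. \<Sum>j\<in>J. rho j x ^ l * (rho i x * rho j x - (cmod (gram i j x))\<^sup>2))"
      by (simp add: sum.cartesian_product' )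
    then show ?thesis using gram_determinant_pos[OF x, of l] by (simp only: of_real_eq_0_iff)
  qed
  show ?thesis using eq cont nz by blast
qed

text \<open>An element of degree \<open>k\<close> carries a shift by \<open>r\<close> into one by
  \<open>r + k\<close>, while the assumed relation carries \<open>m\<close> into
  \<open>m + 1\<close>. Comparing both makes \<open>a\<close> nearly annihilate the difference of
  two transpositions \<open>l\<close> factors apart. That difference can be completed to the
  invertible function \<open>\<tau>\<close>, which bounds \<open>a\<close> itself. The constant
  involves only \<open>l\<close>, not the tensor powers on which \<open>a\<close> is
  represented.\<close>

lemma other_components:
  assumes k: "k \<noteq> 1"
  shows "\<exists>C\<ge>0. \<forall>a\<in>graded_part E emb k. \<forall>\<epsilon>.
    (\<forall>m. norm (a * shift m (flip 1) - shift (m + 1) (flip 1) * a) \<le> \<epsilon>) \<longrightarrow> norm a \<le> C * \<epsilon>"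
proof -
  define l where "l = nat \<bar>k - 1\<bar>"
  have l: "l > 0" using k by (simp add: l_def)
  define \<Delta> where "\<Delta> = flip 1 - shift l (flip 1)"
  define u v where "u p = psi (snd p) * (psi (fst p) * pw (snd p) l)"
    and "v p = psi (fst p) * (psi (snd p) * pw (snd p) l)" for p
  obtain \<tau> where \<tau>: "continuous_fun (base E) \<tau>" "\<forall>x\<in>X. \<tau> x \<noteq> 0" "(\<Sum>p\<in>J\<times>J. star (u p) * \<Delta> * v p) = func \<tau>"
    using ex_flip_separation[OF l] unfolding u_def v_def \<Delta>_def by blast
  have inv_cont: "continuous_fun (base E) (\<lambda>x. 1 / \<tau> x)"
    by (intro continuous_fun_divide \<tau>(1)) (use \<tau>(2) in auto)
  have inv: "func \<tau> * func (\<lambda>x. 1 / \<tau> x) = unit"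
    unfolding func_mult[OF \<tau>(1) inv_cont] by (rule func_1) (use \<tau>(2) in simp)
  define C where "C = (\<Sum>p\<in>J\<times>J. norm (u p) * norm (v p)) * norm (func (\<lambda>x. 1 / \<tau> x))"
  show ?thesis
  proof (intro exI[of _ C] conjI ballI allI impI)
    show "0 \<le> C" unfolding C_def by (intro mult_nonneg_nonneg sum_nonneg) auto
    fix a \<epsilon> assume a: "a \<in> graded_part E emb k"
      and comm: "\<forall>m. norm (a * shift m (flip 1) - shift (m + 1) (flip 1) * a) \<le> \<epsilon>"
    obtain r s t where t: "t \<in> arrows E r s" "int s - int r = k" "a = emb r s t"
      using a unfolding graded_part_def by blast
    have sh: "a * shift r b = shift s b * a" for b unfolding t(3) by (rule emb_shift[OF t(1)])
    \<comment> \<open>The value of \<open>m\<close> is chosen so that the relation \<open>sh\<close>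
      brings both terms of the commutator to the right of \<open>a\<close>: \<open>r + l\<close>
      above degree 1, and \<open>r\<close> below it.\<close>
    have \<Delta>: "norm (a * shift r \<Delta>) \<le> \<epsilon>"
    proof (cases "k > 1")
      case True
      then have s: "r + l + 1 = s" using t(2) by (simp add: l_def)
      have "a * shift (r + l) (flip 1) - shift (r + l + 1) (flip 1) * a = - (a * shift r \<Delta>)"
        unfolding s shift_shift[of r l] sh[symmetric]
        by (simp add: \<Delta>_def star_hom_diff[OF star_hom_shift] right_diff_distrib)
      then show ?thesis using comm[rule_format, of "r + l"] by simp
    next
      case False
      then have s: "r + 1 = s + l" using t(2) k by (simp add: l_def)
      have "a * shift r (flip 1) - shift (r + 1) (flip 1) * a = a * shift r \<Delta>"
        unfolding s shift_shift[of s l] sh[symmetric]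
        by (simp add: \<Delta>_def star_hom_diff[OF star_hom_shift] right_diff_distrib)
      then show ?thesis using comm[rule_format, of r] by simp
    qed
    have e0: "0 \<le> \<epsilon>" using order_trans[OF norm_ge_zero \<Delta>] .
    \<comment> \<open>Functions on the base do not notice the shift, so the identity expressing
      \<open>\<tau>\<close> through the difference of flips may be shifted behind the
      \<open>r\<close> factors of \<open>a\<close>.\<close>
    have "a * func \<tau> = a * shift r (func \<tau>)" by (simp add: shift_central[OF func_H0[OF \<tau>(1)]])
    also have "\<dots> = (\<Sum>p\<in>J\<times>J. shift s (star (u p)) * (a * shift r \<Delta>) * shift r (v p))"
      unfolding \<tau>(3)[symmetric] star_hom_sum[OF star_hom_shift] shift_mult sum_distrib_left
    proof (intro sum.cong refl)
      fix p
      show "a * (shift r (star (u p)) * shift r \<Delta> * shift r (v p)) =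
        shift s (star (u p)) * (a * shift r \<Delta>) * shift r (v p)"
        using sh[of "star (u p)"] by (simp add: mult.assoc) (simp add: mult.assoc[symmetric])
    qed
    finally have aT: "a * func \<tau> = (\<Sum>p\<in>J\<times>J. shift s (star (u p)) * (a * shift r \<Delta>) * shift r (v p))" .
    have "norm (a * func \<tau>) \<le> (\<Sum>p\<in>J\<times>J. norm (u p) * \<epsilon> * norm (v p))"
      unfolding aT
    proof (rule sum_norm_le)
      fix p
      show "norm (shift s (star (u p)) * (a * shift r \<Delta>) * shift r (v p)) \<le> norm (u p) * \<epsilon> * norm (v p)"
        by (rule norm_sandwich_le)
          (use \<Delta> e0 norm_shift_le[of s "star (u p)"] norm_shift_le[of r "v p"] in auto)
    qed
    also have "\<dots> = (\<Sum>p\<in>J\<times>J. norm (u p) * norm (v p)) * \<epsilon>"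
      unfolding sum_distrib_right by (intro sum.cong refl) (simp add: mult_ac)
    finally have n: "norm (a * func \<tau>) \<le> (\<Sum>p\<in>J\<times>J. norm (u p) * norm (v p)) * \<epsilon>" .
    have "a = a * func \<tau> * func (\<lambda>x. 1 / \<tau> x)" by (simp add: mult.assoc inv unit_right)
    then have "norm a \<le> norm (a * func \<tau>) * norm (func (\<lambda>x. 1 / \<tau> x))" by (metis norm_mult_ineq)
    also have "\<dots> \<le> ((\<Sum>p\<in>J\<times>J. norm (u p) * norm (v p)) * \<epsilon>) * norm (func (\<lambda>x. 1 / \<tau> x))"
      by (intro mult_right_mono n) simp
    also have "\<dots> = C * \<epsilon>" by (simp add: C_def mult_ac)
    finally show "norm a \<le> C * \<epsilon>" .
  qed
qed

end

section \<open>From homogeneous approximations to exact intertwiners\<close>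

context cp_algebra
begin

text \<open>The family is total and vanishes off \<open>K\<close>, so that two approximations can
  later be compared over a common finite set of degrees.\<close>

lemma graded_approx:
  assumes "0 < \<epsilon>"
  shows "\<exists>K a. finite K \<and> (\<forall>k. a k \<in> graded_part E emb k) \<and> (\<forall>k. k \<notin> K \<longrightarrow> a k = 0) \<and>
    norm (y - (\<Sum>k\<in>K. a k)) < \<epsilon>"
proof -
  define T where "T = {\<Sum>k\<in>K. a k | K a. finite K \<and> (\<forall>k. a k \<in> graded_part E emb k) \<and> (\<forall>k. k \<notin> K \<longrightarrow> a k = 0)}"
  have TI: "(\<Sum>k\<in>K. a k) \<in> T" if "finite K" "\<forall>k. a k \<in> graded_part E emb k" "\<forall>k. k \<notin> K \<longrightarrow> a k = 0" for K a
    using that unfolding T_def by blast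
  have TE: "\<exists>K a. finite K \<and> (\<forall>k. a k \<in> graded_part E emb k) \<and> (\<forall>k. k \<notin> K \<longrightarrow> a k = 0) \<and> b = (\<Sum>k\<in>K. a k)"
    if "b \<in> T" for b using that unfolding T_def by blast
  have "subspace T"
  proof (rule subspaceI)
    show "0 \<in> T" using TI[of "{}" "\<lambda>_. 0"] graded_zero by simp
  next
    fix b c assume "b \<in> T" "c \<in> T"
    then obtain K a L a' where a: "finite K" "\<forall>k. a k \<in> graded_part E emb k" "\<forall>k. k \<notin> K \<longrightarrow> a k = 0" "b = (\<Sum>k\<in>K. a k)"
      and a': "finite L" "\<forall>k. a' k \<in> graded_part E emb k" "\<forall>k. k \<notin> L \<longrightarrow> a' k = 0" "c = (\<Sum>k\<in>L. a' k)"
      using TE by metis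
    have "b = (\<Sum>k\<in>K \<union> L. a k)" "c = (\<Sum>k\<in>K \<union> L. a' k)"
      unfolding a(4) a'(4) using a a' by (auto intro!: sum.mono_neutral_left)
    then have "b + c = (\<Sum>k\<in>K \<union> L. a k + a' k)" by (simp add: sum.distrib)
    moreover have "\<forall>k. a k + a' k \<in> graded_part E emb k"
      using graded_lincomb[of _ _ _ 1 1] a(2) a'(2) by simp
    ultimately show "b + c \<in> T" using TI[of "K \<union> L" "\<lambda>k. a k + a' k"] a a' by simp
  next
    fix c :: real and b assume "b \<in> T"
    then obtain K a where a: "finite K" "\<forall>k. a k \<in> graded_part E emb k" "\<forall>k. k \<notin> K \<longrightarrow> a k = 0" "b = (\<Sum>k\<in>K. a k)"
      using TE by metis
    have "\<forall>k. c *\<^sub>R a k \<in> graded_part E emb k"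
      using graded_lincomb[OF a(2)[rule_format] graded_zero, where c = "complex_of_real c" and c' = 0] by (simp add: scaleC_of_real)
    then show "c *\<^sub>R b \<in> T" using TI[of K "\<lambda>k. c *\<^sub>R a k"] a by (simp add: scaleR_right.sum)
  qed
  moreover have "emb r s t \<in> T" if t: "t \<in> arrows E r s" for r s t
    using TI[of "{int s - int r}" "\<lambda>k. if k = int s - int r then emb r s t else 0"] gradedI[OF t] graded_zero by simp
  then have "(\<Union>r s. emb r s ` arrows E r s) \<subseteq> T" by blast
  ultimately have "span (\<Union>r s. emb r s ` arrows E r s) \<subseteq> T" by (rule span_minimal[rotated])
  then have "y \<in> closure T" using emb_dense closure_mono by blast
  then obtain b where "b \<in> T" "dist b y < \<epsilon>" using assms unfolding closure_approachable by blast
  then show ?thesis using TE[of b] by (metis dist_commute dist_norm)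
qed

text \<open>A function is bounded pointwise by the norm of its image, so a convergent sequence in
  \<open>H 0\<close> comes from a uniformly Cauchy sequence of continuous functions, and conversely
  uniform limits are limits in norm.\<close>

lemma closed_H0: "closed (H 0)"
  unfolding closed_sequential_limits
proof (intro allI impI, elim conjE)
  fix z l assume z: "\<forall>n. z n \<in> H 0" and lim: "z \<longlonglongrightarrow> l"
  have "\<forall>n. \<exists>g. continuous_fun (base E) g \<and> z n = func g" using H0_func z by blast
  then obtain g where g: "\<And>n. continuous_fun (base E) (g n)" "\<And>n. z n = func (g n)" by metis
  have dist: "dist (g m x) (g n x) \<le> dist (z m) (z n)" if "x \<in> X" for m n x
    using le_norm_func[OF continuous_map_diff[OF g(1) g(1)] that, of m n]
    by (simp add: dist_norm g(2) func_diff[OF g(1) g(1)])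
  have "Cauchy z" using lim by (rule LIMSEQ_imp_Cauchy)
  then have cau: "\<exists>N. \<forall>m n x. N \<le> m \<longrightarrow> N \<le> n \<longrightarrow> x \<in> X \<longrightarrow> dist (g m x) (g n x) < e" if "0 < e" for e
    using dist that unfolding Cauchy_def by (meson le_less_trans)
  have gm: "\<forall>\<^sub>F n in sequentially. continuous_map (base E) Met_TC.mtopology (g n)"
    using g(1) by simp
  obtain h where h: "continuous_map (base E) Met_TC.mtopology h"
    "\<And>e. 0 < e \<Longrightarrow> \<forall>\<^sub>F n in sequentially. \<forall>x\<in>X. dist (g n x) (h x) < e"
    by (rule Met_TC.continuous_map_uniformly_Cauchy_limit[OF _ gm cau]) auto
  have hc: "continuous_fun (base E) h" using h(1) by simp
  have "z \<longlonglongrightarrow> func h"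
  proof (rule metric_LIMSEQ_I)
    fix e :: real assume "0 < e"
    then have "\<forall>\<^sub>F n in sequentially. \<forall>x\<in>X. dist (g n x) (h x) < e / 2" by (intro h(2)) simp
    then obtain N where N: "\<And>n x. N \<le> n \<Longrightarrow> x \<in> X \<Longrightarrow> dist (g n x) (h x) < e / 2"
      unfolding eventually_sequentially by blast
    have "dist (z n) (func h) < e" if n: "N \<le> n" for n
    proof -
      have "norm (func (\<lambda>x. g n x - h x)) \<le> e / 2"
        by (rule norm_func_le[OF continuous_map_diff[OF g(1) hc]])
          (use N[OF n] \<open>0 < e\<close> in \<open>auto simp: dist_norm less_imp_le\<close>)
      then show ?thesis using \<open>0 < e\<close> by (simp add: dist_norm g(2) func_diff[OF g(1) hc])
    qed
    then show "\<exists>N. \<forall>n\<ge>N. dist (z n) (func h) < e" by blast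
  qed
  then have "l = func h" using lim LIMSEQ_unique by blast
  then show "l \<in> H 0" using func_H0[OF hc] by simp
qed

text \<open>A limit is rebuilt from its coefficients \<open>star (psi j) * l\<close>, which lie in
  the closed space \<open>H 0\<close>.\<close>

lemma closed_H1: "closed (H 1)"
  unfolding closed_sequential_limits
proof (intro allI impI, elim conjE)
  fix z l assume z: "\<forall>n. z n \<in> H 1" and lim: "z \<longlonglongrightarrow> l"
  have "star (psi j) * l \<in> H 0" if j: "j \<in> J" for j
  proof (rule closed_sequentially[OF closed_H0])
    show "star (psi j) * z n \<in> H 0" for n using star_H_mult[OF psi_H[OF j], of "z n" 0] z by simp
    show "(\<lambda>n. star (psi j) * z n) \<longlonglongrightarrow> star (psi j) * l" by (intro tendsto_mult tendsto_const lim)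
  qed
  then have "(\<Sum>j\<in>J. psi j * (star (psi j) * l)) \<in> H 1"
    using H_mult[OF psi_H, of _ _ 0] by (intro H_sum) simp
  also have "(\<Sum>j\<in>J. psi j * (star (psi j) * l)) = l"
    using arg_cong[OF psi_frame, of "\<lambda>u. u * l"] by (simp add: sum_distrib_right unit_left mult.assoc)
  finally show "l \<in> H 1" .
qed

lemma shift_0: "shift 0 a = a"
  by (simp add: shift_def star_unit unit_left unit_right)

text \<open>Shifted flips have degree 0, so the commutator of a sum has the commutators of its
  components as components, and each is dominated by the whole. The exact relation for
  \<open>y\<close> leaves two copies of the approximation error, multiplied by elements of norm at
  most 1.\<close>

lemma component_commutator:
  assumes K: "finite K" and a: "\<And>k. a k \<in> graded_part E emb k" "\<And>k. k \<notin> K \<Longrightarrow> a k = 0"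
    and y: "norm (y - (\<Sum>k\<in>K. a k)) \<le> \<epsilon>"
    and comm: "y * shift m (flip r) = shift (m + 1) (flip r) * y"
  shows "norm (a k * shift m (flip r) - shift (m + 1) (flip r) * a k) \<le> 2 * \<epsilon>"
proof (cases "k \<in> K")
  case True
  let ?p = "shift m (flip r)" and ?q = "shift (m + 1) (flip r)" and ?t = "\<Sum>k\<in>K. a k"
  have np: "norm ?p \<le> 1" "norm ?q \<le> 1"
    using order_trans[OF norm_shift_le norm_flip] by auto
  define b where "b k = a k * ?p - ?q * a k" for k
  have b: "b k \<in> graded_part E emb k" for k
    unfolding b_def using graded_mult[OF a(1) graded_shift[OF graded_flip], of k m r]
      graded_mult[OF graded_shift[OF graded_flip] a(1), of "m + 1" r k] by (intro graded_diff) simp_all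
  have "norm (b k) \<le> norm (\<Sum>k\<in>K. b k)"
    by (rule norm_component_le[OF K True emb_circle[OF K b]])
  also have "(\<Sum>k\<in>K. b k) = (?t - y) * ?p - ?q * (?t - y)"
    using comm by (simp add: b_def sum_subtractf sum_distrib_left sum_distrib_right algebra_simps)
  also have "norm \<dots> \<le> norm (?t - y) * norm ?p + norm ?q * norm (?t - y)"
    by (intro order_trans[OF norm_triangle_ineq4] add_mono norm_mult_ineq)
  also have "\<dots> \<le> \<epsilon> * 1 + 1 * \<epsilon>"
    using y np by (intro add_mono mult_mono) (auto simp: norm_minus_commute intro: order_trans[OF norm_ge_zero])
  finally show ?thesis by (simp add: b_def)
next
  case False
  then show ?thesis using a(2) order_trans[OF norm_ge_zero y] by simp
qed

text \<open>Approximate \<open>y\<close> by a finite sum of homogeneous elements. As the approximation improves, the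
  components of degree other than 1 tend to 0, though not uniformly in the degree; a Fejer
  mean cuts off all but finitely many degrees.\<close>

theorem shift_intertwiner:
  assumes comm: "\<And>m r. y * shift m (flip r) = shift (m + 1) (flip r) * y"
  shows "y \<in> H 1"
proof -
  have "\<forall>k. \<exists>C\<ge>0. k \<noteq> 1 \<longrightarrow> (\<forall>a\<in>graded_part E emb k. \<forall>\<epsilon>.
    (\<forall>m. norm (a * shift m (flip 1) - shift (m + 1) (flip 1) * a) \<le> \<epsilon>) \<longrightarrow> norm a \<le> C * \<epsilon>)"
    using other_components by (metis order_refl)
  then obtain C where C: "\<And>k. 0 \<le> C k" "\<And>k a \<epsilon>. k \<noteq> 1 \<Longrightarrow> a \<in> graded_part E emb k \<Longrightarrow>
    (\<And>m. norm (a * shift m (flip 1) - shift (m + 1) (flip 1) * a) \<le> \<epsilon>) \<Longrightarrow> norm a \<le> C k * \<epsilon>"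
    by metis
  have "\<exists>\<eta>\<in>H 1. dist \<eta> y < e" if e: "0 < e" for e
  proof -
    \<comment> \<open>The final estimate adds errors of \<open>6 * \<delta>\<close> in total and has
      to stay strictly below \<open>e\<close>.\<close>
    define \<delta> where "\<delta> = e / 7"
    have \<delta>: "0 < \<delta>" using e by (simp add: \<delta>_def)
    obtain K1 a1 where K1: "finite K1" and a1: "\<And>k. a1 k \<in> graded_part E emb k" "\<And>k. k \<notin> K1 \<Longrightarrow> a1 k = 0"
      and y1: "norm (y - (\<Sum>k\<in>K1. a1 k)) < \<delta>" using graded_approx[OF \<delta>, of y] by blast
    define S1 where "S1 = (\<Sum>k\<in>K1. \<bar>real_of_int (k - 1)\<bar> * norm (a1 k))"
    \<comment> \<open>The first approximation only serves to fix the window: it is so wide that the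
      Fejer weights move this approximation by at most \<open>\<delta>\<close>.\<close>
    obtain N :: nat where N: "S1 / \<delta> < real N" "0 < N"
      by (metis reals_Archimedean2 gr0I less_trans of_nat_0 of_nat_0_less_iff zero_less_one not_less0
          linorder_neqE_linordered_idom of_nat_less_iff of_nat_1 less_one)
    define c where "c k = max 0 (1 - \<bar>real_of_int (k - 1)\<bar> / real N)" for k
    have c01: "0 \<le> c k" "c k \<le> 1" "1 - c k \<le> \<bar>real_of_int (k - 1)\<bar> / real N" for k
      by (auto simp: c_def)
    define I where "I = {1 - int N..1 + int N} - {1}"
    have c0: "c k = 0" if "k \<notin> I" "k \<noteq> 1" for k
    proof -
      have "int N \<le> \<bar>k - 1\<bar>" using that by (auto simp: I_def)
      then have "real N \<le> \<bar>real_of_int (k - 1)\<bar>" by (metis of_int_abs of_int_le_iff of_int_of_nat_eq)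
      then show ?thesis using N(2) by (simp add: c_def)
    qed
    define CS where "CS = (\<Sum>k\<in>I. C k)"
    have CS: "0 \<le> CS" unfolding CS_def by (intro sum_nonneg C(1))
    \<comment> \<open>Chosen after the window, because the constants \<open>C k\<close> have no
      common bound over all degrees; only those in \<open>I\<close> matter now. The errors listed in
      \<open>sum\<epsilon>\<close> then add up to exactly \<open>\<delta>\<close>.\<close>
    define \<epsilon> where "\<epsilon> = \<delta> / (1 + 2 * CS + 2 * real (card J))"
    have den: "1 \<le> 1 + 2 * CS + 2 * real (card J)" using CS by simp
    have \<epsilon>: "0 < \<epsilon>" using \<delta> den by (simp add: \<epsilon>_def)
    have sum\<epsilon>: "\<epsilon> + CS * (2 * \<epsilon>) + real (card J) * (2 * \<epsilon>) = \<delta>"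
    proof -
      have "\<epsilon> * (1 + 2 * CS + 2 * real (card J)) = \<delta>" using den by (simp add: \<epsilon>_def)
      then show ?thesis by (simp add: algebra_simps)
    qed
    have parts: "0 \<le> CS * (2 * \<epsilon>)" "0 \<le> real (card J) * (2 * \<epsilon>)" using CS \<epsilon> by simp_all
    \<comment> \<open>The finer approximation supplies the component of degree 1. Its support may be
      much larger, but its Fejer mean is compared with that of the first one by
      \<open>fejer_contraction\<close>, with a bound independent of the supports.\<close>
    obtain K2 a2 where K2: "finite K2" and a2: "\<And>k. a2 k \<in> graded_part E emb k" "\<And>k. k \<notin> K2 \<Longrightarrow> a2 k = 0"
      and y2: "norm (y - (\<Sum>k\<in>K2. a2 k)) < \<epsilon>" using graded_approx[OF \<epsilon>, of y] by blast
    note small = component_commutator[OF K2 a2 less_imp_le[OF y2] comm]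
    have other: "norm (a2 k) \<le> C k * (2 * \<epsilon>)" if "k \<noteq> 1" for k by (rule C(2)[OF that a2(1) small])
    have "norm (a2 1 * flip r - shift 1 (flip r) * a2 1) \<le> 2 * \<epsilon>" for r
      using small[of 1 0 r] by (simp add: shift_0)
    from degree_one_component[OF a2(1) this]
    obtain \<eta> where \<eta>: "\<eta> \<in> H 1" "norm (a2 1 - \<eta>) \<le> real (card J) * (2 * \<epsilon>)" by blast
    define K where "K = K1 \<union> K2 \<union> insert 1 I"
    have K: "finite K" using K1 K2 by (simp add: K_def I_def)
    have t1: "(\<Sum>k\<in>K1. a1 k) = (\<Sum>k\<in>K. a1 k)" and t2: "(\<Sum>k\<in>K2. a2 k) = (\<Sum>k\<in>K. a2 k)"
      using K a1(2) a2(2) by (auto intro!: sum.mono_neutral_left simp: K_def)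
    have s1: "norm ((\<Sum>k\<in>K. a1 k) - (\<Sum>k\<in>K. c k *\<^sub>R a1 k)) \<le> \<delta>"
    proof -
      have "(\<Sum>k\<in>K. a1 k) - (\<Sum>k\<in>K. c k *\<^sub>R a1 k) = (\<Sum>k\<in>K1. (1 - c k) *\<^sub>R a1 k)"
        using K a1(2) by (auto simp: sum_subtractf[symmetric] algebra_simps K_def intro!: sum.mono_neutral_right)
      also have "norm \<dots> \<le> (\<Sum>k\<in>K1. \<bar>real_of_int (k - 1)\<bar> / real N * norm (a1 k))"
      proof (rule sum_norm_le)
        fix k
        have "norm ((1 - c k) *\<^sub>R a1 k) = (1 - c k) * norm (a1 k)" using c01(2)[of k] by simp
        also have "\<dots> \<le> \<bar>real_of_int (k - 1)\<bar> / real N * norm (a1 k)" by (rule mult_right_mono[OF c01(3)]) simp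
        finally show "norm ((1 - c k) *\<^sub>R a1 k) \<le> \<bar>real_of_int (k - 1)\<bar> / real N * norm (a1 k)" .
      qed
      also have "\<dots> = S1 / real N" by (simp add: S1_def sum_divide_distrib)
      also have "\<dots> \<le> \<delta>" using N \<delta> by (simp add: field_simps)
      finally show ?thesis .
    qed
    have s2: "norm ((\<Sum>k\<in>K. c k *\<^sub>R a1 k) - (\<Sum>k\<in>K. c k *\<^sub>R a2 k)) \<le> 2 * \<delta>"
    proof -
      have gd: "a1 k - a2 k \<in> graded_part E emb k" for k by (rule graded_diff[OF a1(1) a2(1)])
      have "(\<Sum>k\<in>K. c k *\<^sub>R a1 k) - (\<Sum>k\<in>K. c k *\<^sub>R a2 k) = (\<Sum>k\<in>K. c k *\<^sub>R (a1 k - a2 k))"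
        by (simp add: sum_subtractf[symmetric] scaleR_diff_right)
      also have "norm \<dots> \<le> norm (\<Sum>k\<in>K. a1 k - a2 k)"
        unfolding c_def by (rule fejer_contraction[OF K N(2) emb_circle[OF K gd]])
      also have "(\<Sum>k\<in>K. a1 k - a2 k) = (y - (\<Sum>k\<in>K2. a2 k)) - (y - (\<Sum>k\<in>K1. a1 k))"
        unfolding t1 t2 by (simp add: sum_subtractf)
      also have "norm \<dots> \<le> \<epsilon> + \<delta>"
        by (rule order_trans[OF norm_triangle_ineq4]) (use y1 y2 in simp)
      also have "\<dots> \<le> 2 * \<delta>" using sum\<epsilon> parts by linarith
      finally show ?thesis .
    qed
    have s3: "norm ((\<Sum>k\<in>K. c k *\<^sub>R a2 k) - a2 1) \<le> \<delta>"
    proof -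
      have c1: "c 1 = 1" by (simp add: c_def)
      have "(\<Sum>k\<in>K. c k *\<^sub>R a2 k) = c 1 *\<^sub>R a2 1 + (\<Sum>k\<in>K - {1}. c k *\<^sub>R a2 k)"
        using K by (intro sum.remove) (auto simp: K_def)
      also have "(\<Sum>k\<in>K - {1}. c k *\<^sub>R a2 k) = (\<Sum>k\<in>I. c k *\<^sub>R a2 k)"
      proof (rule sum.mono_neutral_right)
        show "finite (K - {1})" using K by simp
        show "I \<subseteq> K - {1}" by (auto simp: K_def I_def)
        show "\<forall>k\<in>K - {1} - I. c k *\<^sub>R a2 k = 0" using c0 by simp
      qed
      finally have "(\<Sum>k\<in>K. c k *\<^sub>R a2 k) - a2 1 = (\<Sum>k\<in>I. c k *\<^sub>R a2 k)" by (simp add: c1)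
      also have "norm \<dots> \<le> (\<Sum>k\<in>I. C k * (2 * \<epsilon>))"
      proof (rule sum_norm_le)
        fix k assume "k \<in> I"
        then have "norm (a2 k) \<le> C k * (2 * \<epsilon>)" by (intro other) (auto simp: I_def)
        moreover have "c k * norm (a2 k) \<le> 1 * norm (a2 k)" using c01 by (intro mult_right_mono) auto
        ultimately show "norm (c k *\<^sub>R a2 k) \<le> C k * (2 * \<epsilon>)" using c01(1) by simp
      qed
      also have "\<dots> = CS * (2 * \<epsilon>)" by (simp add: CS_def sum_distrib_right)
      also have "\<dots> \<le> \<delta>" using sum\<epsilon> parts \<epsilon> by linarith
      finally show ?thesis .
    qed
    have s4: "norm (a2 1 - \<eta>) \<le> \<delta>" using \<eta>(2) sum\<epsilon> parts \<epsilon> by linarith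
    have "y - \<eta> = (y - (\<Sum>k\<in>K1. a1 k)) + ((\<Sum>k\<in>K. a1 k) - (\<Sum>k\<in>K. c k *\<^sub>R a1 k)) +
      ((\<Sum>k\<in>K. c k *\<^sub>R a1 k) - (\<Sum>k\<in>K. c k *\<^sub>R a2 k)) + ((\<Sum>k\<in>K. c k *\<^sub>R a2 k) - a2 1) + (a2 1 - \<eta>)"
      by (simp add: t1)
    also have "norm \<dots> \<le> \<delta> + \<delta> + 2 * \<delta> + \<delta> + \<delta>"
      by (intro order_trans[OF norm_triangle_ineq] add_mono s1 s2 s3 s4 less_imp_le[OF y1])
    also have "\<dots> < e" using e by (simp add: \<delta>_def)
    finally show ?thesis using \<eta>(1) by (metis dist_commute dist_norm)
  qed
  then have "y \<in> closure (H 1)" unfolding closure_approachable by blast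
  then show ?thesis using closed_H1 by simp
qed

section \<open>The isomorphism\<close>

text \<open>All functions on the base lie in the fixed algebra of every \<open>G\<close>, so an
  automorphism fixing that algebra is linear over them and unital.\<close>

lemma unit_fixed: "t \<in> arrows E 0 0 \<Longrightarrow> emb 0 0 t \<in> fixed_algebra E emb G"
  by (rule fixed_arrow_emb) (simp add: fixed_arrows_def arr_act_scalar)

lemma hat_H: "g \<in> unitaries E \<Longrightarrow> hat_aut E emb g ` H r \<subseteq> H r"
  unfolding H_def using hat_emb arr_act_in unitary_arrow by fastforce

lemma hat_unit: "g \<in> unitaries E \<Longrightarrow> hat_aut E emb g unit = unit"
  unfolding unit_def by (simp add: hat_emb[OF _ arr_id_in] arr_act_scalar[OF arr_id_in])

text \<open>Being homogeneous, a shifted flip is the image of an arrow, and by injectivity of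
  \<open>emb\<close> its invariance under \<open>hat_aut E emb g\<close> is invariance of that
  arrow. So it comes from the dual of \<open>G\<close>.\<close>

lemma shift_flip_fixed:
  assumes G: "G \<subseteq> unitaries E"
  shows "shift m (flip r) \<in> fixed_algebra E emb G"
proof -
  have "shift m (flip r) \<in> graded_part E emb 0" by (rule graded_shift[OF graded_flip])
  then obtain q q' t where t: "t \<in> arrows E q q'" "shift m (flip r) = emb q q' t" unfolding graded_part_def by blast
  have "arr_act E q q' g t = t" if "g \<in> G" for g
  proof (rule emb_inj[OF _ t(1)])
    have g: "g \<in> unitaries E" using that G by blast
    show "arr_act E q q' g t \<in> arrows E q q'" by (rule arr_act_in[OF unitary_arrow[OF g] t(1)])
    note \<beta> = hat_star_hom[OF g] hat_unit[OF g] hat_H[OF g]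
    show "emb q q' (arr_act E q q' g t) = emb q q' t"
      unfolding hat_emb[OF g t(1), symmetric] t(2)[symmetric] star_hom_of_shift[OF \<beta>] star_hom_flip[OF \<beta>] ..
  qed
  then have "t \<in> fixed_arrows E G q q'" using t(1) by (simp add: fixed_arrows_def)
  then show ?thesis unfolding t(2) by (rule fixed_arrow_emb)
qed

lemma aut_is_hat:
  assumes G: "G \<subseteq> unitaries E" and \<alpha>: "star_hom \<alpha>" and fixed: "\<And>a. a \<in> fixed_algebra E emb G \<Longrightarrow> \<alpha> a = a"
  shows "\<exists>g\<in>unitaries E. fixes_dual G g \<and> hat_aut E emb g = \<alpha>"
proof -
  note mult = star_hom_mult[OF \<alpha>] and sum = star_hom_sum[OF \<alpha>] and st = star_hom_star[OF \<alpha>]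
  have \<alpha>0: "\<alpha> z = z" if "z \<in> H 0" for z using H_E[OF that] fixed unit_fixed by auto
  have \<alpha>u: "\<alpha> unit = unit" by (rule \<alpha>0[OF unit_H0])
  have \<alpha>_bounded: "bounded_linear \<alpha>"
  proof (rule bounded_linear_intro[where K = 1])
    show "norm (\<alpha> a) \<le> norm a * 1" for a
      using star_hom_contractive[OF \<alpha>, of unit a] unit_left unit_right \<alpha>u by simp
  qed (simp_all add: star_hom_add[OF \<alpha>] star_hom_scaleR[OF \<alpha>])
  have \<alpha>psi: "\<alpha> (psi j) \<in> H 1" if j: "j \<in> J" for j
  proof (rule shift_intertwiner)
    fix m r
    have "psi j * shift m (flip r) = shift 1 (shift m (flip r)) * psi j" by (rule shift_H[OF psi_H[OF j], symmetric])
    then have "\<alpha> (psi j) * \<alpha> (shift m (flip r)) = \<alpha> (shift (m + 1) (flip r)) * \<alpha> (psi j)"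
      unfolding shift_shift[of 1 m, symmetric] mult[symmetric] by (simp add: add.commute)
    then show "\<alpha> (psi j) * shift m (flip r) = shift (m + 1) (flip r) * \<alpha> (psi j)"
      using fixed[OF shift_flip_fixed[OF G]] by simp
  qed
  have "\<forall>j\<in>J. \<exists>t. t \<in> arrows E 0 1 \<and> \<alpha> (psi j) = emb 0 1 t"
    using H_E[OF \<alpha>psi] by blast
  from bchoice[OF this] obtain t where
    t: "\<And>j. j \<in> J \<Longrightarrow> t j \<in> arrows E 0 1" "\<And>j. j \<in> J \<Longrightarrow> \<alpha> (psi j) = emb 0 1 (t j)" by blast
  define g where "g = (\<lambda>x \<xi> ws. \<Sum>j\<in>J. arr_comp (t j) (arr_adj E 0 1 (sec j)) x \<xi> ws)"
  define b where "b = (\<Sum>j\<in>J. \<alpha> (psi j) * star (psi j))"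
  have cj: "arr_comp (t j) (arr_adj E 0 1 (sec j)) \<in> arrows E 1 1" if "j \<in> J" for j
    by (rule arr_comp_in[OF arr_adj_in[OF sec_in[OF that]] t(1)[OF that]])
  have g_in: "g \<in> arrows E 1 1"
    unfolding g_def by (rule emb_sum[THEN conjunct1, OF finite_J cj])
  have "emb 1 1 g = (\<Sum>j\<in>J. emb 1 1 (arr_comp (t j) (arr_adj E 0 1 (sec j))))"
    unfolding g_def by (rule emb_sum[THEN conjunct2, OF finite_J cj])
  also have "\<dots> = b"
    unfolding b_def
  proof (intro sum.cong refl)
    fix j assume j: "j \<in> J"
    show "emb 1 1 (arr_comp (t j) (arr_adj E 0 1 (sec j))) = \<alpha> (psi j) * star (psi j)"
      using emb_comp[OF arr_adj_in[OF sec_in[OF j]] t(1)[OF j]] emb_adj[OF sec_in[OF j]] t(2)[OF j]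
      by (simp add: psi_def)
  qed
  finally have g_emb: "emb 1 1 g = b" .
  \<comment> \<open>The coefficients \<open>star (psi j) * \<phi>\<close> are functions on the base,
    where \<open>\<alpha>\<close> is the identity; so left multiplication by \<open>b\<close>
    implements \<open>\<alpha>\<close> on sections.\<close>
  have b_psi: "b * \<phi> = \<alpha> \<phi>" if \<phi>: "\<phi> \<in> H 1" for \<phi>
  proof -
    have "b * \<phi> = (\<Sum>j\<in>J. \<alpha> (psi j * (star (psi j) * \<phi>)))"
    proof -
      have "star (psi j) * \<phi> = \<alpha> (star (psi j) * \<phi>)" if "j \<in> J" for j
        using \<alpha>0 star_H_mult[OF psi_H[OF that], of \<phi> 0] \<phi> by simp
      then show ?thesis unfolding b_def sum_distrib_right mult.assoc mult[of _ "star _ * _"] by (intro sum.cong refl) simp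
    qed
    also have "\<dots> = \<alpha> ((\<Sum>j\<in>J. psi j * star (psi j)) * \<phi>)" by (simp add: sum sum_distrib_right mult.assoc)
    finally show ?thesis by (simp add: psi_frame unit_left)
  qed
  \<comment> \<open>The Gram functions are fixed by \<open>\<alpha>\<close>. This removes
    \<open>\<alpha>\<close> from the middle of \<open>star b * b\<close>, and in
    \<open>b * star b\<close> allows it to be drawn outside the whole product, so that both reduce
    to the frame relation.\<close>
  have c1: "\<alpha> (star (psi i) * psi j) = star (psi i) * psi j" if "i \<in> J" "j \<in> J" for i j
    using \<alpha>0 star_H_mult[OF psi_H[OF that(1)], of "psi j" 0] psi_H[OF that(2)] by simp
  have sb: "star b = (\<Sum>i\<in>J. psi i * \<alpha> (star (psi i)))" by (simp add: b_def star_sum star_mult star_star st)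
  have "star b * b = (\<Sum>i\<in>J. \<Sum>j\<in>J. (psi i * star (psi i)) * (psi j * star (psi j)))"
    unfolding sb unfolding b_def sum_product
  proof (intro sum.cong refl)
    fix i j assume "i \<in> J" "j \<in> J"
    from c1[OF this] have "\<alpha> (star (psi i)) * \<alpha> (psi j) = star (psi i) * psi j" by (simp add: mult)
    then show "psi i * \<alpha> (star (psi i)) * (\<alpha> (psi j) * star (psi j)) = psi i * star (psi i) * (psi j * star (psi j))"
      by (metis mult.assoc)
  qed
  then have left: "star b * b = unit" by (simp add: sum_product[symmetric] psi_frame unit_left)
  have "b * star b = (\<Sum>i\<in>J. \<Sum>j\<in>J. \<alpha> ((psi i * star (psi i)) * (psi j * star (psi j))))"
    unfolding sb unfolding b_def sum_product
  proof (intro sum.cong refl)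
    fix i j assume "i \<in> J" "j \<in> J"
    from c1[OF this] have "\<alpha> (star (psi i)) * \<alpha> (psi j) = star (psi i) * psi j" by (simp add: mult)
    then show "\<alpha> (psi i) * star (psi i) * (psi j * \<alpha> (star (psi j))) = \<alpha> (psi i * star (psi i) * (psi j * star (psi j)))"
      unfolding mult by (metis mult.assoc)
  qed
  also have "\<dots> = \<alpha> ((\<Sum>i\<in>J. psi i * star (psi i)) * (\<Sum>j\<in>J. psi j * star (psi j)))" by (simp add: sum sum_product)
  finally have right: "b * star b = unit" by (simp add: psi_frame unit_left \<alpha>u)
  note ga = arr_adj_in[OF g_in]
  have "arr_comp (arr_adj E 1 1 g) g = arr_id E 1"
    by (rule emb_inj[OF arr_comp_in[OF g_in ga] arr_id_in])
      (simp add: emb_comp[OF g_in ga] emb_adj[OF g_in] g_emb left emb_id)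
  moreover have "arr_comp g (arr_adj E 1 1 g) = arr_id E 1"
    by (rule emb_inj[OF arr_comp_in[OF ga g_in] arr_id_in])
      (simp add: emb_comp[OF ga g_in] emb_adj[OF g_in] g_emb right emb_id)
  ultimately have g: "g \<in> unitaries E" using g_in by (simp add: unitaries_def)
  note hat = hat_star_hom[OF g]
  have hat0: "hat_aut E emb g z = \<alpha> z" if z: "z \<in> H 0" for z
  proof -
    obtain w where "w \<in> arrows E 0 0" "z = emb 0 0 w" using H_E[OF z] by blast
    then show ?thesis using \<alpha>0[OF z] hat_emb[OF g, of w 0 0] arr_act_scalar[of w g] by simp
  qed
  have hat1: "hat_aut E emb g (psi j) = \<alpha> (psi j)" if j: "j \<in> J" for j
  proof -
    have "hat_aut E emb g (psi j) = emb 1 1 g * psi j"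
      using hat_emb[OF g sec_in[OF j]] arr_act_vector[OF g_in sec_in[OF j]] emb_comp[OF sec_in[OF j] g_in]
      by (simp add: psi_def)
    then show ?thesis using b_psi[OF psi_H[OF j]] by (simp add: g_emb)
  qed
  have hatw: "hat_aut E emb g (word is) = \<alpha> (word is)" if "set is \<subseteq> J" for "is"
    using that
  proof (induction "is")
    case Nil
    then show ?case using hat0[OF unit_H0] by simp
  next
    case (Cons j "is")
    then show ?case using hat1[of j] by (simp add: star_hom_mult[OF hat] mult)
  qed
  have hat_eq: "hat_aut E emb g = \<alpha>"
  proof (rule emb_determines[OF hat_bounded[OF g] \<alpha>_bounded])
    fix r s u assume u: "u \<in> arrows E r s"
    \<comment> \<open>Every arrow is a combination of words and adjoints of words with coefficients
      \<open>z\<close> in \<open>H 0\<close>. The two homomorphisms agree on functions and on words,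
      hence on arrows.\<close>
    define z where "z is js = star (word is) * (emb r s u * word js)" for "is" js
    have z: "z is js \<in> H 0" if "is \<in> tuples J s" "js \<in> tuples J r" for "is" js
      unfolding z_def using star_H_mult[OF word_H[OF that(1)], of _ 0] emb_H[OF u word_H[OF that(2)]] by simp
    have "emb r s u = (\<Sum>is\<in>tuples J s. word is * (star (word is) * emb r s u))"
      by (rule word_frame_left[symmetric])
    also have "\<dots> = (\<Sum>is\<in>tuples J s. word is * (\<Sum>js\<in>tuples J r. z is js * star (word js)))"
      using word_frame_right[of "star (word _) * emb r s u" r] unfolding z_def
      by (intro sum.cong refl) (simp add: mult.assoc)
    finally have e: "emb r s u = (\<Sum>is\<in>tuples J s. word is * (\<Sum>js\<in>tuples J r. z is js * star (word js)))" .
    have "hat_aut E emb g (\<Sum>is\<in>tuples J s. word is * (\<Sum>js\<in>tuples J r. z is js * star (word js))) =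
      \<alpha> (\<Sum>is\<in>tuples J s. word is * (\<Sum>js\<in>tuples J r. z is js * star (word js)))"
      unfolding sum star_hom_sum[OF hat] mult star_hom_mult[OF hat] st star_hom_star[OF hat]
      by (intro sum.cong refl arg_cong2[of _ _ _ _ "(*)"] arg_cong[of _ _ star] hatw hat0 z) (auto simp: tuples_def)
    then show "hat_aut E emb g (emb r s u) = \<alpha> (emb r s u)" unfolding e[symmetric] .
  qed
  moreover have "fixes_dual G g"
    unfolding fixes_dual_def
  proof (intro allI ballI)
    fix r s u assume uG: "u \<in> fixed_arrows E G r s"
    then have u: "u \<in> arrows E r s" by (simp add: fixed_arrows_def)
    show "arr_act E r s g u = u"
      by (rule emb_inj[OF arr_act_in[OF g_in u] u])
        (use hat_emb[OF g u] fixed[OF fixed_arrow_emb[OF uG]] hat_eq in simp)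
  qed
  ultimately show ?thesis using g hat_eq by blast
qed

text \<open>On sections the automorphism is left multiplication by \<open>emb 1 1 g\<close>, and the
  frame relation recovers this element from its products with the \<open>psi j\<close>.\<close>

lemma hat_inj:
  assumes g: "g \<in> unitaries E" and h: "h \<in> unitaries E" and eq: "hat_aut E emb g = hat_aut E emb h"
  shows "g = h"
proof (rule emb_inj[OF unitary_arrow[OF g] unitary_arrow[OF h]])
  have hat_psi: "hat_aut E emb g (psi j) = emb 1 1 g * psi j" if "g \<in> unitaries E" "j \<in> J" for g j
    using hat_emb[OF that(1) sec_in[OF that(2)]] arr_act_vector[OF unitary_arrow[OF that(1)] sec_in[OF that(2)]]
      emb_comp[OF sec_in[OF that(2)] unitary_arrow[OF that(1)]] by (simp add: psi_def)
  have ex: "a = (\<Sum>j\<in>J. a * psi j * star (psi j))" for a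
    using arg_cong[OF psi_frame, of "\<lambda>u. a * u"] by (simp add: sum_distrib_left unit_right mult.assoc)
  show "emb 1 1 g = emb 1 1 h"
    using ex[of "emb 1 1 g"] ex[of "emb 1 1 h"] hat_psi[OF g] hat_psi[OF h] eq by simp
qed

lemma subgroup_fixes_dual: "subgroup {g \<in> unitaries E. fixes_dual G g} (unitary_group E)"
proof (rule group.subgroupI[OF group_unitary])
  show "{g \<in> unitaries E. fixes_dual G g} \<subseteq> carrier (unitary_group E)" by (auto simp: unitary_group_def)
  have "arr_id E 1 \<in> {g \<in> unitaries E. fixes_dual G g}"
    using arr_id_unitary arr_act_id by (simp add: fixes_dual_def fixed_arrows_def)
  then show "{g \<in> unitaries E. fixes_dual G g} \<noteq> {}" by blast
next
  fix g assume "g \<in> {g \<in> unitaries E. fixes_dual G g}"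
  then have g: "g \<in> unitaries E" and fx: "fixes_dual G g" by auto
  have "inv\<^bsub>unitary_group E\<^esub> g = arr_adj E 1 1 g"
    by (rule group.inv_equality[OF group_unitary])
      (use g unitary_left[OF g] arr_adj_unitary[OF g] in \<open>simp_all add: unitary_group_def\<close>)
  moreover have "fixes_dual G (arr_adj E 1 1 g)"
    unfolding fixes_dual_def
  proof (intro allI ballI)
    fix r s t assume tG: "t \<in> fixed_arrows E G r s"
    then have t: "t \<in> arrows E r s" by (simp add: fixed_arrows_def)
    have gt: "arr_act E r s g t = t" using fx tG by (simp add: fixes_dual_def)
    have "arr_act E r s (arr_adj E 1 1 g) (arr_act E r s g t) = t"
      unfolding arr_act_mult[OF arr_adj_in[OF unitary_arrow[OF g]] unitary_arrow[OF g], symmetric] unitary_left[OF g]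
      by (rule arr_act_id[OF t])
    then show "arr_act E r s (arr_adj E 1 1 g) t = t" by (simp add: gt)
  qed
  ultimately show "inv\<^bsub>unitary_group E\<^esub> g \<in> {g \<in> unitaries E. fixes_dual G g}"
    using arr_adj_unitary[OF g] by simp
  fix h assume "h \<in> {g \<in> unitaries E. fixes_dual G g}"
  then have h: "h \<in> unitaries E" and fh: "fixes_dual G h" by auto
  have "fixes_dual G (arr_comp g h)"
    using fx fh arr_act_mult[OF unitary_arrow[OF g] unitary_arrow[OF h]] by (simp add: fixes_dual_def)
  then show "g \<otimes>\<^bsub>unitary_group E\<^esub> h \<in> {g \<in> unitaries E. fixes_dual G g}"
    using arr_comp_unitary[OF g h] by (simp add: unitary_group_def)
qed

end

section \<open>The group of automorphisms fixing a set\<close>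

lemma star_hom_comp: "star_hom f \<Longrightarrow> star_hom g \<Longrightarrow> star_hom (f \<circ> g)"
  by (simp add: star_hom_def)

lemma star_hom_inv:
  assumes f: "star_hom f" "bij f"
  shows "star_hom (inv_into UNIV f)"
proof -
  have i: "inv_into UNIV f (f x) = x" "f (inv_into UNIV f y) = y" for x y using f(2) by (simp_all add: bij_is_inj bij_is_surj surj_f_inv_f)
  show ?thesis
    unfolding star_hom_def
    by (intro conjI allI; rule inj_onD[OF bij_is_inj[OF f(2)]])
      (simp_all add: i star_hom_add[OF f(1)] star_hom_mult[OF f(1)] star_hom_star[OF f(1)] star_hom_scaleC[OF f(1)])
qed

lemma group_aut_group: "group (aut_group S)"
proof (rule groupI)
  fix f assume "f \<in> carrier (aut_group S)"
  then have f: "star_hom f" "bij f" "\<forall>a\<in>S. f a = a" by (auto simp: aut_group_def)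
  have "inv_into UNIV f a = a" if "a \<in> S" for a using f(2,3) that by (metis bij_is_inj inv_f_f)
  then have "inv_into UNIV f \<in> carrier (aut_group S)" using star_hom_inv[OF f(1,2)] bij_imp_bij_inv[OF f(2)] by (simp add: aut_group_def)
  moreover have "inv_into UNIV f \<circ> f = id" using f(2) by (simp add: bij_is_inj)
  ultimately show "\<exists>g\<in>carrier (aut_group S). g \<otimes>\<^bsub>aut_group S\<^esub> f = \<one>\<^bsub>aut_group S\<^esub>"
    by (auto simp: aut_group_def)
qed (auto simp: aut_group_def star_hom_comp bij_comp o_assoc, simp add: star_hom_def)

context cp_algebra
begin

text \<open>Once sections of the spectral bundle are replaced by unitaries satisfying
  \<open>fixes_dual\<close>, the fibre algebras disappear, and surjectivity is
  \<open>aut_is_hat\<close>.\<close>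

theorem section_group_iso:
  assumes cpx: "\<And>x. x \<in> X \<Longrightarrow> cuntz_pimsner (restrict_bundle E x) (fib x)" and G: "G \<subseteq> unitaries E"
  shows "group (section_group E emb fib G)"
    and "hat_aut E emb \<in> iso (section_group E emb fib G) (aut_group (fixed_algebra E emb G))"
proof -
  have car: "{g \<in> unitaries E. \<forall>x\<in>X. (x, g x) \<in> topspace (spectral_bundle E emb fib G)} =
      {g \<in> unitaries E. fixes_dual G g}"
    using spectral_section_iff[where fib = fib, OF _ cpx] by blast
  have sg: "section_group E emb fib G = (unitary_group E)\<lparr>carrier := {g \<in> unitaries E. fixes_dual G g}\<rparr>"
    unfolding section_group_def car ..
  show "group (section_group E emb fib G)"
    unfolding sg by (rule subgroup.subgroup_is_group[OF subgroup_fixes_dual group_unitary])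
  have aut: "hat_aut E emb g \<in> carrier (aut_group (fixed_algebra E emb G))"
    if "g \<in> unitaries E" "fixes_dual G g" for g
    using that hat_star_hom hat_bij fixed_algebra_hat by (simp add: aut_group_def)
  show "hat_aut E emb \<in> iso (section_group E emb fib G) (aut_group (fixed_algebra E emb G))"
    unfolding iso_def mem_Collect_eq
  proof (intro conjI)
    show "hat_aut E emb \<in> hom (section_group E emb fib G) (aut_group (fixed_algebra E emb G))"
      unfolding hom_def sg using aut hat_comp by (auto simp: unitary_group_def aut_group_def)
    show "bij_betw (hat_aut E emb) (carrier (section_group E emb fib G)) (carrier (aut_group (fixed_algebra E emb G)))"
      unfolding bij_betw_def sg
    proof (intro conjI equalityI)
      show "inj_on (hat_aut E emb) (carrier ((unitary_group E)\<lparr>carrier := {g \<in> unitaries E. fixes_dual G g}\<rparr>))"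
        by (auto intro!: inj_onI hat_inj)
      show "hat_aut E emb ` carrier ((unitary_group E)\<lparr>carrier := {g \<in> unitaries E. fixes_dual G g}\<rparr>) \<subseteq>
          carrier (aut_group (fixed_algebra E emb G))"
        using aut by auto
      show "carrier (aut_group (fixed_algebra E emb G)) \<subseteq>
          hat_aut E emb ` carrier ((unitary_group E)\<lparr>carrier := {g \<in> unitaries E. fixes_dual G g}\<rparr>)"
      proof
        fix \<alpha> assume "\<alpha> \<in> carrier (aut_group (fixed_algebra E emb G))"
        then have "star_hom \<alpha>" "\<And>a. a \<in> fixed_algebra E emb G \<Longrightarrow> \<alpha> a = a" by (auto simp: aut_group_def)
        from aut_is_hat[OF G this] show "\<alpha> \<in> hat_aut E emb `
          carrier ((unitary_group E)\<lparr>carrier := {g \<in> unitaries E. fixes_dual G g}\<rparr>)" by auto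
      qed
    qed
  qed
qed

end

text \<open>The bound on \<open>d\<close> in front of the isomorphism excludes line bundles, for
  which permutations of tensor factors are trivial. Over a point with \<open>d = 1\<close> the
  algebra is that of continuous functions on the circle; for \<open>G\<close> the whole unitary
  group the fixed algebra consists of scalars, and every homeomorphism of the circle gives an
  automorphism fixing it, far more than the rotations coming from unitaries.\<close>

theorem proposition4p8:
  fixes E :: "('x, 'e) vbundle" and d :: nat
    and emb :: "nat \<Rightarrow> nat \<Rightarrow> ('x, 'e) arrow \<Rightarrow> 'a::cstar_algebra"
    and fib :: "'x \<Rightarrow> nat \<Rightarrow> nat \<Rightarrow> ('x, 'e) arrow \<Rightarrow> 'b::cstar_algebra"
  assumes "compact_space (base E)" and "Hausdorff_space (base E)"
    and "hermitian_vector_bundle d E"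
    and "cuntz_pimsner E emb"
    and "\<And>x. x \<in> topspace (base E) \<Longrightarrow> cuntz_pimsner (restrict_bundle E x) (fib x)"
  shows "(2 \<le> d \<longrightarrow>
      (\<forall>G. closed_unitary_subgroup E G \<longrightarrow>
         group (section_group E emb fib G) \<and>
         group (aut_group (fixed_algebra E emb G)) \<and>
         hat_aut E emb \<in> iso (section_group E emb fib G) (aut_group (fixed_algebra E emb G)))) \<and>
    (\<forall>G G'. closed_unitary_subgroup E G \<longrightarrow> closed_unitary_subgroup E G' \<longrightarrow>
       dual E G = dual E G' \<longrightarrow> spectral_bundle E emb fib G = spectral_bundle E emb fib G')"
proof (intro conjI impI allI)
  fix G assume d: "2 \<le> d" and "closed_unitary_subgroup E G"
  then have G: "G \<subseteq> unitaries E"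
    using subgroup.subset[of G "unitary_group E"] by (simp add: closed_unitary_subgroup_def unitary_group_def)
  obtain J and f :: "'x \<times> nat \<Rightarrow> 'x \<Rightarrow> 'e" where "framed_bundle E J f d"
    using hermitian_bundle.ex_framed_bundle[OF hermitian_bundle.intro[OF assms(3)] assms(1,2) d] by blast
  then interpret cp_algebra E J f d emb by (intro cp_algebra.intro cp_algebra_axioms.intro assms(4))
  show "group (section_group E emb fib G)" by (rule section_group_iso(1)[OF assms(5) G])
  show "group (aut_group (fixed_algebra E emb G))" by (rule group_aut_group)
  show "hat_aut E emb \<in> iso (section_group E emb fib G) (aut_group (fixed_algebra E emb G))"
    by (rule section_group_iso(2)[OF assms(5) G])
next
  fix G G' assume "dual E G = dual E G'"
  \<comment> \<open>The group enters the spectral bundle only through the generators of its fixed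
    algebra, which are the arrows of the dual.\<close>
  then have "fixed_arrows E G = fixed_arrows E G'" unfolding dual_def by (simp add: fun_eq_iff)
  then show "spectral_bundle E emb fib G = spectral_bundle E emb fib G'"
    unfolding spectral_bundle_def fixed_algebra_def by simp
qed

end
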